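(* Let $(X,g_0)$ be a closed Riemannian surface, $\gamma$ an elliptic generic closed geodesic of $(X,g_0)$ of period $T>0$, and let $(u_m)_{m\in\mathbb{N}}$ and $(\lambda_m)_{m\in\mathbb{N}}$ be an associated sequence of quasi-modes and quasi-eigenvalues with the properties listed in the context. Let $f:X\to[0,+\infty)$ be a smooth function, flat on $\gamma$ (i.e. vanishing to infinite order at every point of $\gamma$), with zero set $f^{-1}(0)=\gamma$. For $t\in[0,1]$ put $g_t:=e^{-tf}g_0$, and let $\Delta_t$ and $dx_t$ be the Laplace operator and the area measure of $g_t$. Then there exist a sequence $l_m>0$ with $l_m=O(m^{-\infty})$ such that for every $t\in[0,1]$ and every $m$ $$\mathrm{Spectrum}(\Delta_t)\cap[\lambda_m-l_m,\lambda_m+l_m]\neq\emptyset,$$ and a subset $Z\subset[0,1]$ of Lebesgue measure $1$, such that for every $t\in Z$ and every sequence of eigenvalues $\mu_{j_m}(t)\in[\lambda_m-l_m,\lambda_m+l_m]$ of $\Delta_t$ with associated $L^2(X,dx_t)$-normalized eigenfunctions $\varphi_{j_m}(t)$, $$\int_X f\,|\varphi_{j_m}(t)|^2\,dx_0=O(m^{-\infty}).$$ Moreover (for $t\in Z$ and such sequences), for every compact $K\subset X$ with $K\cap\gamma=\emptyset$ and every $k\in\mathbb{N}$, $$\|\varphi_{j_m}(t)\|_{C^k(K)}=O(m^{-\infty}).$$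
   Context: Closed means compact without boundary; Laplace operators are non-negative; $a_m=O(m^{-\infty})$ means $a_m=O(m^{-N})$ as $m\to\infty$ for every $N$. A periodic geodesic $\gamma$ on a Riemannian surface is called elliptic generic if the eigenvalues of its linearized Poincaré map have modulus $1$ and are not roots of unity. By a theorem of Babich–Lazutkin and Ralston, to an elliptic generic closed geodesic $\gamma$ of period $T$ one can associate functions $u_m$ with $\|u_m\|_{L^2(X,dx_0)}=1$ and real numbers $\lambda_m$ such that: (i) $\|(\Delta_0-\lambda_m)u_m\|_{L^2(X,dx_0)}=O(m^{-\infty})$, where $\Delta_0$ is the Laplace operator of $g_0$; (ii) there is a constant $\alpha$ with $\lambda_m=\left(\frac{2\pi m+\alpha}{T}\right)^2+O(1)$; (iii) for every compact $K$ disjoint from $\gamma$, $\int_K|u_m|^2dx_0=O(m^{-\infty})$; (iv) $u_m$ is concentrated on $\gamma$ in a Gaussian way: there are constants $c>0$, $C>0$, $M\ge0$ such that, for all large $m$ and all $x\in X$, $|u_m(x)|\le C\,m^{M}e^{-c\sqrt{\lambda_m}\,d(x,\gamma)^2}$, where $d$ is the $g_0$-distance. The sequences $(u_m)$, $(\lambda_m)$ in the claim are such sequences. One has $dx_t=e^{-tf}dx_0$ and $\Delta_t=e^{tf}\Delta_0$. *)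

theory Defs
  imports "HOL-Analysis.Analysis" "HOL-Library.Landau_Symbols"
begin

section \<open>Calculus in the plane\<close>

definition partial_deriv :: "2 \<Rightarrow> (real^2 \<Rightarrow> 'b::real_normed_vector) \<Rightarrow> real^2 \<Rightarrow> 'b" where
  "partial_deriv i h y = frechet_derivative h (at y) (axis i 1)"

fun partial_derivs :: "2 list \<Rightarrow> (real^2 \<Rightarrow> 'b::real_normed_vector) \<Rightarrow> real^2 \<Rightarrow> 'b" where
  "partial_derivs [] h = h"
| "partial_derivs (i # is) h = partial_deriv i (partial_derivs is h)"

definition smooth_on :: "(real^2) set \<Rightarrow> (real^2 \<Rightarrow> 'b::real_normed_vector) \<Rightarrow> bool" where
  "smooth_on V h \<longleftrightarrow> (\<forall>is. \<forall>y\<in>V. partial_derivs is h differentiable (at y))"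

definition rapidly_decreasing :: "(nat \<Rightarrow> real) \<Rightarrow> bool" where
  "rapidly_decreasing a \<longleftrightarrow> (\<forall>N::nat. a \<in> O(\<lambda>m. 1 / real m ^ N))"


section \<open>Smooth surfaces\<close>

text \<open>The underlying set of a surface is a whole type. A chart is a pair of an open domain and a
  coordinate map, whose values outside the domain are irrelevant. Atlases need not be maximal.\<close>

type_synonym 'a chart = "'a set \<times> ('a \<Rightarrow> real^2)"

abbreviation chart_dom :: "'a chart \<Rightarrow> 'a set" where
  "chart_dom c \<equiv> fst c"

abbreviation chart_map :: "'a chart \<Rightarrow> 'a \<Rightarrow> real^2" where
  "chart_map c \<equiv> snd c"

definition chart_image :: "'a chart \<Rightarrow> (real^2) set" where
  "chart_image c = chart_map c ` chart_dom c"

definition chart_inv :: "'a chart \<Rightarrow> real^2 \<Rightarrow> 'a" where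
  "chart_inv c = inv_into (chart_dom c) (chart_map c)"

definition in_chart :: "'a chart \<Rightarrow> ('a \<Rightarrow> 'b) \<Rightarrow> real^2 \<Rightarrow> 'b" where
  "in_chart c u = (\<lambda>y. u (chart_inv c y))"

definition smooth_atlas :: "'a::t2_space chart set \<Rightarrow> bool" where
  "smooth_atlas A \<longleftrightarrow>
     (\<Union>c\<in>A. chart_dom c) = UNIV \<and>
     (\<forall>c\<in>A. open (chart_dom c) \<and> open (chart_image c) \<and>
        homeomorphism (chart_dom c) (chart_image c) (chart_map c) (chart_inv c)) \<and>
     (\<forall>c\<in>A. \<forall>c'\<in>A.
        smooth_on (chart_map c ` (chart_dom c \<inter> chart_dom c')) (in_chart c (chart_map c')))"

text \<open>An arbitrary chart around a point. It is only used for quantities that do not depend on the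
  choice of the chart.\<close>

definition chart_at :: "'a chart set \<Rightarrow> 'a \<Rightarrow> 'a chart" where
  "chart_at A x = (SOME c. c \<in> A \<and> x \<in> chart_dom c)"

definition smooth_function :: "'a chart set \<Rightarrow> ('a \<Rightarrow> 'b::real_normed_vector) \<Rightarrow> bool" where
  "smooth_function A u \<longleftrightarrow> (\<forall>c\<in>A. smooth_on (chart_image c) (in_chart c u))"

definition flat_on :: "'a chart set \<Rightarrow> 'a set \<Rightarrow> ('a \<Rightarrow> real) \<Rightarrow> bool" where
  "flat_on A S f \<longleftrightarrow>
     (\<forall>c\<in>A. \<forall>x \<in> S \<inter> chart_dom c. \<forall>is. partial_derivs is (in_chart c f) (chart_map c x) = 0)"

text \<open>The norm of \<open>C\<^sup>k(K)\<close> is defined up to equivalence only: it depends on a finite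
  family of compact pieces covering \<open>K\<close>, each contained in the domain of a chart.\<close>

definition chart_decomposition ::
    "'a::t2_space chart set \<Rightarrow> 'a set \<Rightarrow> ('a chart \<times> 'a set) set \<Rightarrow> bool" where
  "chart_decomposition A K P \<longleftrightarrow>
     finite P \<and> (\<Union>(c, L)\<in>P. L) = K \<and>
     (\<forall>(c, L)\<in>P. c \<in> A \<and> compact L \<and> L \<subseteq> chart_dom c)"

definition Ck_norm :: "('a chart \<times> 'a set) set \<Rightarrow> nat \<Rightarrow> ('a \<Rightarrow> complex) \<Rightarrow> real" where
  "Ck_norm P k u = Sup (insert 0
     {cmod (partial_derivs is (in_chart c u) (chart_map c x)) | is c L x.
        (c, L) \<in> P \<and> x \<in> L \<and> length is \<le> k})"


section \<open>Riemannian metrics\<close>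

text \<open>\<open>g c x\<close> is the Gram matrix at the point \<open>x\<close> of the metric in the
  coordinates of the chart \<open>c\<close>.\<close>

type_synonym 'a metric = "'a chart \<Rightarrow> 'a \<Rightarrow> real^2^2"

definition riemannian_metric :: "'a::t2_space chart set \<Rightarrow> 'a metric \<Rightarrow> bool" where
  "riemannian_metric A g \<longleftrightarrow>
     (\<forall>c\<in>A. smooth_on (chart_image c) (in_chart c (g c))) \<and>
     (\<forall>c\<in>A. \<forall>x\<in>chart_dom c. transpose (g c x) = g c x \<and> (\<forall>v. v \<noteq> 0 \<longrightarrow> v \<bullet> (g c x *v v) > 0)) \<and>
     (\<forall>c\<in>A. \<forall>c'\<in>A. \<forall>x \<in> chart_dom c \<inter> chart_dom c'.
        let J = matrix (frechet_derivative (in_chart c (chart_map c')) (at (chart_map c x)))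
        in g c x = transpose J ** g c' x ** J)"

definition closed_riemannian_surface :: "'a::t2_space chart set \<Rightarrow> 'a metric \<Rightarrow> bool" where
  "closed_riemannian_surface A g \<longleftrightarrow>
     compact (UNIV :: 'a set) \<and> smooth_atlas A \<and> riemannian_metric A g"

definition conformal_metric :: "('a \<Rightarrow> real) \<Rightarrow> 'a metric \<Rightarrow> real \<Rightarrow> 'a metric" where
  "conformal_metric f g t = (\<lambda>c x. exp (- t * f x) *\<^sub>R g c x)"

definition area_measure :: "'a::t2_space chart set \<Rightarrow> 'a metric \<Rightarrow> 'a measure" where
  "area_measure A g = (THE M. sets M = sets borel \<and>
     (\<forall>c\<in>A. \<forall>B\<in>sets borel. B \<subseteq> chart_dom c \<longrightarrow>
        emeasure M B =
          (\<integral>\<^sup>+ y \<in> chart_map c ` B. ennreal (sqrt (det (in_chart c (g c) y))) \<partial>lborel)))"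

definition laplacian :: "'a chart set \<Rightarrow> 'a metric \<Rightarrow> ('a \<Rightarrow> complex) \<Rightarrow> 'a \<Rightarrow> complex" where
  "laplacian A g u x =
     (let c = chart_at A x; G = in_chart c (g c); w = (\<lambda>y. sqrt (det (G y)));
          p = chart_map c x
      in - ((1 / w p) *\<^sub>R
           (\<Sum>i\<in>UNIV. partial_deriv i
              (\<lambda>y. \<Sum>j\<in>UNIV. (w y * matrix_inv (G y) $ i $ j) *\<^sub>R
                     partial_deriv j (in_chart c u) y) p)))"


section \<open>Curves, geodesics and the distance\<close>

definition velocity :: "'a chart \<Rightarrow> (real \<Rightarrow> 'a) \<Rightarrow> real \<Rightarrow> real^2" where
  "velocity c \<sigma> s = vector_derivative (\<lambda>r. chart_map c (\<sigma> r)) (at s)"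

definition speed :: "'a chart set \<Rightarrow> 'a metric \<Rightarrow> (real \<Rightarrow> 'a) \<Rightarrow> real \<Rightarrow> real" where
  "speed A g \<sigma> s =
     (let c = chart_at A (\<sigma> s); v = velocity c \<sigma> s in sqrt (v \<bullet> (g c (\<sigma> s) *v v)))"

definition piecewise_C1_curve :: "'a::t2_space chart set \<Rightarrow> (real \<Rightarrow> 'a) \<Rightarrow> bool" where
  "piecewise_C1_curve A \<sigma> \<longleftrightarrow>
     continuous_on {0..1} \<sigma> \<and>
     (\<exists>D. finite D \<and> (\<forall>c\<in>A. \<forall>s \<in> {0<..<1} - D. \<sigma> s \<in> chart_dom c \<longrightarrow>
        (\<lambda>r. chart_map c (\<sigma> r)) differentiable (at s) \<and> isCont (velocity c \<sigma>) s))"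

definition curve_length :: "'a chart set \<Rightarrow> 'a metric \<Rightarrow> (real \<Rightarrow> 'a) \<Rightarrow> ennreal" where
  "curve_length A g \<sigma> = (\<integral>\<^sup>+ s \<in> {0..1}. ennreal (speed A g \<sigma> s) \<partial>lborel)"

text \<open>The distance between different connected components is infinite.\<close>

definition riemannian_dist :: "'a::t2_space chart set \<Rightarrow> 'a metric \<Rightarrow> 'a \<Rightarrow> 'a \<Rightarrow> ennreal" where
  "riemannian_dist A g x y =
     (INF \<sigma> \<in> {\<sigma>. piecewise_C1_curve A \<sigma> \<and> \<sigma> 0 = x \<and> \<sigma> 1 = y}. curve_length A g \<sigma>)"

definition dist_to_set :: "'a::t2_space chart set \<Rightarrow> 'a metric \<Rightarrow> 'a \<Rightarrow> 'a set \<Rightarrow> ennreal" where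
  "dist_to_set A g x S = (INF y\<in>S. riemannian_dist A g x y)"

definition christoffel :: "'a metric \<Rightarrow> 'a chart \<Rightarrow> 2 \<Rightarrow> 2 \<Rightarrow> 2 \<Rightarrow> real^2 \<Rightarrow> real" where
  "christoffel g c k i j y =
     (let G = in_chart c (g c) in
      (1/2) * (\<Sum>l\<in>UNIV. matrix_inv (G y) $ k $ l *
        (partial_deriv i (\<lambda>z. G z $ j $ l) y + partial_deriv j (\<lambda>z. G z $ i $ l) y
         - partial_deriv l (\<lambda>z. G z $ i $ j) y)))"

definition geodesic :: "'a::t2_space chart set \<Rightarrow> 'a metric \<Rightarrow> (real \<Rightarrow> 'a) \<Rightarrow> bool" where
  "geodesic A g \<sigma> \<longleftrightarrow>
     continuous_on UNIV \<sigma> \<and>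
     (\<forall>c\<in>A. \<forall>s. \<sigma> s \<in> chart_dom c \<longrightarrow>
        (\<lambda>r. chart_map c (\<sigma> r)) differentiable (at s) \<and>
        (velocity c \<sigma> has_vector_derivative
           (\<chi> k. - (\<Sum>i\<in>UNIV. \<Sum>j\<in>UNIV. christoffel g c k i j (chart_map c (\<sigma> s)) *
                     velocity c \<sigma> s $ i * velocity c \<sigma> s $ j))) (at s))"

text \<open>Unit speed makes the period a length. The period need not be the smallest one, and
  self-intersections are allowed.\<close>

definition closed_geodesic ::
    "'a::t2_space chart set \<Rightarrow> 'a metric \<Rightarrow> (real \<Rightarrow> 'a) \<Rightarrow> real \<Rightarrow> bool" where
  "closed_geodesic A g \<gamma> T \<longleftrightarrow>
     T > 0 \<and> geodesic A g \<gamma> \<and> (\<forall>s. speed A g \<gamma> s = 1) \<and> (\<forall>s. \<gamma> (s + T) = \<gamma> s)"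


section \<open>The linearized Poincare map\<close>

text \<open>The geodesic flow on the tangent bundle, read in the coordinates (position, velocity) induced
  by a chart. It is meaningful as long as the initial and the final position are in the domain of
  the chart.\<close>

definition geodesic_flow ::
    "'a::t2_space chart set \<Rightarrow> 'a metric \<Rightarrow> 'a chart \<Rightarrow> real \<Rightarrow>
      (real^2) \<times> (real^2) \<Rightarrow> (real^2) \<times> (real^2)" where
  "geodesic_flow A g c s z =
     (let \<sigma> = (THE \<sigma>. geodesic A g \<sigma> \<and> \<sigma> 0 = chart_inv c (fst z) \<and> velocity c \<sigma> 0 = snd z)
      in (chart_map c (\<sigma> s), velocity c \<sigma> s))"

text \<open>A surface in the unit tangent bundle through \<open>z\<close>, transverse to the geodesic flow at
  \<open>z\<close>.\<close>

definition poincare_section ::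
    "'a metric \<Rightarrow> 'a chart \<Rightarrow> (real^2) \<times> (real^2) \<Rightarrow> ((real^2) \<times> (real^2)) set" where
  "poincare_section g c z =
     {(y, v). y \<in> chart_image c \<and> v \<bullet> (in_chart c (g c) y *v v) = 1 \<and> (y - fst z) \<bullet> snd z = 0}"

definition tangent_vectors :: "'b::real_normed_vector set \<Rightarrow> 'b \<Rightarrow> 'b set" where
  "tangent_vectors S z =
     {w. \<exists>\<rho>::real \<Rightarrow> 'b. \<rho> 0 = z \<and> (\<forall>\<^sub>F s in nhds 0. \<rho> s \<in> S) \<and>
          (\<rho> has_vector_derivative w) (at 0)}"

text \<open>\<open>P\<close> maps a point of the section \<open>S\<close> near \<open>z\<close> to the point of \<open>S\<close>
  where its orbit returns after a time close to \<open>T\<close>.\<close>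

definition poincare_map ::
    "'a::t2_space chart set \<Rightarrow> 'a metric \<Rightarrow> 'a chart \<Rightarrow> real \<Rightarrow> (real^2) \<times> (real^2) \<Rightarrow>
      ((real^2) \<times> (real^2) \<Rightarrow> (real^2) \<times> (real^2)) \<Rightarrow> bool" where
  "poincare_map A g c T z P \<longleftrightarrow>
     (let S = poincare_section g c z in
      P z = z \<and>
      (\<exists>\<tau>. \<tau> z = T \<and> continuous (at z within S) \<tau> \<and>
           (\<forall>\<^sub>F z' in at z within S. P z' = geodesic_flow A g c (\<tau> z') z' \<and> P z' \<in> S)))"

text \<open>Eigenvalues of the complexification of a real linear map on a real subspace \<open>E\<close>, the
  eigenvector being \<open>a + \<i> b\<close>.\<close>

definition complex_eigenvalue ::
    "('b::real_vector \<Rightarrow> 'b) \<Rightarrow> 'b set \<Rightarrow> complex \<Rightarrow> bool" where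
  "complex_eigenvalue L E \<zeta> \<longleftrightarrow>
     (\<exists>a\<in>E. \<exists>b\<in>E. (a \<noteq> 0 \<or> b \<noteq> 0) \<and>
        L a = Re \<zeta> *\<^sub>R a - Im \<zeta> *\<^sub>R b \<and> L b = Im \<zeta> *\<^sub>R a + Re \<zeta> *\<^sub>R b)"

text \<open>The derivative of \<open>P\<close> within the section is determined on the tangent space of the
  section only, and it is used only there.\<close>

definition elliptic_generic ::
    "'a::t2_space chart set \<Rightarrow> 'a metric \<Rightarrow> (real \<Rightarrow> 'a) \<Rightarrow> real \<Rightarrow> bool" where
  "elliptic_generic A g \<gamma> T \<longleftrightarrow>
     (\<exists>c\<in>A. \<gamma> 0 \<in> chart_dom c \<and>
       (let z = (chart_map c (\<gamma> 0), velocity c \<gamma> 0); S = poincare_section g c z in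
        \<exists>P L. poincare_map A g c T z P \<and> (P has_derivative L) (at z within S) \<and>
          (\<forall>\<zeta>. complex_eigenvalue L (tangent_vectors S z) \<zeta> \<longrightarrow>
             cmod \<zeta> = 1 \<and> (\<forall>n>0. \<zeta> ^ n \<noteq> 1))))"


section \<open>Spectral theory of the Laplace operator\<close>

definition square_integrable :: "'a measure \<Rightarrow> ('a \<Rightarrow> complex) \<Rightarrow> bool" where
  "square_integrable M u \<longleftrightarrow> u \<in> borel_measurable M \<and> integrable M (\<lambda>x. (cmod (u x))\<^sup>2)"

definition L2_norm_on :: "'a measure \<Rightarrow> ('a \<Rightarrow> complex) \<Rightarrow> real" where
  "L2_norm_on M u = sqrt (LINT x|M. (cmod (u x))\<^sup>2)"

text \<open>The graph of the self-adjoint operator defined by the Laplacian, that is of the closure of the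
  Laplacian on smooth functions. Functions are not identified when they agree almost everywhere.\<close>

definition laplace_graph ::
    "'a::t2_space chart set \<Rightarrow> 'a metric \<Rightarrow> (('a \<Rightarrow> complex) \<times> ('a \<Rightarrow> complex)) set" where
  "laplace_graph A g =
     (let M = area_measure A g in
      {(u, v). square_integrable M u \<and> square_integrable M v \<and>
         (\<exists>w. (\<forall>n::nat. smooth_function A (w n)) \<and>
              (\<lambda>n. L2_norm_on M (\<lambda>x. w n x - u x)) \<longlonglongrightarrow> 0 \<and>
              (\<lambda>n. L2_norm_on M (\<lambda>x. laplacian A g (w n) x - v x)) \<longlonglongrightarrow> 0)})"

definition laplace_resolvent_set :: "'a::t2_space chart set \<Rightarrow> 'a metric \<Rightarrow> complex set" where
  "laplace_resolvent_set A g =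
     (let M = area_measure A g in
      {\<zeta>. (\<exists>B. \<forall>(u, v)\<in>laplace_graph A g. L2_norm_on M u \<le> B * L2_norm_on M (\<lambda>x. v x - \<zeta> * u x)) \<and>
          (\<forall>h. square_integrable M h \<longrightarrow>
             (\<exists>(u, v)\<in>laplace_graph A g. AE x in M. v x - \<zeta> * u x = h x))})"

definition laplace_spectrum :: "'a::t2_space chart set \<Rightarrow> 'a metric \<Rightarrow> complex set" where
  "laplace_spectrum A g = - laplace_resolvent_set A g"

text \<open>Eigenfunctions are represented by smooth functions, as elliptic regularity permits.\<close>

definition normalized_eigenfunction ::
    "'a::t2_space chart set \<Rightarrow> 'a metric \<Rightarrow> real \<Rightarrow> ('a \<Rightarrow> complex) \<Rightarrow> bool" where
  "normalized_eigenfunction A g \<mu> \<phi> \<longleftrightarrow>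
     smooth_function A \<phi> \<and> (\<forall>x. laplacian A g \<phi> x = of_real \<mu> * \<phi> x) \<and>
     L2_norm_on (area_measure A g) \<phi> = 1"


section \<open>Quasi-modes\<close>

definition gaussian :: "real \<Rightarrow> ennreal \<Rightarrow> real" where
  "gaussian b d = (if d = \<infinity> then 0 else exp (- b * (enn2real d)\<^sup>2))"

definition quasi_modes ::
    "'a::t2_space chart set \<Rightarrow> 'a metric \<Rightarrow> (real \<Rightarrow> 'a) \<Rightarrow> real \<Rightarrow>
      (nat \<Rightarrow> 'a \<Rightarrow> complex) \<Rightarrow> (nat \<Rightarrow> real) \<Rightarrow> bool" where
  "quasi_modes A g \<gamma> T u lam \<longleftrightarrow>
     (let M = area_measure A g in
      (\<forall>m. smooth_function A (u m) \<and> L2_norm_on M (u m) = 1) \<and>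
      rapidly_decreasing
        (\<lambda>m. L2_norm_on M (\<lambda>x. laplacian A g (u m) x - of_real (lam m) * u m x)) \<and>
      (\<exists>\<alpha>::real. (\<lambda>m. lam m - ((2 * pi * real m + \<alpha>) / T)\<^sup>2) \<in> O(\<lambda>_. 1)) \<and>
      (\<forall>K. compact K \<and> K \<inter> range \<gamma> = {} \<longrightarrow>
         rapidly_decreasing (\<lambda>m. LINT x:K|M. (cmod (u m x))\<^sup>2)) \<and>
      (\<exists>b>0. \<exists>C>0. \<exists>N\<ge>0. \<forall>\<^sub>F m in sequentially. \<forall>x.
         cmod (u m x) \<le>
           C * real m powr N * gaussian (b * sqrt (lam m)) (dist_to_set A g x (range \<gamma>))))"

end

theory Submission
 imports Defs
begin

text \<open>Since \<open>f\<close> is flat on \<open>\<gamma>\<close> and \<open>u\<^sub>m\<close> is concentrated on \<open>\<gamma>\<close> in a Gaussian way, \<open>f u\<^sub>m\<close> is \<open>O(m\<^sup>-\<^sup>\<infinity>)\<close>, and so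
  \<open>u\<^sub>m\<close> remains a quasi-mode of \<open>\<Delta>\<^sub>t = e\<^sup>t\<^sup>f \<Delta>\<^sub>0\<close>. The eigenvalues of \<open>\<Delta>\<^sub>t\<close> are the min-max values of the
  Rayleigh quotient with denominator \<open>\<integral> e\<^sup>-\<^sup>t\<^sup>f |u|\<^sup>2 dx\<^sub>0\<close>, hence increase with \<open>t\<close>; where \<open>\<mu>\<close> has an eigenfunction with
  \<open>\<integral> f |\<phi>|\<^sup>2 dx\<^sub>t > \<epsilon>\<close> some eigenvalue branch increases with slope at least of order \<open>\<mu> \<epsilon>\<close> and stays only for a time of
  order \<open>l\<^sub>m / (\<mu> \<epsilon>)\<close> in a window of length \<open>2 l\<^sub>m\<close>. There are polynomially many branches, so with
  \<open>\<epsilon> = l\<^sub>m\<^sup>1\<^sup>/\<^sup>2\<close> the measures of the exceptional sets of \<open>t\<close> are summable, and Borel-Cantelli yields \<open>Z\<close>. Away from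
  \<open>\<gamma>\<close>, where \<open>f\<close> is bounded below, interior elliptic estimates with constants polynomial in \<open>\<mu>\<close>
  turn the smallness of \<open>\<integral> f |\<phi>|\<^sup>2 dx\<^sub>0\<close> into bounds of all derivatives.\<close>

section \<open>Functions of class \<open>C\<^sup>n\<close> in the plane\<close>

text \<open>Eigenvalues are handled through a quantity that makes sense for finitely many smooth
  functions: the infimum of the levels \<open>a\<close> with \<open>low_dim t a k\<close>. Because
  of multiplicities such numbers may fail to be differentiable in \<open>t\<close>; what survives is
  monotonicity and, at a parameter with an eigenfunction of large mass, a drop of definite slope
  towards the left. An elementary covering argument for monotone functions turns these two facts
  into the bound on the time spent in the window. The number of branches that can meet the window
  has to be bounded uniformly in \<open>t\<close>; since weights only decrease with
  \<open>t\<close>, it is bounded at \<open>t = 0\<close>, by Poincare inequalities on the cells of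
  a grid of width \<open>1/N\<close> with \<open>N^2\<close> comparable to the eigenvalue. The
  exponent 1/2 in the mass threshold balances two demands: the threshold and the ratio of window
  length to threshold both have to be rapidly decreasing. That the window contains spectrum is a
  separate matter: it follows from the symmetry of the closed graph and the quasi-mode.\<close>

lemma partial_deriv_eqI:
 "(h has_derivative D) (at y) \<Longrightarrow> partial_deriv i h y = D (axis i 1)"
 unfolding partial_deriv_def by (simp add: frechet_derivative_at[symmetric])

lemma has_derivative_frechet:
 "h differentiable (at y) \<Longrightarrow> (h has_derivative frechet_derivative h (at y)) (at y)"
 by (simp add: frechet_derivative_works)

lemma frechet_derivative_cong_open:
 assumes "open V" "y \<in> V" "\<And>z. z \<in> V \<Longrightarrow> h z = k z"
 shows "frechet_derivative h (at y) = frechet_derivative k (at y)"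
proof -
 have "(h has_derivative D) (at y) \<longleftrightarrow> (k has_derivative D) (at y)" for D
  using has_derivative_transform_within_open[OF _ assms(1,2)] assms(3) by metis
 then show ?thesis by (simp add: frechet_derivative_def)
qed

lemma partial_deriv_cong:
 assumes "open V" "y \<in> V" "\<And>z. z \<in> V \<Longrightarrow> h z = k z"
 shows "partial_deriv i h y = partial_deriv i k y"
 unfolding partial_deriv_def using frechet_derivative_cong_open[OF assms] by simp

lemma differentiable_cong_open:
 assumes "open V" "y \<in> V" "\<And>z. z \<in> V \<Longrightarrow> h z = k z"
 shows "h differentiable (at y) \<longleftrightarrow> k differentiable (at y)"
proof -
 have "(h has_derivative D) (at y) \<longleftrightarrow> (k has_derivative D) (at y)" for D
  using has_derivative_transform_within_open[OF _ assms(1,2)] assms(3) by metis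
 then show ?thesis by (simp add: differentiable_def)
qed

lemma partial_derivs_append:
 "partial_derivs (is @ js) h = partial_derivs is (partial_derivs js h)"
 by (induction "is") auto

text \<open>\<open>smooth_on\<close> speaks of all orders at once, while closure under products and
  compositions is proved by induction on the order, and the cutoffs below are of class C^1 only.
  Differentiability is required at the point and not within \<open>V\<close>, so for open
  \<open>V\<close> the class depends only on the values on \<open>V\<close>.\<close>

fun Ck_on :: "nat \<Rightarrow> (real^2) set \<Rightarrow> (real^2 \<Rightarrow> 'b::real_normed_vector) \<Rightarrow> bool" where
 "Ck_on 0 V h = continuous_on V h"
| "Ck_on (Suc n) V h = ((\<forall>y\<in>V. h differentiable (at y)) \<and> (\<forall>i. Ck_on n V (partial_deriv i h)))"

lemma Ck_on_cong:
 assumes "open V" "\<And>z. z \<in> V \<Longrightarrow> h z = k z"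
 shows "Ck_on n V h \<longleftrightarrow> Ck_on n V k"
 using assms(2)
proof (induction n arbitrary: h k)
 case 0
 then show ?case using continuous_on_cong[OF refl, of V h k] by simp
next
 case (Suc n)
 have "Ck_on n V (partial_deriv i h) \<longleftrightarrow> Ck_on n V (partial_deriv i k)" for i
  by (rule Suc.IH) (use partial_deriv_cong[OF assms(1)] Suc.prems in blast)
 moreover have "h differentiable (at y) \<longleftrightarrow> k differentiable (at y)" if "y \<in> V" for y
  by (rule differentiable_cong_open[OF assms(1) that Suc.prems])
 ultimately show ?case by simp
qed

lemma Ck_on_imp_continuous: "Ck_on n V h \<Longrightarrow> continuous_on V h"
 by (cases n) (auto intro!: differentiable_imp_continuous_on
   simp: differentiable_on_def differentiable_at_withinI)

lemma Ck_on_Suc_imp: "Ck_on (Suc n) V h \<Longrightarrow> Ck_on n V h"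
proof (induction n arbitrary: h)
 case 0
 then show ?case by (metis Ck_on.simps(1) Ck_on_imp_continuous)
qed auto

text \<open>The inductive step of the closure properties below. \<open>partial_deriv i h\<close> is
  a total function with arbitrary values outside \<open>V\<close>, so its formula is asked for on
  \<open>V\<close> only.\<close>

lemma Ck_on_SucI:
 assumes "open V" "\<And>y. y \<in> V \<Longrightarrow> h differentiable (at y)"
  and "\<And>i y. y \<in> V \<Longrightarrow> partial_deriv i h y = k i y" "\<And>i. Ck_on n V (k i)"
 shows "Ck_on (Suc n) V h"
proof -
 have "Ck_on n V (partial_deriv i h)" for i
  using Ck_on_cong[OF assms(1), of "partial_deriv i h" "k i" n] assms(3,4) by blast
 then show ?thesis using assms(2) by simp
qed

lemma Ck_on_Suc_differentiable: "Ck_on (Suc n) V h \<Longrightarrow> y \<in> V \<Longrightarrow> h differentiable (at y)"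
 by simp

lemma Ck_on_Suc_partial_deriv: "Ck_on (Suc n) V h \<Longrightarrow> Ck_on n V (partial_deriv i h)"
 by simp

lemma Ck_on_mono: "Ck_on n V h \<Longrightarrow> m \<le> n \<Longrightarrow> Ck_on m V h"
 by (rule dec_induct[where P = "\<lambda>n. Ck_on n V h \<longrightarrow> Ck_on m V h", THEN mp])
   (auto dest: Ck_on_Suc_imp simp del: Ck_on.simps)

lemma Ck_on_subset: "Ck_on n V h \<Longrightarrow> W \<subseteq> V \<Longrightarrow> Ck_on n W h"
 by (induction n arbitrary: h) (auto intro: continuous_on_subset)

lemma Ck_on_local:
 assumes "open V" "\<And>y. y \<in> V \<Longrightarrow> \<exists>W. open W \<and> y \<in> W \<and> Ck_on n W h"
 shows "Ck_on n V h"
 using assms(2)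
proof (induction n arbitrary: h)
 case 0
 then show ?case
  by (metis Ck_on.simps(1) assms(1) continuous_on_eq_continuous_at)
next
 case (Suc n)
 have "Ck_on n V (partial_deriv i h)" for i
  by (rule Suc.IH) (use Suc.prems in \<open>fastforce\<close>)
 then show ?case using Suc.prems by fastforce
qed

lemma Ck_on_Un:
 assumes "open V" "open W" "Ck_on n V h" "Ck_on n W h"
 shows "Ck_on n (V \<union> W) h"
 by (rule Ck_on_local) (use assms in auto)

lemma smooth_on_imp_differentiable: "smooth_on V h \<Longrightarrow> y \<in> V \<Longrightarrow> h differentiable (at y)"
 unfolding smooth_on_def using partial_derivs.simps(1) by metis

lemma smooth_on_partial_derivs: "smooth_on V h \<Longrightarrow> smooth_on V (partial_derivs js h)"
 unfolding smooth_on_def by (metis partial_derivs_append)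

lemma smooth_on_partial_deriv: "smooth_on V h \<Longrightarrow> smooth_on V (partial_deriv i h)"
 using smooth_on_partial_derivs[of V h "[i]"] by simp

lemma smooth_on_iff_Ck: "smooth_on V h \<longleftrightarrow> (\<forall>n. Ck_on n V h)"
proof
 assume "smooth_on V h"
 then show "\<forall>n. Ck_on n V h"
 proof (intro allI)
  fix n show "smooth_on V h \<Longrightarrow> Ck_on n V h"
  proof (induction n arbitrary: h)
   case 0
   then have "h differentiable_on V"
    unfolding differentiable_on_def by (metis differentiable_at_withinI smooth_on_imp_differentiable)
   then show ?case by (simp add: differentiable_imp_continuous_on)
  next
   case (Suc n)
   then show ?case using smooth_on_partial_deriv smooth_on_imp_differentiable by auto
  qed
 qed
next
 assume *: "\<forall>n. Ck_on n V h"
 \<comment> \<open>The induction peels off the last index: it is the innermost derivative, the one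
   that lowers the order of \<open>h\<close>.\<close>
 have "Ck_on (Suc (length is)) V h \<Longrightarrow> y \<in> V \<Longrightarrow> partial_derivs is h differentiable (at y)" for "is" y
 proof (induction "is" arbitrary: h rule: rev_induct)
  case (snoc i "is")
  then show ?case by (simp add: partial_derivs_append)
 qed auto
 then show "smooth_on V h" unfolding smooth_on_def using * by (auto simp del: Ck_on.simps)
qed

lemma smooth_on_imp_continuous: "smooth_on V h \<Longrightarrow> continuous_on V h"
 using Ck_on_imp_continuous smooth_on_iff_Ck by blast

lemma partial_deriv_const: "partial_deriv i (\<lambda>y. c) = (\<lambda>y. 0)"
 by (rule ext, rule partial_deriv_eqI[where D = "\<lambda>_. 0"]) simp

lemma Ck_on_const: "Ck_on n V (\<lambda>y. c)"
 by (induction n arbitrary: c) (auto simp: partial_deriv_const)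

lemma partial_deriv_linear:
 assumes "bounded_linear f" "h differentiable (at y)"
 shows "partial_deriv i (\<lambda>z. f (h z)) y = f (partial_deriv i h y)"
 unfolding partial_deriv_def[of _ h]
 by (rule partial_deriv_eqI)
   (use bounded_linear.has_derivative[OF assms(1) has_derivative_frechet[OF assms(2)]] in simp)

lemma differentiable_linear:
 "bounded_linear f \<Longrightarrow> h differentiable (at y) \<Longrightarrow> (\<lambda>z. f (h z)) differentiable (at y)"
 using bounded_linear.has_derivative unfolding differentiable_def by blast

lemma Ck_on_linear:
 assumes "bounded_linear f" "open V"
 shows "Ck_on n V h \<Longrightarrow> Ck_on n V (\<lambda>z. f (h z))"
proof (induction n arbitrary: h)
 case 0
 then show ?case using bounded_linear.continuous_on[OF assms(1)] by auto
next
 case (Suc n)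
 note D = Ck_on_Suc_differentiable[OF Suc.prems]
 show ?case
  by (rule Ck_on_SucI[OF assms(2) differentiable_linear[OF assms(1) D] partial_deriv_linear[OF assms(1) D]
     Suc.IH[OF Ck_on_Suc_partial_deriv[OF Suc.prems]]])
qed

lemma partial_deriv_add:
 assumes "h differentiable (at y)" "k differentiable (at y)"
 shows "partial_deriv i (\<lambda>z. h z + k z) y = partial_deriv i h y + partial_deriv i k y"
 unfolding partial_deriv_def[of _ h] partial_deriv_def[of _ k]
 by (rule partial_deriv_eqI)
   (intro has_derivative_add has_derivative_frechet assms)

lemma Ck_on_add:
 assumes "open V"
 shows "Ck_on n V h \<Longrightarrow> Ck_on n V k \<Longrightarrow> Ck_on n V (\<lambda>z. h z + k z)"
proof (induction n arbitrary: h k)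
 case 0
 then show ?case by (auto intro: continuous_intros)
next
 case (Suc n)
 note D = Ck_on_Suc_differentiable[OF Suc.prems(1)] Ck_on_Suc_differentiable[OF Suc.prems(2)]
 show ?case
  by (rule Ck_on_SucI[OF assms differentiable_add[OF D] partial_deriv_add[OF D]
     Suc.IH[OF Ck_on_Suc_partial_deriv[OF Suc.prems(1)] Ck_on_Suc_partial_deriv[OF Suc.prems(2)]]])
qed

lemma Ck_on_sum:
 assumes "open V" "\<And>i. i \<in> I \<Longrightarrow> Ck_on n V (h i)"
 shows "Ck_on n V (\<lambda>z. \<Sum>i\<in>I. h i z)"
 using assms(2)
 by (induction I rule: infinite_finite_induct) (auto intro: Ck_on_const Ck_on_add[OF assms(1)])

lemma partial_deriv_sum:
 assumes "\<And>i. i \<in> I \<Longrightarrow> h i differentiable (at y)"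
 shows "partial_deriv j (\<lambda>z. \<Sum>i\<in>I. h i z) y = (\<Sum>i\<in>I. partial_deriv j (h i) y)"
 using assms
proof (induction I rule: infinite_finite_induct)
 case (insert x F)
 then have "(\<lambda>z. \<Sum>i\<in>F. h i z) differentiable (at y)"
  by (intro differentiable_sum) auto
 then show ?case using insert by (simp add: partial_deriv_add)
qed (auto simp: partial_deriv_const)

context bounded_bilinear
begin

lemma partial_deriv_prod:
 fixes h :: "real^2 \<Rightarrow> 'a" and k :: "real^2 \<Rightarrow> 'b"
 assumes "h differentiable (at y)" "k differentiable (at y)"
 shows "partial_deriv i (\<lambda>z. prod (h z) (k z)) y
  = prod (h y) (partial_deriv i k y) + prod (partial_deriv i h y) (k y)"
 unfolding partial_deriv_def[of _ h] partial_deriv_def[of _ k]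
 by (rule partial_deriv_eqI)
   (intro FDERIV has_derivative_frechet assms)

lemma differentiable_prod:
 "h differentiable (at y) \<Longrightarrow> k differentiable (at y) \<Longrightarrow>
  (\<lambda>z. prod (h z) (k z)) differentiable (at y)"
 using FDERIV unfolding differentiable_def by blast

lemma Ck_on_prod:
 fixes h :: "real^2 \<Rightarrow> 'a" and k :: "real^2 \<Rightarrow> 'b"
 assumes "open V"
 shows "Ck_on n V h \<Longrightarrow> Ck_on n V k \<Longrightarrow> Ck_on n V (\<lambda>z. prod (h z) (k z))"
proof (induction n arbitrary: h k)
 case 0
 then show ?case by (auto intro: continuous_on)
next
 case (Suc n)
 note D = Ck_on_Suc_differentiable[OF Suc.prems(1)] Ck_on_Suc_differentiable[OF Suc.prems(2)]
 note P = Ck_on_Suc_partial_deriv[OF Suc.prems(1)] Ck_on_Suc_partial_deriv[OF Suc.prems(2)]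
 show ?case
  by (rule Ck_on_SucI[OF assms differentiable_prod[OF D] partial_deriv_prod[OF D]])
    (auto simp del: Ck_on.simps
     intro!: Ck_on_add[OF assms] Suc.IH[OF Ck_on_Suc_imp P(2)] Suc.IH[OF P(1) Ck_on_Suc_imp] Suc.prems)
qed

end

lemmas Ck_on_mult = bounded_bilinear.Ck_on_prod[OF bounded_bilinear_mult]
lemmas Ck_on_scaleR = bounded_bilinear.Ck_on_prod[OF bounded_bilinear_scaleR]
lemmas Ck_on_inner = bounded_bilinear.Ck_on_prod[OF bounded_bilinear_inner]
lemmas partial_deriv_mult = bounded_bilinear.partial_deriv_prod[OF bounded_bilinear_mult]
lemmas partial_deriv_scaleR = bounded_bilinear.partial_deriv_prod[OF bounded_bilinear_scaleR]
lemmas partial_deriv_inner = bounded_bilinear.partial_deriv_prod[OF bounded_bilinear_inner]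

lemma vector_2_expand: "v = (\<Sum>j\<in>UNIV. (v $ j) *\<^sub>R axis j (1::real))" for v :: "real^2"
 by (simp add: basis_expansion scalar_mult_eq_scaleR[symmetric])

lemma differentiable_comp:
 assumes "h differentiable (at (\<psi> y))" "\<psi> differentiable (at y)"
 shows "(\<lambda>z. h (\<psi> z)) differentiable (at y)"
 using differentiable_chain_at[OF assms(2,1)] by (simp add: o_def)

lemma frechet_derivative_eq_sum:
 fixes h :: "real^2 \<Rightarrow> 'b::real_normed_vector"
 assumes "h differentiable (at y)"
 shows "frechet_derivative h (at y) v = (\<Sum>j\<in>UNIV. (v $ j) *\<^sub>R partial_deriv j h y)"
proof -
 interpret bounded_linear "frechet_derivative h (at y)"
  using has_derivative_bounded_linear has_derivative_frechet[OF assms] by blast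
 show ?thesis unfolding partial_deriv_def
  by (subst (1) vector_2_expand) (simp add: sum scaleR)
qed

lemma partial_deriv_comp:
 fixes h :: "real^2 \<Rightarrow> 'b::real_normed_vector"
 assumes "h differentiable (at (\<psi> y))" "\<psi> differentiable (at y)"
 shows "partial_deriv i (\<lambda>z. h (\<psi> z)) y
  = (\<Sum>j\<in>UNIV. (partial_deriv i \<psi> y $ j) *\<^sub>R partial_deriv j h (\<psi> y))"
proof -
 have "((\<lambda>z. h (\<psi> z)) has_derivative
  (\<lambda>v. frechet_derivative h (at (\<psi> y)) (frechet_derivative \<psi> (at y) v))) (at y)"
  using diff_chain_at[OF has_derivative_frechet[OF assms(2)] has_derivative_frechet[OF assms(1)]]
  by (simp add: o_def)
 from partial_deriv_eqI[OF this] show ?thesis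
  by (simp add: frechet_derivative_eq_sum[OF assms(1)] partial_deriv_def[symmetric])
qed

lemma Ck_on_nth: "open V \<Longrightarrow> Ck_on n V h \<Longrightarrow> Ck_on n V (\<lambda>y. h y $ j)"
 for h :: "real^2 \<Rightarrow> ('b::real_normed_vector)^'n"
 by (rule Ck_on_linear[OF bounded_linear_vec_nth])

lemma Ck_on_comp:
 fixes h :: "real^2 \<Rightarrow> 'b::real_normed_vector"
 assumes "open V" "open W" "\<And>y. y \<in> W \<Longrightarrow> \<psi> y \<in> V"
 shows "Ck_on n V h \<Longrightarrow> Ck_on n W \<psi> \<Longrightarrow> Ck_on n W (\<lambda>z. h (\<psi> z))"
proof (induction n arbitrary: h)
 case 0
 then show ?case using continuous_on_compose2[of V h W \<psi>] assms by auto
next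
 case (Suc n)
 note D = Ck_on_Suc_differentiable[OF Suc.prems(1) assms(3)] Ck_on_Suc_differentiable[OF Suc.prems(2)]
 show ?case
 proof (rule Ck_on_SucI[OF assms(2) differentiable_comp[OF D] partial_deriv_comp[OF D]])
  show "Ck_on n W (\<lambda>z. \<Sum>j\<in>UNIV. (partial_deriv i \<psi> z $ j) *\<^sub>R partial_deriv j h (\<psi> z))" for i
   using Ck_on_Suc_imp[OF Suc.prems(2)] Suc.prems
   by (intro Ck_on_sum[OF assms(2)] Ck_on_scaleR[OF assms(2)] Ck_on_nth[OF assms(2)] Suc.IH) auto
 qed auto
qed

lemma partial_deriv_real_comp:
 fixes h :: "real^2 \<Rightarrow> real"
 assumes "(F has_real_derivative D) (at (h y))" "h differentiable (at y)"
 shows "partial_deriv i (\<lambda>z. F (h z)) y = D * partial_deriv i h y"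
proof -
 have "((\<lambda>z. F (h z)) has_derivative (\<lambda>v. D * frechet_derivative h (at y) v)) (at y)"
  using diff_chain_at[OF has_derivative_frechet[OF assms(2)] assms(1)[unfolded has_field_derivative_def]]
  by (simp add: o_def)
 from partial_deriv_eqI[OF this] show ?thesis by (simp add: partial_deriv_def)
qed

lemma differentiable_real_comp:
 assumes "(F has_real_derivative D) (at (h y))" "h differentiable (at y)"
 shows "(\<lambda>z. F (h z)) differentiable (at y)"
 using differentiable_chain_at[OF assms(2), of F] assms(1)
 by (auto simp: o_def has_field_derivative_def differentiable_def)

text \<open>The induction for \<open>F \<circ> h\<close> only needs the outer derivative to be of class
 \<open>C\<^sup>n\<close> once \<open>F \<circ> h\<close> is.\<close>

lemma Ck_on_real_comp:
 fixes h :: "real^2 \<Rightarrow> real"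
 assumes V: "open V"
  and F: "\<And>y. y \<in> V \<Longrightarrow> (F has_real_derivative F' (h y)) (at (h y))"
  and step: "\<And>n. Ck_on n V h \<Longrightarrow> Ck_on n V (\<lambda>z. F (h z)) \<Longrightarrow> Ck_on n V (\<lambda>z. F' (h z))"
 shows "Ck_on n V h \<Longrightarrow> Ck_on n V (\<lambda>z. F (h z))"
proof (induction n)
 case 0
 then have "isCont (\<lambda>z. F (h z)) y" if "y \<in> V" for y
  using that V DERIV_isCont[OF F[OF that]]
  by (auto simp: continuous_on_eq_continuous_at intro: isCont_o2)
 then show ?case
  using V by (auto simp: continuous_on_eq_continuous_at)
next
 case (Suc n)
 note n = Ck_on_Suc_imp[OF Suc.prems] and D = Ck_on_Suc_differentiable[OF Suc.prems]
 show ?case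
  by (rule Ck_on_SucI[OF V differentiable_real_comp[OF F D] partial_deriv_real_comp[OF F D]
     Ck_on_mult[OF V step[OF n Suc.IH[OF n]] Ck_on_Suc_partial_deriv[OF Suc.prems]]])
qed

lemma Ck_on_exp: "open V \<Longrightarrow> Ck_on n V h \<Longrightarrow> Ck_on n V (\<lambda>z. exp (h z :: real))"
 by (rule Ck_on_real_comp[where F' = exp]) (auto intro: DERIV_exp)

text \<open>The derivative of the inverse is a polynomial in the inverse itself, so the regularity
  of the composition feeds back into that of the outer derivative, as \<open>Ck_on_real_comp\<close>
  asks. The square root works alike, its derivative being half the inverse of the root.\<close>

lemma Ck_on_inverse:
 fixes h :: "real^2 \<Rightarrow> real"
 assumes "open V" "\<And>y. y \<in> V \<Longrightarrow> h y \<noteq> 0" "Ck_on n V h"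
 shows "Ck_on n V (\<lambda>z. inverse (h z))"
proof (rule Ck_on_real_comp[OF assms(1) _ _ assms(3), where F' = "\<lambda>x. -1 * (inverse x * inverse x)"])
 fix n assume "Ck_on n V (\<lambda>z. inverse (h z))"
 then show "Ck_on n V (\<lambda>z. - 1 * (inverse (h z) * inverse (h z)))"
  by (intro Ck_on_mult[OF assms(1)] Ck_on_const)
next
 fix y assume "y \<in> V"
 then show "(inverse has_real_derivative - 1 * (inverse (h y) * inverse (h y))) (at (h y))"
  using DERIV_inverse[of "h y"] assms(2) by (simp add: power2_eq_square)
qed

lemma Ck_on_sqrt:
 fixes h :: "real^2 \<Rightarrow> real"
 assumes "open V" "\<And>y. y \<in> V \<Longrightarrow> h y > 0" "Ck_on n V h"
 shows "Ck_on n V (\<lambda>z. sqrt (h z))"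
proof (rule Ck_on_real_comp[OF assms(1) _ _ assms(3), where F' = "\<lambda>x. inverse (sqrt x) * (1/2)"])
 fix n assume "Ck_on n V (\<lambda>z. sqrt (h z))"
 then show "Ck_on n V (\<lambda>z. inverse (sqrt (h z)) * (1 / 2))"
  by (intro Ck_on_mult[OF assms(1)] Ck_on_const Ck_on_inverse[OF assms(1)])
    (use assms(2) in fastforce)
next
 fix y assume "y \<in> V"
 then show "(sqrt has_real_derivative inverse (sqrt (h y)) * (1/2)) (at (h y))"
  using DERIV_real_sqrt[of "h y"] assms(2) by simp
qed

lemma Ck_on_id: "Ck_on n V (\<lambda>y. y)"
proof (cases n)
 case (Suc m)
 have "partial_deriv i (\<lambda>y::real^2. y) = (\<lambda>y. axis i 1)" for i
  by (rule ext, rule partial_deriv_eqI[where D = "\<lambda>v. v"]) simp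
 then show ?thesis using Suc by (simp add: Ck_on_const)
qed simp

lemma Ck_on_uminus: "open V \<Longrightarrow> Ck_on n V h \<Longrightarrow> Ck_on n V (\<lambda>y. - h y)"
 by (rule Ck_on_linear[OF bounded_linear_minus[OF bounded_linear_ident]])

lemma Ck_on_diff:
 assumes "open V" "Ck_on n V h" "Ck_on n V k"
 shows "Ck_on n V (\<lambda>y. h y - k y)"
 using Ck_on_add[OF assms(1,2) Ck_on_uminus[OF assms(1,3)]] by simp

text \<open>The open sets \<open>V\<close> and \<open>- K\<close> cover the plane, and on the second
  one the extension vanishes identically. This makes a function with compact support in a chart
  image accessible to integration over the whole plane.\<close>

lemma Ck_on_UNIV_zero_extension:
 assumes "open V" "compact K" "K \<subseteq> V" "Ck_on n V h" "\<And>y. y \<in> V - K \<Longrightarrow> h y = 0"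
 shows "Ck_on n UNIV (\<lambda>y. if y \<in> V then h y else 0)"
proof -
 have "Ck_on n V (\<lambda>y. if y \<in> V then h y else 0)"
  by (subst Ck_on_cong[OF assms(1), of _ h]) (use assms(4) in auto)
 moreover have "Ck_on n (- K) (\<lambda>y. if y \<in> V then h y else 0)"
 proof (subst Ck_on_cong[of "-K" _ "\<lambda>y. 0"])
  show "open (- K)" using assms(2) by (simp add: compact_imp_closed open_Compl)
 qed (use assms(5) in \<open>auto simp: Ck_on_const\<close>)
 ultimately have "Ck_on n (V \<union> - K) (\<lambda>y. if y \<in> V then h y else 0)"
  using assms(1,2) by (intro Ck_on_Un) (simp_all add: compact_imp_closed open_Compl)
 moreover have "V \<union> - K = UNIV" using assms(3) by auto
 ultimately show ?thesis by metis
qed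

section \<open>Derivatives along segments and the symmetry of second derivatives\<close>

lemma has_vector_derivative_along_segment:
 assumes "h differentiable (at (z + x *\<^sub>R q))"
 shows "((\<lambda>x. h (z + x *\<^sub>R q)) has_vector_derivative frechet_derivative h (at (z + x *\<^sub>R q)) q) (at x)"
proof -
 have "((\<lambda>x. z + x *\<^sub>R q) has_derivative (\<lambda>t. t *\<^sub>R q)) (at x)" by (auto intro!: derivative_eq_intros)
 from diff_chain_at[OF this has_derivative_frechet[OF assms]] show ?thesis
  by (simp add: o_def has_vector_derivative_def linear_cmul[OF linear_frechet_derivative[OF assms]])
qed

lemma DERIV_along_axis:
 fixes h :: "real^2 \<Rightarrow> real"
 assumes "h differentiable (at (z + x *\<^sub>R axis i 1))"
 shows "((\<lambda>x. h (z + x *\<^sub>R axis i 1)) has_real_derivative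
  partial_deriv i h (z + x *\<^sub>R axis i 1)) (at x)"
 using has_vector_derivative_along_segment[OF assms]
 by (simp add: has_real_derivative_iff_has_vector_derivative partial_deriv_def)

lemma norm_axis_one: "norm (axis i (1::real) :: real^2) = 1"
 by simp

text \<open>Two applications of the mean value theorem, first along \<open>i\<close> to the
  increment in direction \<open>j\<close>, then along \<open>j\<close>. The second difference is
  symmetric in \<open>i\<close> and \<open>j\<close> and the right side is not; commutation of
  derivatives comes from this asymmetry. The radius \<open>2 * s\<close> holds the whole
  parallelogram, also for \<open>i = j\<close>.\<close>

lemma mixed_difference_mvt:
 fixes h :: "real^2 \<Rightarrow> real"
 assumes h: "Ck_on 2 V h" and V: "cball y (2 * s) \<subseteq> V" and s: "s > 0"
 shows "\<exists>z\<in>cball y (2 * s).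
  h (y + s *\<^sub>R axis i 1 + s *\<^sub>R axis j 1) - h (y + s *\<^sub>R axis i 1) - h (y + s *\<^sub>R axis j 1) + h y
  = s * s * partial_deriv j (partial_deriv i h) z"
proof -
 let ?e = "\<lambda>i. axis i (1::real) :: real^2"
 have in_V: "y + a *\<^sub>R ?e i + b *\<^sub>R ?e j \<in> cball y (2 * s)" if "0 \<le> a" "a \<le> s" "0 \<le> b" "b \<le> s" for a b
 proof -
  have "norm (a *\<^sub>R ?e i + b *\<^sub>R ?e j) \<le> a + b"
   using norm_triangle_ineq[of "a *\<^sub>R ?e i" "b *\<^sub>R ?e j"] that by (simp add: norm_axis_one)
  then show ?thesis using that by (simp add: dist_commute[of y] add.assoc) (simp add: dist_norm)
 qed
 have d1: "h differentiable (at z)" if "z \<in> cball y (2 * s)" for z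
  using h V that by (auto simp: numeral_2_eq_2)
 have d2: "partial_deriv i h differentiable (at z)" if "z \<in> cball y (2 * s)" for z
  using h V that by (auto simp: numeral_2_eq_2)
 define \<phi> where "\<phi> x = h (y + s *\<^sub>R ?e j + x *\<^sub>R ?e i) - h (y + x *\<^sub>R ?e i)" for x
 have "(\<phi> has_real_derivative
   partial_deriv i h (y + s *\<^sub>R ?e j + x *\<^sub>R ?e i) - partial_deriv i h (y + x *\<^sub>R ?e i)) (at x)"
  if "0 \<le> x" "x \<le> s" for x
  unfolding \<phi>_def using in_V[of x s] in_V[of x 0] that s
  by (intro DERIV_diff DERIV_along_axis d1) (auto simp: add_ac)
 from MVT2[OF s this] obtain \<xi> where \<xi>: "0 < \<xi>" "\<xi> < s"
  "\<phi> s - \<phi> 0 = s * (partial_deriv i h (y + s *\<^sub>R ?e j + \<xi> *\<^sub>R ?e i) - partial_deriv i h (y + \<xi> *\<^sub>R ?e i))"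
  by auto
 have "((\<lambda>x. partial_deriv i h (y + \<xi> *\<^sub>R ?e i + x *\<^sub>R ?e j)) has_real_derivative
   partial_deriv j (partial_deriv i h) (y + \<xi> *\<^sub>R ?e i + x *\<^sub>R ?e j)) (at x)"
  if "0 \<le> x" "x \<le> s" for x
  using in_V[of \<xi> x] that \<xi> by (intro DERIV_along_axis d2) auto
 from MVT2[OF s this] obtain \<eta> where \<eta>: "0 < \<eta>" "\<eta> < s"
  "partial_deriv i h (y + \<xi> *\<^sub>R ?e i + s *\<^sub>R ?e j) - partial_deriv i h (y + \<xi> *\<^sub>R ?e i)
   = s * partial_deriv j (partial_deriv i h) (y + \<xi> *\<^sub>R ?e i + \<eta> *\<^sub>R ?e j)" by auto
 have "\<phi> s - \<phi> 0 = s * s * partial_deriv j (partial_deriv i h) (y + \<xi> *\<^sub>R ?e i + \<eta> *\<^sub>R ?e j)"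
  using \<xi>(3) \<eta>(3) by (simp add: add_ac)
 moreover have "\<phi> s - \<phi> 0 = h (y + s *\<^sub>R ?e i + s *\<^sub>R ?e j) - h (y + s *\<^sub>R ?e i) - h (y + s *\<^sub>R ?e j) + h y"
  by (simp add: \<phi>_def add_ac)
 ultimately show ?thesis using in_V[of \<xi> \<eta>] \<xi> \<eta> by force
qed

lemma partial_deriv_commute_real:
 fixes h :: "real^2 \<Rightarrow> real"
 assumes V: "open V" "y \<in> V" and h: "Ck_on 2 V h"
 shows "partial_deriv i (partial_deriv j h) y = partial_deriv j (partial_deriv i h) y"
proof (rule ccontr)
 let ?a = "partial_deriv i (partial_deriv j h)" and ?b = "partial_deriv j (partial_deriv i h)"
 assume "?a y \<noteq> ?b y"
 define \<epsilon> where "\<epsilon> = \<bar>?a y - ?b y\<bar> / 2"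
 have \<epsilon>: "\<epsilon> > 0" using \<open>?a y \<noteq> ?b y\<close> by (simp add: \<epsilon>_def)
 have "isCont ?a y" "isCont ?b y"
  using h V by (auto simp: numeral_2_eq_2 continuous_on_eq_continuous_at)
 then obtain d e where d: "d > 0" "\<forall>z. dist z y < d \<longrightarrow> dist (?a z) (?a y) < \<epsilon>"
  and e: "e > 0" "\<forall>z. dist z y < e \<longrightarrow> dist (?b z) (?b y) < \<epsilon>"
  using \<epsilon> unfolding continuous_at_eps_delta by blast
 obtain r where r: "r > 0" "cball y r \<subseteq> V" using V open_contains_cball by blast
 define s where "s = min r (min d e) / 4"
 have s: "s > 0" "2 * s < d" "2 * s < e" "cball y (2 * s) \<subseteq> V"
  using d e r by (auto simp: s_def)
 obtain z where z: "z \<in> cball y (2 * s)"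
  "h (y + s *\<^sub>R axis i 1 + s *\<^sub>R axis j 1) - h (y + s *\<^sub>R axis i 1) - h (y + s *\<^sub>R axis j 1) + h y = s * s * ?b z"
  using mixed_difference_mvt[OF h s(4,1)] by blast
 obtain w where w: "w \<in> cball y (2 * s)"
  "h (y + s *\<^sub>R axis j 1 + s *\<^sub>R axis i 1) - h (y + s *\<^sub>R axis j 1) - h (y + s *\<^sub>R axis i 1) + h y = s * s * ?a w"
  using mixed_difference_mvt[OF h s(4,1)] by blast
 have "s * s * ?b z = s * s * ?a w" unfolding z(2)[symmetric] w(2)[symmetric] by (simp add: add_ac)
 then have "?b z = ?a w" using s(1) by simp
 moreover have "\<bar>?a w - ?a y\<bar> < \<epsilon>" using d(2)[rule_format, of w] w(1) s by (simp add: dist_commute dist_real_def)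
 moreover have "\<bar>?b z - ?b y\<bar> < \<epsilon>" using e(2)[rule_format, of z] z(1) s by (simp add: dist_commute dist_real_def)
 ultimately show False unfolding \<epsilon>_def by (simp add: field_simps abs_if split: if_splits)
qed

text \<open>Testing with every vector \<open>e\<close> reduces this to real-valued functions,
  because a bounded linear functional commutes with partial derivatives.\<close>

lemma partial_deriv_commute:
 fixes h :: "real^2 \<Rightarrow> 'b::real_inner"
 assumes V: "open V" "y \<in> V" and h: "Ck_on 2 V h"
 shows "partial_deriv i (partial_deriv j h) y = partial_deriv j (partial_deriv i h) y"
proof -
 have "e \<bullet> partial_deriv i (partial_deriv j h) y = e \<bullet> partial_deriv j (partial_deriv i h) y" for e
 proof -
 have bl: "bounded_linear (\<lambda>v::'b. e \<bullet> v)" by (rule bounded_linear_inner_right)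
 have d: "h differentiable (at z)" "partial_deriv k h differentiable (at z)" if "z \<in> V" for z k
  using h that by (auto simp: numeral_2_eq_2)
 have "e \<bullet> partial_deriv k (partial_deriv l h) y = partial_deriv k (partial_deriv l (\<lambda>z. e \<bullet> h z)) y" for k l
  using partial_deriv_cong[OF V, of "partial_deriv l (\<lambda>z. e \<bullet> h z)" "\<lambda>z. e \<bullet> partial_deriv l h z" k]
   partial_deriv_linear[OF bl d(1)] partial_deriv_linear[OF bl d(2)] V by simp
 then show ?thesis
  using partial_deriv_commute_real[OF V Ck_on_linear[OF bl V(1) h]] by metis
 qed
 then show ?thesis using vector_eq_ldot by blast
qed

lemma compact_bounded_values:
 fixes k :: "'b::topological_space \<Rightarrow> real"
 assumes "compact K" "continuous_on K k" shows "\<exists>b>0. \<forall>y\<in>K. \<bar>k y\<bar> \<le> b"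
 using compact_imp_bounded[OF compact_continuous_image[OF assms(2,1)]] unfolding bounded_pos by auto

lemma compact_positive_lower_bound:
 fixes k :: "'b::topological_space \<Rightarrow> real"
 assumes "compact K" "continuous_on K k" "\<And>y. y \<in> K \<Longrightarrow> k y > 0"
 shows "\<exists>\<delta>>0. \<forall>y\<in>K. \<delta> \<le> k y"
proof (cases "K = {}")
 case False
 then obtain y where "y \<in> K" "\<forall>z\<in>K. k y \<le> k z"
  using continuous_attains_inf[OF assms(1) _ assms(2)] by blast
 then show ?thesis using assms(3) by blast
qed (auto intro: exI[of _ 1])

lemma borel_measurable_indicator_ennreal:
 fixes k :: "'b::topological_space \<Rightarrow> real"
 assumes "S \<in> sets borel" "continuous_on S k"
 shows "(\<lambda>y. indicator S y * ennreal (k y)) \<in> borel_measurable borel"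
proof -
 have "(\<lambda>y. ennreal (indicator S y *\<^sub>R k y)) \<in> borel_measurable borel"
  using borel_measurable_continuous_on_indicator[OF assms] by simp
 moreover have "(\<lambda>y. ennreal (indicator S y *\<^sub>R k y)) = (\<lambda>y. indicator S y * ennreal (k y))"
  by (auto simp: indicator_def)
 ultimately show ?thesis by (simp only:)
qed

section \<open>The divergence theorem for compactly supported fields\<close>

lemma integrable_continuous_compact_support:
 fixes h :: "real^2 \<Rightarrow> 'b::euclidean_space"
 assumes "continuous_on UNIV h" "compact K" "\<And>y. y \<notin> K \<Longrightarrow> h y = 0"
 shows "integrable lborel h"
proof -
 have "integrable lborel (\<lambda>y. indicator K y *\<^sub>R h y)"
  by (rule borel_integrable_compact[OF assms(2) continuous_on_subset[OF assms(1)]]) simp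
 moreover have "(\<lambda>y. indicator K y *\<^sub>R h y) = h"
  using assms(3) by (auto simp: indicator_def)
 ultimately show ?thesis by simp
qed

text \<open>Lebesgue measure on \<open>real^2\<close> is recognised as the image of a product
  measure by comparing boxes, which makes Fubini's theorem available. Either axis can be the inner
  variable.\<close>

lemma lborel_axes:
 assumes ij: "i \<noteq> (j::2)"
 defines "F \<equiv> \<lambda>(a, b). a *\<^sub>R axis i 1 + b *\<^sub>R axis j (1::real)"
 shows "F \<in> lborel \<Otimes>\<^sub>M lborel \<rightarrow>\<^sub>M borel" "lborel = distr (lborel \<Otimes>\<^sub>M lborel) borel F"
proof -
 have "F \<in> borel \<rightarrow>\<^sub>M borel"
  unfolding F_def by (intro borel_measurable_continuous_onI) (auto simp: case_prod_unfold intro!: continuous_intros)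
 then show F: "F \<in> lborel \<Otimes>\<^sub>M lborel \<rightarrow>\<^sub>M borel" unfolding lborel_prod by simp
 have U: "UNIV = {i, j}" using ij exhaust_2[of i] exhaust_2[of j] by (auto simp: UNIV_2)
 then have all: "(\<forall>k. P k) \<longleftrightarrow> P i \<and> P j" for P by (metis UNIV_I insertE singletonD)
 have ax: "axis i (1::real) $ j = 0" "axis j (1::real) $ i = 0" using ij by (auto simp: axis_def)
 show "lborel = distr (lborel \<Otimes>\<^sub>M lborel) borel F"
 proof (rule lborel_eqI)
  fix l u :: "real^2" assume le: "\<And>b. b \<in> Basis \<Longrightarrow> l \<bullet> b \<le> u \<bullet> b"
  have "F -` box l u = {l $ i<..<u $ i} \<times> {l $ j<..<u $ j}"
   by (auto simp: F_def box_def Basis_vec_def all inner_axis ax)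
  moreover have "l $ k \<le> u $ k" for k using le[of "axis k 1"] by (simp add: inner_axis axis_in_Basis_iff)
  moreover have "(\<Prod>b\<in>Basis. (u - l) \<bullet> b) = (u $ i - l $ i) * (u $ j - l $ j)"
  proof -
   have "(\<Prod>b\<in>Basis. (u - l) \<bullet> b) = (\<Prod>k\<in>UNIV. (u - l) \<bullet> axis k 1)"
    by (simp add: Basis_vec_def UNION_singleton_eq_range prod.reindex inj_on_def axis_eq_axis)
   then show ?thesis using ij by (simp add: U inner_axis)
  qed
  ultimately show "emeasure (distr (lborel \<Otimes>\<^sub>M lborel) borel F) (box l u) = (\<Prod>b\<in>Basis. (u - l) \<bullet> b)"
   by (simp add: emeasure_distr[OF F] lborel.emeasure_pair_measure_Times ennreal_mult)
 qed simp
qed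

lemma integral_partial_deriv_zero:
 fixes h :: "real^2 \<Rightarrow> real"
 assumes h: "Ck_on 1 UNIV h" and K: "compact K" "\<And>y. y \<notin> K \<Longrightarrow> h y = 0"
 shows "integrable lborel (partial_deriv i h)" "(LINT y|lborel. partial_deriv i h y) = 0"
proof -
 let ?d = "partial_deriv i h"
 have cont: "continuous_on UNIV ?d" using h by auto
 have diff: "h differentiable (at y)" for y using h by simp
 have out: "?d y = 0" if "y \<notin> K" for y
  using partial_deriv_cong[of "- K" y h "\<lambda>_. 0" i] that K
  by (simp add: compact_imp_closed open_Compl partial_deriv_const)
 show int: "integrable lborel ?d"
  by (rule integrable_continuous_compact_support[OF cont K(1) out])
 obtain R where R: "R > 0" "\<And>y. y \<in> K \<Longrightarrow> norm y \<le> R"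
  using compact_imp_bounded[OF K(1)] unfolding bounded_pos by blast
 obtain j :: 2 where j: "j \<noteq> i" using exhaust_2[of i] by (metis zero_neq_one)
 \<comment> \<open>The direction \<open>i\<close> of the derivative becomes the inner variable, so
   the inner integral is a fundamental theorem of calculus along a line.\<close>
 let ?z = "\<lambda>s t. s *\<^sub>R axis j 1 + t *\<^sub>R axis i (1::real)"
 note L = lborel_axes[OF j]
 have "(LINT t|lborel. ?d (?z s t)) = 0" for s
 proof -
  have far: "?z s t \<notin> K" if "\<bar>t\<bar> > R" for t
   using R(2)[of "?z s t"] component_le_norm_cart[of "?z s t" i] that j by (auto simp: axis_def)
  \<comment> \<open>\<open>K\<close> lies in the ball of radius \<open>R\<close>; the margin 1 puts
    both end points outside \<open>K\<close>, where \<open>h\<close> vanishes.\<close>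
  have "(LINT t|lborel. ?d (?z s t)) = (LINT t|lborel. ?d (?z s t) * indicator {- (R + 1)..R + 1} t)"
  proof (rule Bochner_Integration.integral_cong[OF refl])
   show "?d (?z s t) = ?d (?z s t) * indicator {- (R + 1)..R + 1} t" for t
    using out[OF far, of t] by (cases "\<bar>t\<bar> \<le> R") (auto simp: indicator_def)
  qed
  also have "\<dots> = h (?z s (R + 1)) - h (?z s (- (R + 1)))"
  proof (rule integral_FTC_Icc_real)
   show "((\<lambda>t. h (?z s t)) has_real_derivative ?d (?z s t)) (at t)" for t
    using DERIV_along_axis[of h "s *\<^sub>R axis j 1" t i, OF diff] by simp
   show "isCont (\<lambda>t. ?d (?z s t)) t" for t
    by (rule isCont_o2[of _ "?z s" ?d]) (use cont in \<open>auto simp: continuous_on_eq_continuous_at intro!: continuous_intros\<close>)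
  qed (use R in auto)
  also have "\<dots> = 0" using K(2) far R(1) by simp
  finally show ?thesis .
 qed
 moreover have "(LINT y|lborel. ?d y) = (LINT s|lborel. LINT t|lborel. ?d (?z s t))"
 proof -
  have m: "?d \<in> borel_measurable borel" using cont by (rule borel_measurable_continuous_onI)
  have "integrable (lborel \<Otimes>\<^sub>M lborel) (\<lambda>p. ?d (case p of (a, b) \<Rightarrow> ?z a b))"
   using int unfolding L(2) integrable_distr_eq[OF L(1) m] .
  from lborel_pair.integral_fst'[OF this] show ?thesis
   unfolding L(2) integral_distr[OF L(1) m] by simp
 qed
 ultimately show "(LINT y|lborel. ?d y) = 0" by simp
qed

text \<open>Squaring the positive part removes its kink. The derivative is continuous, which is the
  regularity at which the cutoffs of this development live.\<close>

lemma DERIV_max_square: "((\<lambda>x. (max 0 x)^2) has_real_derivative 2 * max 0 x) (at (x::real))"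
proof -
 consider "x > 0" | "x < 0" | "x = 0" by linarith
 then show ?thesis
 proof cases
  case 1
  have "((\<lambda>x. x^2) has_real_derivative 2 * x) (at x)" by (auto intro!: derivative_eq_intros)
  then show ?thesis
   using has_field_derivative_transform_within_open[of "\<lambda>x. x^2" "2 * x" x "{0<..}" "\<lambda>x. (max 0 x)^2"] 1
   by (auto simp: max_def)
 next
  case 2
  have "((\<lambda>x. 0::real) has_real_derivative 0) (at x)" by simp
  then show ?thesis
   using has_field_derivative_transform_within_open[of "\<lambda>x. 0" 0 x "{..<0}" "\<lambda>x. (max 0 x)^2"] 2
   by (auto simp: max_def)
 next
  case 3
  have "((\<lambda>x::real. (max 0 x)^2 / x) \<longlongrightarrow> 0) (at 0)"
  proof (rule Lim_null_comparison[where g = "\<lambda>x. \<bar>x\<bar>"])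
   show "\<forall>\<^sub>F x::real in at 0. norm ((max 0 x)^2 / x) \<le> \<bar>x\<bar>"
    by (rule always_eventually) (auto simp: max_def power2_eq_square)
   show "((\<lambda>x::real. \<bar>x\<bar>) \<longlongrightarrow> 0) (at 0)" by (intro tendsto_rabs_zero) simp
  qed
  then show ?thesis using 3 by (simp add: DERIV_def)
 qed
qed

text \<open>The squared positive part of a quadratic polynomial: positive exactly in the open ball
  and of class C^1 on the plane, so that finite sums of bumps give cutoffs and, after division,
  partitions of unity.\<close>

definition bump :: "real^2 \<Rightarrow> real \<Rightarrow> real^2 \<Rightarrow> real" where
 "bump p r y = (max 0 (r^2 - (y - p) \<bullet> (y - p)))^2"

lemma bump_nonneg: "bump p r y \<ge> 0"
 by (simp add: bump_def)

lemma bump_pos_iff: "r > 0 \<Longrightarrow> bump p r y > 0 \<longleftrightarrow> y \<in> ball p r"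
proof -
 assume r: "r > 0"
 have "(y - p) \<bullet> (y - p) = (dist p y)^2"
  by (simp add: dist_norm power2_norm_eq_inner norm_minus_commute[of p])
 moreover have "(dist p y)^2 < r^2 \<longleftrightarrow> dist p y < r"
  using r by (smt (verit) power_mono_iff zero_le_dist zero_less_numeral)
 ultimately show ?thesis by (auto simp: bump_def max_def)
qed

lemma bump_zero: "r > 0 \<Longrightarrow> y \<notin> ball p r \<Longrightarrow> bump p r y = 0"
 using bump_pos_iff[of r p y] bump_nonneg[of p r y] by linarith

lemma Ck_on_bump: "Ck_on 1 UNIV (bump p r)"
proof -
 let ?k = "\<lambda>y. r^2 - (y - p) \<bullet> (y - p)"
 have k: "Ck_on n UNIV ?k" for n
  by (intro Ck_on_diff Ck_on_inner Ck_on_const Ck_on_id open_UNIV)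
 have "Ck_on (Suc 0) UNIV (\<lambda>y. (max 0 (?k y))^2)"
 proof (rule Ck_on_SucI[OF open_UNIV])
  have d: "?k differentiable (at y)" for y using k[of 1] by simp
  show "(\<lambda>y. (max 0 (?k y))^2) differentiable (at y)" for y
   by (rule differentiable_real_comp[OF DERIV_max_square d])
  show "partial_deriv i (\<lambda>y. (max 0 (?k y))^2) y = 2 * max 0 (?k y) * partial_deriv i ?k y" for i y
   by (rule partial_deriv_real_comp[OF DERIV_max_square d])
  show "Ck_on 0 UNIV (\<lambda>y. 2 * max 0 (?k y) * partial_deriv i ?k y)" for i
   using k[of 1] by (auto intro!: continuous_intros)
 qed
 then show ?thesis by (simp add: bump_def[abs_def])
qed

section \<open>The area measure\<close>

lemma det_pos_def_2:
 fixes G :: "real^2^2"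
 assumes "transpose G = G" "\<And>v. v \<noteq> 0 \<Longrightarrow> v \<bullet> (G *v v) > 0"
 shows "det G > 0"
proof -
 have sym: "G $ 1 $ 2 = G $ 2 $ 1"
  using arg_cong[OF assms(1), of "\<lambda>M. M $ 1 $ 2"] by (simp add: transpose_def)
 have 1: "axis 1 1 \<bullet> (G *v axis 1 1) = G $ 1 $ 1"
  by (simp add: inner_vec_def matrix_vector_mult_def sum_2 axis_def)
 have pos: "G $ 1 $ 1 > 0" using assms(2)[of "axis 1 1"] 1 by simp
 \<comment> \<open>On this vector the quadratic form takes the value
   \<open>G $ 1 $ 1 * det G\<close>, so positivity of the form gives positivity of the
   determinant.\<close>
 define v :: "real^2" where "v = vector [- G $ 1 $ 2, G $ 1 $ 1]"
 have v: "v $ 1 = - G $ 1 $ 2" "v $ 2 = G $ 1 $ 1" by (simp_all add: v_def)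
 have "v \<noteq> 0" using pos v(2) by auto
 moreover have "v \<bullet> (G *v v) = G $ 1 $ 1 * det G"
  by (simp add: inner_vec_def matrix_vector_mult_def sum_2 v det_2 sym algebra_simps)
 ultimately show ?thesis using assms(2)[of v] pos by (simp add: zero_less_mult_iff)
qed

text \<open>The change of variables theorem speaks of absolutely integrable functions and their
  gauge integrals, whereas area is defined by nonnegative integrals that may be infinite. The case
  distinction translates between the two.\<close>

lemma nn_integral_eq_integral_on:
 fixes h :: "'n::euclidean_space \<Rightarrow> real"
 assumes S: "S \<in> sets borel" and m: "(\<lambda>y. indicator S y *\<^sub>R h y) \<in> borel_measurable borel"
  and nn: "\<And>y. y \<in> S \<Longrightarrow> h y \<ge> 0"
 shows "(\<integral>\<^sup>+ y \<in> S. ennreal (h y) \<partial>lborel) =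
  (if h absolutely_integrable_on S then ennreal (integral S h) else \<infinity>)"
proof -
 have *: "(\<integral>\<^sup>+ y \<in> S. ennreal (h y) \<partial>lborel) = (\<integral>\<^sup>+ y. ennreal (indicator S y *\<^sub>R h y) \<partial>lebesgue)"
  by (subst nn_integral_completion, rule nn_integral_cong) (auto simp: indicator_def)
 show ?thesis
 proof (cases "h absolutely_integrable_on S")
  case True
  then have "integrable lebesgue (\<lambda>y. indicator S y *\<^sub>R h y)"
   by (simp add: set_integrable_def)
  then have "(\<integral>\<^sup>+ y. ennreal (indicator S y *\<^sub>R h y) \<partial>lebesgue) = ennreal (LINT y:S|lebesgue. h y)"
   unfolding set_lebesgue_integral_def
   by (rule nn_integral_eq_integral) (auto simp: indicator_def nn)
  then show ?thesis using True * set_lebesgue_integral_eq_integral(2)[OF True] by simp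
 next
  case False
  have "(\<lambda>y. indicator S y *\<^sub>R h y) \<in> borel_measurable lebesgue"
   using m by (intro measurable_completion) simp
  moreover have "AE y in lebesgue. 0 \<le> indicator S y *\<^sub>R h y"
   using nn by (intro AE_I2) (auto simp: indicator_def)
  ultimately have "\<not> (\<integral>\<^sup>+ y. ennreal (indicator S y *\<^sub>R h y) \<partial>lebesgue) < \<infinity>"
   using False integrableI_nonneg unfolding set_integrable_def by blast
  then show ?thesis using False * by (simp add: not_less top.extremum_unique)
 qed
qed

lemma nn_integral_change_of_variables:
 fixes \<psi> :: "real^2 \<Rightarrow> real^2" and h :: "real^2 \<Rightarrow> real"
 assumes S: "S \<in> sets borel" "\<psi> ` S \<in> sets borel"
  and der: "\<And>y. y \<in> S \<Longrightarrow> \<psi> differentiable (at y)" and inj: "inj_on \<psi> S"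
  and nn: "\<And>y. y \<in> \<psi> ` S \<Longrightarrow> h y \<ge> 0"
  and m1: "(\<lambda>y. indicator (\<psi> ` S) y *\<^sub>R h y) \<in> borel_measurable borel"
  and m2: "(\<lambda>y. indicator S y *\<^sub>R k y) \<in> borel_measurable borel"
  and k: "\<And>y. y \<in> S \<Longrightarrow> k y = \<bar>det (matrix (frechet_derivative \<psi> (at y)))\<bar> * h (\<psi> y)"
 shows "(\<integral>\<^sup>+ y \<in> S. ennreal (k y) \<partial>lborel) = (\<integral>\<^sup>+ y \<in> \<psi> ` S. ennreal (h y) \<partial>lborel)"
proof -
 let ?k = "\<lambda>y. \<bar>det (matrix (frechet_derivative \<psi> (at y)))\<bar> * h (\<psi> y)"
 \<comment> \<open>Real functions enter the theorem as functions into \<open>real^1\<close>.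
   Quantifying over the value \<open>b\<close> transfers integrability and the integral in one
   equivalence.\<close>
 have "?k absolutely_integrable_on S \<and> integral S ?k = b \<longleftrightarrow>
    h absolutely_integrable_on (\<psi> ` S) \<and> integral (\<psi> ` S) h = b" for b
  using has_absolute_integral_change_of_variables[of S \<psi> "\<lambda>y. frechet_derivative \<psi> (at y)"
    "\<lambda>y. vec (h y) :: real^1" "vec b"]
   S(1) inj has_derivative_at_withinI[OF has_derivative_frechet[OF der]]
  by (auto simp: absolutely_integrable_on_1_iff integral_on_1_eq o_def vec_eq_iff)
 moreover have "k absolutely_integrable_on S \<longleftrightarrow> ?k absolutely_integrable_on S"
  using k by (intro set_integrable_cong) auto
 moreover have "integral S k = integral S ?k"
  using k by (rule integral_cong)
 ultimately have *: "k absolutely_integrable_on S \<and> integral S k = b \<longleftrightarrow>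
    h absolutely_integrable_on (\<psi> ` S) \<and> integral (\<psi> ` S) h = b" for b
  by simp
 have "k y \<ge> 0" if "y \<in> S" for y using k nn that by simp
 then show ?thesis
  using nn_integral_eq_integral_on[OF S(1) m2] nn_integral_eq_integral_on[OF S(2) m1 nn]
   *[of "integral S k"] *[of "integral (\<psi> ` S) h"] by (auto split: if_splits)
qed

locale surface =
 fixes A :: "'a::t2_space chart set" and g :: "'a metric"
 assumes closed_surface: "closed_riemannian_surface A g"
begin

lemma compact_UNIV: "compact (UNIV :: 'a set)"
 and atlas: "smooth_atlas A"
 and metric: "riemannian_metric A g"
 using closed_surface by (auto simp: closed_riemannian_surface_def)

lemma ex_chart: "\<exists>c\<in>A. x \<in> chart_dom c"
 using atlas by (auto simp: smooth_atlas_def)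

lemma chart_at_in: "chart_at A x \<in> A" "x \<in> chart_dom (chart_at A x)"
 using someI_ex[of "\<lambda>c. c \<in> A \<and> x \<in> chart_dom c"] ex_chart[of x] unfolding chart_at_def by blast+

context
 fixes c assumes c: "c \<in> A"
begin

lemma open_dom: "open (chart_dom c)"
 and open_image: "open (chart_image c)"
 and homeo: "homeomorphism (chart_dom c) (chart_image c) (chart_map c) (chart_inv c)"
 using atlas c by (auto simp: smooth_atlas_def)

lemma chart_inv_map: "x \<in> chart_dom c \<Longrightarrow> chart_inv c (chart_map c x) = x"
 and chart_map_inv: "y \<in> chart_image c \<Longrightarrow> chart_map c (chart_inv c y) = y"
 and chart_map_in: "x \<in> chart_dom c \<Longrightarrow> chart_map c x \<in> chart_image c"
 and chart_inv_in: "y \<in> chart_image c \<Longrightarrow> chart_inv c y \<in> chart_dom c"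
 and continuous_chart_map: "continuous_on (chart_dom c) (chart_map c)"
 and continuous_chart_inv: "continuous_on (chart_image c) (chart_inv c)"
 using homeo by (auto simp: homeomorphism_def)

lemma smooth_gram: "smooth_on (chart_image c) (in_chart c (g c))"
 using metric c by (auto simp: riemannian_metric_def)

lemma gram_sym: "y \<in> chart_image c \<Longrightarrow> transpose (in_chart c (g c) y) = in_chart c (g c) y"
 and gram_pos: "y \<in> chart_image c \<Longrightarrow> v \<noteq> 0 \<Longrightarrow> v \<bullet> (in_chart c (g c) y *v v) > 0"
 using metric c chart_inv_in unfolding riemannian_metric_def in_chart_def by blast+

lemma det_gram_pos: "y \<in> chart_image c \<Longrightarrow> det (in_chart c (g c) y) > 0"
 using det_pos_def_2 gram_sym gram_pos by blast

lemma image_eq_preimage: "B \<subseteq> chart_dom c \<Longrightarrow> chart_map c ` B = chart_image c \<inter> chart_inv c -` B"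
 using chart_inv_map chart_map_in chart_map_inv by force

lemma open_chart_map_image: "open B \<Longrightarrow> B \<subseteq> chart_dom c \<Longrightarrow> open (chart_map c ` B)"
 unfolding image_eq_preimage
 using continuous_on_open_vimage[OF open_image] continuous_chart_inv by (metis inf_commute)

lemma open_chart_inv_image:
 assumes "open B" "B \<subseteq> chart_image c" shows "open (chart_inv c ` B)"
proof -
 have "chart_inv c ` B = chart_map c -` B \<inter> chart_dom c"
  using assms(2) chart_inv_map chart_inv_in chart_map_inv by force
 then show ?thesis
  using continuous_on_open_vimage[OF open_dom] continuous_chart_map assms(1) by metis
qed

lemma compact_chart_inv_image: "compact K \<Longrightarrow> K \<subseteq> chart_image c \<Longrightarrow> compact (chart_inv c ` K)"
 using compact_continuous_image continuous_on_subset[OF continuous_chart_inv] by blast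

lemma closed_chart_inv_image: "compact K \<Longrightarrow> K \<subseteq> chart_image c \<Longrightarrow> closed (chart_inv c ` K)"
 using compact_chart_inv_image compact_imp_closed by blast

lemma measurable_chart_inv:
 "(\<lambda>y. if y \<in> chart_image c then chart_inv c y else undefined) \<in> borel \<rightarrow>\<^sub>M borel"
 using continuous_chart_inv open_image
 by (intro borel_measurable_continuous_on_if) auto

lemma sets_chart_map_image:
 assumes "B \<in> sets borel" "B \<subseteq> chart_dom c" shows "chart_map c ` B \<in> sets borel"
proof -
 have "(\<lambda>y. if y \<in> chart_image c then chart_inv c y else undefined) -` B \<inter> space borel \<in> sets borel"
  using measurable_chart_inv assms(1) by (rule measurable_sets)
 moreover have "chart_map c ` B = chart_image c \<inter>
   ((\<lambda>y. if y \<in> chart_image c then chart_inv c y else undefined) -` B \<inter> space borel)"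
  unfolding image_eq_preimage[OF assms(2)] by auto
 ultimately show ?thesis using borel_open[OF open_image] by simp
qed

end

lemma chart_inv_mem_iff:
 assumes c: "c \<in> A" and K: "K \<subseteq> chart_image c" and y: "y \<in> chart_image c"
 shows "chart_inv c y \<in> chart_inv c ` K \<longleftrightarrow> y \<in> K"
proof
 assume "chart_inv c y \<in> chart_inv c ` K"
 then obtain z where z: "z \<in> K" "chart_inv c y = chart_inv c z" by blast
 from arg_cong[OF z(2), of "chart_map c"] have "y = z"
  by (simp only: chart_map_inv[OF c y] chart_map_inv[OF c subsetD[OF K z(1)]])
 then show "y \<in> K" using z(1) by simp
qed (rule imageI)

lemma finite_open_cover:
 fixes U :: "'a \<Rightarrow> 'a set"
 assumes "\<And>x. open (U x)" "\<And>x. x \<in> U x"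
 obtains F where "finite F" "UNIV \<subseteq> (\<Union>x\<in>F. U x)"
 using compactE_image[OF compact_UNIV, of UNIV U] assms by (metis UNIV_I UN_I subsetI)

lemma gram_diagonal_pos:
 assumes "c \<in> A" "y \<in> chart_image c" shows "in_chart c (g c) y $ i $ i > 0"
proof -
 have "axis i 1 \<bullet> (in_chart c (g c) y *v axis i 1) = in_chart c (g c) y $ i $ i"
  using exhaust_2[of i] by (auto simp: inner_vec_def matrix_vector_mult_def sum_2 axis_def)
 moreover have "axis i (1::real) \<noteq> 0" by (simp add: axis_eq_0_iff)
 ultimately show ?thesis using gram_pos[OF assms] by metis
qed

section \<open>Area densities and coordinate changes\<close>

definition vol :: "'a chart \<Rightarrow> real^2 \<Rightarrow> real" where
 "vol c y = sqrt (det (in_chart c (g c) y))"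

lemma vol_pos: "c \<in> A \<Longrightarrow> y \<in> chart_image c \<Longrightarrow> vol c y > 0"
 using det_gram_pos by (simp add: vol_def)

lemma Ck_on_gram: "c \<in> A \<Longrightarrow> Ck_on n (chart_image c) (\<lambda>y. in_chart c (g c) y $ i $ j)"
 using smooth_gram[of c] unfolding smooth_on_iff_Ck by (intro Ck_on_nth open_image) auto

lemma Ck_on_det_gram: "c \<in> A \<Longrightarrow> Ck_on n (chart_image c) (\<lambda>y. det (in_chart c (g c) y))"
 unfolding det_2 by (intro Ck_on_diff Ck_on_mult open_image Ck_on_gram)

lemma Ck_on_vol: "c \<in> A \<Longrightarrow> Ck_on n (chart_image c) (vol c)"
 unfolding vol_def[abs_def] by (intro Ck_on_sqrt Ck_on_det_gram det_gram_pos open_image) auto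

lemma continuous_vol: "c \<in> A \<Longrightarrow> continuous_on (chart_image c) (vol c)"
 using Ck_on_vol Ck_on_imp_continuous by blast

abbreviation transition :: "'a chart \<Rightarrow> 'a chart \<Rightarrow> real^2 \<Rightarrow> real^2" where
 "transition c c' \<equiv> in_chart c (chart_map c')"

context
 fixes c c' assumes c: "c \<in> A" and c': "c' \<in> A"
begin

abbreviation overlap :: "(real^2) set" where
 "overlap \<equiv> chart_map c ` (chart_dom c \<inter> chart_dom c')"

lemma open_overlap: "open overlap"
 by (rule open_chart_map_image[OF c open_Int[OF open_dom[OF c] open_dom[OF c']]]) simp

lemma overlap_subset: "overlap \<subseteq> chart_image c"
 using chart_map_in[OF c] by auto

lemma overlap_iff: "y \<in> overlap \<longleftrightarrow> y \<in> chart_image c \<and> chart_inv c y \<in> chart_dom c'"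
 using chart_map_in[OF c] chart_inv_map[OF c] chart_map_inv[OF c] chart_inv_in[OF c] by force

lemma smooth_transition: "smooth_on overlap (transition c c')"
 using atlas c c' by (auto simp: smooth_atlas_def)

lemma Ck_on_transition: "Ck_on n overlap (transition c c')"
 using smooth_transition smooth_on_iff_Ck by blast

lemma transition_chart_map: "x \<in> chart_dom c \<Longrightarrow> transition c c' (chart_map c x) = chart_map c' x"
 by (simp add: in_chart_def chart_inv_map[OF c])

lemma transition_in: "y \<in> overlap \<Longrightarrow> transition c c' y \<in> chart_image c'"
 using transition_chart_map chart_map_in[OF c'] by auto

lemma chart_inv_transition: "y \<in> overlap \<Longrightarrow> chart_inv c' (transition c c' y) = chart_inv c y"
 using transition_chart_map chart_inv_map[OF c] chart_inv_map[OF c'] by auto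

lemma in_chart_transition: "y \<in> overlap \<Longrightarrow> in_chart c u y = in_chart c' u (transition c c' y)"
 by (simp add: chart_inv_transition in_chart_def[of c'] in_chart_def[of c u])

definition jacobian :: "real^2 \<Rightarrow> real^2^2" where
 "jacobian y = matrix (frechet_derivative (transition c c') (at y))"

lemma differentiable_transition: "y \<in> overlap \<Longrightarrow> transition c c' differentiable (at y)"
 using smooth_transition smooth_on_imp_differentiable by blast

lemma jacobian_nth: "jacobian y $ i $ j = partial_deriv j (transition c c') y $ i"
 by (simp add: jacobian_def matrix_def partial_deriv_def)

lemma gram_transition:
 assumes "y \<in> overlap"
 shows "in_chart c (g c) y
  = transpose (jacobian y) ** in_chart c' (g c') (transition c c' y) ** jacobian y"
proof -
 obtain x where x: "x \<in> chart_dom c \<inter> chart_dom c'" "y = chart_map c x" using assms by auto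
 have "g c x = transpose (jacobian y) ** g c' x ** jacobian y"
  using metric c c' x unfolding riemannian_metric_def Let_def jacobian_def by blast
 moreover have "in_chart c (g c) y = g c x" "in_chart c' (g c') (transition c c' y) = g c' x"
  using x chart_inv_map[OF c] chart_inv_map[OF c'] by (auto simp: in_chart_def)
 ultimately show ?thesis by simp
qed

lemma vol_transition:
 assumes "y \<in> overlap"
 shows "vol c y = \<bar>det (jacobian y)\<bar> * vol c' (transition c c' y)"
proof -
 have "det (in_chart c (g c) y) = (det (jacobian y))^2 * det (in_chart c' (g c') (transition c c' y))"
  by (simp add: gram_transition[OF assms] det_mul det_transpose power2_eq_square)
 then show ?thesis by (simp add: vol_def real_sqrt_mult)
qed

end

text \<open>Lebesgue measure with density \<open>vol c\<close>, pushed forward by the inverse chart.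
  The density vanishes outside the chart image, so the value \<open>undefined\<close> taken there,
  which only serves to make the map total, carries no mass.\<close>

definition chart_measure :: "'a chart \<Rightarrow> 'a measure" where
 "chart_measure c = distr (density lborel (\<lambda>y. indicator (chart_image c) y * ennreal (vol c y))) borel
   (\<lambda>y. if y \<in> chart_image c then chart_inv c y else undefined)"

lemma measurable_indicator_vol:
 assumes "c \<in> A" shows "(\<lambda>y. indicator (chart_image c) y * ennreal (vol c y)) \<in> borel_measurable borel"
 by (intro borel_measurable_indicator_ennreal continuous_vol assms) (use open_image[OF assms] in simp)

lemma nn_integral_chart_measure:
 assumes c: "c \<in> A" and h: "h \<in> borel_measurable borel"
 shows "(\<integral>\<^sup>+ x. h x \<partial>chart_measure c) = (\<integral>\<^sup>+ y \<in> chart_image c. ennreal (vol c y) * h (chart_inv c y) \<partial>lborel)"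
proof -
 have [measurable]: "(\<lambda>y. if y \<in> chart_image c then chart_inv c y else undefined) \<in> borel \<rightarrow>\<^sub>M borel"
  by (rule measurable_chart_inv[OF c])
 note [measurable] = measurable_indicator_vol[OF c] h
 have "(\<integral>\<^sup>+ x. h x \<partial>chart_measure c)
  = (\<integral>\<^sup>+ y. indicator (chart_image c) y * ennreal (vol c y) *
    h (if y \<in> chart_image c then chart_inv c y else undefined) \<partial>lborel)"
  unfolding chart_measure_def
  by (subst nn_integral_distr, simp, simp) (subst nn_integral_density, simp_all)
 also have "\<dots> = (\<integral>\<^sup>+ y \<in> chart_image c. ennreal (vol c y) * h (chart_inv c y) \<partial>lborel)"
  by (rule nn_integral_cong) (auto simp: indicator_def)
 finally show ?thesis .
qed

lemma emeasure_chart_measure: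
 assumes c: "c \<in> A" and B: "B \<in> sets borel" "B \<subseteq> chart_dom c"
 shows "emeasure (chart_measure c) B = (\<integral>\<^sup>+ y \<in> chart_map c ` B. ennreal (vol c y) \<partial>lborel)"
proof -
 have "emeasure (chart_measure c) B = (\<integral>\<^sup>+ x. indicator B x \<partial>chart_measure c)"
  using B by (simp add: chart_measure_def)
 also have "\<dots> = (\<integral>\<^sup>+ y \<in> chart_image c. ennreal (vol c y) * indicator B (chart_inv c y) \<partial>lborel)"
  by (rule nn_integral_chart_measure[OF c]) (use B in simp)
 also have "\<dots> = (\<integral>\<^sup>+ y \<in> chart_map c ` B. ennreal (vol c y) \<partial>lborel)"
  by (rule nn_integral_cong) (auto simp: indicator_def image_eq_preimage[OF c B(2)])
 finally show ?thesis .
qed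

text \<open>By \<open>vol_transition\<close> the density changes with the absolute value of the
  Jacobian determinant, which is exactly the factor in the change of variables along the transition
  map.\<close>

lemma chart_measure_transition:
 assumes c: "c \<in> A" "c' \<in> A" and B: "B \<in> sets borel" "B \<subseteq> chart_dom c" "B \<subseteq> chart_dom c'"
 shows "emeasure (chart_measure c) B = emeasure (chart_measure c') B"
proof -
 let ?\<psi> = "transition c c'" and ?S = "chart_map c ` B"
 have S: "?S \<subseteq> chart_map c ` (chart_dom c \<inter> chart_dom c')" using B by auto
 have im: "?\<psi> ` ?S = chart_map c' ` B"
  using transition_chart_map[OF c] B by (force simp: image_image)
 have m: "(\<lambda>y. indicator (chart_map d ` B) y *\<^sub>R vol d y) \<in> borel_measurable borel"
  if "d \<in> A" "B \<subseteq> chart_dom d" for d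
 proof (rule borel_measurable_continuous_on_indicator)
  show "continuous_on (chart_map d ` B) (vol d)"
   by (rule continuous_on_subset[OF continuous_vol[OF that(1)]]) (use chart_map_in[OF that(1)] that(2) in blast)
 qed (use sets_chart_map_image[OF that(1) B(1) that(2)] in simp)
 have inj: "inj_on ?\<psi> ?S"
 proof (rule inj_onI)
  fix y z assume "y \<in> ?S" "z \<in> ?S" "?\<psi> y = ?\<psi> z"
  then obtain a b where ab: "a \<in> B" "b \<in> B" "y = chart_map c a" "z = chart_map c b"
   "chart_map c' a = chart_map c' b"
   using transition_chart_map[OF c] subsetD[OF B(2)] by auto
  then have "a = b" using chart_inv_map[OF c(2)] B by (metis subsetD)
  then show "y = z" using ab by simp
 qed
 have "(\<integral>\<^sup>+ y \<in> ?S. ennreal (vol c y) \<partial>lborel) = (\<integral>\<^sup>+ y \<in> ?\<psi> ` ?S. ennreal (vol c' y) \<partial>lborel)"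
  using S B m sets_chart_map_image c differentiable_transition[OF c] vol_transition[OF c] im
   less_imp_le[OF vol_pos[OF c(2)]] chart_map_in[OF c(2)] inj
  by (intro nn_integral_change_of_variables) (auto simp: jacobian_def[OF c] image_subset_iff)
 then show ?thesis using emeasure_chart_measure c B im by simp
qed

lemma finite_chart_cover:
 "\<exists>(n::nat) C. (\<forall>i<n. C i \<in> A) \<and> (\<Union>i<n. chart_dom (C i)) = (UNIV :: 'a set)"
proof -
 have "UNIV \<subseteq> (\<Union>c\<in>A. chart_dom c)" using ex_chart by auto
 then obtain F where F: "F \<subseteq> A" "finite F" "UNIV \<subseteq> (\<Union>c\<in>F. chart_dom c)"
  using compactE_image[OF compact_UNIV, of A chart_dom] open_dom by metis
 obtain C and n :: nat where C: "F = C ` {i. i < n}"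
  using finite_imp_nat_seg_image_inj_on[OF F(2)] by blast
 show ?thesis
  by (intro exI[of _ n] exI[of _ C]) (use F C in \<open>auto simp: lessThan_def\<close>)
qed

text \<open>This is the predicate under the definite description in \<open>area_measure\<close>,
  isolated to prove existence and uniqueness. The metric \<open>h\<close> is a parameter so that
  uniqueness also identifies the area of the conformal metrics.\<close>

definition charted_measure :: "'a metric \<Rightarrow> 'a measure \<Rightarrow> bool" where
 "charted_measure h M \<longleftrightarrow> sets M = sets borel \<and>
   (\<forall>c\<in>A. \<forall>B\<in>sets borel. B \<subseteq> chart_dom c \<longrightarrow>
    emeasure M B =
     (\<integral>\<^sup>+ y \<in> chart_map c ` B. ennreal (sqrt (det (in_chart c (h c) y))) \<partial>lborel))"

text \<open>Finitely many chart domains are made disjoint, so every Borel set splits into pieces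
  that each lie in one chart. A measure is thus determined by its values inside chart
  domains.\<close>

lemma emeasure_disjointed_cover:
 assumes C: "(\<Union>i<n::nat. chart_dom (C i)) = (UNIV :: 'a set)" "\<And>i. i < n \<Longrightarrow> C i \<in> A"
  and M: "sets M = sets borel" and B: "B \<in> sets borel"
 shows "emeasure M B = (\<Sum>i<n. emeasure M (B \<inter> disjointed (\<lambda>i. if i < n then chart_dom (C i) else {}) i))"
proof -
 let ?D = "disjointed (\<lambda>i. if i < n then chart_dom (C i) else {})"
 have D: "?D i \<in> sets borel" for i
 proof -
  have "range (\<lambda>i. if i < n then chart_dom (C i) else {}) \<subseteq> sets borel"
   using borel_open[OF open_dom[OF C(2)]] by auto
  then have "range ?D \<subseteq> sets borel" by (rule sets.range_disjointed_sets)
  then show ?thesis by auto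
 qed
 have D_empty: "?D i = {}" if "i \<ge> n" for i
  using disjointed_subset[of _ i] that by fastforce
 have "(\<Union>i. ?D i) = UNIV"
  unfolding UN_disjointed_eq using C(1) by (auto split: if_splits)
 have "x \<in> (\<Union>i<n. ?D i)" for x
 proof -
  have "x \<in> (\<Union>i. ?D i)" using \<open>(\<Union>i. ?D i) = UNIV\<close> by simp
  then obtain i where "x \<in> ?D i" by blast
  then show ?thesis using D_empty[of i] by (cases "i < n") auto
 qed
 then have *: "B = (\<Union>i<n. B \<inter> ?D i)" by blast
 have "(\<Sum>i<n. emeasure M (B \<inter> ?D i)) = emeasure M (\<Union>i<n. B \<inter> ?D i)"
 proof (rule sum_emeasure)
  show "disjoint_family_on (\<lambda>i. B \<inter> ?D i) {..<n}"
   using disjoint_family_disjointed[of "\<lambda>i. if i < n then chart_dom (C i) else {}"]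
   by (auto simp: disjoint_family_on_def)
 qed (use D B M in auto)
 then show ?thesis using * by simp
qed

lemma charted_measure_unique:
 assumes "charted_measure h M" "charted_measure h N" shows "M = N"
proof (rule measure_eqI)
 show "sets M = sets N" using assms by (simp add: charted_measure_def)
 fix B assume "B \<in> sets M"
 then have B: "B \<in> sets borel" using assms by (simp add: charted_measure_def)
 obtain n :: nat and C where C: "\<And>i. i < n \<Longrightarrow> C i \<in> A" "(\<Union>i<n. chart_dom (C i)) = (UNIV :: 'a set)"
  using finite_chart_cover by auto
 let ?D = "disjointed (\<lambda>i. if i < n then chart_dom (C i) else {})"
 have "emeasure M (B \<inter> ?D i) = emeasure N (B \<inter> ?D i)" if "i < n" for i
 proof -
  have "range ?D \<subseteq> sets borel"
   by (rule sets.range_disjointed_sets) (use borel_open[OF open_dom[OF C(1)]] in auto)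
  then have "B \<inter> ?D i \<in> sets borel" using B by auto
  moreover have "B \<inter> ?D i \<subseteq> chart_dom (C i)"
   using disjointed_subset[of "\<lambda>i. if i < n then chart_dom (C i) else {}" i] that by auto
  ultimately show ?thesis using assms C(1)[OF that] by (simp add: charted_measure_def)
 qed
 then show "emeasure M B = emeasure N B"
  using emeasure_disjointed_cover[OF C(2,1) _ B] assms by (simp add: charted_measure_def)
qed

lemma area_measure_eqI: "charted_measure h M \<Longrightarrow> area_measure A h = M"
 unfolding area_measure_def
 by (rule the_equality) (use charted_measure_unique in \<open>auto simp: charted_measure_def\<close>)

lemma ex_charted_measure: "\<exists>M. charted_measure g M"
proof -
 obtain n :: nat and C where C: "\<And>i. i < n \<Longrightarrow> C i \<in> A" "(\<Union>i<n. chart_dom (C i)) = (UNIV :: 'a set)"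
  using finite_chart_cover by auto
 let ?D = "disjointed (\<lambda>i. if i < n then chart_dom (C i) else {})"
 have "range ?D \<subseteq> sets borel"
  by (rule sets.range_disjointed_sets) (use borel_open[OF open_dom[OF C(1)]] in auto)
 then have D: "?D i \<in> sets borel" for i by auto
 have D_sub: "?D i \<subseteq> chart_dom (C i)" if "i < n" for i
  using disjointed_subset[of "\<lambda>i. if i < n then chart_dom (C i) else {}" i] that by auto
 \<comment> \<open>Each disjoint piece is measured in its own chart.
   \<open>chart_measure_transition\<close> later shows that a set inside any other chart domain
   receives the measure of that chart.\<close>
 define \<mu> where "\<mu> B = (\<Sum>i<n. emeasure (chart_measure (C i)) (B \<inter> ?D i))" for B
 define M where "M = measure_of UNIV (sets borel) \<mu>"
 have sets_cm: "sets (chart_measure c) = sets borel" for c by (simp add: chart_measure_def)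
 have sets_M: "sets M = sets borel"
  unfolding M_def by (metis sets.sets_measure_of_eq space_borel)
 have "countably_additive (sets M) \<mu>"
 proof (rule countably_additiveI)
  fix B :: "nat \<Rightarrow> 'a set"
  assume B: "range B \<subseteq> sets M" "disjoint_family B"
  have "(\<Sum>k. \<mu> (B k)) = (\<Sum>i<n. \<Sum>k. emeasure (chart_measure (C i)) (B k \<inter> ?D i))"
   unfolding \<mu>_def by (rule suminf_sum) simp
  also have "\<dots> = \<mu> (\<Union>k. B k)"
   unfolding \<mu>_def
  proof (rule sum.cong[OF refl])
   fix i
   have "(\<Sum>k. emeasure (chart_measure (C i)) (B k \<inter> ?D i)) = emeasure (chart_measure (C i)) (\<Union>k. B k \<inter> ?D i)"
    by (rule suminf_emeasure) (use B D sets_M sets_cm in \<open>auto simp: disjoint_family_on_def\<close>)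
   then show "(\<Sum>k. emeasure (chart_measure (C i)) (B k \<inter> ?D i)) = emeasure (chart_measure (C i)) (\<Union> (range B) \<inter> ?D i)"
    by (simp add: Int_commute)
  qed
  finally show "(\<Sum>k. \<mu> (B k)) = \<mu> (\<Union>k. B k)" .
 qed
 moreover have "positive (sets M) \<mu>" by (simp add: positive_def \<mu>_def)
 ultimately have em: "emeasure M B = \<mu> B" if "B \<in> sets borel" for B
  using emeasure_measure_of[OF M_def, of B] that sets_M sets.space_closed[of borel] by simp
 have "emeasure M B = (\<integral>\<^sup>+ y \<in> chart_map c ` B. ennreal (vol c y) \<partial>lborel)"
  if c: "c \<in> A" and B: "B \<in> sets borel" "B \<subseteq> chart_dom c" for c B
 proof -
  have "emeasure M B = (\<Sum>i<n. emeasure (chart_measure c) (B \<inter> ?D i))"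
   unfolding em[OF B(1)] \<mu>_def using D B D_sub C(1) c
   by (intro sum.cong refl chart_measure_transition) auto
  also have "\<dots> = emeasure (chart_measure c) B"
   using emeasure_disjointed_cover[OF C(2,1) sets_cm B(1)] by simp
  finally show ?thesis using emeasure_chart_measure[OF c B] by simp
 qed
 then show ?thesis using sets_M by (auto simp: charted_measure_def vol_def)
qed

definition area :: "'a measure" where
 "area = area_measure A g"

lemma charted_area: "charted_measure g area"
 using ex_charted_measure area_measure_eqI unfolding area_def by metis

lemma sets_area [measurable_cong, simp]: "sets area = sets borel"
 using charted_area by (simp add: charted_measure_def)

lemma space_area [simp]: "space area = UNIV"
 using sets_eq_imp_space_eq[OF sets_area] by simp

lemma emeasure_area:
 "c \<in> A \<Longrightarrow> B \<in> sets borel \<Longrightarrow> B \<subseteq> chart_dom c \<Longrightarrow>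
  emeasure area B = emeasure (chart_measure c) B"
 using charted_area emeasure_chart_measure by (simp add: charted_measure_def vol_def)

text \<open>Integrals of functions supported in one chart are computed in coordinates through this
  identity: area restricted to the chart domain is the measure transported from the plane.\<close>

lemma density_indicator_area:
 assumes c: "c \<in> A"
 shows "density area (indicator (chart_dom c)) = chart_measure c"
proof (rule measure_eqI)
 show "sets (density area (indicator (chart_dom c))) = sets (chart_measure c)"
  by (simp add: chart_measure_def)
 fix B assume "B \<in> sets (density area (indicator (chart_dom c)))"
 then have B: "B \<in> sets borel" by simp
 have D: "chart_dom c \<in> sets borel" using open_dom[OF c] by simp
 have "emeasure (density area (indicator (chart_dom c))) B = emeasure area (B \<inter> chart_dom c)"
  using B D by (subst emeasure_density) (auto simp flip: indicator_inter_arith simp: Int_commute)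
 also have "\<dots> = emeasure (chart_measure c) (B \<inter> chart_dom c)"
  using B D by (intro emeasure_area c) auto
 also have "\<dots> = emeasure (chart_measure c) B"
 proof -
  have cm: "(\<integral>\<^sup>+ x. indicator S x \<partial>chart_measure c) = emeasure (chart_measure c) S" if "S \<in> sets borel" for S
   using that by (simp add: chart_measure_def)
  have "(\<integral>\<^sup>+ x. indicator (B \<inter> chart_dom c) x \<partial>chart_measure c) = (\<integral>\<^sup>+ x. indicator B x \<partial>chart_measure c)"
   using B D chart_inv_in[OF c]
   by (subst (1 2) nn_integral_chart_measure[OF c]) (auto intro!: nn_integral_cong simp: indicator_def)
  then show ?thesis using cm B D by simp
 qed
 finally show "emeasure (density area (indicator (chart_dom c))) B = emeasure (chart_measure c) B" .
qed

lemma nn_integral_area_chart: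
 assumes c: "c \<in> A" and h: "h \<in> borel_measurable borel" "\<And>x. x \<notin> chart_dom c \<Longrightarrow> h x = 0"
 shows "(\<integral>\<^sup>+ x. h x \<partial>area) = (\<integral>\<^sup>+ y \<in> chart_image c. ennreal (vol c y) * h (chart_inv c y) \<partial>lborel)"
proof -
 have "(\<integral>\<^sup>+ x. h x \<partial>area) = (\<integral>\<^sup>+ x. indicator (chart_dom c) x * h x \<partial>area)"
  using h(2) by (intro nn_integral_cong) (auto simp: indicator_def)
 also have "\<dots> = (\<integral>\<^sup>+ x. h x \<partial>density area (indicator (chart_dom c)))"
  using h(1) borel_open[OF open_dom[OF c]]
  by (subst nn_integral_density) (auto simp: measurable_cong_sets[OF sets_area refl])
 finally show ?thesis
  using nn_integral_chart_measure[OF c h(1)] by (simp add: density_indicator_area[OF c])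
qed

lemma nn_integral_area_chart_inv_image:
 assumes c: "c \<in> A" and K: "compact K" "K \<subseteq> chart_image c" and h: "h \<in> borel_measurable borel" "\<And>x. h x \<ge> 0"
 shows "(\<integral>\<^sup>+ x \<in> chart_inv c ` K. ennreal (h x) \<partial>area) = (\<integral>\<^sup>+ y \<in> K. ennreal (vol c y * h (chart_inv c y)) \<partial>lborel)"
proof -
 let ?W = "chart_inv c ` K"
 have W: "closed ?W" by (rule closed_chart_inv_image[OF c K])
 have "(\<integral>\<^sup>+ x \<in> ?W. ennreal (h x) \<partial>area)
   = (\<integral>\<^sup>+ y \<in> chart_image c. ennreal (vol c y) * (ennreal (h (chart_inv c y)) * indicator ?W (chart_inv c y)) \<partial>lborel)"
  using W h(1) K(2) chart_inv_in[OF c]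
  by (intro nn_integral_area_chart c borel_measurable_times_ennreal borel_measurable_indicator)
    (auto split: split_indicator)
 also have "\<dots> = (\<integral>\<^sup>+ y \<in> K. ennreal (vol c y * h (chart_inv c y)) \<partial>lborel)"
 proof (rule nn_integral_cong)
  fix y
  show "ennreal (vol c y) * (ennreal (h (chart_inv c y)) * indicator ?W (chart_inv c y)) * indicator (chart_image c) y
    = ennreal (vol c y * h (chart_inv c y)) * indicator K y"
   using chart_inv_mem_iff[OF c K(2)] less_imp_le[OF vol_pos[OF c]] h(2) K(2)
   by (cases "y \<in> chart_image c") (auto simp: indicator_def ennreal_mult)
 qed
 finally show ?thesis .
qed

lemma chart_measure_eq:
 fixes h :: "'a \<Rightarrow> 'b::euclidean_space"
 assumes c: "c \<in> A" and h: "h \<in> borel_measurable borel"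
 defines "k \<equiv> \<lambda>y. indicator (chart_image c) y *\<^sub>R (vol c y *\<^sub>R h (chart_inv c y))"
 shows "integrable (chart_measure c) h \<longleftrightarrow> integrable lborel k"
  and "(LINT x|chart_measure c. h x) = (LINT y|lborel. k y)"
proof -
 let ?i = "\<lambda>y. if y \<in> chart_image c then chart_inv c y else undefined"
 let ?d = "\<lambda>y. indicator (chart_image c) y * ennreal (vol c y)"
 let ?r = "\<lambda>y. indicator (chart_image c) y *\<^sub>R vol c y"
 have i: "?i \<in> borel \<rightarrow>\<^sub>M borel" by (rule measurable_chart_inv[OF c])
 have r: "?r \<in> borel_measurable borel"
  by (rule borel_measurable_continuous_on_indicator) (use continuous_vol open_image c in auto)
 have d: "?d = (\<lambda>y. ennreal (?r y))" by (auto simp: indicator_def)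
 have nn: "?r y \<ge> 0" for y using vol_pos[OF c, of y] by (auto simp: indicator_def intro: less_imp_le)
 have k: "k = (\<lambda>y. ?r y *\<^sub>R h (?i y))" by (auto simp: k_def indicator_def)
 have hi: "(\<lambda>y. h (?i y)) \<in> borel_measurable borel" using measurable_compose[OF i h] .
 show "integrable (chart_measure c) h \<longleftrightarrow> integrable lborel k"
  unfolding chart_measure_def k d
  using i h hi r nn by (subst integrable_distr_eq, simp, simp) (subst integrable_density, auto)
 show "(LINT x|chart_measure c. h x) = (LINT y|lborel. k y)"
  unfolding chart_measure_def k d
  using i h hi r nn by (subst integral_distr, simp, simp) (subst integral_density, auto)
qed

lemma area_chart_eq:
 fixes h :: "'a \<Rightarrow> 'b::euclidean_space"
 assumes c: "c \<in> A" and h: "h \<in> borel_measurable borel" "\<And>x. x \<notin> chart_dom c \<Longrightarrow> h x = 0"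
 defines "k \<equiv> \<lambda>y. indicator (chart_image c) y *\<^sub>R (vol c y *\<^sub>R h (chart_inv c y))"
 shows "integrable area h \<longleftrightarrow> integrable lborel k"
  and "(LINT x|area. h x) = (LINT y|lborel. k y)"
proof -
 let ?r = "indicator (chart_dom c) :: 'a \<Rightarrow> real"
 have D: "chart_dom c \<in> sets borel" using open_dom[OF c] by simp
 have h': "(\<lambda>x. ?r x *\<^sub>R h x) = h" using h(2) by (auto simp: indicator_def)
 have eq: "density area (\<lambda>x. ennreal (?r x)) = chart_measure c"
  using density_indicator_area[OF c] by (simp add: ennreal_indicator)
 have 1: "integrable (density area (\<lambda>x. ennreal (?r x))) h \<longleftrightarrow> integrable area (\<lambda>x. ?r x *\<^sub>R h x)"
  using h(1) D by (intro integrable_density) auto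
 have 2: "(LINT x|density area (\<lambda>x. ennreal (?r x)). h x) = (LINT x|area. ?r x *\<^sub>R h x)"
  using h(1) D by (intro integral_density) auto
 show "integrable area h \<longleftrightarrow> integrable lborel k" "(LINT x|area. h x) = (LINT y|lborel. k y)"
  using 1 2 chart_measure_eq[OF c h(1)] unfolding eq h' k_def by simp_all
qed

lemma ex_chart_cball:
 obtains c r where "c \<in> A" "x \<in> chart_dom c" "r > 0" "cball (chart_map c x) r \<subseteq> chart_image c"
proof -
 obtain c where c: "c \<in> A" "x \<in> chart_dom c" using ex_chart by blast
 then show ?thesis
  using that open_image[OF c(1)] chart_map_in[OF c] open_contains_cball by metis
qed

text \<open>Area is locally finite because \<open>vol c\<close> is bounded on closed coordinate
  balls; compactness of the surface does the rest.\<close>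

lemma finite_measure_area: "finite_measure area"
proof
 have "\<exists>U. open U \<and> x \<in> U \<and> emeasure area U < \<infinity>" for x
 proof -
  obtain c r where c: "c \<in> A" "x \<in> chart_dom c" and r: "r > 0" "cball (chart_map c x) r \<subseteq> chart_image c"
   using ex_chart_cball .
  let ?B = "ball (chart_map c x) r" let ?U = "chart_inv c ` ?B"
  have B: "?B \<subseteq> chart_image c" using r(2) ball_subset_cball by blast
  have U: "open ?U" "?U \<subseteq> chart_dom c"
   using open_chart_inv_image[OF c(1) open_ball B] chart_inv_in[OF c(1)] B by auto
  have "x \<in> ?U" using c r chart_inv_map[OF c(1)] by (metis centre_in_ball imageI)
  obtain b where "\<And>y. y \<in> cball (chart_map c x) r \<Longrightarrow> \<bar>vol c y\<bar> \<le> b"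
   using compact_bounded_values[OF compact_cball continuous_on_subset[OF continuous_vol[OF c(1)] r(2)]] by blast
  then have b: "vol c y \<le> b" if "y \<in> cball (chart_map c x) r" for y using that abs_le_D1 by blast
  have "chart_map c ` ?U = ?B" using B chart_map_inv[OF c(1)] by force
  then have "emeasure area ?U = (\<integral>\<^sup>+ y \<in> ?B. ennreal (vol c y) \<partial>lborel)"
   using emeasure_area[OF c(1) borel_open[OF U(1)] U(2)] emeasure_chart_measure[OF c(1) borel_open[OF U(1)] U(2)]
   by simp
  also have "\<dots> \<le> (\<integral>\<^sup>+ y \<in> ?B. ennreal b \<partial>lborel)"
   using b by (intro nn_integral_mono) (auto simp: indicator_def intro!: ennreal_leI)
  also have "\<dots> = ennreal b * emeasure lborel ?B"
   by (subst nn_integral_cmult_indicator) auto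
  also have "\<dots> < \<infinity>"
   using emeasure_bounded_finite[OF bounded_ball, of "chart_map c x" r] by (simp add: ennreal_mult_less_top)
  finally show ?thesis using U(1) \<open>x \<in> ?U\<close> by blast
 qed
 then obtain U where U: "\<And>x. open (U x)" "\<And>x. x \<in> U x" "\<And>x. emeasure area (U x) < \<infinity>" by metis
 obtain F where F: "finite F" "UNIV \<subseteq> (\<Union>x\<in>F. U x)"
  by (rule finite_open_cover[OF U(1,2)])
 have "emeasure area UNIV \<le> emeasure area (\<Union>x\<in>F. U x)"
  using F U by (intro emeasure_mono) auto
 also have "\<dots> \<le> (\<Sum>x\<in>F. emeasure area (U x))"
  using F U by (intro emeasure_subadditive_finite) auto
 also have "\<dots> < \<infinity>" using F U by (simp add: less_top)
 finally show "emeasure area (space area) \<noteq> \<infinity>" by simp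
qed

text \<open>In dimension two the conformal factor enters the determinant squared, so the area
  density is multiplied by exactly that factor. Uniqueness of charted measures then identifies the
  area measure.\<close>

lemma area_measure_conformal:
 assumes h: "h \<in> borel_measurable borel"
 shows "area_measure A (conformal_metric h g t) = density area (\<lambda>x. ennreal (exp (- t * h x)))"
proof (rule area_measure_eqI)
 have "emeasure (density area (\<lambda>x. ennreal (exp (- t * h x)))) B =
   (\<integral>\<^sup>+ y \<in> chart_map c ` B. ennreal (sqrt (det (in_chart c (conformal_metric h g t c) y))) \<partial>lborel)"
  if c: "c \<in> A" and B: "B \<in> sets borel" "B \<subseteq> chart_dom c" for c B
 proof -
  have "emeasure (density area (\<lambda>x. ennreal (exp (- t * h x)))) B =
    (\<integral>\<^sup>+ x. ennreal (exp (- t * h x)) * indicator B x \<partial>area)"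
   using h B by (subst emeasure_density) auto
  also have "\<dots> = (\<integral>\<^sup>+ y \<in> chart_image c. ennreal (vol c y) *
    (ennreal (exp (- t * h (chart_inv c y))) * indicator B (chart_inv c y)) \<partial>lborel)"
   using h B by (intro nn_integral_area_chart c) (auto simp: indicator_def)
  also have "\<dots> = (\<integral>\<^sup>+ y \<in> chart_map c ` B. ennreal (sqrt (det (in_chart c (conformal_metric h g t c) y))) \<partial>lborel)"
  proof (rule nn_integral_cong)
   fix y
   have "sqrt (det (in_chart c (conformal_metric h g t c) y)) = vol c y * exp (- t * h (chart_inv c y))"
   proof -
    let ?e = "exp (- t * h (chart_inv c y))" and ?G = "in_chart c (g c) y"
    have "in_chart c (conformal_metric h g t c) y = ?e *\<^sub>R ?G"
     by (simp add: in_chart_def conformal_metric_def)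
    moreover have "det (?e *\<^sub>R ?G) = det ?G * ?e^2"
     unfolding det_2 by (simp add: power2_eq_square algebra_simps)
    ultimately show ?thesis by (simp add: vol_def real_sqrt_mult)
   qed
   then show "ennreal (vol c y) * (ennreal (exp (- t * h (chart_inv c y))) * indicator B (chart_inv c y)) *
      indicator (chart_image c) y
     = ennreal (sqrt (det (in_chart c (conformal_metric h g t c) y))) * indicator (chart_map c ` B) y"
    using image_eq_preimage[OF c B(2)] vol_pos[OF c, of y] by (auto simp: indicator_def ennreal_mult)
  qed
  finally show ?thesis .
 qed
 then show "charted_measure (conformal_metric h g t) (density area (\<lambda>x. ennreal (exp (- t * h x))))"
  by (auto simp: charted_measure_def)
qed

end

section \<open>The Laplace operator\<close>

lemma Ck_on_eqI: "open V \<Longrightarrow> Ck_on n V k \<Longrightarrow> (\<And>z. z \<in> V \<Longrightarrow> h z = k z) \<Longrightarrow> Ck_on n V h"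
 using Ck_on_cong by blast

lemma matrix_inv_unique:
 fixes M B :: "real^'n^'n"
 assumes "M ** B = mat 1" "B ** M = mat 1"
 shows "matrix_inv M = B"
proof -
 have "matrix_inv M ** M = mat 1"
  unfolding matrix_inv_def using someI[of "\<lambda>B. M ** B = mat 1 \<and> B ** M = mat 1" B] assms by blast
 then have "matrix_inv M ** (M ** B) = B" by (simp add: matrix_mul_assoc)
 then show ?thesis using assms(1) by simp
qed

lemma matrix_inv_2:
 fixes M :: "real^2^2"
 assumes "det M \<noteq> 0"
 shows "matrix_inv M $ 1 $ 1 = M $ 2 $ 2 / det M" "matrix_inv M $ 1 $ 2 = - M $ 1 $ 2 / det M"
  "matrix_inv M $ 2 $ 1 = - M $ 2 $ 1 / det M" "matrix_inv M $ 2 $ 2 = M $ 1 $ 1 / det M"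
proof -
 define B :: "real^2^2" where "B = vector [vector [M $ 2 $ 2 / det M, - M $ 1 $ 2 / det M],
  vector [- M $ 2 $ 1 / det M, M $ 1 $ 1 / det M]]"
 have B: "B $ 1 $ 1 = M $ 2 $ 2 / det M" "B $ 1 $ 2 = - M $ 1 $ 2 / det M"
  "B $ 2 $ 1 = - M $ 2 $ 1 / det M" "B $ 2 $ 2 = M $ 1 $ 1 / det M"
  by (simp_all add: B_def)
 have d: "M $ 1 $ 1 * M $ 2 $ 2 - M $ 1 $ 2 * M $ 2 $ 1 = det M" by (simp add: det_2)
 have "M ** B = mat 1"
  using assms d by (simp add: vec_eq_iff forall_2 matrix_matrix_mult_def sum_2 B mat_def field_simps)
 then have "B ** M = mat 1" using matrix_left_right_inverse by blast
 with \<open>M ** B = mat 1\<close> have "matrix_inv M = B" by (rule matrix_inv_unique)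
 then show "matrix_inv M $ 1 $ 1 = M $ 2 $ 2 / det M" "matrix_inv M $ 1 $ 2 = - M $ 1 $ 2 / det M"
  "matrix_inv M $ 2 $ 1 = - M $ 2 $ 1 / det M" "matrix_inv M $ 2 $ 2 = M $ 1 $ 1 / det M"
  using B by simp_all
qed

text \<open>The Gram matrices of two charts are congruent by the Jacobian; this is the resulting
  rule for their inverses, which makes the product of gradients independent of the chart.\<close>

lemma matrix_inv_congruence:
 fixes G J N :: "real^2^2"
 assumes "det (transpose J ** G ** J) \<noteq> 0"
 shows "J ** matrix_inv (transpose J ** G ** J) ** transpose J = matrix_inv G"
proof -
 let ?H = "transpose J ** G ** J"
 have "?H ** matrix_inv ?H = mat 1"
  using assms someI_ex[of "\<lambda>B. ?H ** B = mat 1 \<and> B ** ?H = mat 1"]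
  unfolding matrix_inv_def invertible_det_nz[symmetric] invertible_def by blast
 then have "transpose J ** (G ** J ** matrix_inv ?H) = mat 1"
  by (simp add: matrix_mul_assoc)
 then have "(G ** J ** matrix_inv ?H) ** transpose J = mat 1"
  using matrix_left_right_inverse by blast
 then have *: "G ** (J ** matrix_inv ?H ** transpose J) = mat 1"
  by (simp add: matrix_mul_assoc)
 then have "(J ** matrix_inv ?H ** transpose J) ** G = mat 1"
  using matrix_left_right_inverse by blast
 with * show ?thesis by (rule matrix_inv_unique[symmetric])
qed

text \<open>By Cayley-Hamilton, trace times M minus determinant is the square of the symmetric
  matrix M with entries a, b, b, d. The difference of the two sides is therefore the squared norm of
  M applied to (p, q). Determinant over trace thus bounds a positive form from below.\<close>

lemma quadratic_form_lower_bound: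
 fixes p q :: "'b::real_inner"
 shows "(a + d) * (a * (p \<bullet> p) + 2 * b * (p \<bullet> q) + d * (q \<bullet> q))
  \<ge> (a * d - b * b) * (p \<bullet> p + q \<bullet> q)"
proof -
 have "(a + d) * (a * (p \<bullet> p) + 2 * b * (p \<bullet> q) + d * (q \<bullet> q))
  = (a * d - b * b) * (p \<bullet> p + q \<bullet> q)
   + (a *\<^sub>R p + b *\<^sub>R q) \<bullet> (a *\<^sub>R p + b *\<^sub>R q) + (b *\<^sub>R p + d *\<^sub>R q) \<bullet> (b *\<^sub>R p + d *\<^sub>R q)"
  by (simp add: inner_add_left inner_add_right inner_commute[of q p]) (simp add: algebra_simps)
 then show ?thesis by simp
qed

lemma integral_pos_of_continuous:
 fixes h :: "real^2 \<Rightarrow> real"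
 assumes "continuous_on UNIV h" "\<And>y. h y \<ge> 0" "integrable lborel h" "h p > 0"
 shows "(LINT y|lborel. h y) > 0"
proof -
 have "isCont h p" using assms(1) by (simp add: continuous_on_eq_continuous_at)
 then obtain d where d: "d > 0" "\<forall>y. dist y p < d \<longrightarrow> dist (h y) (h p) < h p / 2"
  using assms(4) unfolding continuous_at_eps_delta by (meson half_gt_zero)
 have lower: "indicator (ball p d) y * (h p / 2) \<le> h y" for y
 proof (cases "y \<in> ball p d")
  case True
  then have "\<bar>h y - h p\<bar> < h p / 2" using d(2)[rule_format, of y] by (simp only: mem_ball dist_commute[of p] dist_real_def)
  then have "h p / 2 \<le> h y" by linarith
  then show ?thesis using True by simp
 qed (use assms(2) in auto)
 have fin: "emeasure lborel (ball p d) < \<infinity>" by (rule emeasure_bounded_finite) simp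
 have "0 < measure lborel (ball p d) * (h p / 2)"
  using content_ball_pos[OF d(1), of p] assms(4) by simp
 also have "\<dots> = (LINT y|lborel. indicator (ball p d) y * (h p / 2))" by simp
 also have "\<dots> \<le> (LINT y|lborel. h y)"
  using lower fin assms(3) by (intro integral_mono) auto
 finally show ?thesis .
qed

context surface
begin

text \<open>The coefficients of the Laplacian in divergence form. In dimension two they form a
  matrix of determinant one and are invariant under conformal changes of the metric.\<close>

definition coeff :: "'a chart \<Rightarrow> 2 \<Rightarrow> 2 \<Rightarrow> real^2 \<Rightarrow> real" where
 "coeff c i j y = vol c y * matrix_inv (in_chart c (g c) y) $ i $ j"

text \<open>A density with respect to Lebesgue measure in the chart; dividing by
  \<open>vol c\<close> gives a function on the surface. The inner product of complex numbers is the
  real one, the real part of z times the conjugate of w.\<close>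

definition dirichlet :: "'a chart \<Rightarrow> (real^2 \<Rightarrow> complex) \<Rightarrow> (real^2 \<Rightarrow> complex) \<Rightarrow> real^2 \<Rightarrow> real" where
 "dirichlet c h k y = (\<Sum>i\<in>UNIV. \<Sum>j\<in>UNIV. coeff c i j y * (partial_deriv i h y \<bullet> partial_deriv j k y))"

definition local_laplacian :: "'a chart \<Rightarrow> (real^2 \<Rightarrow> complex) \<Rightarrow> real^2 \<Rightarrow> complex" where
 "local_laplacian c h y = - ((1 / vol c y) *\<^sub>R
   (\<Sum>i\<in>UNIV. partial_deriv i (\<lambda>z. \<Sum>j\<in>UNIV. coeff c i j z *\<^sub>R partial_deriv j h z) y))"

lemma laplacian_eq_local:
 "laplacian A g u x = local_laplacian (chart_at A x) (in_chart (chart_at A x) u) (chart_map (chart_at A x) x)"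
 by (simp add: laplacian_def local_laplacian_def coeff_def vol_def Let_def)

lemma coeff_sym:
 assumes "c \<in> A" "y \<in> chart_image c" shows "coeff c i j y = coeff c j i y"
proof -
 have "in_chart c (g c) y $ 1 $ 2 = in_chart c (g c) y $ 2 $ 1"
  using arg_cong[OF gram_sym[OF assms], of "\<lambda>M. M $ 1 $ 2"] by (simp add: transpose_def)
 then have "coeff c 1 2 y = coeff c 2 1 y"
  using matrix_inv_2[of "in_chart c (g c) y"] det_gram_pos[OF assms] by (simp add: coeff_def)
 then show ?thesis using exhaust_2[of i] exhaust_2[of j] by auto
qed

lemma coeff_det:
 assumes "c \<in> A" "y \<in> chart_image c"
 shows "coeff c 1 1 y * coeff c 2 2 y - coeff c 1 2 y * coeff c 2 1 y = 1"
proof -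
 let ?G = "in_chart c (g c) y"
 have d: "det ?G > 0" and v: "vol c y * vol c y = det ?G"
  using det_gram_pos[OF assms] by (simp_all add: vol_def)
 have "coeff c 1 1 y * coeff c 2 2 y - coeff c 1 2 y * coeff c 2 1 y
  = (vol c y * vol c y) * (?G $ 1 $ 1 * ?G $ 2 $ 2 - ?G $ 1 $ 2 * ?G $ 2 $ 1) / (det ?G * det ?G)"
  using d by (simp add: coeff_def matrix_inv_2 field_simps)
 then show ?thesis using d by (simp add: v det_2[symmetric])
qed

lemma coeff_trace_pos:
 assumes "c \<in> A" "y \<in> chart_image c"
 shows "coeff c 1 1 y + coeff c 2 2 y > 0"
 using gram_diagonal_pos[OF assms] det_gram_pos[OF assms] vol_pos[OF assms] by (simp add: coeff_def matrix_inv_2 add_pos_pos)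

lemma Ck_on_coeff:
 assumes c: "c \<in> A" shows "Ck_on n (chart_image c) (coeff c i j)"
proof -
 let ?G = "in_chart c (g c)"
 have inv: "Ck_on n (chart_image c) (\<lambda>y. inverse (det (?G y)))"
  using det_gram_pos[OF c] by (intro Ck_on_inverse open_image Ck_on_det_gram c) fastforce
 have *: "Ck_on n (chart_image c) (coeff c i j)"
  if "\<And>y. y \<in> chart_image c \<Longrightarrow> coeff c i j y = vol c y * (s * ?G y $ k $ l * inverse (det (?G y)))" for s k l i j
  by (rule Ck_on_eqI[OF open_image[OF c] _ that])
    (intro Ck_on_mult open_image c Ck_on_vol Ck_on_const Ck_on_gram inv)
 have d: "y \<in> chart_image c \<Longrightarrow> det (?G y) \<noteq> 0" for y using det_gram_pos[OF c, of y] by simp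
 have "Ck_on n (chart_image c) (coeff c 1 1)"
  by (rule *[where s=1 and k=2 and l=2]) (simp add: coeff_def matrix_inv_2 d divide_inverse)
 moreover have "Ck_on n (chart_image c) (coeff c 1 2)"
  by (rule *[where s="-1" and k=1 and l=2]) (simp add: coeff_def matrix_inv_2 d divide_inverse)
 moreover have "Ck_on n (chart_image c) (coeff c 2 1)"
  by (rule *[where s="-1" and k=2 and l=1]) (simp add: coeff_def matrix_inv_2 d divide_inverse)
 moreover have "Ck_on n (chart_image c) (coeff c 2 2)"
  by (rule *[where s=1 and k=1 and l=1]) (simp add: coeff_def matrix_inv_2 d divide_inverse)
 ultimately show ?thesis using exhaust_2[of i] exhaust_2[of j] by auto
qed

lemma dirichlet_sym:
 assumes "c \<in> A" "y \<in> chart_image c" shows "dirichlet c h k y = dirichlet c k h y"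
 unfolding dirichlet_def sum_2
 by (simp add: coeff_sym[OF assms, of 2 1] inner_commute)

text \<open>\<open>quadratic_form_lower_bound\<close> with determinant one, by
  \<open>coeff_det\<close>: the inverse of the trace is a constant of ellipticity, and it is locally
  bounded below by continuity.\<close>

lemma coeff_lower_bound:
 fixes p :: "2 \<Rightarrow> 'b::real_inner"
 assumes "c \<in> A" "y \<in> chart_image c"
 shows "(\<Sum>i\<in>UNIV. (norm (p i))^2) \<le> (coeff c 1 1 y + coeff c 2 2 y) * (\<Sum>i\<in>UNIV. \<Sum>j\<in>UNIV. coeff c i j y * (p i \<bullet> p j))"
 using quadratic_form_lower_bound[of "coeff c 1 1 y" "coeff c 2 2 y" "coeff c 1 2 y" "p 1" "p 2"]
  coeff_det[OF assms] coeff_sym[OF assms, of 2 1]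
 by (simp add: sum_2 power2_norm_eq_inner inner_commute[of "p 2" "p 1"] add_ac mult_ac)

lemma coeff_form_nonneg:
 fixes p :: "2 \<Rightarrow> 'b::real_inner"
 assumes "c \<in> A" "y \<in> chart_image c"
 shows "0 \<le> (\<Sum>i\<in>UNIV. \<Sum>j\<in>UNIV. coeff c i j y * (p i \<bullet> p j))"
proof -
 have "0 \<le> (\<Sum>i\<in>UNIV. (norm (p i))^2)" by (simp add: sum_nonneg)
 then show ?thesis
  using coeff_lower_bound[OF assms, of p] coeff_trace_pos[OF assms] by (meson order_trans zero_le_mult_iff not_le)
qed

lemma dirichlet_nonneg:
 assumes "c \<in> A" "y \<in> chart_image c" shows "dirichlet c h h y \<ge> 0"
 unfolding dirichlet_def by (rule coeff_form_nonneg[OF assms])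

lemma Ck_on_dirichlet:
 assumes "c \<in> A" "open V" "V \<subseteq> chart_image c" "Ck_on (Suc n) V h" "Ck_on (Suc n) V k"
 shows "Ck_on n V (dirichlet c h k)"
 unfolding dirichlet_def[abs_def]
 using assms by (intro Ck_on_sum Ck_on_mult Ck_on_inner Ck_on_subset[OF Ck_on_coeff]) auto

lemma Ck_on_flux:
 assumes "c \<in> A" "open V" "V \<subseteq> chart_image c" "Ck_on (Suc n) V h"
 shows "Ck_on n V (\<lambda>z. \<Sum>j\<in>UNIV. coeff c i j z *\<^sub>R partial_deriv j h z)"
 using assms by (intro Ck_on_sum Ck_on_scaleR Ck_on_subset[OF Ck_on_coeff]) auto

lemma Ck_on_local_laplacian:
 assumes "c \<in> A" "open V" "V \<subseteq> chart_image c" "Ck_on (Suc (Suc n)) V h"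
 shows "Ck_on n V (local_laplacian c h)"
proof -
 have "Ck_on n V (\<lambda>y. inverse (vol c y))"
  using vol_pos[OF assms(1)] assms(3)
  by (intro Ck_on_inverse assms(2) Ck_on_subset[OF Ck_on_vol[OF assms(1)] assms(3)]) fastforce
 moreover have "Ck_on n V (partial_deriv i (\<lambda>z. \<Sum>j\<in>UNIV. coeff c i j z *\<^sub>R partial_deriv j h z))" for i
  using Ck_on_flux[OF assms] by simp
 ultimately show ?thesis
  unfolding local_laplacian_def[abs_def] inverse_eq_divide[symmetric]
  by (intro Ck_on_uminus Ck_on_scaleR Ck_on_sum assms(2)) auto
qed

text \<open>The divergence theorem for the field \<open>v \<bullet> (a\<^sub>i\<^sub>j \<partial>\<^sub>j h)\<close>; only first derivatives of
 \<open>v\<close> enter, so cutoff functions of class \<open>C\<^sup>1\<close> suffice.\<close>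

lemma green_chart:
 assumes c: "c \<in> A" and h: "Ck_on 2 (chart_image c) h" and v: "Ck_on 1 (chart_image c) v"
  and K: "compact K" "K \<subseteq> chart_image c" "\<And>y. y \<in> chart_image c - K \<Longrightarrow> v y = 0"
 shows "integrable lborel (\<lambda>y. indicator (chart_image c) y *\<^sub>R (vol c y * (v y \<bullet> local_laplacian c h y)))" (is "integrable _ ?P")
  and "integrable lborel (\<lambda>y. indicator (chart_image c) y *\<^sub>R dirichlet c h v y)" (is "integrable _ ?Q")
  and "(LINT y|lborel. indicator (chart_image c) y *\<^sub>R (vol c y * (v y \<bullet> local_laplacian c h y)))
    = (LINT y|lborel. indicator (chart_image c) y *\<^sub>R dirichlet c h v y)"
proof -
 let ?I = "chart_image c"
 have I: "open ?I" by (rule open_image[OF c])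
 have h': "Ck_on (Suc (Suc 0)) ?I h" and v': "Ck_on (Suc 0) ?I v" using h v by (simp_all add: numeral_2_eq_2)
 have v0: "partial_deriv i v y = 0" if "y \<in> ?I - K" for i y
  using partial_deriv_cong[of "?I - K" y v "\<lambda>_. 0" i] that K
  by (simp add: I compact_imp_closed open_Diff partial_deriv_const)
 have ext: "integrable lborel (\<lambda>y. indicator ?I y *\<^sub>R k y)" "continuous_on UNIV (\<lambda>y. indicator ?I y *\<^sub>R k y)"
  if "Ck_on 0 ?I k" "\<And>y. y \<in> ?I - K \<Longrightarrow> k y = 0" for k :: "real^2 \<Rightarrow> real"
 proof -
  have eq: "(\<lambda>y. indicator ?I y *\<^sub>R k y) = (\<lambda>y. if y \<in> ?I then k y else 0)" by (auto simp: indicator_def)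
  have "Ck_on 0 UNIV (\<lambda>y. if y \<in> ?I then k y else 0)"
   by (rule Ck_on_UNIV_zero_extension[OF I K(1,2) that])
  then show "continuous_on UNIV (\<lambda>y. indicator ?I y *\<^sub>R k y)" unfolding eq by simp
  then show "integrable lborel (\<lambda>y. indicator ?I y *\<^sub>R k y)"
   by (rule integrable_continuous_compact_support[OF _ K(1)]) (use that(2) in \<open>auto simp: indicator_def\<close>)
 qed
 show P: "integrable lborel ?P"
 proof (rule ext)
  show "Ck_on 0 ?I (\<lambda>y. vol c y * (v y \<bullet> local_laplacian c h y))"
   using v by (intro Ck_on_mult Ck_on_inner I Ck_on_vol c Ck_on_local_laplacian h' Ck_on_mono[OF v]) auto
 qed (use K(3) in simp)
 show Q: "integrable lborel ?Q"
 proof (rule ext)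
  show "Ck_on 0 ?I (dirichlet c h v)"
   by (intro Ck_on_dirichlet c I order_refl Ck_on_mono[OF h'] v') auto
 qed (use v0 in \<open>simp add: dirichlet_def\<close>)
 define F where "F i z = (\<Sum>j\<in>UNIV. coeff c i j z *\<^sub>R partial_deriv j h z)" for i z
 have F: "Ck_on (Suc 0) ?I (F i)" for i unfolding F_def[abs_def] by (rule Ck_on_flux[OF c I order_refl h'])
 define V where "V i y = (if y \<in> ?I then v y \<bullet> F i y else 0)" for i y
 have V: "Ck_on 1 UNIV (V i)" for i
  unfolding V_def[abs_def] One_nat_def
  by (rule Ck_on_UNIV_zero_extension[OF I K(1,2) Ck_on_inner[OF I v' F]]) (use K(3) in simp)
 have V0: "V i y = 0" if "y \<notin> K" for i y using that K(3) by (simp add: V_def)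
 note div = integral_partial_deriv_zero[OF V K(1) V0]
 \<comment> \<open>The product rule for the divergence: derivatives of the flux produce
   \<open>- vol c\<close> times the product of \<open>v\<close> with the Laplacian, derivatives of
   \<open>v\<close> the Dirichlet density. Outside the chart image both sides are zero.\<close>
 have dV: "(\<Sum>i\<in>UNIV. partial_deriv i (V i) y) = ?Q y - ?P y" for y
 proof (cases "y \<in> ?I")
  case True
  have "partial_deriv i (V i) y = v y \<bullet> partial_deriv i (F i) y + partial_deriv i v y \<bullet> F i y" for i
  proof -
   have "partial_deriv i (V i) y = partial_deriv i (\<lambda>z. v z \<bullet> F i z) y"
    by (rule partial_deriv_cong[OF I True]) (simp add: V_def)
   also have "\<dots> = v y \<bullet> partial_deriv i (F i) y + partial_deriv i v y \<bullet> F i y"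
    by (rule partial_deriv_inner) (use True F v' in auto)
   finally show ?thesis .
  qed
  moreover have "(\<Sum>i\<in>UNIV. v y \<bullet> partial_deriv i (F i) y) = - (vol c y * (v y \<bullet> local_laplacian c h y))"
   using vol_pos[OF c True]
   by (simp add: local_laplacian_def F_def[abs_def] inner_sum_right)
  moreover have "(\<Sum>i\<in>UNIV. partial_deriv i v y \<bullet> F i y) = dirichlet c v h y"
   by (simp add: dirichlet_def F_def inner_sum_right)
  ultimately show ?thesis
   using True by (simp add: sum.distrib dirichlet_sym[OF c True, of h v])
 next
  case False
  then have "partial_deriv i (V i) y = 0" for i
   using partial_deriv_cong[of "- K" y "V i" "\<lambda>_. 0" i] K V0
   by (auto simp: compact_imp_closed open_Compl partial_deriv_const)
  then show ?thesis using False by simp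
 qed
 have "(LINT y|lborel. ?Q y - ?P y) = (LINT y|lborel. (\<Sum>i\<in>UNIV. partial_deriv i (V i) y))"
  by (simp only: dV)
 also have "\<dots> = 0" using div by (subst Bochner_Integration.integral_sum) auto
 finally show "(LINT y|lborel. ?P y) = (LINT y|lborel. ?Q y)" using P Q by simp
qed

section \<open>Functions of class C^n on the surface\<close>

definition Ck_function :: "nat \<Rightarrow> ('a \<Rightarrow> 'b::real_normed_vector) \<Rightarrow> bool" where
 "Ck_function n v \<longleftrightarrow> (\<forall>c\<in>A. Ck_on n (chart_image c) (in_chart c v))"

lemma smooth_function_iff_Ck: "smooth_function A v \<longleftrightarrow> (\<forall>n. Ck_function n v)"
 by (auto simp: smooth_function_def Ck_function_def smooth_on_iff_Ck)

lemma in_chart_map: "c \<in> A \<Longrightarrow> x \<in> chart_dom c \<Longrightarrow> in_chart c u (chart_map c x) = u x"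
 by (simp add: in_chart_def chart_inv_map)

lemma continuous_local_chart:
 assumes "\<And>x. \<exists>c\<in>A. \<exists>W k. open W \<and> x \<in> W \<and> W \<subseteq> chart_dom c \<and> continuous_on (chart_map c ` W) k \<and>
  (\<forall>z\<in>W. v z = k (chart_map c z))"
 shows "continuous_on UNIV v"
proof -
 have "isCont v x" for x
 proof -
  obtain c W k where c: "c \<in> A" and W: "open W" "x \<in> W" "W \<subseteq> chart_dom c" "continuous_on (chart_map c ` W) k"
   "\<forall>z\<in>W. v z = k (chart_map c z)" using assms by blast
  have "continuous_on W (\<lambda>z. k (chart_map c z))"
   by (rule continuous_on_compose2[OF W(4) continuous_on_subset[OF continuous_chart_map[OF c] W(3)]]) auto
  then have "continuous_on W v" using W(5) by (simp cong: continuous_on_cong)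
  then show ?thesis using W(1,2) by (simp add: continuous_on_eq_continuous_at)
 qed
 then show ?thesis by (simp add: continuous_on_eq_continuous_at)
qed

lemma Ck_function_continuous:
 assumes "Ck_function n v" shows "continuous_on UNIV v"
proof (rule continuous_local_chart)
 fix x
 obtain c where c: "c \<in> A" "x \<in> chart_dom c" using ex_chart by blast
 have "chart_map c ` chart_dom c \<subseteq> chart_image c" by (simp add: chart_image_def)
 then have "continuous_on (chart_map c ` chart_dom c) (in_chart c v)"
  using assms c by (intro continuous_on_subset[OF Ck_on_imp_continuous[of n "chart_image c"]])
   (auto simp: Ck_function_def)
 then show "\<exists>c\<in>A. \<exists>W k. open W \<and> x \<in> W \<and> W \<subseteq> chart_dom c \<and> continuous_on (chart_map c ` W) k \<and>
   (\<forall>z\<in>W. v z = k (chart_map c z))"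
  using c open_dom[OF c(1)] in_chart_map[OF c(1), of _ v]
  by (intro bexI[of _ c] exI[of _ "chart_dom c"] exI[of _ "in_chart c v"]) auto
qed

lemma Ck_function_add: "Ck_function n v \<Longrightarrow> Ck_function n w \<Longrightarrow> Ck_function n (\<lambda>x. v x + w x)"
 unfolding Ck_function_def in_chart_def using Ck_on_add open_image by blast

lemma Ck_function_const: "Ck_function n (\<lambda>x. k)"
 unfolding Ck_function_def in_chart_def using Ck_on_const by blast

lemma Ck_function_scaleR: "Ck_function n v \<Longrightarrow> Ck_function n w \<Longrightarrow> Ck_function n (\<lambda>x. v x *\<^sub>R w x)"
 unfolding Ck_function_def in_chart_def using Ck_on_scaleR open_image by blast

lemma Ck_function_sum: "(\<And>i. i \<in> I \<Longrightarrow> Ck_function n (v i)) \<Longrightarrow> Ck_function n (\<lambda>x. \<Sum>i\<in>I. v i x)"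
 by (induction I rule: infinite_finite_induct) (auto simp: Ck_function_const Ck_function_add)

lemma Ck_function_inverse:
 fixes v :: "'a \<Rightarrow> real"
 shows "Ck_function n v \<Longrightarrow> (\<And>x. v x \<noteq> 0) \<Longrightarrow> Ck_function n (\<lambda>x. inverse (v x))"
 unfolding Ck_function_def in_chart_def by (auto intro!: Ck_on_inverse open_image)

lemma smooth_function_add:
 "smooth_function A v \<Longrightarrow> smooth_function A w \<Longrightarrow> smooth_function A (\<lambda>x. v x + w x)"
 by (simp add: smooth_function_iff_Ck Ck_function_add)

lemma smooth_function_scaleR:
 "smooth_function A v \<Longrightarrow> smooth_function A (\<lambda>x. (k::real) *\<^sub>R v x)"
 by (simp add: smooth_function_iff_Ck Ck_function_scaleR Ck_function_const)

lemma smooth_function_sum: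
 "(\<And>i. i \<in> I \<Longrightarrow> smooth_function A (v i)) \<Longrightarrow> smooth_function A (\<lambda>x. \<Sum>i\<in>I. v i x)"
 by (simp add: smooth_function_iff_Ck Ck_function_sum)

lemma smooth_function_continuous: "smooth_function A v \<Longrightarrow> continuous_on UNIV v"
 by (simp add: smooth_function_iff_Ck Ck_function_continuous[of 0])

definition extend :: "'a chart \<Rightarrow> (real^2 \<Rightarrow> 'b::real_normed_vector) \<Rightarrow> 'a \<Rightarrow> 'b" where
 "extend c k x = (if x \<in> chart_dom c then k (chart_map c x) else 0)"

text \<open>In another chart \<open>d\<close> two open sets cover the image: the overlap, where the
  extension is \<open>k\<close> composed with the transition map, and the part off the support,
  where it is zero. The second set is open because the compact support is closed in the Hausdorff
  surface.\<close>

lemma Ck_function_extend: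
 assumes c: "c \<in> A" and k: "Ck_on n (chart_image c) k"
  and K: "compact K" "K \<subseteq> chart_image c" "\<And>y. y \<in> chart_image c - K \<Longrightarrow> k y = 0"
 shows "Ck_function n (extend c k)"
 unfolding Ck_function_def
proof
 fix d assume d: "d \<in> A"
 let ?U = "chart_map d ` (chart_dom d \<inter> chart_dom c)"
 let ?W = "chart_map d ` (chart_dom d - chart_inv c ` K)"
 have W: "open ?W"
  by (rule open_chart_map_image[OF d])
    (use open_dom[OF d] closed_chart_inv_image[OF c K(1,2)] in auto)
 have U: "open ?U" by (rule open_overlap[OF d c])
 have eqU: "in_chart d (extend c k) y = k (transition d c y)" if "y \<in> ?U" for y
  using that overlap_iff[OF d c, of y] by (simp add: in_chart_def extend_def)
 have "Ck_on n ?U (\<lambda>y. k (transition d c y))"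
  by (rule Ck_on_comp[OF open_image[OF c] U _ k Ck_on_transition[OF d c]]) (rule transition_in[OF d c])
 then have "Ck_on n ?U (in_chart d (extend c k))"
  by (rule Ck_on_eqI[OF U]) (rule eqU)
 moreover have "in_chart d (extend c k) y = 0" if y: "y \<in> ?W" for y
 proof -
  obtain x where x: "x \<in> chart_dom d" "x \<notin> chart_inv c ` K" "y = chart_map d x" using y by auto
  have "chart_map c x \<notin> K" if "x \<in> chart_dom c"
   using x(2) chart_inv_map[OF c that] by force
  then show ?thesis
   using x K(3) chart_map_in[OF c] by (auto simp: in_chart_map[OF d] extend_def)
 qed
 then have "Ck_on n ?W (in_chart d (extend c k))"
  using Ck_on_eqI[OF W Ck_on_const] by metis
 ultimately have "Ck_on n (?U \<union> ?W) (in_chart d (extend c k))" by (rule Ck_on_Un[OF U W])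
 moreover have "chart_image d \<subseteq> ?U \<union> ?W"
  using K(2) chart_inv_in[OF c] by (force simp: chart_image_def[of d])
 ultimately show "Ck_on n (chart_image d) (in_chart d (extend c k))" using Ck_on_subset by blast
qed

text \<open>Gradients transform by the Jacobian (chain rule) and inverse Gram matrices by
  \<open>matrix_inv_congruence\<close>, so the Jacobians cancel. Only first derivatives are
  involved.\<close>

lemma dirichlet_transition:
 assumes c: "c \<in> A" "c' \<in> A" and x: "x \<in> chart_dom c" "x \<in> chart_dom c'"
  and u: "Ck_function 1 u" and v: "Ck_function 1 v"
 shows "dirichlet c (in_chart c u) (in_chart c v) (chart_map c x) / vol c (chart_map c x)
  = dirichlet c' (in_chart c' u) (in_chart c' v) (chart_map c' x) / vol c' (chart_map c' x)"
proof -
 let ?y = "chart_map c x" let ?y' = "chart_map c' x"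
 let ?J = "jacobian c c' ?y"
 let ?G = "in_chart c (g c) ?y" and ?G' = "in_chart c' (g c') ?y'"
 have y: "?y \<in> chart_map c ` (chart_dom c \<inter> chart_dom c')" using x by auto
 have tr: "transition c c' ?y = ?y'" by (rule transition_chart_map[OF c x(1)])
 have pd: "partial_deriv i (in_chart c w) ?y = (\<Sum>k\<in>UNIV. ?J $ k $ i *\<^sub>R partial_deriv k (in_chart c' w) ?y')"
  if w: "Ck_function 1 w" for w :: "'a \<Rightarrow> complex" and i
 proof -
  have "partial_deriv i (in_chart c w) ?y = partial_deriv i (\<lambda>z. in_chart c' w (transition c c' z)) ?y"
   by (rule partial_deriv_cong[OF open_overlap[OF c] y]) (rule in_chart_transition[OF c])
  also have "\<dots> = (\<Sum>k\<in>UNIV. partial_deriv i (transition c c') ?y $ k *\<^sub>R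
    partial_deriv k (in_chart c' w) (transition c c' ?y))"
   by (rule partial_deriv_comp)
     (use w c y x chart_map_in[OF c(2)] differentiable_transition[OF c] in \<open>auto simp: Ck_function_def tr\<close>)
  finally show ?thesis by (simp add: jacobian_nth[OF c] tr)
 qed
 have G: "?G = transpose ?J ** ?G' ** ?J" using gram_transition[OF c y] by (simp add: tr)
 have "det ?G > 0" using det_gram_pos[OF c(1) chart_map_in[OF c(1) x(1)]] .
 then have "?J ** matrix_inv ?G ** transpose ?J = matrix_inv ?G'"
  unfolding G by (intro matrix_inv_congruence) simp
 then have "(?J ** matrix_inv ?G ** transpose ?J) $ k $ l = matrix_inv ?G' $ k $ l" for k l by simp
 then have N: "matrix_inv ?G' $ k $ l = (\<Sum>j\<in>UNIV. (\<Sum>i\<in>UNIV. ?J $ k $ i * matrix_inv ?G $ i $ j) * ?J $ l $ j)" for k l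
  by (simp add: matrix_matrix_mult_def transpose_def)
 have d: "dirichlet d h k z / vol d z = (\<Sum>i\<in>UNIV. \<Sum>j\<in>UNIV. matrix_inv (in_chart d (g d) z) $ i $ j *
   (partial_deriv i h z \<bullet> partial_deriv j k z))" if "d \<in> A" "z \<in> chart_image d" for d h k z
  using vol_pos[OF that] by (simp add: dirichlet_def coeff_def sum_divide_distrib)
 show ?thesis
  unfolding d[OF c(1) chart_map_in[OF c(1) x(1)]] d[OF c(2) chart_map_in[OF c(2) x(2)]] pd[OF u] pd[OF v] N
  by (simp add: sum_2 inner_add_left inner_add_right) (simp add: algebra_simps)
qed

end

context surface
begin

section \<open>Green's formula on the surface\<close>

lemma integrable_area_continuous:
 fixes h :: "'a \<Rightarrow> 'b::euclidean_space"
 assumes "continuous_on UNIV h" shows "integrable area h"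
proof -
 interpret finite_measure area by (rule finite_measure_area)
 have "bounded (range h)"
  using compact_continuous_image[OF assms compact_UNIV] compact_imp_bounded by blast
 then obtain B where "\<And>x. norm (h x) \<le> B" by (auto simp: bounded_iff)
 then show ?thesis
  using borel_measurable_continuous_onI[OF assms]
  by (intro integrable_const_bound[of _ B]) (auto simp: measurable_cong_sets[OF sets_area refl])
qed

lemma in_chart_extend: "c \<in> A \<Longrightarrow> y \<in> chart_image c \<Longrightarrow> in_chart c (extend c k) y = k y"
 by (simp add: in_chart_def extend_def chart_inv_in chart_map_inv)

lemma continuous_extend:
 fixes k :: "real^2 \<Rightarrow> 'b::real_normed_vector"
 assumes c: "c \<in> A" and k: "continuous_on (chart_image c) k"
  and W: "compact W" "W \<subseteq> chart_dom c" "\<And>x. x \<in> chart_dom c - W \<Longrightarrow> k (chart_map c x) = 0"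
 shows "continuous_on UNIV (extend c k)"
proof -
 have "compact (chart_map c ` W)"
  using W by (intro compact_continuous_image continuous_on_subset[OF continuous_chart_map[OF c]])
 moreover have "chart_map c ` W \<subseteq> chart_image c" using W(2) chart_map_in[OF c] by auto
 moreover have "k y = 0" if "y \<in> chart_image c - chart_map c ` W" for y
  using W(3)[of "chart_inv c y"] that chart_inv_in[OF c, of y] chart_map_inv[OF c, of y] by force
 ultimately have "Ck_function 0 (extend c k)"
  using k by (intro Ck_function_extend[OF c]) auto
 then show ?thesis by (rule Ck_function_continuous)
qed

lemma integral_extend:
 fixes k :: "real^2 \<Rightarrow> real"
 assumes c: "c \<in> A" and k: "continuous_on (chart_image c) k"
  and W: "compact W" "W \<subseteq> chart_dom c" "\<And>x. x \<in> chart_dom c - W \<Longrightarrow> k (chart_map c x) = 0"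
 shows "(LINT x|area. extend c k x) = (LINT y|lborel. indicator (chart_image c) y *\<^sub>R (vol c y * k y))"
proof -
 have "(LINT x|area. extend c k x)
   = (LINT y|lborel. indicator (chart_image c) y *\<^sub>R (vol c y *\<^sub>R extend c k (chart_inv c y)))"
 proof (rule area_chart_eq(2)[OF c])
  show "extend c k \<in> borel_measurable borel"
   by (rule borel_measurable_continuous_onI[OF continuous_extend[OF assms]])
 qed (simp add: extend_def)
 also have "\<dots> = (LINT y|lborel. indicator (chart_image c) y *\<^sub>R (vol c y * k y))"
  using in_chart_extend[OF c, of _ k]
  by (intro Bochner_Integration.integral_cong) (auto simp: indicator_def in_chart_def)
 finally show ?thesis .
qed

text \<open>\<open>green_chart\<close> carried over to the surface for a test function supported in
  one chart. The two integrands are kept as global continuous functions vanishing off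
  \<open>W\<close>, so that those of different charts can be compared pointwise and
  subtracted.\<close>

lemma green_support:
 assumes c: "c \<in> A" and u: "Ck_function 2 u" and v: "Ck_function 1 v"
  and W: "compact W" "W \<subseteq> chart_dom c" "\<And>x. x \<notin> W \<Longrightarrow> v x = 0"
 defines "P \<equiv> extend c (\<lambda>y. in_chart c v y \<bullet> local_laplacian c (in_chart c u) y)"
  and "Q \<equiv> extend c (\<lambda>y. dirichlet c (in_chart c u) (in_chart c v) y / vol c y)"
 shows "continuous_on UNIV P" "continuous_on UNIV Q" "(LINT x|area. P x) = (LINT x|area. Q x)"
  "\<And>x. x \<notin> W \<Longrightarrow> P x = 0" "\<And>x. x \<notin> W \<Longrightarrow> Q x = 0"
proof -
 let ?I = "chart_image c" and ?u = "in_chart c u" and ?v = "in_chart c v"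
 let ?K = "chart_map c ` W"
 have I: "open ?I" by (rule open_image[OF c])
 have uc: "Ck_on 2 ?I ?u" and vc: "Ck_on 1 ?I ?v" using u v c by (auto simp: Ck_function_def)
 have u': "Ck_on (Suc (Suc 0)) ?I ?u" and v': "Ck_on (Suc 0) ?I ?v" using uc vc by (simp_all add: numeral_2_eq_2)
 have K: "compact ?K" "?K \<subseteq> ?I"
  using W chart_map_in[OF c]
  by (auto intro!: compact_continuous_image continuous_on_subset[OF continuous_chart_map[OF c]])
 have v0: "?v y = 0" if "y \<in> ?I - ?K" for y
  using W(3)[of "chart_inv c y"] that chart_map_inv[OF c, of y] by (force simp: in_chart_def)
 have dv0: "partial_deriv i ?v y = 0" if "y \<in> ?I - ?K" for i y
  using partial_deriv_cong[of "?I - ?K" y ?v "\<lambda>_. 0" i] that K v0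
  by (simp add: I compact_imp_closed open_Diff partial_deriv_const)
 have Kc: "chart_map c x \<in> ?I - ?K" if "x \<in> chart_dom c" "x \<notin> W" for x
 proof
  show "chart_map c x \<in> ?I" by (rule chart_map_in[OF c that(1)])
  show "chart_map c x \<notin> ?K"
  proof
   assume "chart_map c x \<in> ?K"
   then obtain z where "z \<in> W" "chart_map c x = chart_map c z" by blast
   then have "x = z" using chart_inv_map[OF c] that(1) W(2) by (metis subsetD)
   then show False using \<open>z \<in> W\<close> that(2) by simp
  qed
 qed
 have cP: "continuous_on ?I (\<lambda>y. ?v y \<bullet> local_laplacian c ?u y)"
  using Ck_on_imp_continuous[OF vc] Ck_on_imp_continuous[OF Ck_on_local_laplacian[OF c I order_refl u']]
  by (intro continuous_intros)
 have cQ: "continuous_on ?I (\<lambda>y. dirichlet c ?u ?v y / vol c y)"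
  using Ck_on_imp_continuous[OF Ck_on_dirichlet[OF c I order_refl Ck_on_Suc_imp[OF u'] v']]
   continuous_vol[OF c] vol_pos[OF c] by (intro continuous_intros) fastforce+
 show "continuous_on UNIV P" unfolding P_def
  by (rule continuous_extend[OF c cP W(1,2)]) (use v0 Kc in auto)
 show "continuous_on UNIV Q" unfolding Q_def
  by (rule continuous_extend[OF c cQ W(1,2)]) (use dv0 Kc in \<open>auto simp: dirichlet_def\<close>)
 show "P x = 0" "Q x = 0" if "x \<notin> W" for x
  using v0 dv0 Kc that by (auto simp: P_def Q_def extend_def dirichlet_def)
 have "(LINT x|area. P x) = (LINT y|lborel. indicator ?I y *\<^sub>R (vol c y * (?v y \<bullet> local_laplacian c ?u y)))"
  unfolding P_def by (rule integral_extend[OF c cP W(1,2)]) (use v0 Kc in auto)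
 also have "\<dots> = (LINT y|lborel. indicator ?I y *\<^sub>R dirichlet c ?u ?v y)"
  by (rule green_chart(3)[OF c uc vc K v0])
 also have "\<dots> = (LINT y|lborel. indicator ?I y *\<^sub>R (vol c y * (dirichlet c ?u ?v y / vol c y)))"
  using vol_pos[OF c] by (intro Bochner_Integration.integral_cong) (fastforce simp: indicator_def)+
 also have "\<dots> = (LINT x|area. Q x)"
  unfolding Q_def by (rule integral_extend[OF c cQ W(1,2), symmetric]) (use dv0 Kc in \<open>auto simp: dirichlet_def\<close>)
 finally show "(LINT x|area. P x) = (LINT x|area. Q x)" .
qed

text \<open>By Green's formula in both charts the difference \<open>D\<close> of the two expressions is orthogonal to
 \<open>\<chi> D\<close> for a cutoff function \<open>\<chi>\<close>; this avoids computing with second derivatives of the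
 coordinate change.\<close>

lemma local_laplacian_transition:
 assumes c: "c \<in> A" "c' \<in> A" and x: "x \<in> chart_dom c" "x \<in> chart_dom c'" and u: "smooth_function A u"
 shows "local_laplacian c (in_chart c u) (chart_map c x) = local_laplacian c' (in_chart c' u) (chart_map c' x)"
proof (rule ccontr)
 assume neq: "\<not> ?thesis"
 let ?U = "chart_map c ` (chart_dom c \<inter> chart_dom c')" and ?p = "chart_map c x"
 let ?L = "local_laplacian c (in_chart c u)" and ?L' = "local_laplacian c' (in_chart c' u)"
 have u_n: "Ck_function n u" for n using u by (simp add: smooth_function_iff_Ck)
 have uc: "Ck_on n (chart_image d) (in_chart d u)" if "d \<in> A" for d n
  using u_n[of n] that by (simp add: Ck_function_def)
 have U: "open ?U" by (rule open_overlap[OF c])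
 have UI: "?U \<subseteq> chart_image c" by (rule overlap_subset[OF c])
 define D where "D y = ?L y - ?L' (transition c c' y)" for y
 have D: "Ck_on 1 ?U D"
  unfolding D_def[abs_def]
  by (intro Ck_on_diff U Ck_on_subset[OF Ck_on_local_laplacian[OF c(1) open_image[OF c(1)] order_refl uc[OF c(1)]] UI]
    Ck_on_comp[OF open_image[OF c(2)] U transition_in[OF c]
     Ck_on_local_laplacian[OF c(2) open_image[OF c(2)] order_refl uc[OF c(2)]] Ck_on_transition[OF c]])
 have p: "?p \<in> ?U" using x by auto
 then obtain r where r: "r > 0" "cball ?p r \<subseteq> ?U" using U open_contains_cball by blast
 define k where "k y = (if y \<in> ?U then bump ?p r y *\<^sub>R D y else 0)" for y
 have kD: "Ck_on 1 ?U (\<lambda>y. bump ?p r y *\<^sub>R D y)"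
  by (intro Ck_on_scaleR U D Ck_on_subset[OF Ck_on_bump]) simp
 have k: "Ck_on 1 UNIV k"
  unfolding k_def[abs_def]
  by (rule Ck_on_UNIV_zero_extension[OF U compact_cball r(2) kD]) (use bump_zero[OF r(1)] in auto)
 have k0: "k y = 0" if "y \<notin> cball ?p r" for y using that bump_zero[OF r(1), of y ?p] by (auto simp: k_def)
 define v where "v = extend c k"
 define W where "W = chart_inv c ` cball ?p r"
 have rI: "cball ?p r \<subseteq> chart_image c" using r(2) UI by blast
 have W: "compact W" unfolding W_def by (rule compact_chart_inv_image[OF c(1) compact_cball rI])
 have W1: "W \<subseteq> chart_dom c" unfolding W_def using rI chart_inv_in[OF c(1)] by auto
 have W2: "W \<subseteq> chart_dom c'" unfolding W_def using r(2) overlap_iff[OF c] by auto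
 have v: "Ck_function 1 v"
  unfolding v_def by (rule Ck_function_extend[OF c(1) Ck_on_subset[OF k] compact_cball rI]) (use k0 in auto)
 have v0: "v z = 0" if "z \<notin> W" for z
 proof (cases "z \<in> chart_dom c")
  case True
  then have "chart_map c z \<notin> cball ?p r"
   using that chart_inv_map[OF c(1) True] unfolding W_def by (metis imageI)
  then show ?thesis using k0 by (simp add: v_def extend_def)
 qed (simp add: v_def extend_def)
 define P where "P d = extend d (\<lambda>y. in_chart d v y \<bullet> local_laplacian d (in_chart d u) y)" for d
 define Q where "Q d = extend d (\<lambda>y. dirichlet d (in_chart d u) (in_chart d v) y / vol d y)" for d
 note g = green_support[OF c(1) u_n v W W1 v0, folded P_def Q_def]
 note g' = green_support[OF c(2) u_n v W W2 v0, folded P_def Q_def]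
 \<comment> \<open>The first-order sides agree pointwise by \<open>dirichlet_transition\<close>;
   hence the integrals of the sides containing the two local Laplacians agree as well.\<close>
 have "Q c z = Q c' z" for z
 proof (cases "z \<in> W")
  case True
  then have z: "z \<in> chart_dom c" "z \<in> chart_dom c'" using W1 W2 by auto
  then show ?thesis
   unfolding Q_def extend_def using dirichlet_transition[OF c z u_n v] by simp
 qed (use g(5) g'(5) in auto)
 then have "Q c = Q c'" by auto
 then have "(LINT z|area. P c z) = (LINT z|area. P c' z)" using g(3) g'(3) by simp
 moreover have "(LINT z|area. P c z - P c' z) = (LINT z|area. P c z) - (LINT z|area. P c' z)"
  using integrable_area_continuous[OF g(1)] integrable_area_continuous[OF g'(1)] by simp
 ultimately have z0: "(LINT z|area. P c z - P c' z) = 0" by simp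
 define m where "m y = (if y \<in> ?U then bump ?p r y *\<^sub>R (D y \<bullet> D y) else 0)" for y
 have m: "Ck_on 0 UNIV m"
  unfolding m_def[abs_def]
  by (rule Ck_on_UNIV_zero_extension[OF U compact_cball r(2)])
    (use bump_zero[OF r(1)] in \<open>auto intro!: Ck_on_scaleR[OF U] Ck_on_inner[OF U]
     Ck_on_mono[OF D] Ck_on_subset[OF Ck_on_mono[OF Ck_on_bump]] simp del: Ck_on.simps real_scaleR_def\<close>)
 have m0: "m y = 0" if "y \<notin> cball ?p r" for y using that bump_zero[OF r(1), of y ?p] by (auto simp: m_def)
 have "P c z - P c' z = extend c m z" for z
 proof (cases "z \<in> W")
  case True
  then have z: "z \<in> chart_dom c" "z \<in> chart_dom c'" using W1 W2 by auto
  then have "chart_map c z \<in> ?U" by auto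
  then show ?thesis
   using z chart_inv_map[OF c(1)] chart_inv_map[OF c(2)] transition_chart_map[OF c z(1)]
   by (simp add: P_def extend_def in_chart_map[OF c(1)] in_chart_map[OF c(2)] v_def m_def k_def D_def
     inner_diff_right right_diff_distrib)
 next
  case False
  have "extend c m z = 0"
  proof (cases "z \<in> chart_dom c")
   case True
   then have "chart_map c z \<notin> cball ?p r"
    using False chart_inv_map[OF c(1) True] unfolding W_def by (metis imageI)
   then show ?thesis using m0 by (simp add: extend_def)
  qed (simp add: extend_def)
  then show ?thesis using False g(4) g'(4) by simp
 qed
 then have "(LINT z|area. extend c m z) = 0" using z0 by simp
 moreover have "(LINT z|area. extend c m z) = (LINT y|lborel. indicator (chart_image c) y *\<^sub>R (vol c y * m y))"
 proof (rule integral_extend[OF c(1) _ W W1])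
  show "continuous_on (chart_image c) m" using m continuous_on_subset by auto
  fix z assume "z \<in> chart_dom c - W"
  then have "chart_map c z \<notin> cball ?p r"
   using chart_inv_map[OF c(1)] unfolding W_def by (metis DiffE imageI)
  then show "m (chart_map c z) = 0" using m0 by simp
 qed
 ultimately have int0: "(LINT y|lborel. indicator (chart_image c) y *\<^sub>R (vol c y * m y)) = 0" by simp
 define h where "h y = (if y \<in> chart_image c then vol c y * m y else 0)" for y
 have eq: "(\<lambda>y. indicator (chart_image c) y *\<^sub>R (vol c y * m y)) = h" by (auto simp: h_def indicator_def)
 have "Ck_on 0 UNIV h"
  unfolding h_def[abs_def]
  by (rule Ck_on_UNIV_zero_extension[OF open_image[OF c(1)] compact_cball rI])
    (use m0 in \<open>auto intro!: Ck_on_mult open_image[OF c(1)] Ck_on_vol[OF c(1)] Ck_on_subset[OF m] simp del: Ck_on.simps\<close>)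
 then have h: "continuous_on UNIV h" by simp
 have "(LINT y|lborel. h y) > 0"
 proof (rule integral_pos_of_continuous[OF h])
  show "integrable lborel h"
   by (rule integrable_continuous_compact_support[OF h compact_cball]) (use m0 in \<open>auto simp: h_def\<close>)
  show "h y \<ge> 0" for y
   using vol_pos[OF c(1), of y] bump_nonneg[of ?p r y] by (auto simp: h_def m_def less_imp_le)
  have "D ?p \<noteq> 0" using neq transition_chart_map[OF c x(1)] by (simp add: D_def)
  then show "h ?p > 0"
   using p UI vol_pos[OF c(1), of ?p] bump_pos_iff[OF r(1), of ?p ?p] r(1) by (auto simp: h_def m_def)
 qed
 then show False using int0 eq by simp
qed

definition carre_du_champ :: "('a \<Rightarrow> complex) \<Rightarrow> ('a \<Rightarrow> complex) \<Rightarrow> 'a \<Rightarrow> real" where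
 "carre_du_champ u v x = (let c = chart_at A x in
   dirichlet c (in_chart c u) (in_chart c v) (chart_map c x) / vol c (chart_map c x))"

lemma laplacian_chart:
 assumes "c \<in> A" "x \<in> chart_dom c" "smooth_function A u"
 shows "laplacian A g u x = local_laplacian c (in_chart c u) (chart_map c x)"
 unfolding laplacian_eq_local
 by (rule local_laplacian_transition[OF chart_at_in(1) assms(1) chart_at_in(2) assms(2,3)])

lemma carre_du_champ_chart:
 assumes "c \<in> A" "x \<in> chart_dom c" "Ck_function 1 u" "Ck_function 1 v"
 shows "carre_du_champ u v x = dirichlet c (in_chart c u) (in_chart c v) (chart_map c x) / vol c (chart_map c x)"
 unfolding carre_du_champ_def Let_def
 by (rule dirichlet_transition[OF chart_at_in(1) assms(1) chart_at_in(2) assms(2-4)])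

lemma continuous_laplacian:
 assumes u: "smooth_function A u" shows "continuous_on UNIV (laplacian A g u)"
proof (rule continuous_local_chart)
 fix x
 obtain c where c: "c \<in> A" "x \<in> chart_dom c" using ex_chart by blast
 have "Ck_on 0 (chart_image c) (local_laplacian c (in_chart c u))"
  using u c by (intro Ck_on_local_laplacian open_image) (auto simp: smooth_function_iff_Ck Ck_function_def simp del: Ck_on.simps)
 then show "\<exists>c\<in>A. \<exists>W k. open W \<and> x \<in> W \<and> W \<subseteq> chart_dom c \<and> continuous_on (chart_map c ` W) k \<and>
   (\<forall>z\<in>W. laplacian A g u z = k (chart_map c z))"
  using c open_dom[OF c(1)] laplacian_chart[OF c(1) _ u]
  by (intro bexI[of _ c] exI[of _ "chart_dom c"] exI[of _ "local_laplacian c (in_chart c u)"])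
    (auto simp: chart_image_def)
qed

lemma continuous_carre_du_champ:
 assumes u: "Ck_function 1 u" and v: "Ck_function 1 v" shows "continuous_on UNIV (carre_du_champ u v)"
proof (rule continuous_local_chart)
 fix x
 obtain c where c: "c \<in> A" "x \<in> chart_dom c" using ex_chart by blast
 have "Ck_on (Suc 0) (chart_image c) (in_chart c u)" "Ck_on (Suc 0) (chart_image c) (in_chart c v)"
  using u v c by (auto simp: Ck_function_def)
 then have "continuous_on (chart_image c) (dirichlet c (in_chart c u) (in_chart c v))"
  using Ck_on_dirichlet[OF c(1) open_image[OF c(1)] order_refl] Ck_on_imp_continuous by blast
 then have "continuous_on (chart_image c) (\<lambda>y. dirichlet c (in_chart c u) (in_chart c v) y / vol c y)"
  using continuous_vol[OF c(1)] vol_pos[OF c(1)] by (intro continuous_intros) fastforce+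
 then show "\<exists>c\<in>A. \<exists>W k. open W \<and> x \<in> W \<and> W \<subseteq> chart_dom c \<and> continuous_on (chart_map c ` W) k \<and>
   (\<forall>z\<in>W. carre_du_champ u v z = k (chart_map c z))"
  using c open_dom[OF c(1)] carre_du_champ_chart[OF c(1) _ u v]
  by (intro bexI[of _ c] exI[of _ "chart_dom c"] exI[of _ "\<lambda>y. dirichlet c (in_chart c u) (in_chart c v) y / vol c y"])
    (auto simp: chart_image_def)
qed

lemma carre_du_champ_nonneg: "carre_du_champ u u x \<ge> 0"
 unfolding carre_du_champ_def Let_def
 using dirichlet_nonneg[OF chart_at_in(1) chart_map_in[OF chart_at_in]] vol_pos[OF chart_at_in(1) chart_map_in[OF chart_at_in]]
 by (simp add: less_imp_le)

lemma carre_du_champ_sym: "carre_du_champ u v x = carre_du_champ v u x"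
 unfolding carre_du_champ_def Let_def
 using dirichlet_sym[OF chart_at_in(1) chart_map_in[OF chart_at_in]] by simp

text \<open>Bumps on finitely many coordinate balls that cover the surface, divided by their
  positive sum. They are of class C^1, the regularity that Green's formula asks of a test
  function.\<close>

lemma partition_of_unity:
 "\<exists>(F :: 'a set) \<rho> W C. finite F \<and> (\<forall>i\<in>F. Ck_function 1 (\<rho> i) \<and> C i \<in> A \<and> compact (W i) \<and> W i \<subseteq> chart_dom (C i) \<and>
   (\<forall>x. x \<notin> W i \<longrightarrow> \<rho> i x = 0)) \<and> (\<forall>x. (\<Sum>i\<in>F. \<rho> i x) = (1::real))"
proof -
 have "\<forall>x. \<exists>c r. c \<in> A \<and> x \<in> chart_dom c \<and> r > 0 \<and> cball (chart_map c x) r \<subseteq> chart_image c"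
  using ex_chart_cball by blast
 then obtain C r where C: "\<And>x. C x \<in> A" "\<And>x. x \<in> chart_dom (C x)" "\<And>x. r x > 0"
  "\<And>x. cball (chart_map (C x) x) (r x) \<subseteq> chart_image (C x)" by metis
 define \<beta> where "\<beta> x = extend (C x) (bump (chart_map (C x) x) (r x))" for x
 define W where "W x = chart_inv (C x) ` cball (chart_map (C x) x) (r x)" for x
 have W: "compact (W x)" "W x \<subseteq> chart_dom (C x)" for x
  unfolding W_def using compact_chart_inv_image[OF C(1) compact_cball C(4)] chart_inv_in[OF C(1)] subsetD[OF C(4)]
  by auto
 have \<beta>: "Ck_function 1 (\<beta> x)" for x
  unfolding \<beta>_def
  by (rule Ck_function_extend[OF C(1) Ck_on_subset[OF Ck_on_bump] compact_cball C(4)])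
    (use bump_zero[OF C(3)] in auto)
 have \<beta>_nonneg: "\<beta> x z \<ge> 0" for x z by (simp add: \<beta>_def extend_def bump_nonneg)
 have \<beta>_zero: "\<beta> x z = 0" if "z \<notin> W x" for x z
 proof (cases "z \<in> chart_dom (C x)")
  case True
  then have "chart_map (C x) z \<notin> cball (chart_map (C x) x) (r x)"
   using that chart_inv_map[OF C(1) True] unfolding W_def by (metis imageI)
  then show ?thesis using bump_zero[OF C(3)] by (auto simp: \<beta>_def extend_def)
 qed (simp add: \<beta>_def extend_def)
 have op: "open {z. \<beta> x z > 0}" for x
  using Ck_function_continuous[OF \<beta>] by (intro open_Collect_less continuous_intros) auto
 have "x \<in> {z. \<beta> x z > 0}" for x
  using C(2,3) bump_pos_iff[OF C(3)] by (auto simp: \<beta>_def extend_def)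
 then obtain F where F: "finite F" "UNIV \<subseteq> (\<Union>x\<in>F. {z. \<beta> x z > 0})"
  by (rule finite_open_cover[OF op])
 define s where "s z = (\<Sum>x\<in>F. \<beta> x z)" for z
 have s_pos: "s z > 0" for z
 proof -
  obtain x where "x \<in> F" "\<beta> x z > 0" using F(2) by blast
  then show ?thesis unfolding s_def using F(1) \<beta>_nonneg by (intro sum_pos2[of _ x]) auto
 qed
 have s: "Ck_function 1 s" unfolding s_def[abs_def] by (rule Ck_function_sum) (rule \<beta>)
 have s0: "s z \<noteq> 0" for z using s_pos[of z] by simp
 have "Ck_function 1 (\<lambda>z. inverse (s z) *\<^sub>R \<beta> x z)" for x
  by (intro Ck_function_scaleR Ck_function_inverse s \<beta> s0)
 moreover have "(\<Sum>x\<in>F. inverse (s z) *\<^sub>R \<beta> x z) = 1" for z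
  using s0[of z] by (simp add: sum_distrib_left[symmetric] s_def[symmetric])
 ultimately show ?thesis
  using F(1) W C(1) \<beta>_zero
  by (intro exI[of _ F] exI[of _ "\<lambda>x z. inverse (s z) *\<^sub>R \<beta> x z"] exI[of _ W] exI[of _ C]) auto
qed

lemma carre_du_champ_sum:
 assumes "\<And>i. i \<in> I \<Longrightarrow> Ck_function 1 (v i)"
 shows "carre_du_champ u (\<lambda>x. \<Sum>i\<in>I. v i x) x = (\<Sum>i\<in>I. carre_du_champ u (v i) x)"
proof -
 let ?c = "chart_at A x" let ?y = "chart_map ?c x"
 have y: "?y \<in> chart_image ?c" using chart_at_in chart_map_in by blast
 have "in_chart ?c (v i) differentiable (at ?y)" if "i \<in> I" for i
  using assms[OF that] chart_at_in(1) y by (simp add: Ck_function_def)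
 then have pd: "partial_deriv j (in_chart ?c (\<lambda>x. \<Sum>i\<in>I. v i x)) ?y = (\<Sum>i\<in>I. partial_deriv j (in_chart ?c (v i)) ?y)" for j
  using partial_deriv_sum[of I "\<lambda>i. in_chart ?c (v i)" ?y j] by (simp add: in_chart_def)
 show ?thesis
  unfolding carre_du_champ_def Let_def dirichlet_def pd
  by (simp add: sum_2 inner_sum_right sum.distrib sum_distrib_left sum_divide_distrib add_divide_distrib)
qed

text \<open>Both sides are additive in \<open>v\<close>, and a partition of unity splits
  \<open>v\<close> into pieces supported in single charts, where \<open>green_support\<close>
  applies.\<close>

lemma green:
 assumes u: "smooth_function A u" and v: "Ck_function 1 v"
 shows "(LINT x|area. v x \<bullet> laplacian A g u x) = (LINT x|area. carre_du_champ u v x)"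
proof -
 obtain F :: "'a set" and \<rho> W C where "finite F \<and> (\<forall>i\<in>F. Ck_function 1 (\<rho> i) \<and> C i \<in> A \<and> compact (W i) \<and>
   W i \<subseteq> chart_dom (C i) \<and> (\<forall>x. x \<notin> W i \<longrightarrow> \<rho> i x = 0)) \<and> (\<forall>x. (\<Sum>i\<in>F. \<rho> i x) = (1::real))"
  using partition_of_unity by (elim exE)
 then have F: "finite F" "\<And>i. i \<in> F \<Longrightarrow> Ck_function 1 (\<rho> i)"
  "\<And>i. i \<in> F \<Longrightarrow> C i \<in> A" "\<And>i. i \<in> F \<Longrightarrow> compact (W i)" "\<And>i. i \<in> F \<Longrightarrow> W i \<subseteq> chart_dom (C i)"
  "\<And>i x. i \<in> F \<Longrightarrow> x \<notin> W i \<Longrightarrow> \<rho> i x = 0" "\<And>x. (\<Sum>i\<in>F. \<rho> i x) = (1::real)"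
  by (simp_all only: simp_thms)
 have un: "Ck_function n u" for n using u by (simp add: smooth_function_iff_Ck)
 define w where "w i x = \<rho> i x *\<^sub>R v x" for i x
 have w: "Ck_function 1 (w i)" if "i \<in> F" for i
  unfolding w_def[abs_def] using F(2)[OF that] v by (intro Ck_function_scaleR)
 have w0: "w i x = 0" if "i \<in> F" "x \<notin> W i" for i x using F(6)[OF that] by (simp add: w_def)
 have v_eq: "v = (\<lambda>x. \<Sum>i\<in>F. w i x)"
  by (auto simp: w_def scaleR_sum_left[symmetric] F(7))
 have piece: "(LINT x|area. w i x \<bullet> laplacian A g u x) = (LINT x|area. carre_du_champ u (w i) x)"
  if i: "i \<in> F" for i
 proof -
  let ?c = "C i"
  let ?P = "extend ?c (\<lambda>y. in_chart ?c (w i) y \<bullet> local_laplacian ?c (in_chart ?c u) y)"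
  let ?Q = "extend ?c (\<lambda>y. dirichlet ?c (in_chart ?c u) (in_chart ?c (w i)) y / vol ?c y)"
  note c = F(3)[OF i]
  note gs = green_support[OF c un w[OF i] F(4)[OF i] F(5)[OF i] w0[OF i]]
  have "w i x \<bullet> laplacian A g u x = ?P x" for x
  proof (cases "x \<in> W i")
   case True
   then have "x \<in> chart_dom ?c" using F(5)[OF i] by auto
   then show ?thesis by (simp add: extend_def in_chart_map[OF c] laplacian_chart[OF c _ u])
  qed (use gs(4) w0[OF i] in auto)
  moreover have "carre_du_champ u (w i) x = ?Q x" for x
  proof (cases "x \<in> chart_dom ?c")
   case True
   then show ?thesis by (simp add: extend_def carre_du_champ_chart[OF c _ un w[OF i]])
  next
   case False
   \<comment> \<open>\<open>carre_du_champ\<close> is evaluated in the chart chosen at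
     \<open>x\<close>, which may differ from the chart of the piece. The piece vanishes near
     \<open>x\<close>, so its derivatives in the chosen chart are zero.\<close>
   let ?d = "chart_at A x"
   have d: "?d \<in> A" "x \<in> chart_dom ?d" by (rule chart_at_in)+
   have x: "x \<notin> W i" using False F(5)[OF i] by auto
   let ?V = "chart_map ?d ` (chart_dom ?d - W i)"
   have V: "open ?V"
    by (rule open_chart_map_image[OF d(1)])
      (use open_dom[OF d(1)] compact_imp_closed[OF F(4)[OF i]] in auto)
   have "in_chart ?d (w i) z = 0" if "z \<in> ?V" for z
    using that w0[OF i] in_chart_map[OF d(1), of _ "w i"] by auto
   then have "partial_deriv j (in_chart ?d (w i)) (chart_map ?d x) = 0" for j
    using partial_deriv_cong[OF V, of "chart_map ?d x" "in_chart ?d (w i)" "\<lambda>_. 0" j] d x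
    by (simp add: partial_deriv_const)
   then have "carre_du_champ u (w i) x = 0"
    by (simp add: carre_du_champ_def Let_def dirichlet_def)
   then show ?thesis using False by (simp add: extend_def)
  qed
  ultimately show ?thesis using gs(3) by simp
 qed
 have iP: "integrable area (\<lambda>x. w i x \<bullet> laplacian A g u x)" if "i \<in> F" for i
  using Ck_function_continuous[OF w[OF that]] continuous_laplacian[OF u]
  by (intro integrable_area_continuous continuous_intros)
 have iQ: "integrable area (carre_du_champ u (w i))" if "i \<in> F" for i
  by (intro integrable_area_continuous continuous_carre_du_champ un w that)
 have "(LINT x|area. v x \<bullet> laplacian A g u x) = (\<Sum>i\<in>F. LINT x|area. w i x \<bullet> laplacian A g u x)"
  unfolding v_eq inner_sum_left by (rule Bochner_Integration.integral_sum) (rule iP)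
 also have "\<dots> = (\<Sum>i\<in>F. LINT x|area. carre_du_champ u (w i) x)" using piece by simp
 also have "\<dots> = (LINT x|area. carre_du_champ u v x)"
 proof -
  have "carre_du_champ u v = (\<lambda>x. \<Sum>i\<in>F. carre_du_champ u (w i) x)"
   unfolding v_eq by (rule ext, rule carre_du_champ_sum) (rule w)
  then show ?thesis using iQ by simp
 qed
 finally show ?thesis .
qed

lemma laplacian_symmetric:
 assumes u: "smooth_function A u" and v: "smooth_function A v"
 shows "(LINT x|area. v x \<bullet> laplacian A g u x) = (LINT x|area. u x \<bullet> laplacian A g v x)"
 using green[OF u] green[OF v] u v carre_du_champ_sym
 by (simp add: smooth_function_iff_Ck)

text \<open>The divergence-form coefficients are conformally invariant in dimension two; only the
  prefactor, the inverse of the area density, changes.\<close>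

lemma laplacian_conformal:
 "laplacian A (conformal_metric f g t) u x = exp (t * f x) *\<^sub>R laplacian A g u x"
proof -
 let ?c = "chart_at A x" let ?y = "chart_map ?c x"
 have c: "?c \<in> A" "x \<in> chart_dom ?c" by (rule chart_at_in)+
 let ?I = "chart_image ?c"
 have I: "open ?I" "?y \<in> ?I" using open_image[OF c(1)] chart_map_in[OF c] by auto
 let ?H = "in_chart ?c (conformal_metric f g t ?c)" and ?G = "in_chart ?c (g ?c)"
 let ?e = "\<lambda>y. exp (- t * f (chart_inv ?c y))"
 have H: "?H y = ?e y *\<^sub>R ?G y" for y by (simp add: in_chart_def conformal_metric_def)
 have det: "det (?H y) = det (?G y) * (?e y)^2" for y
  unfolding H det_2 by (simp add: power2_eq_square algebra_simps)
 have w: "sqrt (det (?H y)) = ?e y * sqrt (det (?G y))" for y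
  unfolding det by (simp add: real_sqrt_mult)
 have co: "sqrt (det (?H y)) * matrix_inv (?H y) $ i $ j = sqrt (det (?G y)) * matrix_inv (?G y) $ i $ j"
  if "y \<in> ?I" for y i j
 proof -
  have d: "det (?G y) > 0" by (rule det_gram_pos[OF c(1) that])
  have "det (?H y) \<noteq> 0" unfolding det using d by simp
  then have "matrix_inv (?H y) $ i $ j = inverse (?e y) * matrix_inv (?G y) $ i $ j" for i j
   using exhaust_2[of i] exhaust_2[of j] d
   by (auto simp: matrix_inv_2 det) (auto simp: H power2_eq_square field_simps)
  then show ?thesis unfolding w by simp
 qed
 have "partial_deriv i (\<lambda>z. \<Sum>j\<in>UNIV. (sqrt (det (?H z)) * matrix_inv (?H z) $ i $ j) *\<^sub>R partial_deriv j h z) ?y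
   = partial_deriv i (\<lambda>z. \<Sum>j\<in>UNIV. (sqrt (det (?G z)) * matrix_inv (?G z) $ i $ j) *\<^sub>R partial_deriv j h z) ?y"
  for i and h :: "real^2 \<Rightarrow> complex"
  by (rule partial_deriv_cong[OF I]) (simp only: co)
 moreover have "1 / (?e ?y * r) = exp (t * f x) * (1 / r)" for r
  using chart_inv_map[OF c] by (simp add: exp_minus divide_inverse)
 ultimately show ?thesis
  unfolding laplacian_def Let_def w[of ?y] by simp
qed

lemma laplacian_add:
 assumes "smooth_function A u" "smooth_function A v"
 shows "laplacian A g (\<lambda>x. u x + v x) x = laplacian A g u x + laplacian A g v x"
proof -
 let ?c = "chart_at A x" let ?y = "chart_map ?c x"
 have c: "?c \<in> A" "x \<in> chart_dom ?c" by (rule chart_at_in)+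
 let ?I = "chart_image ?c"
 have I: "open ?I" "?y \<in> ?I" using open_image[OF c(1)] chart_map_in[OF c] by auto
 have uv: "Ck_on (Suc (Suc 0)) ?I (in_chart ?c u)" "Ck_on (Suc (Suc 0)) ?I (in_chart ?c v)"
  using assms c by (auto simp: smooth_function_iff_Ck Ck_function_def simp del: Ck_on.simps)
 let ?F = "\<lambda>h i z. \<Sum>j\<in>UNIV. coeff ?c i j z *\<^sub>R partial_deriv j h z"
 have "partial_deriv i (?F (in_chart ?c (\<lambda>x. u x + v x)) i) ?y
   = partial_deriv i (\<lambda>z. ?F (in_chart ?c u) i z + ?F (in_chart ?c v) i z) ?y" for i
 proof (rule partial_deriv_cong[OF I])
  fix z assume "z \<in> ?I"
  then have "partial_deriv j (in_chart ?c (\<lambda>x. u x + v x)) z = partial_deriv j (in_chart ?c u) z + partial_deriv j (in_chart ?c v) z" for j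
   using partial_deriv_add[of "in_chart ?c u" z "in_chart ?c v" j] uv by (simp add: in_chart_def)
  then show "?F (in_chart ?c (\<lambda>x. u x + v x)) i z = ?F (in_chart ?c u) i z + ?F (in_chart ?c v) i z"
   by (simp add: sum_2 scaleR_add_right)
 qed
 also have "\<dots> i = partial_deriv i (?F (in_chart ?c u) i) ?y + partial_deriv i (?F (in_chart ?c v) i) ?y" for i
  using Ck_on_flux[OF c(1) I(1) order_refl uv(1)] Ck_on_flux[OF c(1) I(1) order_refl uv(2)] I(2)
  by (intro partial_deriv_add) auto
 finally show ?thesis
  by (simp add: laplacian_eq_local local_laplacian_def sum.distrib scaleR_add_right)
qed

lemma laplacian_scaleR:
 assumes "smooth_function A u"
 shows "laplacian A g (\<lambda>x. (k::real) *\<^sub>R u x) x = k *\<^sub>R laplacian A g u x"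
proof -
 let ?c = "chart_at A x" let ?y = "chart_map ?c x"
 have c: "?c \<in> A" "x \<in> chart_dom ?c" by (rule chart_at_in)+
 let ?I = "chart_image ?c"
 have I: "open ?I" "?y \<in> ?I" using open_image[OF c(1)] chart_map_in[OF c] by auto
 have u: "Ck_on (Suc (Suc 0)) ?I (in_chart ?c u)"
  using assms c by (auto simp: smooth_function_iff_Ck Ck_function_def simp del: Ck_on.simps)
 let ?F = "\<lambda>h i z. \<Sum>j\<in>UNIV. coeff ?c i j z *\<^sub>R partial_deriv j h z"
 have bl: "bounded_linear (\<lambda>z::complex. k *\<^sub>R z)" by (rule bounded_linear_scaleR_right)
 have "partial_deriv i (?F (in_chart ?c (\<lambda>x. k *\<^sub>R u x)) i) ?y = partial_deriv i (\<lambda>z. k *\<^sub>R ?F (in_chart ?c u) i z) ?y" for i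
 proof (rule partial_deriv_cong[OF I])
  fix z assume "z \<in> ?I"
  then have "partial_deriv j (in_chart ?c (\<lambda>x. k *\<^sub>R u x)) z = k *\<^sub>R partial_deriv j (in_chart ?c u) z" for j
   using partial_deriv_linear[OF bl, of "in_chart ?c u" z j] u by (simp add: in_chart_def)
  then show "?F (in_chart ?c (\<lambda>x. k *\<^sub>R u x)) i z = k *\<^sub>R ?F (in_chart ?c u) i z"
   by (simp add: sum_2 scaleR_add_right mult.commute)
 qed
 also have "\<dots> i = k *\<^sub>R partial_deriv i (?F (in_chart ?c u) i) ?y" for i
  using Ck_on_flux[OF c(1) I(1) order_refl u] I(2) by (intro partial_deriv_linear[OF bl]) auto
 finally show ?thesis
  by (simp add: laplacian_eq_local local_laplacian_def scaleR_sum_right[symmetric] del: sum_2)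
qed

end

section \<open>A polynomial bound for the number of eigenvalues\<close>

text \<open>Gaussian elimination by induction on the equations. An equation with a nonzero
  coefficient removes one unknown, which preserves the surplus of unknowns over equations.\<close>

lemma linear_system_nontrivial:
 fixes M :: "'e \<Rightarrow> 'j \<Rightarrow> real"
 assumes "finite E" "finite J" "card E < card J"
 shows "\<exists>c. (\<exists>j\<in>J. c j \<noteq> 0) \<and> (\<forall>e\<in>E. (\<Sum>j\<in>J. c j * M e j) = 0)"
 using assms
proof (induction E arbitrary: M J rule: finite_induct)
 case empty
 then obtain j where "j \<in> J" by fastforce
 then show ?case by (intro exI[of _ "\<lambda>_. 1"]) auto
next
 case (insert e E)
 show ?case
 proof (cases "\<forall>j\<in>J. M e j = 0")
  case True
  obtain c where "\<exists>j\<in>J. c j \<noteq> 0" "\<forall>e\<in>E. (\<Sum>j\<in>J. c j * M e j) = 0"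
   using insert.IH[OF insert.prems(1), of M] insert.prems(2) insert.hyps by auto
  then show ?thesis using True by (intro exI[of _ c]) auto
 next
  case False
  then obtain k where k: "k \<in> J" "M e k \<noteq> 0" by blast
  \<comment> \<open>The remaining equations after solving equation \<open>e\<close> for the unknown
    \<open>k\<close>; the value of that unknown is put back below through \<open>c'\<close>.\<close>
  define M' where "M' e' j = M e' j - M e' k * M e j / M e k" for e' j
  have "card E < card (J - {k})" using insert.prems insert.hyps k by simp
  then obtain c where c: "\<exists>j\<in>J - {k}. c j \<noteq> 0" "\<forall>e'\<in>E. (\<Sum>j\<in>J - {k}. c j * M' e' j) = 0"
   using insert.IH[of "J - {k}" M'] insert.prems(1) by blast
  define s where "s = (\<Sum>j\<in>J - {k}. c j * M e j)"
  define c' where "c' j = (if j = k then - s / M e k else c j)" for j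
  have sum: "(\<Sum>j\<in>J. c' j * M e' j) = - s / M e k * M e' k + (\<Sum>j\<in>J - {k}. c j * M e' j)" for e'
  proof -
   have "(\<Sum>j\<in>J. c' j * M e' j) = c' k * M e' k + (\<Sum>j\<in>J - {k}. c' j * M e' j)"
    using k insert.prems(1) by (simp add: sum.remove)
   also have "(\<Sum>j\<in>J - {k}. c' j * M e' j) = (\<Sum>j\<in>J - {k}. c j * M e' j)"
    by (rule sum.cong) (auto simp: c'_def)
   finally show ?thesis by (simp add: c'_def)
  qed
  have "(\<Sum>j\<in>J. c' j * M e' j) = 0" if "e' \<in> insert e E" for e'
  proof (cases "e' = e")
   case True
   then show ?thesis unfolding sum using k by (simp add: s_def)
  next
   case False
   then have "(\<Sum>j\<in>J - {k}. c j * M e' j) - M e' k / M e k * s = 0"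
    using c(2) that
    by (auto simp: M'_def s_def sum_subtractf right_diff_distrib sum_distrib_left algebra_simps)
   then show ?thesis unfolding sum by (simp add: field_simps)
  qed
  moreover have "\<exists>j\<in>J. c' j \<noteq> 0" using c(1) by (auto simp: c'_def)
  ultimately show ?thesis by blast
 qed
qed

section \<open>Poincare inequalities on convex sets and on grid cells\<close>

lemma nn_integral_lborel_affine:
 fixes h :: "real^2 \<Rightarrow> ennreal"
 assumes h: "h \<in> borel_measurable borel" and c: "c \<noteq> 0"
 shows "(\<integral>\<^sup>+ x. h x \<partial>lborel) = ennreal (c^2) * (\<integral>\<^sup>+ x. h (t + c *\<^sub>R x) \<partial>lborel)"
proof -
 have "(\<integral>\<^sup>+ x. h x \<partial>lborel) = (\<integral>\<^sup>+ x. h x \<partial>density (distr lborel borel (\<lambda>x. t + c *\<^sub>R x)) (\<lambda>_. \<bar>c\<bar> ^ DIM(real^2)))"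
  using lborel_affine[OF c, of t] by simp
 also have "\<dots> = ennreal (c^2) * (\<integral>\<^sup>+ x. h (t + c *\<^sub>R x) \<partial>lborel)"
  using h by (simp add: nn_integral_density nn_integral_distr nn_integral_cmult)
 finally show ?thesis .
qed

text \<open>The difference of the two sides is the variance of \<open>h\<close> on the unit
  interval.\<close>

lemma square_integral_le:
 fixes h :: "real \<Rightarrow> real"
 assumes h: "continuous_on {0..1} h"
 shows "(integral {0..1} h)^2 \<le> integral {0..1} (\<lambda>s. (h s)^2)"
proof -
 let ?c = "integral {0..1} h"
 have i: "h integrable_on {0..1}" "(\<lambda>s. (h s)^2) integrable_on {0..1}"
  by (auto intro!: integrable_continuous_real continuous_intros h)
 have "0 \<le> integral {0..1} (\<lambda>s. (h s - ?c)^2)"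
  by (rule integral_nonneg) (auto intro!: integrable_continuous_real continuous_intros h)
 also have "\<dots> = integral {0..1} (\<lambda>s. (h s)^2 - 2 * ?c * h s + ?c^2)"
  by (intro integral_cong) (simp add: power2_diff)
 also have "\<dots> = integral {0..1} (\<lambda>s. (h s)^2) - 2 * ?c * ?c + ?c^2"
  using i by (subst integral_add, (auto intro!: integrable_diff integrable_on_mult_right)[2], subst integral_diff)
   (auto intro!: integrable_on_mult_right)
 finally show ?thesis by (simp add: power2_eq_square)
qed

definition grad_sq :: "(real^2 \<Rightarrow> 'b::real_normed_vector) \<Rightarrow> real^2 \<Rightarrow> real" where
 "grad_sq h y = (\<Sum>i\<in>UNIV. (norm (partial_deriv i h y))^2)"

lemma grad_sq_nonneg: "grad_sq h y \<ge> 0"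
 by (simp add: grad_sq_def sum_nonneg)

lemma continuous_on_grad_sq: "Ck_on 1 V h \<Longrightarrow> continuous_on V (grad_sq h)"
 unfolding grad_sq_def[abs_def] by (auto intro!: continuous_intros)

lemma norm_frechet_derivative_le:
 assumes "h differentiable (at y)"
 shows "(norm (frechet_derivative h (at y) v))^2 \<le> (norm v)^2 * grad_sq h y"
proof -
 let ?a = "\<lambda>i. \<bar>v $ i\<bar>" and ?b = "\<lambda>i. norm (partial_deriv i h y)"
 have "norm (frechet_derivative h (at y) v) \<le> (\<Sum>i\<in>UNIV. ?a i * ?b i)"
  unfolding frechet_derivative_eq_sum[OF assms] by (rule order_trans[OF norm_sum]) simp
 then have "(norm (frechet_derivative h (at y) v))^2 \<le> (\<Sum>i\<in>UNIV. ?a i * ?b i)^2"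
  by (rule power_mono) simp
 also have "\<dots> \<le> (\<Sum>i\<in>UNIV. (?a i)^2) * (\<Sum>i\<in>UNIV. (?b i)^2)" by (rule Cauchy_Schwarz_ineq_sum)
 also have "(\<Sum>i\<in>UNIV. (?a i)^2) = (norm v)^2"
  by (simp add: norm_vec_def L2_set_def sum_nonneg)
 finally show ?thesis by (simp add: grad_sq_def)
qed

text \<open>The fundamental theorem of calculus along the segment, followed by
  \<open>square_integral_le\<close> and Cauchy-Schwarz for the directional derivative.\<close>

lemma difference_sq_le_segment_integral:
 fixes h :: "real^2 \<Rightarrow> 'b::euclidean_space"
 assumes h: "Ck_on 1 V h" and seg: "closed_segment q p \<subseteq> V"
 shows "(norm (h p - h q))^2 \<le> (dist p q)^2 * integral {0..1} (\<lambda>s. grad_sq h (q + s *\<^sub>R (p - q)))"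
proof -
 let ?z = "\<lambda>s. q + s *\<^sub>R (p - q)"
 have zV: "?z s \<in> V" if "s \<in> {0..1}" for s
 proof -
  have "?z s \<in> closed_segment q p"
   using that by (auto simp: closed_segment_def algebra_simps intro!: exI[of _ s])
  then show ?thesis using seg by blast
 qed
 have cz: "continuous_on {0..1} ?z" by (intro continuous_intros)
 define \<phi>' where "\<phi>' s = frechet_derivative h (at (?z s)) (p - q)" for s
 have diff: "h differentiable (at (?z s))" if "s \<in> {0..1}" for s using h zV[OF that] by simp
 have "((\<lambda>s. h (?z s)) has_vector_derivative \<phi>' s) (at s within {0..1})" if s: "s \<in> {0..1}" for s
 proof -
  show ?thesis
   unfolding \<phi>'_def by (rule has_vector_derivative_at_within[OF has_vector_derivative_along_segment[OF diff[OF s]]])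
 qed
 then have FTC: "(\<phi>' has_integral (h (?z 1) - h (?z 0))) {0..1}"
  by (intro fundamental_theorem_of_calculus) auto
 have cont: "continuous_on {0..1} \<phi>'"
 proof -
  have "continuous_on {0..1} (\<lambda>s. partial_deriv j h (?z s))" for j
   using h zV by (intro continuous_on_compose2[OF _ cz, of V "partial_deriv j h"]) auto
  then have "continuous_on {0..1} (\<lambda>s. \<Sum>j\<in>UNIV. ((p - q) $ j) *\<^sub>R partial_deriv j h (?z s))"
   by (intro continuous_intros)
  then show ?thesis
   by (rule continuous_on_eq) (simp add: \<phi>'_def frechet_derivative_eq_sum[OF diff])
 qed
 have "norm (h p - h q) = norm (integral {0..1} \<phi>')" using FTC by (simp add: integral_unique)
 also have "\<dots> \<le> integral {0..1} (\<lambda>s. norm (\<phi>' s))"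
  by (intro integral_norm_bound_integral integrable_continuous_real continuous_intros cont) auto
 finally have "(norm (h p - h q))^2 \<le> (integral {0..1} (\<lambda>s. norm (\<phi>' s)))^2"
  by (rule power_mono) simp
 also have "\<dots> \<le> integral {0..1} (\<lambda>s. (norm (\<phi>' s))^2)"
  by (intro square_integral_le continuous_intros cont)
 also have "\<dots> \<le> integral {0..1} (\<lambda>s. (dist p q)^2 * grad_sq h (?z s))"
  using h zV norm_frechet_derivative_le[OF diff, of _ "p - q"]
  by (intro integral_le integrable_continuous_real continuous_intros cont
    continuous_on_compose2[OF continuous_on_grad_sq[OF h] cz])
    (auto simp: \<phi>'_def dist_norm)
 finally show ?thesis by simp
qed

text \<open>A double integral over a convex set of the mean of \<open>E\<close> along segments: for a parameter
 \<open>s \<ge> 1/2\<close> substitute in the endpoint \<open>p\<close>, otherwise in \<open>q\<close>.\<close>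

lemma segment_average_bound:
 fixes E :: "real^2 \<Rightarrow> ennreal"
 assumes S: "S \<in> sets borel" and E[measurable]: "E \<in> borel_measurable borel"
 shows "(\<integral>\<^sup>+ p \<in> S. (\<integral>\<^sup>+ q \<in> S. (\<integral>\<^sup>+ s \<in> {0..1}. E (q + s *\<^sub>R (p - q)) \<partial>lborel) \<partial>lborel) \<partial>lborel)
  \<le> 4 * emeasure lborel S * (\<integral>\<^sup>+ y. E y \<partial>lborel)"
proof -
 note [measurable] = S
 let ?I = "\<integral>\<^sup>+ y. E y \<partial>lborel"
 define f where "f p q s = indicator S p * indicator S q * indicator {0..1} s * E (q + s *\<^sub>R (p - q))"
  for p q :: "real^2" and s :: real
 have [measurable]: "(\<lambda>(p, q, s). f p q s) \<in> borel_measurable (lborel \<Otimes>\<^sub>M lborel \<Otimes>\<^sub>M lborel)"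
  unfolding f_def by measurable
 \<comment> \<open>The substitution costs the Jacobian factor \<open>c^2\<close>, which is at least
   1/4 for \<open>c \<ge> 1/2\<close>. This is the origin of the constant 4.\<close>
 have sub: "(\<integral>\<^sup>+ x. E (t + c *\<^sub>R x) \<partial>lborel) \<le> 4 * ?I" if c: "c \<ge> 1/2" for c t
 proof -
  have "1 \<le> 4 * c^2" using power_mono[OF c, of 2] by (simp add: power2_eq_square)
  then have "(\<integral>\<^sup>+ x. E (t + c *\<^sub>R x) \<partial>lborel) \<le> ennreal (4 * c^2) * (\<integral>\<^sup>+ x. E (t + c *\<^sub>R x) \<partial>lborel)"
   by (metis ennreal_1 ennreal_leI mult_1 mult_right_mono zero_le)
  also have "\<dots> = 4 * (ennreal (c^2) * (\<integral>\<^sup>+ x. E (t + c *\<^sub>R x) \<partial>lborel))"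
   by (simp add: ennreal_mult' mult.assoc)
  also have "\<dots> = 4 * ?I" using nn_integral_lborel_affine[OF E, of c t] c by simp
  finally show ?thesis .
 qed
 have half: "(\<integral>\<^sup>+ q. \<integral>\<^sup>+ p. k p q \<partial>lborel \<partial>lborel) \<le> 4 * emeasure lborel S * ?I"
  if c: "c \<ge> 1/2" and k: "\<And>p q. k p q \<le> indicator S q * E ((1 - c) *\<^sub>R q + c *\<^sub>R p)" for c and k :: "real^2 \<Rightarrow> real^2 \<Rightarrow> ennreal"
 proof -
  have "(\<integral>\<^sup>+ p. k p q \<partial>lborel) \<le> indicator S q * (4 * ?I)" for q
  proof -
   have "(\<integral>\<^sup>+ p. k p q \<partial>lborel) \<le> (\<integral>\<^sup>+ p. indicator S q * E ((1 - c) *\<^sub>R q + c *\<^sub>R p) \<partial>lborel)"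
    by (intro nn_integral_mono k)
   also have "\<dots> = indicator S q * (\<integral>\<^sup>+ p. E ((1 - c) *\<^sub>R q + c *\<^sub>R p) \<partial>lborel)"
    by (rule nn_integral_cmult) measurable
   also have "\<dots> \<le> indicator S q * (4 * ?I)" by (intro mult_left_mono sub c) simp
   finally show ?thesis .
  qed
  then have "(\<integral>\<^sup>+ q. \<integral>\<^sup>+ p. k p q \<partial>lborel \<partial>lborel) \<le> (\<integral>\<^sup>+ q. indicator S q * (4 * ?I) \<partial>lborel)"
   by (intro nn_integral_mono)
  also have "\<dots> = 4 * emeasure lborel S * ?I" by (simp add: nn_integral_multc mult_ac)
  finally show ?thesis .
 qed
 have fixed: "(\<integral>\<^sup>+ p. \<integral>\<^sup>+ q. f p q s \<partial>lborel \<partial>lborel) \<le> indicator {0..1} s * (4 * emeasure lborel S * ?I)" for s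
 proof (cases "s \<in> {0..1}")
  case s: True
  have "(\<integral>\<^sup>+ p. \<integral>\<^sup>+ q. f p q s \<partial>lborel \<partial>lborel) \<le> 4 * emeasure lborel S * ?I"
  proof (cases "s \<ge> 1/2")
   case True
   have "(\<integral>\<^sup>+ p. \<integral>\<^sup>+ q. f p q s \<partial>lborel \<partial>lborel) = (\<integral>\<^sup>+ q. \<integral>\<^sup>+ p. f p q s \<partial>lborel \<partial>lborel)"
    by (rule lborel_pair.Fubini'[symmetric]) (unfold f_def, measurable)
   also have "\<dots> \<le> 4 * emeasure lborel S * ?I"
    by (rule half[OF True]) (auto simp: f_def indicator_def algebra_simps)
   finally show ?thesis .
  next
   case False
   then show ?thesis by (intro half[of "1 - s"]) (auto simp: f_def indicator_def algebra_simps)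
  qed
  then show ?thesis using s by simp
 qed (simp add: f_def)
 have "(\<integral>\<^sup>+ p \<in> S. (\<integral>\<^sup>+ q \<in> S. (\<integral>\<^sup>+ s \<in> {0..1}. E (q + s *\<^sub>R (p - q)) \<partial>lborel) \<partial>lborel) \<partial>lborel)
   = (\<integral>\<^sup>+ p. \<integral>\<^sup>+ q. \<integral>\<^sup>+ s. f p q s \<partial>lborel \<partial>lborel \<partial>lborel)"
 proof (rule nn_integral_cong)
  fix p
  have "(\<integral>\<^sup>+ s. f p q s \<partial>lborel) = indicator S p * ((\<integral>\<^sup>+ s \<in> {0..1}. E (q + s *\<^sub>R (p - q)) \<partial>lborel) * indicator S q)" for q
   unfolding f_def by (subst nn_integral_multc[symmetric], measurable, subst nn_integral_cmult[symmetric], measurable)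
    (auto intro!: nn_integral_cong simp: mult_ac)
  then show "(\<integral>\<^sup>+ q \<in> S. (\<integral>\<^sup>+ s \<in> {0..1}. E (q + s *\<^sub>R (p - q)) \<partial>lborel) \<partial>lborel) * indicator S p
    = (\<integral>\<^sup>+ q. \<integral>\<^sup>+ s. f p q s \<partial>lborel \<partial>lborel)"
   by (simp add: nn_integral_cmult mult.commute)
 qed
 also have "\<dots> = (\<integral>\<^sup>+ p. \<integral>\<^sup>+ s. \<integral>\<^sup>+ q. f p q s \<partial>lborel \<partial>lborel \<partial>lborel)"
  by (intro nn_integral_cong lborel_pair.Fubini') (unfold f_def, measurable)
 also have "\<dots> = (\<integral>\<^sup>+ s. \<integral>\<^sup>+ p. \<integral>\<^sup>+ q. f p q s \<partial>lborel \<partial>lborel \<partial>lborel)"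
  by (intro lborel_pair.Fubini') (unfold f_def, measurable)
 also have "\<dots> \<le> (\<integral>\<^sup>+ s. indicator {0..1::real} s * (4 * emeasure lborel S * ?I) \<partial>lborel)"
  by (rule nn_integral_mono) (rule fixed)
 also have "\<dots> = 4 * emeasure lborel S * ?I"
  by (subst nn_integral_multc) auto
 finally show ?thesis .
qed

text \<open>Both sides are compared with the double integral of the squared differences of
  \<open>h\<close>. For fixed \<open>p\<close> the cross term vanishes because the mean of
  \<open>h\<close> is zero, which bounds the inner integral below by the area of \<open>S\<close>
  times the square of \<open>h p\<close>; from above, the differences are controlled along segments,
  which stay in the convex set.\<close>

lemma poincare_convex:
 fixes h :: "real^2 \<Rightarrow> complex"
 assumes S: "convex S" "S \<in> sets borel" and K: "compact K" "S \<subseteq> K" "K \<subseteq> V" and h: "Ck_on 1 V h"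
  and mean: "(LINT y|lborel. indicator S y *\<^sub>R h y) = 0"
  and d: "\<And>p q. p \<in> S \<Longrightarrow> q \<in> S \<Longrightarrow> dist p q \<le> d"
 shows "(\<integral>\<^sup>+ y \<in> S. ennreal ((norm (h y))^2) \<partial>lborel) \<le> ennreal (4 * d^2) * (\<integral>\<^sup>+ y \<in> S. ennreal (grad_sq h y) \<partial>lborel)"
proof (cases "emeasure lborel S = 0")
 case True
 then have "AE y in lborel. y \<notin> S" using S(2) by (intro AE_not_in) (auto simp: null_sets_def)
 then have "(\<integral>\<^sup>+ y \<in> S. ennreal ((norm (h y))^2) \<partial>lborel) = (\<integral>\<^sup>+ (y::real^2). 0 \<partial>lborel)"
  by (intro nn_integral_cong_AE) (auto simp: indicator_def)
 then show ?thesis by simp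
next
 case False
 have SV: "S \<subseteq> V" using K by blast
 have hK: "continuous_on K h" "continuous_on S h" "continuous_on S (grad_sq h)"
  using Ck_on_imp_continuous[OF h] continuous_on_grad_sq[OF h] K SV continuous_on_subset by blast+
 have fin: "emeasure lborel S < \<infinity>"
  by (rule emeasure_bounded_finite) (use K compact_imp_bounded bounded_subset in blast)
 define m where "m = measure lborel S"
 have m: "emeasure lborel S = ennreal m" "m > 0"
  using fin False unfolding m_def by (auto simp: emeasure_eq_ennreal_measure less_top zero_less_measure_iff)
 note [measurable] = S(2)
 have iK: "integrable lborel (\<lambda>y. indicator S y *\<^sub>R k y)" if "continuous_on K k" for k :: "real^2 \<Rightarrow> 'b::euclidean_space"
 proof -
  have "integrable lborel (\<lambda>y. indicator S y *\<^sub>R (indicator K y *\<^sub>R k y))"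
   by (rule integrable_mult_indicator[OF _ borel_integrable_compact[OF K(1) that]]) (use S(2) in simp)
  moreover have "(\<lambda>y. indicator S y *\<^sub>R (indicator K y *\<^sub>R k y)) = (\<lambda>y. indicator S y *\<^sub>R k y)"
   using K(2) by (intro ext) (auto split: split_indicator)
  ultimately show ?thesis by simp
 qed
 have ih: "integrable lborel (\<lambda>y. indicator S y *\<^sub>R h y)" "integrable lborel (\<lambda>y. indicator S y *\<^sub>R (norm (h y))^2)"
  by (intro iK continuous_intros hK)+
 \<comment> \<open>Cut off outside \<open>S\<close>, so that the integral over the plane in
   \<open>segment_average_bound\<close> is one over \<open>S\<close>; on segments between points of
   \<open>S\<close> the cutoff is invisible by convexity.\<close>
 define E where "E y = indicator S y * ennreal (grad_sq h y)" for y
 have E: "E \<in> borel_measurable borel"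
  unfolding E_def by (rule borel_measurable_indicator_ennreal[OF S(2) hK(3)])
 let ?J = "\<integral>\<^sup>+ p \<in> S. (\<integral>\<^sup>+ q \<in> S. ennreal ((norm (h p - h q))^2) \<partial>lborel) \<partial>lborel"
 have lower: "ennreal (m * (norm (h p))^2) \<le> (\<integral>\<^sup>+ q \<in> S. ennreal ((norm (h p - h q))^2) \<partial>lborel)" if "p \<in> S" for p
 proof -
  have i3: "integrable lborel (\<lambda>q. indicator S q *\<^sub>R (norm (h p - h q))^2)"
   by (intro iK continuous_intros hK)
  have i4: "integrable lborel (\<lambda>q. indicator S q *\<^sub>R (norm (h p))^2)"
   by (intro iK continuous_intros)
  have i5: "integrable lborel (\<lambda>q. h p \<bullet> (indicator S q *\<^sub>R h q))"
   by (rule integrable_inner_right) (use ih(1) in simp)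
  have "(LINT q|lborel. indicator S q *\<^sub>R (norm (h p - h q))^2)
    = (LINT q|lborel. indicator S q *\<^sub>R (norm (h p))^2 - 2 * (h p \<bullet> (indicator S q *\<^sub>R h q)) + indicator S q *\<^sub>R (norm (h q))^2)"
   by (intro Bochner_Integration.integral_cong)
     (auto simp: indicator_def power2_norm_eq_inner inner_diff_left inner_diff_right inner_commute)
  also have "\<dots> = (LINT q|lborel. indicator S q *\<^sub>R (norm (h p))^2) - 2 * (LINT q|lborel. h p \<bullet> (indicator S q *\<^sub>R h q))
    + (LINT q|lborel. indicator S q *\<^sub>R (norm (h q))^2)"
   using i4 i5 ih(2) by simp
  also have "(LINT q|lborel. h p \<bullet> (indicator S q *\<^sub>R h q)) = 0"
   using ih(1) mean by (subst integral_inner_right) auto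
  also have "(LINT q|lborel. indicator S q *\<^sub>R (norm (h p))^2) = m * (norm (h p))^2"
   using fin by (simp add: m_def)
  finally have "m * (norm (h p))^2 \<le> (LINT q|lborel. indicator S q *\<^sub>R (norm (h p - h q))^2)"
   by (simp add: integral_nonneg_AE)
  then have "ennreal (m * (norm (h p))^2) \<le> ennreal (LINT q|lborel. indicator S q *\<^sub>R (norm (h p - h q))^2)"
   by (rule ennreal_leI)
  also have "\<dots> = (\<integral>\<^sup>+ q. ennreal (indicator S q *\<^sub>R (norm (h p - h q))^2) \<partial>lborel)"
   by (rule nn_integral_eq_integral[symmetric]) (use i3 in auto)
  also have "\<dots> = (\<integral>\<^sup>+ q \<in> S. ennreal ((norm (h p - h q))^2) \<partial>lborel)"
   by (rule nn_integral_cong) (auto simp: indicator_def)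
  finally show ?thesis .
 qed
 have meas_h: "(\<lambda>y. indicator S y * ennreal ((norm (h y))^2)) \<in> borel_measurable borel"
  by (intro borel_measurable_indicator_ennreal S(2) continuous_intros hK)
 have "ennreal m * (\<integral>\<^sup>+ y \<in> S. ennreal ((norm (h y))^2) \<partial>lborel) = (\<integral>\<^sup>+ p \<in> S. ennreal (m * (norm (h p))^2) \<partial>lborel)"
  using meas_h m(2)
  by (subst nn_integral_cmult[symmetric])
    (auto simp: mult.commute[of _ "indicator S _"] ennreal_mult intro!: nn_integral_cong simp: mult_ac)
 also have "\<dots> \<le> ?J"
  using lower by (intro nn_integral_mono) (auto simp: indicator_def)
 also have "\<dots> \<le> (\<integral>\<^sup>+ p \<in> S. (\<integral>\<^sup>+ q \<in> S. ennreal (d^2) * (\<integral>\<^sup>+ s \<in> {0..1}. E (q + s *\<^sub>R (p - q)) \<partial>lborel) \<partial>lborel) \<partial>lborel)"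
 proof -
  have pq: "ennreal ((norm (h p - h q))^2) \<le> ennreal (d^2) * (\<integral>\<^sup>+ s \<in> {0..1}. E (q + s *\<^sub>R (p - q)) \<partial>lborel)"
   if "p \<in> S" "q \<in> S" for p q
  proof -
   let ?z = "\<lambda>s. q + s *\<^sub>R (p - q)"
   have segS: "closed_segment q p \<subseteq> S" using S(1) that by (simp add: closed_segment_subset)
   have zS: "?z s \<in> S" if "s \<in> {0..1}" for s
    using convexD_alt[OF S(1) \<open>q \<in> S\<close> \<open>p \<in> S\<close>, of s] that by (simp add: algebra_simps)
   have cont: "continuous_on {0..1} (\<lambda>s. grad_sq h (?z s))"
    by (rule continuous_on_compose2[OF hK(3)]) (use zS in \<open>auto intro!: continuous_intros\<close>)
   have "(norm (h p - h q))^2 \<le> (dist p q)^2 * integral {0..1} (\<lambda>s. grad_sq h (?z s))"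
    by (rule difference_sq_le_segment_integral[OF h]) (use segS SV in blast)
   also have "\<dots> \<le> d^2 * integral {0..1} (\<lambda>s. grad_sq h (?z s))"
    using d[OF that] by (intro mult_right_mono power_mono integral_nonneg)
     (auto intro: integrable_continuous_real cont grad_sq_nonneg)
   finally have "ennreal ((norm (h p - h q))^2) \<le> ennreal (d^2) * ennreal (integral {0..1} (\<lambda>s. grad_sq h (?z s)))"
    by (metis ennreal_leI ennreal_mult' zero_le_power2)
   also have "ennreal (integral {0..1} (\<lambda>s. grad_sq h (?z s))) = (\<integral>\<^sup>+ s \<in> {0..1}. ennreal (grad_sq h (?z s)) \<partial>lborel)"
    using absolutely_integrable_continuous_real[OF cont] cont
    by (subst nn_integral_eq_integral_on)
      (auto simp: grad_sq_nonneg intro!: borel_measurable_continuous_on_indicator simp del: real_scaleR_def)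
   also have "\<dots> = (\<integral>\<^sup>+ s \<in> {0..1}. E (?z s) \<partial>lborel)"
    using zS by (intro nn_integral_cong) (auto simp: E_def indicator_def)
   finally show ?thesis .
  qed
  show ?thesis
   using pq by (intro nn_integral_mono) (auto simp: indicator_def intro!: nn_integral_mono)
 qed
 also have "\<dots> = ennreal (d^2) * (\<integral>\<^sup>+ p \<in> S. (\<integral>\<^sup>+ q \<in> S. (\<integral>\<^sup>+ s \<in> {0..1}. E (q + s *\<^sub>R (p - q)) \<partial>lborel) \<partial>lborel) \<partial>lborel)"
 proof -
  note [measurable] = E
  let ?F = "\<lambda>p q. \<integral>\<^sup>+ s \<in> {0..1}. E (q + s *\<^sub>R (p - q)) \<partial>lborel"
  have [measurable]: "(\<lambda>(p, q). ?F p q) \<in> borel_measurable (borel \<Otimes>\<^sub>M borel)" by measurable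
  have "(\<integral>\<^sup>+ q \<in> S. ennreal (d^2) * ?F p q \<partial>lborel) * indicator S p
    = ennreal (d^2) * ((\<integral>\<^sup>+ q \<in> S. ?F p q \<partial>lborel) * indicator S p)" for p
   unfolding mult.assoc by (subst nn_integral_cmult) (measurable, simp add: mult.assoc)
  then show ?thesis by (simp only:) (rule nn_integral_cmult, measurable)
 qed
 also have "\<dots> \<le> ennreal (d^2) * (4 * emeasure lborel S * (\<integral>\<^sup>+ y. E y \<partial>lborel))"
  by (intro mult_left_mono segment_average_bound S(2) E) simp
 also have "\<dots> = ennreal m * (ennreal (4 * d^2) * (\<integral>\<^sup>+ y. E y \<partial>lborel))"
  by (simp add: m(1) ennreal_mult mult_ac)
 finally have "(\<integral>\<^sup>+ y \<in> S. ennreal ((norm (h y))^2) \<partial>lborel) \<le> ennreal (4 * d^2) * (\<integral>\<^sup>+ y. E y \<partial>lborel)"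
  using m(2) by (simp add: ennreal_mult_le_mult_iff)
 then show ?thesis by (simp add: E_def mult.commute)
qed

text \<open>The cells are the fibres of the index map, hence disjoint and covering. Inside the ball
  each is convex, an intersection with half-planes, and of diameter at most \<open>2 / N\<close>, so
  \<open>poincare_convex\<close> gives the constant 4 * (2/N)^2.\<close>

lemma poincare_cells:
 fixes h :: "real^2 \<Rightarrow> complex"
 assumes h: "Ck_on 1 V h" and V: "cball p r \<subseteq> V" and N: "N \<ge> (1::nat)"
 defines "\<iota> \<equiv> \<lambda>y::real^2. (\<lfloor>real N * y $ 1\<rfloor>, \<lfloor>real N * y $ 2\<rfloor>)"
 assumes Z: "finite Z" "\<iota> ` cball p r \<subseteq> Z"
  and mean: "\<And>z. z \<in> Z \<Longrightarrow> (LINT y|lborel. indicator (cball p r \<inter> \<iota> -` {z}) y *\<^sub>R h y) = 0"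
 shows "(\<integral>\<^sup>+ y \<in> cball p r. ennreal ((norm (h y))^2) \<partial>lborel)
  \<le> ennreal (16 / (real N)^2) * (\<integral>\<^sup>+ y \<in> cball p r. ennreal (grad_sq h y) \<partial>lborel)"
proof -
 let ?S = "\<lambda>z. cball p r \<inter> \<iota> -` {z}"
 have S_eq: "?S z = cball p r \<inter> {y. real_of_int (fst z) \<le> real N * y $ 1} \<inter> {y. real N * y $ 1 < real_of_int (fst z) + 1}
   \<inter> {y. real_of_int (snd z) \<le> real N * y $ 2} \<inter> {y. real N * y $ 2 < real_of_int (snd z) + 1}" for z
  by (auto simp: \<iota>_def floor_eq_iff prod_eq_iff)
 have half: "{y::real^2. a \<le> real N * y $ i} = {y. (real N *\<^sub>R axis i 1) \<bullet> y \<ge> a}"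
  "{y::real^2. real N * y $ i < a} = {y. (real N *\<^sub>R axis i 1) \<bullet> y < a}" for a i
  by (auto simp: inner_axis inner_commute[of "axis i 1"])
 have convex: "convex (?S z)" for z
  unfolding S_eq half
  by (intro convex_Int convex_cball convex_halfspace_lt convex_halfspace_ge)
 have borel: "?S z \<in> sets borel" for z
  unfolding S_eq half
  by (intro sets.Int borel_closed borel_open closed_cball closed_halfspace_ge open_halfspace_lt)
 have diam: "dist x y \<le> 2 / N" if "x \<in> ?S z" "y \<in> ?S z" for x y z
 proof -
  have "\<bar>real N * x $ i - real N * y $ i\<bar> \<le> 1" for i
   using that exhaust_2[of i] unfolding S_eq by auto
  then have "real N * \<bar>x $ i - y $ i\<bar> \<le> 1" for i
   by (metis abs_mult abs_of_nat right_diff_distrib)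
  then have le: "\<bar>(x - y) $ i\<bar> \<le> 1 / N" for i using N by (simp add: field_simps)
  have "dist x y \<le> (\<Sum>i\<in>UNIV. \<bar>(x - y) $ i\<bar>)" unfolding dist_norm by (rule norm_le_l1_cart)
  also have "\<dots> \<le> 2 / N" using le[of 1] le[of 2] by (simp add: sum_2)
  finally show ?thesis .
 qed
 have split: "(\<integral>\<^sup>+ y \<in> cball p r. k y \<partial>lborel) = (\<Sum>z\<in>Z. \<integral>\<^sup>+ y \<in> ?S z. k y \<partial>lborel)"
  if k: "(\<lambda>y. k y * indicator (cball p r) y) \<in> borel_measurable borel" for k :: "real^2 \<Rightarrow> ennreal"
 proof -
  have "(\<Sum>z\<in>Z. k y * indicator (?S z) y) = k y * indicator (cball p r) y" for y
  proof (cases "y \<in> cball p r")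
   case True
   then have "\<iota> y \<in> Z" using Z(2) by auto
   have "(\<Sum>z\<in>Z. k y * indicator (?S z) y) = (\<Sum>z\<in>Z. if z = \<iota> y then k y else 0)"
    using True by (intro sum.cong) (auto simp: indicator_def)
   then show ?thesis using Z(1) \<open>\<iota> y \<in> Z\<close> True by simp
  qed (simp add: indicator_def)
  then have "(\<integral>\<^sup>+ y \<in> cball p r. k y \<partial>lborel) = (\<integral>\<^sup>+ y. (\<Sum>z\<in>Z. k y * indicator (?S z) y) \<partial>lborel)" by simp
  also have "\<dots> = (\<Sum>z\<in>Z. \<integral>\<^sup>+ y \<in> ?S z. k y \<partial>lborel)"
  proof (rule nn_integral_sum)
   fix z
   have "(\<lambda>y. k y * indicator (cball p r) y * indicator (?S z) y) \<in> borel_measurable borel"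
    using k borel[of z] by measurable
   moreover have "(\<lambda>y. k y * indicator (cball p r) y * indicator (?S z) y) = (\<lambda>y. k y * indicator (?S z) y)"
    by (auto simp: indicator_def)
   ultimately show "(\<lambda>y. k y * indicator (?S z) y) \<in> borel_measurable lborel" by simp
  qed
  finally show ?thesis .
 qed
 have meas: "(\<lambda>y. ennreal (k y) * indicator (cball p r) y) \<in> borel_measurable borel"
  if k: "continuous_on (cball p r) k" for k
  using borel_measurable_indicator_ennreal[OF _ k] by (simp add: mult.commute)
 have c: "continuous_on (cball p r) (\<lambda>y. (norm (h y))^2)" "continuous_on (cball p r) (grad_sq h)"
  using continuous_on_subset[OF Ck_on_imp_continuous[OF h] V] continuous_on_subset[OF continuous_on_grad_sq[OF h] V]
  by (auto intro: continuous_intros)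
 have "(\<integral>\<^sup>+ y \<in> cball p r. ennreal ((norm (h y))^2) \<partial>lborel) = (\<Sum>z\<in>Z. \<integral>\<^sup>+ y \<in> ?S z. ennreal ((norm (h y))^2) \<partial>lborel)"
  by (rule split[OF meas[OF c(1)]])
 also have "\<dots> \<le> (\<Sum>z\<in>Z. ennreal (4 * (2 / real N)^2) * (\<integral>\<^sup>+ y \<in> ?S z. ennreal (grad_sq h y) \<partial>lborel))"
  by (intro sum_mono poincare_convex[OF convex borel compact_cball _ V h mean diam]) auto
 also have "\<dots> = ennreal (16 / (real N)^2) * (\<integral>\<^sup>+ y \<in> cball p r. ennreal (grad_sq h y) \<partial>lborel)"
  unfolding split[OF meas[OF c(2)]] sum_distrib_left by (simp add: power_divide)
 finally show ?thesis .
qed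

lemma grid_index_bound:
 fixes y :: "real^2"
 assumes "N \<ge> (1::nat)" "norm y \<le> real B"
 shows "(\<lfloor>real N * y $ 1\<rfloor>, \<lfloor>real N * y $ 2\<rfloor>) \<in> {- int (N * B)..int (N * B)} \<times> {- int (N * B)..int (N * B)}"
proof -
 have "\<bar>y $ i\<bar> \<le> real B" for i using component_le_norm_cart[of y i] assms(2) by linarith
 then have "\<bar>real N * y $ i\<bar> \<le> real N * real B" for i
  by (simp add: abs_mult mult_left_mono)
 then have *: "- real (N * B) \<le> real N * y $ i" "real N * y $ i \<le> real (N * B)" for i
  by (simp_all add: abs_le_iff minus_le_iff)
 have "- int (N * B) \<le> \<lfloor>real N * y $ i\<rfloor>" for i
  using *(1)[of i] by (simp add: le_floor_iff)
 moreover have "\<lfloor>real N * y $ i\<rfloor> \<le> int (N * B)" for i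
  using floor_mono[OF *(2)[of i]] by (simp only: floor_of_nat)
 ultimately show ?thesis by simp
qed

context surface
begin

section \<open>Counting functions of small Rayleigh quotient\<close>

lemma nn_integral_area_continuous:
 assumes "continuous_on UNIV h" "\<And>x. h x \<ge> 0"
 shows "(\<integral>\<^sup>+ x. ennreal (h x) \<partial>area) = ennreal (LINT x|area. h x)"
 by (rule nn_integral_eq_integral) (use assms integrable_area_continuous in auto)

text \<open>The constant is independent of the mesh and of the function. A bound of
  \<open>vol c\<close> compares area with Lebesgue measure, and a bound of the trace of
  \<open>coeff c\<close> compares the coordinate gradient with the Dirichlet density; both come from
  compactness of the ball.\<close>

lemma poincare_chart_ball:
 assumes c: "c \<in> A" and I: "cball p r \<subseteq> chart_image c"
 shows "\<exists>b\<ge>0. \<forall>N\<ge>1::nat. \<forall>v Z. Ck_function 1 v \<and> finite Z \<and>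
   (\<lambda>y. (\<lfloor>real N * y $ 1\<rfloor>, \<lfloor>real N * y $ 2\<rfloor>)) ` cball p r \<subseteq> Z \<and>
   (\<forall>z\<in>Z. (LINT y|lborel. indicator (cball p r \<inter> (\<lambda>y. (\<lfloor>real N * y $ 1\<rfloor>, \<lfloor>real N * y $ 2\<rfloor>)) -` {z}) y
    *\<^sub>R in_chart c v y) = 0) \<longrightarrow>
   (\<integral>\<^sup>+ x \<in> chart_inv c ` cball p r. ennreal ((cmod (v x))^2) \<partial>area)
    \<le> ennreal (b / (real N)^2) * (\<integral>\<^sup>+ x. ennreal (carre_du_champ v v x) \<partial>area)"
proof -
 let ?K = "cball p r" and ?W = "chart_inv c ` cball p r"
 obtain b1 where b1: "b1 > 0" "\<And>y. y \<in> ?K \<Longrightarrow> vol c y \<le> b1"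
  using compact_bounded_values[OF compact_cball continuous_on_subset[OF continuous_vol[OF c] I]]
  by (meson abs_le_D1)
 have "continuous_on ?K (\<lambda>y. coeff c 1 1 y + coeff c 2 2 y)"
  by (intro continuous_intros continuous_on_subset[OF Ck_on_imp_continuous[OF Ck_on_coeff[OF c]] I])
 then obtain b2 where b2: "b2 > 0" "\<And>y. y \<in> ?K \<Longrightarrow> coeff c 1 1 y + coeff c 2 2 y \<le> b2"
  using compact_bounded_values[OF compact_cball, of p r] by (meson abs_le_D1)
 note chart = nn_integral_area_chart_inv_image[OF c compact_cball I borel_measurable_continuous_onI]
 show ?thesis
 proof (intro exI[of _ "b1 * 16 * b2"] conjI allI impI)
  show "0 \<le> b1 * 16 * b2" using b1 b2 by simp
 next
  fix N :: nat and v :: "'a \<Rightarrow> complex" and Z :: "(int \<times> int) set"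
  let ?\<iota> = "\<lambda>y::real^2. (\<lfloor>real N * y $ 1\<rfloor>, \<lfloor>real N * y $ 2\<rfloor>)"
  let ?E = "\<integral>\<^sup>+ x. ennreal (carre_du_champ v v x) \<partial>area"
  assume N: "1 \<le> N" and "Ck_function 1 v \<and> finite Z \<and> ?\<iota> ` ?K \<subseteq> Z \<and>
   (\<forall>z\<in>Z. (LINT y|lborel. indicator (?K \<inter> ?\<iota> -` {z}) y *\<^sub>R in_chart c v y) = 0)"
  then have v: "Ck_function 1 v" and Z: "finite Z" "?\<iota> ` ?K \<subseteq> Z"
   "\<And>z. z \<in> Z \<Longrightarrow> (LINT y|lborel. indicator (?K \<inter> ?\<iota> -` {z}) y *\<^sub>R in_chart c v y) = 0" by auto
  have vc: "Ck_on 1 (chart_image c) (in_chart c v)" using v c by (simp add: Ck_function_def)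
  have cv: "continuous_on UNIV v" by (rule Ck_function_continuous[OF v])
  have "(\<integral>\<^sup>+ x \<in> ?W. ennreal ((cmod (v x))^2) \<partial>area)
    = (\<integral>\<^sup>+ y \<in> ?K. ennreal (vol c y * (cmod (in_chart c v y))^2) \<partial>lborel)"
   using cv by (subst chart) (auto intro!: continuous_intros simp: in_chart_def)
  also have "\<dots> \<le> (\<integral>\<^sup>+ y. ennreal b1 * (ennreal ((cmod (in_chart c v y))^2) * indicator ?K y) \<partial>lborel)"
   using b1 by (intro nn_integral_mono) (auto simp: indicator_def ennreal_mult[symmetric] intro!: ennreal_leI mult_right_mono)
  also have "\<dots> = ennreal b1 * (\<integral>\<^sup>+ y \<in> ?K. ennreal ((cmod (in_chart c v y))^2) \<partial>lborel)"
   unfolding mult.commute[of _ "indicator _ _"] measurable_lborel2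
   by (intro nn_integral_cmult, unfold measurable_lborel2, intro borel_measurable_indicator_ennreal continuous_intros
    continuous_on_subset[OF Ck_on_imp_continuous[OF vc] I]) simp
  also have "\<dots> \<le> ennreal b1 * (ennreal (16 / (real N)^2) * (\<integral>\<^sup>+ y \<in> ?K. ennreal (grad_sq (in_chart c v) y) \<partial>lborel))"
   by (intro mult_left_mono poincare_cells[OF vc I N Z]) auto
  also have "\<dots> \<le> ennreal b1 * (ennreal (16 / (real N)^2) * (ennreal b2 * ?E))"
  proof (intro mult_left_mono)
   have "(\<integral>\<^sup>+ y \<in> ?K. ennreal (grad_sq (in_chart c v) y) \<partial>lborel)
     \<le> (\<integral>\<^sup>+ y \<in> ?K. ennreal (vol c y * (b2 * carre_du_champ v v (chart_inv c y))) \<partial>lborel)"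
   proof (intro nn_integral_mono)
    fix y
    show "ennreal (grad_sq (in_chart c v) y) * indicator ?K y
      \<le> ennreal (vol c y * (b2 * carre_du_champ v v (chart_inv c y))) * indicator ?K y"
    proof (cases "y \<in> ?K")
     case True
     then have y: "y \<in> chart_image c" using I by auto
     have "vol c y * carre_du_champ v v (chart_inv c y) = dirichlet c (in_chart c v) (in_chart c v) y"
      using carre_du_champ_chart[OF c chart_inv_in[OF c y] v v] vol_pos[OF c y] by (simp add: chart_map_inv[OF c y])
     moreover have "grad_sq (in_chart c v) y \<le> b2 * dirichlet c (in_chart c v) (in_chart c v) y"
      using coeff_lower_bound[OF c y, of "\<lambda>i. partial_deriv i (in_chart c v) y"] dirichlet_nonneg[OF c y, of "in_chart c v"] b2(2)[OF True]
      unfolding grad_sq_def dirichlet_def by (meson mult_right_mono order_trans)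
     ultimately show ?thesis using True by (auto intro!: ennreal_leI simp: mult.left_commute)
    qed simp
   qed
   also have "\<dots> = (\<integral>\<^sup>+ x \<in> ?W. ennreal (b2 * carre_du_champ v v x) \<partial>area)"
    using b2(1) by (subst chart) (auto intro!: continuous_intros continuous_carre_du_champ v simp: carre_du_champ_nonneg)
   also have "\<dots> \<le> (\<integral>\<^sup>+ x. ennreal b2 * ennreal (carre_du_champ v v x) \<partial>area)"
    using b2(1) by (intro nn_integral_mono) (auto simp: indicator_def ennreal_mult carre_du_champ_nonneg)
   also have "\<dots> = ennreal b2 * ?E"
    using borel_measurable_continuous_onI[OF continuous_carre_du_champ[OF v v]]
    by (intro nn_integral_cmult) (simp add: measurable_cong_sets[OF sets_area refl])
   finally show "(\<integral>\<^sup>+ y \<in> ?K. ennreal (grad_sq (in_chart c v) y) \<partial>lborel)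
     \<le> ennreal b2 * ?E" .
  qed auto
  also have "\<dots> = ennreal (b1 * 16 * b2 / (real N)^2) * ?E"
  proof -
   have "b1 * 16 * b2 / (real N)^2 = b1 * (16 / (real N)^2 * b2)" by simp
   then show ?thesis using b1 b2 by (simp only: ennreal_mult mult.assoc less_imp_le zero_le_divide_iff
      mult_nonneg_nonneg zero_le_numeral zero_le_power2 simp_thms)
  qed
  finally show "(\<integral>\<^sup>+ x \<in> ?W. ennreal ((cmod (v x))^2) \<partial>area)
    \<le> ennreal (b1 * 16 * b2 / (real N)^2) * ?E" .
 qed
qed

lemma finite_ball_cover:
 "\<exists>(F :: 'a set) C r. finite F \<and> (\<forall>x\<in>F. C x \<in> A \<and> cball (chart_map (C x) x) (r x) \<subseteq> chart_image (C x)) \<and>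
   UNIV \<subseteq> (\<Union>x\<in>F. chart_inv (C x) ` ball (chart_map (C x) x) (r x))"
proof -
 have "\<forall>x. \<exists>c r. c \<in> A \<and> x \<in> chart_dom c \<and> r > 0 \<and> cball (chart_map c x) r \<subseteq> chart_image c"
  using ex_chart_cball by blast
 then obtain C r where C: "\<And>x. C x \<in> A" "\<And>x. x \<in> chart_dom (C x)" "\<And>x. r x > 0"
  "\<And>x. cball (chart_map (C x) x) (r x) \<subseteq> chart_image (C x)" by metis
 let ?U = "\<lambda>x. chart_inv (C x) ` ball (chart_map (C x) x) (r x)"
 have op: "open (?U x)" for x
  using open_chart_inv_image[OF C(1) open_ball order_trans[OF ball_subset_cball C(4)]] .
 have "x \<in> ?U x" for x
  using chart_inv_map[OF C(1) C(2)] C(3) by (metis centre_in_ball imageI)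
 then obtain F where F: "finite F" "UNIV \<subseteq> (\<Union>x\<in>F. ?U x)"
  by (rule finite_open_cover[OF op])
 then show ?thesis
  by (intro exI[of _ F] exI[of _ C] exI[of _ r]) (use C(1,4) in auto)
qed

abbreviation lin_comb :: "nat \<Rightarrow> (nat \<Rightarrow> real) \<Rightarrow> (nat \<Rightarrow> 'x \<Rightarrow> complex) \<Rightarrow> 'x \<Rightarrow> complex" where
 "lin_comb k c v x \<equiv> \<Sum>i<k. c i *\<^sub>R v i x"

text \<open>More than \<open>D N\<^sup>2\<close> functions have a nontrivial combination with mean zero on all cells
 of a grid of width \<open>1/N\<close>.\<close>

lemma small_rayleigh_dimension_bound:
 "\<exists>C>0. \<exists>D>0. \<forall>N\<ge>1::nat. \<forall>k. \<forall>v::nat \<Rightarrow> 'a \<Rightarrow> complex.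
   (\<forall>i<k. smooth_function A (v i)) \<and> real k > D * (real N)^2 \<longrightarrow>
   (\<exists>c::nat \<Rightarrow> real. (\<exists>i<k. c i \<noteq> 0) \<and>
    (LINT x|area. (cmod (\<Sum>i<k. c i *\<^sub>R v i x))^2)
     \<le> C / (real N)^2 * (LINT x|area. carre_du_champ (lin_comb k c v) (lin_comb k c v) x))"
proof -
 obtain F :: "'a set" and C r where "finite F \<and> (\<forall>x\<in>F. C x \<in> A \<and> cball (chart_map (C x) x) (r x) \<subseteq> chart_image (C x)) \<and>
   UNIV \<subseteq> (\<Union>x\<in>F. chart_inv (C x) ` ball (chart_map (C x) x) (r x))"
  using finite_ball_cover by (elim exE)
 then have F: "finite F" "\<And>x. x \<in> F \<Longrightarrow> C x \<in> A"
  "\<And>x. x \<in> F \<Longrightarrow> cball (chart_map (C x) x) (r x) \<subseteq> chart_image (C x)"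
  "UNIV \<subseteq> (\<Union>x\<in>F. chart_inv (C x) ` ball (chart_map (C x) x) (r x))" by auto
 let ?K = "\<lambda>x. cball (chart_map (C x) x) (r x)" and ?W = "\<lambda>x. chart_inv (C x) ` cball (chart_map (C x) x) (r x)"
 let ?\<iota> = "\<lambda>N::nat. \<lambda>y::real^2. (\<lfloor>real N * y $ 1\<rfloor>, \<lfloor>real N * y $ 2\<rfloor>)"
 define P where "P x b \<longleftrightarrow> (\<forall>N\<ge>1::nat. \<forall>v Z. Ck_function 1 v \<and> finite Z \<and> ?\<iota> N ` ?K x \<subseteq> Z \<and>
   (\<forall>z\<in>Z. (LINT y|lborel. indicator (?K x \<inter> ?\<iota> N -` {z}) y *\<^sub>R in_chart (C x) v y) = 0) \<longrightarrow>
   (\<integral>\<^sup>+ z \<in> ?W x. ennreal ((cmod (v z))^2) \<partial>area)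
    \<le> ennreal (b / (real N)^2) * (\<integral>\<^sup>+ z. ennreal (carre_du_champ v v z) \<partial>area))" for x b
 have "\<exists>b\<ge>0. P x b" if "x \<in> F" for x
  unfolding P_def by (rule poincare_chart_ball[OF F(2,3)[OF that]])
 then obtain b where b: "\<And>x. x \<in> F \<Longrightarrow> b x \<ge> 0" and bP: "\<And>x. x \<in> F \<Longrightarrow> P x (b x)" by metis
 have poinc: "(\<integral>\<^sup>+ z \<in> ?W x. ennreal ((cmod (v z))^2) \<partial>area)
    \<le> ennreal (b x / (real N)^2) * (\<integral>\<^sup>+ z. ennreal (carre_du_champ v v z) \<partial>area)"
  if "x \<in> F" "N \<ge> (1::nat)" "Ck_function 1 v" "finite Z" "?\<iota> N ` ?K x \<subseteq> Z"
   "\<forall>z\<in>Z. (LINT y|lborel. indicator (?K x \<inter> ?\<iota> N -` {z}) y *\<^sub>R in_chart (C x) v y) = 0" for x N v Z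
  using bP[OF that(1)] that(2-6) unfolding P_def by blast
 have "bounded (\<Union>x\<in>F. ?K x)" using F(1) by (intro bounded_UN) auto
 then obtain B0 where B0: "\<And>y. y \<in> (\<Union>x\<in>F. ?K x) \<Longrightarrow> norm y \<le> B0" unfolding bounded_iff by blast
 define B where "B = nat \<lceil>B0\<rceil> + 1"
 have B: "norm y \<le> real B" if "x \<in> F" "y \<in> ?K x" for x y
 proof -
  have "norm y \<le> B0" using B0[of y] that by blast
  then show ?thesis using real_nat_ceiling_ge[of B0] by (simp add: B_def)
 qed
 \<comment> \<open>This bounds the number of real equations divided by \<open>N^2\<close>: the mean
   over each cell of each ball gives one for the real and one for the imaginary part, and each
   coordinate has 2 N B + 1 indices, at most 3 N B. The added 1 keeps \<open>D\<close>
   positive.\<close>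
 define D where "D = 2 * (real (card F) + 1) * (3 * real B)^2"
 define C' where "C' = (\<Sum>x\<in>F. b x) + 1"
 have D: "D > 0" by (simp add: D_def B_def)
 have C': "C' > 0" using b by (simp add: C'_def sum_nonneg add_nonneg_pos)
 show ?thesis
 proof (rule exI[of _ C'], rule conjI[OF C'], rule exI[of _ D], rule conjI[OF D], intro allI impI)
  fix N k :: nat and v :: "nat \<Rightarrow> 'a \<Rightarrow> complex"
  assume N: "1 \<le> N" and "(\<forall>i<k. smooth_function A (v i)) \<and> D * (real N)^2 < real k"
  then have v: "\<And>i. i < k \<Longrightarrow> smooth_function A (v i)" and k: "D * (real N)^2 < real k" by auto
  define Z where "Z = {- int (N * B)..int (N * B)} \<times> {- int (N * B)..int (N * B)}"
  have Z: "?\<iota> N ` ?K x \<subseteq> Z" if "x \<in> F" for x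
   unfolding Z_def using grid_index_bound[OF N B[OF that]] by (intro image_subsetI) blast
  have finZ: "finite Z" by (simp add: Z_def)
  have cardZ: "real (card Z) \<le> (3 * real B)^2 * (real N)^2"
  proof -
   have "card Z = (2 * (N * B) + 1)^2"
    by (simp add: Z_def card_cartesian_product power2_eq_square nat_add_distrib nat_mult_distrib)
   moreover have "1 \<le> N * B" using N by (simp add: B_def)
   then have "2 * (N * B) + 1 \<le> 3 * (N * B)" by linarith
   then have "(2 * (N * B) + 1)^2 \<le> (3 * (N * B))^2" by (rule power_mono) simp
   ultimately have "card Z \<le> (3 * (N * B))^2" by simp
   then have "real (card Z) \<le> real ((3 * (N * B))^2)" by (rule of_nat_mono)
   then show ?thesis by (simp add: power_mult_distrib mult_ac)
  qed
  define E where "E = F \<times> Z \<times> (UNIV :: bool set)"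
  define m where "m x z j = (LINT y|lborel. indicator (?K x \<inter> ?\<iota> N -` {z}) y *\<^sub>R in_chart (C x) (v j) y)" for x z j
  define M where "M e j = (case e of (x, z, s) \<Rightarrow> if s then Re (m x z j) else Im (m x z j))" for e :: "'a \<times> (int \<times> int) \<times> bool" and j
  have finE: "finite E" using F(1) finZ by (simp add: E_def)
  have "real (card E) \<le> 2 * real (card F) * ((3 * real B)^2 * (real N)^2)"
   using mult_left_mono[OF cardZ, of "2 * real (card F)"] by (simp add: E_def card_cartesian_product mult_ac)
  also have "\<dots> \<le> D * (real N)^2"
   unfolding D_def by (simp add: mult_ac distrib_left mult_left_mono)
  also have "\<dots> < real k" by (rule k)
  finally have "card E < card {..<k}" by simp
  then obtain c where c: "\<exists>j\<in>{..<k}. c j \<noteq> 0" "\<forall>e\<in>E. (\<Sum>j<k. c j * M e j) = 0"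
   using linear_system_nontrivial[OF finE, of "{..<k}" M] by auto
  define V where "V x = (\<Sum>i<k. c i *\<^sub>R v i x)" for x
  have vc: "Ck_function 1 (v i)" if "i < k" for i using v[OF that] by (simp add: smooth_function_iff_Ck)
  have V: "Ck_function 1 V"
   unfolding V_def[abs_def] using vc by (intro Ck_function_sum Ck_function_scaleR Ck_function_const) auto
  have mean: "(LINT y|lborel. indicator (?K x \<inter> ?\<iota> N -` {z}) y *\<^sub>R in_chart (C x) V y) = 0" if x: "x \<in> F" "z \<in> Z" for x z
  proof -
   let ?S = "?K x \<inter> ?\<iota> N -` {z}"
   have S: "?S \<in> sets borel"
   proof -
    have "(\<lambda>y::real^2. y $ i) \<in> borel_measurable borel" for i by (intro borel_measurable_continuous_onI continuous_intros)
    then have "(\<lambda>y::real^2. \<lfloor>real N * y $ i\<rfloor>) \<in> borel \<rightarrow>\<^sub>M count_space UNIV" for i by measurable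
    then have "(\<lambda>y::real^2. \<lfloor>real N * y $ i\<rfloor>) -` {a} \<inter> space borel \<in> sets borel" for i a
     by (rule measurable_sets) simp
    then have "cball (chart_map (C x) x) (r x) \<inter> ((\<lambda>y::real^2. \<lfloor>real N * y $ 1\<rfloor>) -` {fst z} \<inter> space borel)
      \<inter> ((\<lambda>y::real^2. \<lfloor>real N * y $ 2\<rfloor>) -` {snd z} \<inter> space borel) \<in> sets borel"
     by (intro sets.Int) auto
    moreover have "?S = cball (chart_map (C x) x) (r x) \<inter> ((\<lambda>y::real^2. \<lfloor>real N * y $ 1\<rfloor>) -` {fst z} \<inter> space borel)
      \<inter> ((\<lambda>y::real^2. \<lfloor>real N * y $ 2\<rfloor>) -` {snd z} \<inter> space borel)" by auto
    ultimately show ?thesis by simp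
   qed
   have int: "integrable lborel (\<lambda>y. indicator ?S y *\<^sub>R in_chart (C x) (v i) y)" if "i < k" for i
   proof -
    have "continuous_on (?K x) (in_chart (C x) (v i))"
     using vc[OF that] F(2,3)[OF x(1)] by (intro continuous_on_subset[OF Ck_on_imp_continuous[of 1]]) (auto simp: Ck_function_def)
    then have "integrable lborel (\<lambda>y. indicator ?S y *\<^sub>R (indicator (?K x) y *\<^sub>R in_chart (C x) (v i) y))"
     by (intro integrable_mult_indicator borel_integrable_compact) (use S in auto)
    moreover have "(\<lambda>y. indicator ?S y *\<^sub>R (indicator (?K x) y *\<^sub>R in_chart (C x) (v i) y)) = (\<lambda>y. indicator ?S y *\<^sub>R in_chart (C x) (v i) y)"
     by (intro ext) (auto split: split_indicator)
    ultimately show ?thesis by simp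
   qed
   have "(LINT y|lborel. indicator ?S y *\<^sub>R in_chart (C x) V y) = (LINT y|lborel. (\<Sum>i<k. c i *\<^sub>R (indicator ?S y *\<^sub>R in_chart (C x) (v i) y)))"
    by (intro Bochner_Integration.integral_cong) (auto simp: in_chart_def V_def scaleR_sum_right mult.commute)
   also have "\<dots> = (\<Sum>i<k. c i *\<^sub>R m x z i)"
    using int by (subst Bochner_Integration.integral_sum) (auto simp: m_def simp del: scaleR_scaleR)
   finally have eq: "(LINT y|lborel. indicator ?S y *\<^sub>R in_chart (C x) V y) = (\<Sum>i<k. c i *\<^sub>R m x z i)" .
   have "(\<Sum>j<k. c j * M (x, z, True) j) = 0" "(\<Sum>j<k. c j * M (x, z, False) j) = 0"
    using c(2) x by (auto simp: E_def)
   then have "Re (\<Sum>i<k. c i *\<^sub>R m x z i) = 0" "Im (\<Sum>i<k. c i *\<^sub>R m x z i) = 0"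
    by (simp_all add: M_def)
   then show ?thesis unfolding eq by (simp add: complex_eq_iff)
  qed
  have contV: "continuous_on UNIV V" by (rule Ck_function_continuous[OF V])
  let ?G = "LINT x|area. carre_du_champ V V x"
  have G: "(\<integral>\<^sup>+ z. ennreal (carre_du_champ V V z) \<partial>area) = ennreal ?G"
   by (rule nn_integral_area_continuous[OF continuous_carre_du_champ[OF V V] carre_du_champ_nonneg])
  have G0: "?G \<ge> 0" by (simp add: integral_nonneg_AE carre_du_champ_nonneg)
  have "ennreal (LINT x|area. (cmod (V x))^2) = (\<integral>\<^sup>+ x. ennreal ((cmod (V x))^2) \<partial>area)"
   by (rule nn_integral_area_continuous[symmetric]) (auto intro!: continuous_intros contV)
  also have "\<dots> \<le> (\<integral>\<^sup>+ x. (\<Sum>i\<in>F. ennreal ((cmod (V x))^2) * indicator (?W i) x) \<partial>area)"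
  proof (rule nn_integral_mono)
   fix x
   obtain i where i: "i \<in> F" "x \<in> ?W i" using F(4) ball_subset_cball by blast
   then have "ennreal ((cmod (V x))^2) = ennreal ((cmod (V x))^2) * indicator (?W i) x" by simp
   also have "\<dots> \<le> (\<Sum>i\<in>F. ennreal ((cmod (V x))^2) * indicator (?W i) x)"
    using i F(1) by (intro member_le_sum) auto
   finally show "ennreal ((cmod (V x))^2) \<le> (\<Sum>i\<in>F. ennreal ((cmod (V x))^2) * indicator (?W i) x)" .
  qed
  also have "\<dots> = (\<Sum>i\<in>F. \<integral>\<^sup>+ x \<in> ?W i. ennreal ((cmod (V x))^2) \<partial>area)"
  proof (rule nn_integral_sum)
   fix i assume "i \<in> F"
   then have "?W i \<in> sets borel"
    using closed_chart_inv_image[OF F(2) compact_cball F(3)] by simp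
   moreover have "(\<lambda>x. ennreal ((cmod (V x))^2)) \<in> borel_measurable borel"
    using borel_measurable_continuous_onI[OF contV] by measurable
   ultimately show "(\<lambda>x. ennreal ((cmod (V x))^2) * indicator (?W i) x) \<in> borel_measurable area"
    by (simp add: measurable_cong_sets[OF sets_area refl])
  qed
  also have "\<dots> \<le> (\<Sum>i\<in>F. ennreal (b i / (real N)^2) * ennreal ?G)"
   by (intro sum_mono) (use poinc[OF _ N V finZ Z] mean G in auto)
  also have "\<dots> = (\<Sum>i\<in>F. ennreal (b i / (real N)^2 * ?G))"
   using b G0 by (intro sum.cong refl ennreal_mult[symmetric]) auto
  also have "\<dots> = ennreal (\<Sum>i\<in>F. b i / (real N)^2 * ?G)"
   using b G0 by (intro sum_ennreal) auto
  finally have "(LINT x|area. (cmod (V x))^2) \<le> (\<Sum>i\<in>F. b i / (real N)^2 * ?G)"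
   using b G0 by (subst (asm) ennreal_le_iff) (auto intro!: sum_nonneg mult_nonneg_nonneg)
  also have "\<dots> = (\<Sum>i\<in>F. b i) / (real N)^2 * ?G"
   by (simp add: sum_distrib_right sum_divide_distrib)
  also have "\<dots> \<le> C' / (real N)^2 * ?G"
   using G0 by (intro mult_right_mono divide_right_mono) (auto simp: C'_def)
  finally show "\<exists>c. (\<exists>i<k. c i \<noteq> 0) \<and> (LINT x|area. (cmod (\<Sum>i<k. c i *\<^sub>R v i x))^2)
     \<le> C' / (real N)^2 * (LINT x|area. carre_du_champ (lin_comb k c v) (lin_comb k c v) x)"
   using c(1) unfolding V_def[abs_def] by (intro exI[of _ c]) auto
 qed
qed

end

section \<open>Monotone functions that drop with a definite slope\<close>

text \<open>Were \<open>\<delta>\<close> the same for all points, two points \<open>x < y\<close> of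
  the set closer than \<open>\<delta>\<close> would satisfy
  \<open>\<kappa> * (y - x) \<le> h y - h x\<close>. The part of the set in a short interval then
  fits into an interval whose length is the increment of \<open>h\<close> divided by
  \<open>\<kappa>\<close>, and the increments telescope. As \<open>\<delta>\<close> depends on the
  point, the set is exhausted by the sets \<open>E n\<close>. A Borel cover is produced since the
  set itself is not known to be measurable.\<close>

lemma mono_drop_set_cover:
 fixes h :: "real \<Rightarrow> real"
 assumes mono: "\<And>s t. 0 \<le> s \<Longrightarrow> s \<le> t \<Longrightarrow> t \<le> 1 \<Longrightarrow> h s \<le> h t"
  and \<kappa>: "\<kappa> > 0" and \<alpha>\<beta>: "\<alpha> \<le> \<beta>"
 shows "\<exists>U\<in>sets borel. emeasure lborel U \<le> ennreal ((\<beta> - \<alpha>) / \<kappa>) \<and>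
  {t \<in> {0..1}. \<alpha> \<le> h t \<and> h t \<le> \<beta> \<and> (\<exists>\<delta>>0. \<forall>s. 0 < s \<and> s < \<delta> \<and> s \<le> t \<longrightarrow> h (t - s) \<le> h t - \<kappa> * s)} \<subseteq> U"
  (is "\<exists>U\<in>_. _ \<and> ?S \<subseteq> U")
proof -
 define E where "E n = {t \<in> {0..1}. \<alpha> \<le> h t \<and> h t \<le> \<beta> \<and>
  (\<forall>s. 0 < s \<and> s < 1 / real (Suc n) \<and> s \<le> t \<longrightarrow> h (t - s) \<le> h t - \<kappa> * s)}" for n
 have E_mono: "E n \<subseteq> E k" if "n \<le> k" for n k
 proof -
  have "1 / real (Suc k) \<le> 1 / real (Suc n)" using that by (simp add: frac_le)
  then show ?thesis unfolding E_def by force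
 qed
 have "\<exists>U\<in>sets borel. emeasure lborel U \<le> ennreal ((\<beta> - \<alpha>) / \<kappa>) \<and> E n \<subseteq> U" for n
 proof -
  \<comment> \<open>One more than the denominator in \<open>E n\<close>, so that the mesh is
    strictly below the distance at which the drop is guaranteed.\<close>
  define N where "N = Suc (Suc n)"
  have N: "N > 0" "1 / real N < 1 / real (Suc n)" by (simp_all add: N_def divide_simps)
  define a where "a i = real i / real N" for i
  \<comment> \<open>Truncation to the window: \<open>H\<close> is still monotone and agrees with
    \<open>h\<close> on \<open>E n\<close>, and its total increment is at most
    \<open>\<beta> - \<alpha>\<close>.\<close>
  define H where "H t = max \<alpha> (min \<beta> (h t))" for t
  have H_mono: "H s \<le> H t" if "0 \<le> s" "s \<le> t" "t \<le> 1" for s t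
   using mono[OF that] unfolding H_def by linarith
  have a01: "0 \<le> a i" "i \<le> N \<Longrightarrow> a i \<le> 1" for i using N by (simp_all add: a_def)
  have a_step: "a (Suc i) - a i = 1 / real N" for i by (simp add: a_def diff_divide_distrib[symmetric])
  define A where "A i = E n \<inter> {a i..a (Suc i)}" for i
  define U where "U i = (if A i = {} then {} else {Inf (A i)..Sup (A i)})" for i
  have bdd: "bdd_above (A i)" "bdd_below (A i)" for i
   unfolding A_def by (auto intro: bdd_above_Int2 bdd_below_Int2)
  have A_sub: "A i \<subseteq> U i" for i
   using cInf_lower[OF _ bdd(2)] cSup_upper[OF _ bdd(1)] by (auto simp: U_def)
  have a_le: "a i \<le> a (Suc i)" for i
  proof -
   have "0 \<le> a (Suc i) - a i" unfolding a_step by simp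
   then show ?thesis by simp
  qed
  have osc: "0 \<le> H (a (Suc i)) - H (a i)" if "i < N" for i
   using H_mono[OF a01(1) a_le a01(2)] that by simp
  have gap: "\<kappa> * (y - x) \<le> H (a (Suc i)) - H (a i)" if "x \<in> A i" "y \<in> A i" "i < N" for i x y
  proof (cases "x < y")
   case True
   have xy: "x \<in> E n" "y \<in> E n" "a i \<le> x" "y \<le> a (Suc i)" using that by (auto simp: A_def)
   have "y - x \<le> 1 / real N" using xy a_step[of i] by linarith
   then have "0 < y - x \<and> y - x < 1 / real (Suc n) \<and> y - x \<le> y"
    using xy(1) N(2) True by (auto simp: E_def)
   then have "h (y - (y - x)) \<le> h y - \<kappa> * (y - x)"
    using xy(2) unfolding E_def by blast
   then have "\<kappa> * (y - x) \<le> h y - h x" by simp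
   also have "\<dots> = H y - H x" using xy by (simp add: E_def H_def)
   also have "\<dots> \<le> H (a (Suc i)) - H (a i)"
    using H_mono[of y "a (Suc i)"] H_mono[of "a i" x] xy a01[of i] a01(2)[of "Suc i"] that(3)
    by (simp add: E_def)
   finally show ?thesis .
  next
   case False
   then have "\<kappa> * (y - x) \<le> 0" using \<kappa> by (simp add: mult_nonneg_nonpos)
   also have "0 \<le> H (a (Suc i)) - H (a i)" by (rule osc[OF that(3)])
   finally show ?thesis .
  qed
  have len: "emeasure lborel (U i) \<le> ennreal ((H (a (Suc i)) - H (a i)) / \<kappa>)" if i: "i < N" for i
  proof (cases "A i = {}")
   case False
   have "y \<le> x + (H (a (Suc i)) - H (a i)) / \<kappa>" if "x \<in> A i" "y \<in> A i" for x y
    using gap[OF that i] \<kappa> by (simp add: field_simps)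
   then have "Sup (A i) \<le> x + (H (a (Suc i)) - H (a i)) / \<kappa>" if "x \<in> A i" for x
    using that False by (intro cSup_least) auto
   then have "Sup (A i) - (H (a (Suc i)) - H (a i)) / \<kappa> \<le> Inf (A i)"
    using False by (intro cInf_greatest) (auto simp: algebra_simps)
   moreover have "Inf (A i) \<le> Sup (A i)" using bdd[of i] False by (intro cInf_le_cSup) auto
   ultimately show ?thesis using False by (simp add: U_def ennreal_leI)
  qed (simp add: U_def)
  have "emeasure lborel (\<Union>i<N. U i) \<le> (\<Sum>i<N. emeasure lborel (U i))"
   by (rule emeasure_subadditive_finite) (auto simp: U_def)
  also have "\<dots> \<le> (\<Sum>i<N. ennreal ((H (a (Suc i)) - H (a i)) / \<kappa>))"
   by (intro sum_mono len) simp
  also have "\<dots> = ennreal (\<Sum>i<N. (H (a (Suc i)) - H (a i)) / \<kappa>)"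
   using osc \<kappa> by (intro sum_ennreal) simp
  also have "(\<Sum>i<N. (H (a (Suc i)) - H (a i)) / \<kappa>) = (H (a N) - H (a 0)) / \<kappa>"
   by (simp add: sum_divide_distrib[symmetric] sum_lessThan_telescope[of "\<lambda>i. H (a i)"])
  also have "ennreal \<dots> \<le> ennreal ((\<beta> - \<alpha>) / \<kappa>)"
   using \<kappa> \<alpha>\<beta> by (intro ennreal_leI divide_right_mono) (auto simp: H_def)
  finally have "emeasure lborel (\<Union>i<N. U i) \<le> ennreal ((\<beta> - \<alpha>) / \<kappa>)" .
  moreover have "E n \<subseteq> (\<Union>i<N. U i)"
  proof
   fix t assume t: "t \<in> E n"
   then have t01: "0 \<le> t" "t \<le> 1" by (auto simp: E_def)
   define i where "i = min (nat \<lfloor>t * real N\<rfloor>) (N - 1)"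
   have i: "i < N" using N by (simp add: i_def)
   have "real i \<le> t * real N"
    using t01 by (simp add: i_def min_def) linarith
   moreover have "t * real N \<le> real (Suc i)"
   proof (cases "nat \<lfloor>t * real N\<rfloor> \<le> N - 1")
    case True
    then show ?thesis by (simp add: i_def min_def) linarith
   next
    case False
    then have "real (Suc i) = real N" using N by (simp add: i_def min_def)
    then show ?thesis using t01 N by (simp add: mult_left_le_one_le)
   qed
   ultimately have "a i \<le> t" "t \<le> a (Suc i)" using N by (simp_all add: a_def field_simps)
   then show "t \<in> (\<Union>i<N. U i)" using A_sub[of i] t i by (auto simp: A_def)
  qed
  moreover have "(\<Union>i<N. U i) \<in> sets borel" by (auto simp: U_def)
  ultimately show ?thesis by blast
 qed
 then obtain U where U: "\<And>n. U n \<in> sets borel" "\<And>n. emeasure lborel (U n) \<le> ennreal ((\<beta> - \<alpha>) / \<kappa>)" "\<And>n. E n \<subseteq> U n"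
  by metis
 \<comment> \<open>The sets \<open>E n\<close> increase but their covers are unrelated. The tail
   intersections increase, still contain \<open>E n\<close> and inherit the bound, so it passes to
   their union.\<close>
 define V where "V n = (\<Inter>k\<in>{n..}. U k)" for n
 have V: "V n \<in> sets lborel" for n unfolding V_def using U(1) by (intro sets.countable_INT') auto
 have inc: "incseq V" unfolding V_def by (intro incseq_SucI INT_anti_mono) auto
 have "emeasure lborel (V n) \<le> ennreal ((\<beta> - \<alpha>) / \<kappa>)" for n
  using emeasure_mono[of "V n" "U n" lborel] U(1,2)[of n] by (force simp: V_def)
 then have "emeasure lborel (\<Union>n. V n) \<le> ennreal ((\<beta> - \<alpha>) / \<kappa>)"
  using SUP_emeasure_incseq[of V lborel] V inc by (metis SUP_least image_subsetI)
 moreover have "?S \<subseteq> (\<Union>n. V n)"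
 proof
  fix t assume t: "t \<in> ?S"
  then obtain \<delta> where \<delta>: "\<delta> > 0" "\<forall>s. 0 < s \<and> s < \<delta> \<and> s \<le> t \<longrightarrow> h (t - s) \<le> h t - \<kappa> * s" by blast
  obtain n where "inverse (real (Suc n)) < \<delta>" using reals_Archimedean[OF \<delta>(1)] by blast
  then have "t \<in> E n" using t \<delta>(2) by (auto simp: E_def inverse_eq_divide)
  then have "t \<in> V n" unfolding V_def using E_mono U(3) by blast
  then show "t \<in> (\<Union>n. V n)" by blast
 qed
 moreover have "(\<Union>n. V n) \<in> sets borel" using V by auto
 ultimately show ?thesis by blast
qed

lemma inner_young:
 fixes a b :: "'b::real_inner"
 assumes "\<eta> > 0" shows "\<bar>2 * (a \<bullet> b)\<bar> \<le> (1 / \<eta>) * (a \<bullet> a) + \<eta> * (b \<bullet> b)"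
proof -
 have "0 \<le> (a - \<eta> *\<^sub>R b) \<bullet> (a - \<eta> *\<^sub>R b)" "0 \<le> (a + \<eta> *\<^sub>R b) \<bullet> (a + \<eta> *\<^sub>R b)" by simp_all
 then have "\<eta> * \<bar>2 * (a \<bullet> b)\<bar> \<le> a \<bullet> a + \<eta> * (\<eta> * (b \<bullet> b))"
  using assms by (simp add: inner_add_left inner_add_right inner_diff_left inner_diff_right inner_commute[of b a]
   abs_if algebra_simps)
 also have "\<dots> = \<eta> * ((1 / \<eta>) * (a \<bullet> a) + \<eta> * (b \<bullet> b))" using assms by (simp add: algebra_simps)
 finally show ?thesis using assms by simp
qed

section \<open>Eigenvalues of the conformal family\<close>

locale conformal_family = surface A g for A :: "'a::t2_space chart set" and g +
 fixes f :: "'a \<Rightarrow> real"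
 assumes f_cont: "continuous_on UNIV f" and f_nonneg: "\<And>x. f x \<ge> 0"
begin

definition weight :: "real \<Rightarrow> ('a \<Rightarrow> complex) \<Rightarrow> ('a \<Rightarrow> complex) \<Rightarrow> real" where
 "weight t u v = (LINT x|area. exp (- t * f x) * (u x \<bullet> v x))"

text \<open>The Dirichlet form of \<open>g\<close>. By conformal invariance it is that of every
  metric of the family, so the whole dependence of the Rayleigh quotient on \<open>t\<close> sits in
  \<open>weight\<close>.\<close>

definition energy :: "('a \<Rightarrow> complex) \<Rightarrow> real" where
 "energy v = (LINT x|area. carre_du_champ v v x)"

text \<open>There is a \<open>k\<close>-dimensional space on which the Rayleigh quotient of \<open>\<Delta>\<^sub>t\<close> is at most
 \<open>a\<close>, that is, the \<open>k\<close>-th eigenvalue is at most \<open>a\<close>.\<close>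

definition low_dim :: "real \<Rightarrow> real \<Rightarrow> nat \<Rightarrow> bool" where
 "low_dim t a k \<longleftrightarrow> (\<exists>v::nat \<Rightarrow> 'a \<Rightarrow> complex. (\<forall>i<k. smooth_function A (v i)) \<and>
   (\<forall>c::nat \<Rightarrow> real. (\<exists>i<k. c i \<noteq> 0) \<longrightarrow>
    weight t (lin_comb k c v) (lin_comb k c v) > 0 \<and>
    energy (lin_comb k c v) \<le> a * weight t (lin_comb k c v) (lin_comb k c v)))"

lemma integrable_weight:
 "continuous_on UNIV u \<Longrightarrow> continuous_on UNIV v \<Longrightarrow> integrable area (\<lambda>x. exp (- t * f x) * (u x \<bullet> v x))"
 by (intro integrable_area_continuous continuous_intros f_cont)

lemma weight_nonneg: "weight t v v \<ge> 0"
 by (simp add: weight_def integral_nonneg_AE)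

lemma energy_nonneg: "energy v \<ge> 0"
 by (simp add: energy_def integral_nonneg_AE carre_du_champ_nonneg)

lemma weight_antimono:
 assumes "continuous_on UNIV v" "s \<le> t" shows "weight t v v \<le> weight s v v"
 unfolding weight_def
proof (rule integral_mono)
 fix x
 have "- t * f x \<le> - s * f x" using assms(2) f_nonneg[of x] by (simp add: mult_right_mono)
 then show "exp (- t * f x) * (v x \<bullet> v x) \<le> exp (- s * f x) * (v x \<bullet> v x)"
  by (intro mult_right_mono) auto
qed (use assms(1) integrable_weight in auto)

lemma weight_add_scaleR:
 assumes "continuous_on UNIV u" "continuous_on UNIV v"
 shows "weight t (\<lambda>x. u x + y *\<^sub>R v x) (\<lambda>x. u x + y *\<^sub>R v x) = weight t u u + 2 * y * weight t u v + y^2 * weight t v v"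
proof -
 have "weight t (\<lambda>x. u x + y *\<^sub>R v x) (\<lambda>x. u x + y *\<^sub>R v x)
   = (LINT x|area. exp (- t * f x) * (u x \<bullet> u x) + (2 * y) * (exp (- t * f x) * (u x \<bullet> v x)) + y^2 * (exp (- t * f x) * (v x \<bullet> v x)))"
  unfolding weight_def
  by (intro Bochner_Integration.integral_cong)
    (auto simp: inner_add_left inner_add_right inner_commute algebra_simps power2_eq_square)
 also have "\<dots> = weight t u u + 2 * y * weight t u v + y^2 * weight t v v"
  unfolding weight_def using integrable_weight[OF assms(1,1), of t] integrable_weight[OF assms, of t]
   integrable_weight[OF assms(2,2), of t] by (simp only: Bochner_Integration.integral_add
    Bochner_Integration.integrable_add integrable_mult_right integral_mult_right_zero simp_thms)
 finally show ?thesis .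
qed

lemma smooth_function_Ck: "smooth_function A v \<Longrightarrow> Ck_function n v"
 by (simp add: smooth_function_iff_Ck)

lemma energy_eq: "smooth_function A v \<Longrightarrow> energy v = (LINT x|area. v x \<bullet> laplacian A g v x)"
 unfolding energy_def using green[of v v] smooth_function_Ck[of v] by simp

text \<open>The hypothesis is the eigenvalue equation of the conformal metric multiplied by
  \<open>exp (- t * f x)\<close>. By symmetry of the Laplacian the cross terms become weights, and
  comparison with \<open>weight_add_scaleR\<close> shows that energy minus \<open>\<mu>\<close>
  times weight is unchanged when a multiple of \<open>\<phi>\<close> is added.\<close>

lemma energy_add_eigenfunction:
 assumes u: "smooth_function A u" and \<phi>: "smooth_function A \<phi>"
  and eig: "\<And>x. laplacian A g \<phi> x = (\<mu> * exp (- t * f x)) *\<^sub>R \<phi> x"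
 shows "energy (\<lambda>x. u x + y *\<^sub>R \<phi> x) = energy u + 2 * y * \<mu> * weight t u \<phi> + y^2 * \<mu> * weight t \<phi> \<phi>"
proof -
 have s: "smooth_function A (\<lambda>x. y *\<^sub>R \<phi> x)" by (rule smooth_function_scaleR[OF \<phi>])
 have int: "integrable area (\<lambda>x. p x \<bullet> laplacian A g q x)" if "smooth_function A p" "smooth_function A q" for p q
  using that by (intro integrable_area_continuous continuous_intros continuous_laplacian smooth_function_continuous)
 have e: "(LINT x|area. p x \<bullet> laplacian A g \<phi> x) = \<mu> * weight t p \<phi>" for p
  unfolding weight_def eig by (subst integral_mult_right_zero[symmetric]) (simp add: mult_ac)
 have "energy (\<lambda>x. u x + y *\<^sub>R \<phi> x) = (LINT x|area. (u x + y *\<^sub>R \<phi> x) \<bullet> (laplacian A g u x + y *\<^sub>R laplacian A g \<phi> x))"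
  using laplacian_add[OF u s] laplacian_scaleR[OF \<phi>] by (simp add: energy_eq smooth_function_add u s)
 also have "\<dots> = (LINT x|area. u x \<bullet> laplacian A g u x + y * (\<phi> x \<bullet> laplacian A g u x)
   + y * (u x \<bullet> laplacian A g \<phi> x) + y^2 * (\<phi> x \<bullet> laplacian A g \<phi> x))"
  by (intro Bochner_Integration.integral_cong) (auto simp: inner_add_left inner_add_right power2_eq_square algebra_simps)
 also have "\<dots> = energy u + y * (LINT x|area. \<phi> x \<bullet> laplacian A g u x)
   + y * (LINT x|area. u x \<bullet> laplacian A g \<phi> x) + y^2 * (LINT x|area. \<phi> x \<bullet> laplacian A g \<phi> x)"
  using int u \<phi> by (simp add: energy_eq)
 also have "(LINT x|area. \<phi> x \<bullet> laplacian A g u x) = (LINT x|area. u x \<bullet> laplacian A g \<phi> x)"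
  by (rule laplacian_symmetric[OF u \<phi>])
 finally show ?thesis by (simp add: e algebra_simps)
qed

text \<open>A smaller parameter enlarges the weight and leaves the energy as it is, so the same
  space remains admissible. This is the monotonicity of the eigenvalues in \<open>t\<close>.\<close>

lemma low_dim_mono:
 assumes "low_dim t a k" "0 \<le> a" "a \<le> a'" "t' \<le> t"
 shows "low_dim t' a' k"
proof -
 obtain v :: "nat \<Rightarrow> 'a \<Rightarrow> complex" where v: "\<And>i. i < k \<Longrightarrow> smooth_function A (v i)"
  and c: "\<And>c::nat \<Rightarrow> real. \<exists>i<k. c i \<noteq> 0 \<Longrightarrow>
    weight t (lin_comb k c v) (lin_comb k c v) > 0 \<and>
    energy (lin_comb k c v) \<le> a * weight t (lin_comb k c v) (lin_comb k c v)"
  using assms(1) unfolding low_dim_def by blast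
 show ?thesis
  unfolding low_dim_def
 proof (intro exI[of _ v] conjI allI impI)
  fix b :: "nat \<Rightarrow> real" assume b: "\<exists>i<k. b i \<noteq> 0"
  let ?V = "\<lambda>x. \<Sum>i<k. b i *\<^sub>R v i x"
  have "continuous_on UNIV ?V"
   using v by (intro continuous_intros smooth_function_continuous) auto
  then have w: "weight t ?V ?V \<le> weight t' ?V ?V" by (rule weight_antimono) (rule assms(4))
  show "weight t' ?V ?V > 0" using w c[OF b] by linarith
  have "a * weight t ?V ?V \<le> a' * weight t' ?V ?V"
   using w weight_nonneg assms(2,3) by (intro mult_mono) auto
  then show "energy ?V \<le> a' * weight t' ?V ?V" using c[OF b] by linarith
 qed (use v in blast)
qed

text \<open>A space of too large dimension contains an element with mean zero on all cells of a
  grid, whose Rayleigh quotient is at least of order \<open>N^2\<close>; this exceeds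
  \<open>a\<close> for suitable \<open>N\<close>. Only the weight at parameter 0 enters, so the
  bound is uniform in \<open>t\<close>.\<close>

lemma low_dim_bound:
 "\<exists>D>0. \<forall>t\<ge>0. \<forall>a\<ge>0. \<forall>k. low_dim t a k \<longrightarrow> real k \<le> D * (1 + a)"
proof -
 obtain C D where C: "C > 0" and D: "D > 0" and main: "\<forall>N\<ge>1::nat. \<forall>k. \<forall>v::nat \<Rightarrow> 'a \<Rightarrow> complex.
   (\<forall>i<k. smooth_function A (v i)) \<and> real k > D * (real N)^2 \<longrightarrow>
   (\<exists>c::nat \<Rightarrow> real. (\<exists>i<k. c i \<noteq> 0) \<and>
    (LINT x|area. (cmod (\<Sum>i<k. c i *\<^sub>R v i x))^2)
     \<le> C / (real N)^2 * (LINT x|area. carre_du_champ (lin_comb k c v) (lin_comb k c v) x))"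
  using small_rayleigh_dimension_bound by blast
 have "real k \<le> D * (4 * C + 8) * (1 + a)" if t: "t \<ge> 0" and a: "a \<ge> 0" and low: "low_dim t a k" for t a k
 proof (rule ccontr)
  assume k: "\<not> ?thesis"
  \<comment> \<open>Chosen so that \<open>C * a / N^2\<close> is at most 1/2, which contradicts the
    quotient bound, while \<open>N^2\<close> stays of order \<open>1 + a\<close>.\<close>
  define N where "N = nat \<lceil>sqrt (2 * C * a)\<rceil> + 1"
  have N1: "1 \<le> N" by (simp add: N_def)
  have "sqrt (2 * C * a) \<le> real N" by (simp add: N_def) (use real_nat_ceiling_ge in linarith)
  then have "(sqrt (2 * C * a))^2 \<le> (real N)^2" using C a by (intro power_mono) auto
  then have NC: "2 * C * a \<le> (real N)^2" using C a by simp
  have "real N \<le> sqrt (2 * C * a) + 2"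
   using C a by (simp add: N_def) linarith
  then have "(real N)^2 \<le> (sqrt (2 * C * a) + 2)^2" by (intro power_mono) auto
  also have "\<dots> \<le> 2 * (sqrt (2 * C * a))^2 + 2 * 2^2"
   using zero_le_power2[of "sqrt (2 * C * a) - 2"] unfolding power2_sum power2_diff by linarith
  also have "\<dots> = 4 * C * a + 8" using C a by simp
  also have "\<dots> \<le> (4 * C + 8) * (1 + a)" using C a by (simp add: algebra_simps)
  finally have "D * (real N)^2 \<le> D * ((4 * C + 8) * (1 + a))" using D by (intro mult_left_mono) auto
  then have kN: "D * (real N)^2 < real k" using k by (simp add: mult.assoc)
  obtain v :: "nat \<Rightarrow> 'a \<Rightarrow> complex" where v: "\<And>i. i < k \<Longrightarrow> smooth_function A (v i)"
   and c: "\<And>c::nat \<Rightarrow> real. \<exists>i<k. c i \<noteq> 0 \<Longrightarrow>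
    weight t (lin_comb k c v) (lin_comb k c v) > 0 \<and>
    energy (lin_comb k c v) \<le> a * weight t (lin_comb k c v) (lin_comb k c v)"
   using low unfolding low_dim_def by blast
  obtain b :: "nat \<Rightarrow> real" where b: "\<exists>i<k. b i \<noteq> 0"
   and le: "(LINT x|area. (cmod (\<Sum>i<k. b i *\<^sub>R v i x))^2) \<le> C / (real N)^2 * energy (lin_comb k b v)"
   using main[rule_format, OF N1, of k v] v kN unfolding energy_def by blast
  let ?V = "\<lambda>x. \<Sum>i<k. b i *\<^sub>R v i x"
  let ?n = "LINT x|area. (cmod (?V x))^2"
  have cont: "continuous_on UNIV ?V"
   using v by (intro continuous_intros smooth_function_continuous) auto
  have n: "?n = weight 0 ?V ?V" by (simp add: weight_def power2_norm_eq_inner)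
  have w: "weight t ?V ?V \<le> ?n" unfolding n by (rule weight_antimono[OF cont t])
  have pos: "weight t ?V ?V > 0" and en: "energy ?V \<le> a * weight t ?V ?V" using c[OF b] by auto
  have "?n \<le> C / (real N)^2 * (a * ?n)"
   using le en w a C by (smt (verit) divide_nonneg_nonneg mult_left_mono zero_le_power2)
  also have "\<dots> = (C * a / (real N)^2) * ?n" by simp
  also have "\<dots> \<le> (1/2) * ?n"
   using NC N1 w pos by (intro mult_right_mono) (auto simp: field_simps)
  finally show False using w pos by linarith
 qed
 moreover have "D * (4 * C + 8) > 0" using C D by simp
 ultimately show ?thesis by blast
qed

text \<open>Minus the derivative of \<open>weight t v v\<close> in \<open>t\<close>. For an
  eigenfunction of unit weight, \<open>\<mu>\<close> times this number is the rate at which its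
  Rayleigh quotient grows.\<close>

definition mass :: "real \<Rightarrow> ('a \<Rightarrow> complex) \<Rightarrow> real" where
 "mass t v = (LINT x|area. f x * exp (- t * f x) * (v x \<bullet> v x))"

lemma integrable_mass:
 "continuous_on UNIV u \<Longrightarrow> continuous_on UNIV v \<Longrightarrow> integrable area (\<lambda>x. f x * exp (- t * f x) * (u x \<bullet> v x))"
 by (intro integrable_area_continuous continuous_intros f_cont)

text \<open>The convexity bound \<open>1 + x \<le> exp x\<close> makes the first-order expansion in
  \<open>s\<close> a true inequality, with no error term to control.\<close>

lemma weight_increase:
 assumes "continuous_on UNIV v"
 shows "weight t v v + s * mass t v \<le> weight (t - s) v v"
proof -
 have "weight t v v + s * mass t v
   = (LINT x|area. exp (- t * f x) * (v x \<bullet> v x) + s * (f x * exp (- t * f x) * (v x \<bullet> v x)))"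
  unfolding weight_def mass_def
  by (simp only: Bochner_Integration.integral_add integrable_weight integrable_mass assms
    integrable_mult_right integral_mult_right_zero)
 also have "\<dots> \<le> weight (t - s) v v"
  unfolding weight_def
 proof (rule integral_mono)
  fix x
  have "exp (- t * f x) * (1 + s * f x) \<le> exp (- t * f x) * exp (s * f x)"
   by (intro mult_left_mono exp_ge_add_one_self) simp
  also have "\<dots> = exp (- (t - s) * f x)" by (simp add: exp_add[symmetric] algebra_simps)
  finally have "exp (- t * f x) * (1 + s * f x) * (v x \<bullet> v x) \<le> exp (- (t - s) * f x) * (v x \<bullet> v x)"
   by (rule mult_right_mono) simp
  then show "exp (- t * f x) * (v x \<bullet> v x) + s * (f x * exp (- t * f x) * (v x \<bullet> v x))
    \<le> exp (- (t - s) * f x) * (v x \<bullet> v x)" by (simp add: algebra_simps)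
 qed (intro Bochner_Integration.integrable_add integrable_mult_right integrable_weight integrable_mass assms)+
 finally show ?thesis .
qed

lemma weight_add_scaleR_le:
 assumes "continuous_on UNIV u" "continuous_on UNIV v" "\<eta> > 0"
 shows "weight t (\<lambda>x. u x + y *\<^sub>R v x) (\<lambda>x. u x + y *\<^sub>R v x) \<le> (1 + \<eta>) * y^2 * weight t v v + (1 + 1 / \<eta>) * weight t u u"
proof -
 have "weight t (\<lambda>x. u x + y *\<^sub>R v x) (\<lambda>x. u x + y *\<^sub>R v x)
   \<le> (LINT x|area. ((1 + \<eta>) * y^2) * (exp (- t * f x) * (v x \<bullet> v x)) + (1 + 1 / \<eta>) * (exp (- t * f x) * (u x \<bullet> u x)))"
  unfolding weight_def
 proof (rule integral_mono)
  fix x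
  have "(u x + y *\<^sub>R v x) \<bullet> (u x + y *\<^sub>R v x) = u x \<bullet> u x + 2 * (u x \<bullet> (y *\<^sub>R v x)) + y^2 * (v x \<bullet> v x)"
   by (simp add: inner_add_left inner_add_right inner_commute power2_eq_square)
  also have "\<dots> \<le> (1 + \<eta>) * y^2 * (v x \<bullet> v x) + (1 + 1 / \<eta>) * (u x \<bullet> u x)"
   using inner_young[OF assms(3), of "u x" "y *\<^sub>R v x"] by (simp add: algebra_simps power2_eq_square)
  finally have "exp (- t * f x) * ((u x + y *\<^sub>R v x) \<bullet> (u x + y *\<^sub>R v x))
    \<le> exp (- t * f x) * ((1 + \<eta>) * y^2 * (v x \<bullet> v x) + (1 + 1 / \<eta>) * (u x \<bullet> u x))"
   by (rule mult_left_mono) simp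
  then show "exp (- t * f x) * ((u x + y *\<^sub>R v x) \<bullet> (u x + y *\<^sub>R v x))
    \<le> ((1 + \<eta>) * y^2) * (exp (- t * f x) * (v x \<bullet> v x)) + (1 + 1 / \<eta>) * (exp (- t * f x) * (u x \<bullet> u x))"
   by (simp only: distrib_left mult_ac)
 qed (intro Bochner_Integration.integrable_add integrable_mult_right integrable_weight assms continuous_intros)+
 also have "\<dots> = (1 + \<eta>) * y^2 * weight t v v + (1 + 1 / \<eta>) * weight t u u"
  unfolding weight_def
  by (simp only: Bochner_Integration.integral_add integrable_weight assms integrable_mult_right integral_mult_right_zero)
 finally show ?thesis .
qed

text \<open>A perturbation \<open>u\<close> costs an arbitrarily small fraction
  \<open>\<eta>\<close> of the mass of \<open>v\<close> and a multiple of the weight of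
  \<open>u\<close>. In \<open>eigenvalue_drop\<close> that multiple, times \<open>s\<close>, is
  absorbed by the distance of the lower space from \<open>\<mu>\<close>.\<close>

lemma mass_add_scaleR_ge:
 assumes "continuous_on UNIV u" "continuous_on UNIV v" "\<eta> > 0" and B: "\<And>x. f x \<le> B"
 shows "(1 - \<eta>) * y^2 * mass t v - (B / \<eta>) * weight t u u \<le> mass t (\<lambda>x. u x + y *\<^sub>R v x)"
proof -
 have "(1 - \<eta>) * y^2 * mass t v - (B / \<eta>) * weight t u u
   = (LINT x|area. ((1 - \<eta>) * y^2) * (f x * exp (- t * f x) * (v x \<bullet> v x)) - (B / \<eta>) * (exp (- t * f x) * (u x \<bullet> u x)))"
  unfolding weight_def mass_def
  by (simp only: Bochner_Integration.integral_diff integrable_weight integrable_mass assms integrable_mult_right integral_mult_right_zero)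
 also have "\<dots> \<le> mass t (\<lambda>x. u x + y *\<^sub>R v x)"
  unfolding mass_def
 proof (rule integral_mono)
  fix x
  let ?a = "u x \<bullet> u x" and ?b = "y^2 * (v x \<bullet> v x)"
  let ?w = "(u x + y *\<^sub>R v x) \<bullet> (u x + y *\<^sub>R v x)"
  have eq: "?w = ?a + 2 * (u x \<bullet> (y *\<^sub>R v x)) + ?b"
   by (simp add: inner_add_left inner_add_right inner_commute power2_eq_square)
  have "(1 - \<eta>) * ?b - (1 / \<eta>) * ?a \<le> ?w"
   unfolding eq using inner_young[OF assms(3), of "u x" "y *\<^sub>R v x"] inner_ge_zero[of "u x"]
   by (simp add: algebra_simps power2_eq_square)
  then have "f x * ((1 - \<eta>) * ?b - (1 / \<eta>) * ?a) \<le> f x * ?w"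
   by (rule mult_left_mono) (rule f_nonneg)
  moreover have "f x * ((1 / \<eta>) * ?a) \<le> B * ((1 / \<eta>) * ?a)"
   using assms(3) B by (intro mult_right_mono) auto
  ultimately have "(1 - \<eta>) * y^2 * (f x * (v x \<bullet> v x)) - (B / \<eta>) * ?a \<le> f x * ?w"
   by (simp add: algebra_simps)
  then have "exp (- t * f x) * ((1 - \<eta>) * y^2 * (f x * (v x \<bullet> v x)) - (B / \<eta>) * ?a)
    \<le> exp (- t * f x) * (f x * ?w)"
   by (rule mult_left_mono) simp
  then show "((1 - \<eta>) * y^2) * (f x * exp (- t * f x) * (v x \<bullet> v x)) - (B / \<eta>) * (exp (- t * f x) * (u x \<bullet> u x))
    \<le> f x * exp (- t * f x) * ?w"
   by (simp only: right_diff_distrib mult_ac)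
 qed (intro Bochner_Integration.integrable_diff integrable_mult_right integrable_weight integrable_mass assms continuous_intros)+
 finally show ?thesis .
qed

text \<open>Adding \<open>\<phi>\<close> to a maximal space on which the Rayleigh quotient is below \<open>\<mu>\<close> gives a space that
 is admissible for the parameter \<open>t - s\<close> at the level \<open>\<mu> - \<kappa> s\<close>. No orthogonality is needed: since
 \<open>\<phi>\<close> is an eigenfunction, it drops out of the form \<open>energy - \<mu> weight\<close>.\<close>

lemma eigenvalue_drop:
 assumes \<phi>: "smooth_function A \<phi>" and eig: "\<And>x. laplacian A g \<phi> x = (\<mu> * exp (- t * f x)) *\<^sub>R \<phi> x"
  and norm: "weight t \<phi> \<phi> = 1" and t: "0 \<le> t" and \<kappa>: "0 < \<kappa>" "\<kappa> < \<mu> * \<epsilon>" and \<mu>: "\<mu> > 0"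
  and mass: "mass t \<phi> > \<epsilon>"
 shows "\<exists>k. \<exists>\<delta>>0. (\<forall>a. 0 \<le> a \<and> a < \<mu> \<longrightarrow> \<not> low_dim t a (Suc k)) \<and>
   (\<forall>s. 0 \<le> s \<and> s < \<delta> \<longrightarrow> \<kappa> * s \<le> \<mu> \<and> low_dim (t - s) (\<mu> - \<kappa> * s) (Suc k))"
proof -
 obtain D where D: "\<forall>t\<ge>0. \<forall>a\<ge>0. \<forall>k. low_dim t a k \<longrightarrow> real k \<le> D * (1 + a)" "D > 0"
  using low_dim_bound by blast
 \<comment> \<open>The largest dimension of an admissible space at a level strictly below
   \<open>\<mu>\<close>; it exists by \<open>low_dim_bound\<close>. Maximality is what forbids
   dimension \<open>Suc k\<close> below \<open>\<mu>\<close>.\<close>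
 let ?P = "\<lambda>k. \<exists>a. 0 \<le> a \<and> a < \<mu> \<and> low_dim t a k"
 have "?P 0" using \<mu> by (intro exI[of _ 0]) (simp add: low_dim_def)
 moreover have bound: "k \<le> nat \<lceil>D * (1 + \<mu>)\<rceil>" if "?P k" for k
 proof -
  obtain a where a: "0 \<le> a" "a < \<mu>" "low_dim t a k" using \<open>?P k\<close> by blast
  have "real k \<le> D * (1 + a)" using D a t by blast
  also have "\<dots> \<le> D * (1 + \<mu>)" using a D(2) by simp
  finally show ?thesis by (simp add: le_nat_iff) linarith
 qed
 ultimately obtain k where k: "?P k" "\<And>j. ?P j \<Longrightarrow> j \<le> k"
  using Greatest_le_nat[of ?P _ "nat \<lceil>D * (1 + \<mu>)\<rceil>"] GreatestI_nat[of ?P 0 "nat \<lceil>D * (1 + \<mu>)\<rceil>"] by blast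
 obtain a0 where a0: "0 \<le> a0" "a0 < \<mu>" "low_dim t a0 k" using k(1) by blast
 have no: "\<not> low_dim t a (Suc k)" if "0 \<le> a" "a < \<mu>" for a
  using k(2)[of "Suc k"] that by auto
 obtain v :: "nat \<Rightarrow> 'a \<Rightarrow> complex" where v: "\<And>i. i < k \<Longrightarrow> smooth_function A (v i)"
  and c: "\<And>c::nat \<Rightarrow> real. \<exists>i<k. c i \<noteq> 0 \<Longrightarrow>
    weight t (lin_comb k c v) (lin_comb k c v) > 0 \<and>
    energy (lin_comb k c v) \<le> a0 * weight t (lin_comb k c v) (lin_comb k c v)"
  using a0(3) unfolding low_dim_def by blast
 obtain B where B: "\<And>x. f x \<le> B"
  using compact_bounded_values[OF compact_UNIV f_cont] by (metis UNIV_I abs_le_D1)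
 have \<epsilon>: "\<epsilon> > 0" using \<kappa> \<mu> by (smt (verit) mult_nonneg_nonpos)
 \<comment> \<open>Half of the value at which \<open>\<mu> * (1 - \<eta>) * \<epsilon>\<close> and
   \<open>\<kappa> * (1 + \<eta>)\<close> are equal, hence a strict gap remains.\<close>
 define \<eta> where "\<eta> = (\<mu> * \<epsilon> - \<kappa>) / (2 * (\<mu> * \<epsilon> + \<kappa>))"
 have pos: "\<mu> * \<epsilon> + \<kappa> > 0" using \<kappa> by linarith
 have \<eta>: "\<eta> > 0" "\<eta> \<le> 1" using \<kappa> pos by (auto simp: \<eta>_def field_simps)
 have gap: "\<mu> * (1 - \<eta>) * \<epsilon> - \<kappa> * (1 + \<eta>) > 0"
 proof -
  have "\<eta> * (\<mu> * \<epsilon> + \<kappa>) = (\<mu> * \<epsilon> - \<kappa>) / 2"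
   using pos by (simp add: \<eta>_def divide_simps)
  then show ?thesis using \<kappa> by (simp add: algebra_simps)
 qed
 \<comment> \<open>\<open>?p s\<close> will be the coefficient of \<open>s\<close> times the square
   of the \<open>\<phi>\<close> component and \<open>?q s\<close> that of the weight of the lower
   component. Both are positive at \<open>s = 0\<close>, the second because
   \<open>a0 < \<mu>\<close>, so they stay positive for small \<open>s\<close>.\<close>
 let ?p = "\<lambda>s. (\<mu> - \<kappa> * s) * (1 - \<eta>) * \<epsilon> - \<kappa> * (1 + \<eta>)"
 let ?q = "\<lambda>s. \<mu> - a0 - \<kappa> * s * (1 + 1 / \<eta>) - \<mu> * s * (B / \<eta>)"
 have "(?p \<longlongrightarrow> ?p 0) (at 0)"
  by (intro tendsto_intros)
 then have e1: "\<forall>\<^sub>F s in at 0. ?p s > 0"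
  by (rule order_tendstoD) (use gap in simp)
 have "(?q \<longlongrightarrow> ?q 0) (at 0)"
  by (intro tendsto_intros)
 then have e2: "\<forall>\<^sub>F s in at 0. ?q s > 0"
  by (rule order_tendstoD) (use a0 in simp)
 have "((\<lambda>s. \<mu> - \<kappa> * s) \<longlongrightarrow> \<mu> - \<kappa> * 0) (at 0)" by (intro tendsto_intros)
 then have e3: "\<forall>\<^sub>F s in at 0. \<mu> - \<kappa> * s > 0"
  by (rule order_tendstoD) (use \<mu> in simp)
 have "\<forall>\<^sub>F s in at 0. ?p s > 0 \<and>
   ?q s > 0 \<and> \<mu> - \<kappa> * s > 0"
  using e1 e2 e3 by eventually_elim simp
 then obtain \<delta> where \<delta>: "\<delta> > 0" and small: "\<And>s. s \<noteq> 0 \<Longrightarrow> dist s 0 < \<delta> \<Longrightarrow>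
   ?p s > 0 \<and>
   ?q s > 0 \<and> \<mu> - \<kappa> * s > 0"
  unfolding eventually_at by blast
 have small': "?p s > 0"
  "?q s > 0" "\<mu> - \<kappa> * s > 0" if "0 \<le> s" "s < \<delta>" for s
  using small[of s] that gap a0 \<mu> by (cases "s = 0"; simp)+
 define w where "w = v(k := \<phi>)"
 have w: "smooth_function A (w i)" if "i < Suc k" for i
  using v \<phi> that by (auto simp: w_def less_Suc_eq)
 have "low_dim (t - s) (\<mu> - \<kappa> * s) (Suc k)" if s: "0 \<le> s" "s < \<delta>" for s
  unfolding low_dim_def
 proof (intro exI[of _ w] conjI allI impI)
  fix b :: "nat \<Rightarrow> real" assume b: "\<exists>i<Suc k. b i \<noteq> 0"
  define V0 where "V0 x = (\<Sum>i<k. b i *\<^sub>R v i x)" for x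
  let ?y = "b k"
  let ?V = "\<lambda>x. V0 x + ?y *\<^sub>R \<phi> x"
  have V: "(lin_comb (Suc k) b w) = ?V"
   by (simp add: w_def V0_def)
  have sV0: "smooth_function A V0"
   unfolding V0_def[abs_def] using v by (intro smooth_function_sum smooth_function_scaleR) auto
  have cV0: "continuous_on UNIV V0" and c\<phi>: "continuous_on UNIV \<phi>"
   using sV0 \<phi> smooth_function_continuous by blast+
  have cV: "continuous_on UNIV ?V" by (intro continuous_intros cV0 c\<phi>)
  let ?X = "weight t V0 V0" and ?W = "weight t ?V ?V"
  have X0: "?X \<ge> 0" by (rule weight_nonneg)
  have EV0: "energy V0 \<le> a0 * ?X"
  proof (cases "\<exists>i<k. b i \<noteq> 0")
   case True
   then show ?thesis using c[of b] unfolding V0_def[abs_def] by blast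
  next
   case False
   then have "V0 = (\<lambda>x. 0)" by (auto simp: V0_def)
   then have "energy V0 = 0"
    unfolding energy_def carre_du_champ_def Let_def dirichlet_def in_chart_def by (simp add: partial_deriv_const)
   then show ?thesis using X0 a0 by simp
  qed
  have EV: "energy ?V - \<mu> * ?W = energy V0 - \<mu> * ?X"
   unfolding energy_add_eigenfunction[OF sV0 \<phi> eig] weight_add_scaleR[OF cV0 c\<phi>]
   by (simp add: algebra_simps)
  \<comment> \<open>If the weight of the sum vanished, the invariance \<open>EV\<close> and the gap
    between \<open>a0\<close> and \<open>\<mu>\<close> would force the lower component to be zero,
    and then the normalisation of \<open>\<phi>\<close> would force its coefficient to be
    zero.\<close>
  have Wpos: "?W > 0"
  proof (rule ccontr)
   assume "\<not> ?W > 0"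
   then have W0: "?W = 0" using weight_nonneg[of t ?V] by linarith
   then have "0 \<le> a0 * ?X - \<mu> * ?X" using EV EV0 energy_nonneg[of ?V] by simp
   then have "(\<mu> - a0) * ?X \<le> 0" by (simp add: algebra_simps)
   then have "?X = 0" using X0 a0 by (simp add: mult_le_0_iff)
   then have b0: "\<not> (\<exists>i<k. b i \<noteq> 0)" using c[of b] unfolding V0_def[abs_def] by auto
   then have "V0 = (\<lambda>x. 0)" by (auto simp: V0_def)
   then have "?W = ?y^2" using weight_add_scaleR[OF cV0 c\<phi>, of t ?y] norm by (simp add: weight_def)
   then show False using W0 b b0 by (auto simp: less_Suc_eq)
  qed
  have m_ge: "(1 - \<eta>) * ?y^2 * mass t \<phi> - (B / \<eta>) * ?X \<le> mass t ?V"
   by (rule mass_add_scaleR_ge[OF cV0 c\<phi> \<eta>(1) B])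
  have m_ge': "(1 - \<eta>) * ?y^2 * \<epsilon> - (B / \<eta>) * ?X \<le> mass t ?V"
   using m_ge mult_left_mono[OF less_imp_le[OF mass], of "(1 - \<eta>) * ?y^2"] \<eta> by simp
  have W_le: "?W \<le> (1 + \<eta>) * ?y^2 + (1 + 1 / \<eta>) * ?X"
   using weight_add_scaleR_le[OF cV0 c\<phi> \<eta>(1), of t ?y] norm by simp
  have Ws: "?W + s * mass t ?V \<le> weight (t - s) ?V ?V" by (rule weight_increase[OF cV])
  have W_mono: "?W \<le> weight (t - s) ?V ?V" by (rule weight_antimono[OF cV]) (use s in simp)
  show "weight (t - s) (lin_comb (Suc k) b w) (lin_comb (Suc k) b w) > 0"
   unfolding V using W_mono Wpos by linarith
  have B0: "B \<ge> 0" using B f_nonneg by (meson order_trans)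
  \<comment> \<open>The claim is \<open>0 \<le> (\<mu> - \<kappa> * s) * weight - energy\<close>.
    The chain starts from the two nonnegative coefficients, inserts the Young bounds for mass and
    weight, and ends with \<open>weight_increase\<close> and \<open>EV\<close>.\<close>
  have "0 \<le> s * ?y^2 * (?p s)
    + ?X * (?q s)"
   using small'[OF s] s X0 by (intro add_nonneg_nonneg mult_nonneg_nonneg) auto
  also have "\<dots> \<le> s * ?y^2 * (?p s)
    + ?X * (\<mu> - a0 - \<kappa> * s * (1 + 1 / \<eta>) - (\<mu> - \<kappa> * s) * s * (B / \<eta>))"
   using \<kappa> s B0 \<eta> X0 by (intro add_left_mono mult_left_mono diff_left_mono mult_right_mono) auto
  also have "\<dots> = (\<mu> - \<kappa> * s) * (s * ((1 - \<eta>) * ?y^2 * \<epsilon> - (B / \<eta>) * ?X))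
    - \<kappa> * s * ((1 + \<eta>) * ?y^2 + (1 + 1 / \<eta>) * ?X) + (\<mu> - a0) * ?X"
   by (simp add: algebra_simps diff_divide_distrib)
  also have "\<dots> \<le> (\<mu> - \<kappa> * s) * (s * mass t ?V) - \<kappa> * s * ?W + (\<mu> - a0) * ?X"
   using small'(3)[OF s] s \<kappa> m_ge' W_le
   by (intro add_right_mono diff_mono mult_left_mono) auto
  also have "\<dots> = (\<mu> - \<kappa> * s) * (?W + s * mass t ?V) - \<mu> * ?W + (\<mu> - a0) * ?X"
   by (simp add: algebra_simps)
  also have "\<dots> \<le> (\<mu> - \<kappa> * s) * weight (t - s) ?V ?V - \<mu> * ?W + (\<mu> - a0) * ?X"
   using small'(3)[OF s] Ws by (intro add_right_mono diff_right_mono mult_left_mono) auto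
  also have "\<dots> \<le> (\<mu> - \<kappa> * s) * weight (t - s) ?V ?V - energy ?V"
   using EV EV0 by (simp add: algebra_simps)
  finally show "energy (lin_comb (Suc k) b w)
    \<le> (\<mu> - \<kappa> * s) * weight (t - s) (lin_comb (Suc k) b w) (lin_comb (Suc k) b w)"
   unfolding V by simp
 qed (use w in blast)
 then show ?thesis using no \<delta> small'(3) by (intro exI[of _ k] exI[of _ \<delta>]) (auto simp: less_imp_le)
qed

abbreviation weighted_eigenfunction :: "real \<Rightarrow> real \<Rightarrow> ('a \<Rightarrow> complex) \<Rightarrow> bool" where
 "weighted_eigenfunction t \<mu> \<phi> \<equiv> smooth_function A \<phi> \<and> (\<forall>x. laplacian A g \<phi> x = (\<mu> * exp (- t * f x)) *\<^sub>R \<phi> x)"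

text \<open>The functions \<open>h j\<close> below play the role of the eigenvalue branches.
  \<open>eigenvalue_drop\<close> places every bad parameter in the drop set of some branch with
  index at most \<open>J\<close>, and \<open>mono_drop_set_cover\<close> covers each drop
  set.\<close>

lemma bad_parameters_cover:
 "\<exists>D>0. \<forall>r l \<epsilon>. 0 \<le> l \<and> r - l \<ge> 1 \<and> \<epsilon> > 0 \<longrightarrow>
   (\<exists>U\<in>sets borel. emeasure lborel U \<le> ennreal (D * (2 + r + l) * (4 * l / \<epsilon>)) \<and>
    {t \<in> {0..1}. \<exists>\<mu>\<in>{r - l..r + l}. \<exists>\<phi>. weighted_eigenfunction t \<mu> \<phi> \<and> weight t \<phi> \<phi> = 1 \<and> mass t \<phi> > \<epsilon>} \<subseteq> U)"
proof -
 obtain D where D: "\<forall>t\<ge>0. \<forall>a\<ge>0. \<forall>k. low_dim t a k \<longrightarrow> real k \<le> D * (1 + a)" "D > 0"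
  using low_dim_bound by blast
 show ?thesis
 proof (intro exI[of _ "D + 1"] conjI allI impI)
  show "D + 1 > 0" using D by simp
 next
  fix r l \<epsilon> :: real assume "0 \<le> l \<and> r - l \<ge> 1 \<and> \<epsilon> > 0"
  then have l: "0 \<le> l" and r: "r - l \<ge> 1" and \<epsilon>: "\<epsilon> > 0" by auto
  let ?B = "{t \<in> {0..1}. \<exists>\<mu>\<in>{r - l..r + l}. \<exists>\<phi>. weighted_eigenfunction t \<mu> \<phi> \<and> weight t \<phi> \<phi> = 1 \<and> mass t \<phi> > \<epsilon>}"
  let ?top = "r + l + 1"
  \<comment> \<open>Adding every level from one above the window upwards keeps the set nonempty, so
    that its infimum is meaningful, and leaves infima inside the window unaffected.\<close>
  define S where "S j t = {a. 0 \<le> a \<and> (a \<ge> ?top \<or> low_dim t a j)}" for j t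
  define h where "h j t = Inf (S j t)" for j t
  have S_top: "?top \<in> S j t" for j t using l r by (simp add: S_def)
  have bdd: "bdd_below (S j t)" for j t unfolding S_def by (rule bdd_belowI[of _ 0]) auto
  have h_mono: "h j s \<le> h j t" if "s \<le> t" for j s t
   unfolding h_def
  proof (rule cInf_superset_mono)
   show "S j t \<subseteq> S j s" unfolding S_def using low_dim_mono that by blast
  qed (use S_top[of j t] bdd[of j s] in blast)+
  define J where "J = nat \<lfloor>D * (1 + (r + l))\<rfloor>"
  \<comment> \<open>Since \<open>\<mu> \<ge> 1\<close> in the window, this lies strictly below
    \<open>\<mu> * \<epsilon>\<close>. The window length \<open>2 * l\<close> over
    \<open>\<kappa>\<close> yields the factor \<open>4 * l / \<epsilon>\<close>.\<close>
  define \<kappa> where "\<kappa> = \<epsilon> / 2"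
  have \<kappa>: "\<kappa> > 0" using \<epsilon> by (simp add: \<kappa>_def)
  let ?E = "\<lambda>j. {t \<in> {0..1}. r - l \<le> h j t \<and> h j t \<le> r + l \<and>
   (\<exists>\<delta>>0. \<forall>s. 0 < s \<and> s < \<delta> \<and> s \<le> t \<longrightarrow> h j (t - s) \<le> h j t - \<kappa> * s)}"
  define P where "P j U \<longleftrightarrow> U \<in> sets borel \<and> emeasure lborel U \<le> ennreal ((r + l - (r - l)) / \<kappa>) \<and> ?E j \<subseteq> U" for j U
  have "\<exists>U. P j U" for j
   using mono_drop_set_cover[of "h j" \<kappa> "r - l" "r + l"] h_mono \<kappa> l unfolding P_def by auto
  then obtain U where "\<And>j. P j (U j)" by metis
  then have U: "\<And>j. U j \<in> sets borel" "\<And>j. emeasure lborel (U j) \<le> ennreal ((r + l - (r - l)) / \<kappa>)"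
   "\<And>j. ?E j \<subseteq> U j" unfolding P_def by blast+
  have "?B \<subseteq> (\<Union>j\<le>J. U j)"
  proof
   fix t assume "t \<in> ?B"
   then obtain \<mu> \<phi> where t: "0 \<le> t" "t \<le> 1" and \<mu>: "r - l \<le> \<mu>" "\<mu> \<le> r + l" and \<phi>: "smooth_function A \<phi>"
    "\<And>x. laplacian A g \<phi> x = (\<mu> * exp (- t * f x)) *\<^sub>R \<phi> x" "weight t \<phi> \<phi> = 1" "mass t \<phi> > \<epsilon>" by auto
   have \<mu>1: "\<mu> \<ge> 1" using \<mu> r by linarith
   have "1 * \<epsilon> \<le> \<mu> * \<epsilon>" using \<mu>1 \<epsilon> by (intro mult_right_mono) auto
   then have "\<kappa> < \<mu> * \<epsilon>" using \<epsilon> by (simp add: \<kappa>_def)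
   then obtain k \<delta> where \<delta>: "\<delta> > 0" and no: "\<And>a. 0 \<le> a \<Longrightarrow> a < \<mu> \<Longrightarrow> \<not> low_dim t a (Suc k)"
    and yes: "\<And>s. 0 \<le> s \<Longrightarrow> s < \<delta> \<Longrightarrow> \<kappa> * s \<le> \<mu> \<and> low_dim (t - s) (\<mu> - \<kappa> * s) (Suc k)"
    using eigenvalue_drop[OF \<phi>(1,2,3) t(1) \<kappa> _ _ \<phi>(4)] \<mu>1 by (metis less_le_trans zero_less_one)
   have "low_dim t \<mu> (Suc k)" using yes[of 0] \<delta> by simp
   then have "real (Suc k) \<le> D * (1 + \<mu>)" using D(1)[rule_format, of t \<mu> "Suc k"] t(1) \<mu>1 by simp
   also have "\<dots> \<le> D * (1 + (r + l))" using \<mu> D(2) by simp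
   finally have kJ: "Suc k \<le> J" unfolding J_def by (simp add: le_nat_floor)
   have ge: "\<mu> \<le> h (Suc k) t"
    unfolding h_def
   proof (rule cInf_greatest)
    fix a assume "a \<in> S (Suc k) t"
    then show "\<mu> \<le> a" using no[of a] \<mu> l unfolding S_def by (cases "a < \<mu>") auto
   qed (use S_top in auto)
   have le: "h (Suc k) (t - s) \<le> \<mu> - \<kappa> * s" if "0 \<le> s" "s < \<delta>" for s
    unfolding h_def by (rule cInf_lower[OF _ bdd]) (use yes[OF that] in \<open>auto simp: S_def\<close>)
   have eq: "h (Suc k) t = \<mu>" using ge le[of 0] \<delta> by simp
   have "t \<in> ?E (Suc k)"
    using t \<mu> eq le \<delta> by auto
   then show "t \<in> (\<Union>j\<le>J. U j)" using U(3) kJ by blast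
  qed
  moreover have "emeasure lborel (\<Union>j\<le>J. U j) \<le> ennreal ((D + 1) * (2 + r + l) * (4 * l / \<epsilon>))"
  proof -
   have "emeasure lborel (\<Union>j\<le>J. U j) \<le> (\<Sum>j\<le>J. emeasure lborel (U j))"
    using U(1) by (intro emeasure_subadditive_finite) auto
   also have "\<dots> \<le> (\<Sum>j\<le>J. ennreal (4 * l / \<epsilon>))"
    using U(2) by (intro sum_mono) (simp add: \<kappa>_def)
   also have "\<dots> = ennreal (real (Suc J) * (4 * l / \<epsilon>))"
    using l \<epsilon> by (subst sum_ennreal) auto
   also have "\<dots> \<le> ennreal ((D + 1) * (2 + r + l) * (4 * l / \<epsilon>))"
   proof (intro ennreal_leI mult_right_mono)
    have "real J \<le> D * (1 + (r + l))" using D(2) l r by (simp add: J_def)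
    then show "real (Suc J) \<le> (D + 1) * (2 + r + l)" using D(2) l r by (simp add: algebra_simps)
   qed (use l \<epsilon> in auto)
   finally show ?thesis .
  qed
  moreover have "(\<Union>j\<le>J. U j) \<in> sets borel" using U(1) by auto
  ultimately show "\<exists>U\<in>sets borel. emeasure lborel U \<le> ennreal ((D + 1) * (2 + r + l) * (4 * l / \<epsilon>)) \<and> ?B \<subseteq> U"
   by blast
 qed
qed

end

section \<open>Quasi-modes and the spectrum\<close>

text \<open>The real part of the complex inner product. The operator and the spectral parameters of
  interest are real, so complex-valued functions can be treated as a real space.\<close>

definition L2_inner :: "'a measure \<Rightarrow> ('a \<Rightarrow> complex) \<Rightarrow> ('a \<Rightarrow> complex) \<Rightarrow> real" where
 "L2_inner M u v = (LINT x|M. u x \<bullet> v x)"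

lemma L2_norm_on_nonneg: "L2_norm_on M u \<ge> 0"
 by (simp add: L2_norm_on_def integral_nonneg_AE)

lemma L2_norm_on_sq: "(L2_norm_on M u)^2 = L2_inner M u u"
 by (simp add: L2_norm_on_def L2_inner_def power2_norm_eq_inner integral_nonneg_AE)

lemma square_integrable_inner:
 assumes "square_integrable M u" "square_integrable M v"
 shows "integrable M (\<lambda>x. u x \<bullet> v x)"
proof (rule Bochner_Integration.integrable_bound)
 show "integrable M (\<lambda>x. (cmod (u x))^2 + (cmod (v x))^2)"
  using assms by (simp add: square_integrable_def)
 show "(\<lambda>x. u x \<bullet> v x) \<in> borel_measurable M"
  using assms by (intro borel_measurable_inner) (auto simp: square_integrable_def)
 have "\<bar>u x \<bullet> v x\<bar> \<le> (cmod (u x))^2 + (cmod (v x))^2" for x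
 proof -
  have "\<bar>2 * (u x \<bullet> v x)\<bar> \<le> (cmod (u x))^2 + (cmod (v x))^2"
   using inner_young[of 1 "u x" "v x"] by (simp add: power2_norm_eq_inner)
  then show ?thesis using zero_le_power2[of "cmod (u x)"] zero_le_power2[of "cmod (v x)"] by linarith
 qed
 then show "AE x in M. norm (u x \<bullet> v x) \<le> norm ((cmod (u x))^2 + (cmod (v x))^2)" by simp
qed

lemma square_integrable_scaleR: "square_integrable M u \<Longrightarrow> square_integrable M (\<lambda>x. (s::real) *\<^sub>R u x)"
 by (auto simp: square_integrable_def power_mult_distrib)

lemma square_integrable_add:
 assumes u: "square_integrable M u" and v: "square_integrable M v"
 shows "square_integrable M (\<lambda>x. u x + v x)"
proof -
 have "integrable M (\<lambda>x. (cmod (u x))^2 + 2 * (u x \<bullet> v x) + (cmod (v x))^2)"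
  using square_integrable_inner[OF assms] assms by (simp add: square_integrable_def)
 moreover have "(\<lambda>x. (cmod (u x))^2 + 2 * (u x \<bullet> v x) + (cmod (v x))^2) = (\<lambda>x. (cmod (u x + v x))^2)"
  by (auto simp: power2_norm_eq_inner inner_add_left inner_add_right inner_commute)
 moreover have "(\<lambda>x. u x + v x) \<in> borel_measurable M"
  using assms by (intro borel_measurable_add) (auto simp: square_integrable_def)
 ultimately show ?thesis by (simp add: square_integrable_def)
qed

lemma square_integrable_diff:
 assumes "square_integrable M u" "square_integrable M v"
 shows "square_integrable M (\<lambda>x. u x - v x)"
 using square_integrable_add[OF assms(1) square_integrable_scaleR[OF assms(2), of "-1"]] by simp

lemma L2_inner_sym: "L2_inner M u v = L2_inner M v u"
 by (simp add: L2_inner_def inner_commute)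

lemma L2_inner_add_scaleR:
 assumes "square_integrable M u" "square_integrable M v" "square_integrable M w"
 shows "L2_inner M w (\<lambda>x. u x + s *\<^sub>R v x) = L2_inner M w u + s * L2_inner M w v"
 using square_integrable_inner[OF assms(3,1)] square_integrable_inner[OF assms(3,2)]
 by (simp add: L2_inner_def inner_add_right)

lemma L2_norm_on_add_scaleR_sq:
 assumes "square_integrable M u" "square_integrable M v"
 shows "(L2_norm_on M (\<lambda>x. u x + s *\<^sub>R v x))^2 = (L2_norm_on M u)^2 + 2 * s * L2_inner M u v + s^2 * (L2_norm_on M v)^2"
proof -
 let ?w = "\<lambda>x. u x + s *\<^sub>R v x"
 have w: "square_integrable M ?w" by (intro square_integrable_add square_integrable_scaleR assms)
 have "L2_inner M ?w ?w = L2_inner M u ?w + s * L2_inner M v ?w"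
  unfolding L2_inner_add_scaleR[OF assms w]
  by (simp only: L2_inner_sym[of M ?w u] L2_inner_sym[of M ?w v])
 also have "\<dots> = (L2_inner M u u + s * L2_inner M u v) + s * (L2_inner M v u + s * L2_inner M v v)"
  by (simp only: L2_inner_add_scaleR[OF assms assms(1)] L2_inner_add_scaleR[OF assms assms(2)])
 also have "\<dots> = L2_inner M u u + 2 * s * L2_inner M u v + s^2 * L2_inner M v v"
  by (simp add: L2_inner_sym[of M v u] power2_eq_square algebra_simps)
 finally show ?thesis by (simp only: L2_norm_on_sq)
qed

text \<open>The squared norm of \<open>u + s v\<close> is a nonnegative quadratic polynomial in
  \<open>s\<close>. Functions of norm zero need not be zero, so the degenerate case is treated
  separately.\<close>

lemma L2_Cauchy_Schwarz:
 assumes "square_integrable M u" "square_integrable M v"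
 shows "\<bar>L2_inner M u v\<bar> \<le> L2_norm_on M u * L2_norm_on M v"
proof -
 let ?a = "(L2_norm_on M u)^2" and ?b = "L2_inner M u v" and ?c = "(L2_norm_on M v)^2"
 have q: "0 \<le> ?a + 2 * s * ?b + s^2 * ?c" for s
  using L2_norm_on_add_scaleR_sq[OF assms, of s] by (metis zero_le_power2)
 have "?b^2 \<le> ?a * ?c"
 proof (cases "?c = 0")
  case True
  have "?b = 0"
  proof (rule ccontr)
   assume b: "?b \<noteq> 0"
   \<comment> \<open>At this \<open>s\<close> the polynomial, which is affine in the degenerate
     case, would be negative.\<close>
   have "0 \<le> ?a + 2 * (- (?a + 1) / ?b) * ?b" using q[of "- (?a + 1) / ?b"] True by simp
   also have "\<dots> = - ?a - 2" using b by simp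
   finally show False using zero_le_power2[of "L2_norm_on M u"] by linarith
  qed
  then show ?thesis by simp
 next
  case False
  then have c: "?c > 0" by (simp add: less_le)
  have "0 \<le> ?c * (?a + 2 * (- ?b / ?c) * ?b + (- ?b / ?c)^2 * ?c)"
   using q[of "- ?b / ?c"] c by (intro mult_nonneg_nonneg) auto
  also have "\<dots> = ?a * ?c - ?b^2"
  proof -
   have "c * (a + 2 * (- b / c) * b + (- b / c)^2 * c) = a * c - b^2" if "c \<noteq> 0" for a b c :: real
    using that by (simp add: power2_eq_square field_simps)
   then show ?thesis using False by blast
  qed
  finally show ?thesis by simp
 qed
 then have "\<bar>?b\<bar>^2 \<le> (L2_norm_on M u * L2_norm_on M v)^2" by (simp add: power_mult_distrib)
 then show ?thesis by (rule power2_le_imp_le) (simp add: L2_norm_on_nonneg)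
qed

lemma L2_norm_on_scaleR: "L2_norm_on M (\<lambda>x. s *\<^sub>R u x) = \<bar>s\<bar> * L2_norm_on M u"
 by (simp add: L2_norm_on_def power_mult_distrib real_sqrt_mult)

lemma L2_norm_on_triangle:
 assumes "square_integrable M u" "square_integrable M v"
 shows "L2_norm_on M (\<lambda>x. u x + v x) \<le> L2_norm_on M u + L2_norm_on M v"
proof -
 have "(L2_norm_on M (\<lambda>x. u x + v x))^2 = (L2_norm_on M u)^2 + 2 * L2_inner M u v + (L2_norm_on M v)^2"
  using L2_norm_on_add_scaleR_sq[OF assms, of 1] by simp
 also have "\<dots> \<le> (L2_norm_on M u + L2_norm_on M v)^2"
  using L2_Cauchy_Schwarz[OF assms] by (simp add: power2_sum)
 finally show ?thesis by (rule power2_le_imp_le) (simp add: L2_norm_on_nonneg)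
qed

lemma L2_norm_on_triangle_scaleR:
 assumes "square_integrable M u" "square_integrable M v"
 shows "L2_norm_on M (\<lambda>x. u x + s *\<^sub>R v x) \<le> L2_norm_on M u + \<bar>s\<bar> * L2_norm_on M v"
 using L2_norm_on_triangle[OF assms(1) square_integrable_scaleR[OF assms(2)]] by (simp add: L2_norm_on_scaleR)

lemma L2_norm_on_cong_AE:
 assumes "square_integrable M u" "square_integrable M v" "AE x in M. u x = v x"
 shows "L2_norm_on M u = L2_norm_on M v"
proof -
 have "(LINT x|M. (cmod (u x))^2) = (LINT x|M. (cmod (v x))^2)"
  by (rule integral_cong_AE) (use assms in \<open>auto simp: square_integrable_def\<close>)
 then show ?thesis by (simp add: L2_norm_on_def)
qed

lemma L2_inner_tendsto:
 assumes a: "\<And>n. square_integrable M (a n)" "square_integrable M a'" "(\<lambda>n. L2_norm_on M (\<lambda>x. a n x - a' x)) \<longlonglongrightarrow> 0"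
  and b: "\<And>n. square_integrable M (b n)" "square_integrable M b'" "(\<lambda>n. L2_norm_on M (\<lambda>x. b n x - b' x)) \<longlonglongrightarrow> 0"
 shows "(\<lambda>n. L2_inner M (a n) (b n)) \<longlonglongrightarrow> L2_inner M a' b'"
proof (rule LIM_zero_cancel, rule Lim_null_comparison)
 let ?d = "\<lambda>n x. a n x - a' x" and ?e = "\<lambda>n x. b n x - b' x"
 let ?B = "\<lambda>n. L2_norm_on M (?d n) * L2_norm_on M (?e n) + L2_norm_on M (?d n) * L2_norm_on M b' + L2_norm_on M a' * L2_norm_on M (?e n)"
 have d: "square_integrable M (?d n)" and e: "square_integrable M (?e n)" for n
  using a b by (auto intro: square_integrable_diff)
 have "L2_inner M (a n) (b n) - L2_inner M a' b' = L2_inner M (?d n) (?e n) + L2_inner M (?d n) b' + L2_inner M a' (?e n)" for n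
 proof -
  note i = square_integrable_inner[OF a(1)[of n] b(1)[of n]] square_integrable_inner[OF a(2) b(2)]
   square_integrable_inner[OF d[of n] e[of n]] square_integrable_inner[OF d[of n] b(2)] square_integrable_inner[OF a(2) e[of n]]
  have "L2_inner M (?d n) (?e n) + L2_inner M (?d n) b' + L2_inner M a' (?e n)
    = (LINT x|M. ?d n x \<bullet> ?e n x + ?d n x \<bullet> b' x + a' x \<bullet> ?e n x)"
   using i by (simp add: L2_inner_def)
  also have "\<dots> = (LINT x|M. a n x \<bullet> b n x - a' x \<bullet> b' x)"
   by (intro Bochner_Integration.integral_cong) (auto simp: inner_diff_left inner_diff_right)
  also have "\<dots> = L2_inner M (a n) (b n) - L2_inner M a' b'" using i by (simp add: L2_inner_def)
  finally show ?thesis by simp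
 qed
 then have "\<bar>L2_inner M (a n) (b n) - L2_inner M a' b'\<bar> \<le> ?B n" for n
  using L2_Cauchy_Schwarz[OF d[of n] e[of n]] L2_Cauchy_Schwarz[OF d[of n] b(2)] L2_Cauchy_Schwarz[OF a(2) e[of n]]
  by (simp add: abs_le_iff)
 then show "\<forall>\<^sub>F n in sequentially. norm (L2_inner M (a n) (b n) - L2_inner M a' b')
   \<le> ?B n" by simp
 have "?B
  \<longlonglongrightarrow> 0 * 0 + 0 * L2_norm_on M b' + L2_norm_on M a' * 0"
  by (intro tendsto_intros a b)
 then show "?B \<longlonglongrightarrow> 0" by simp
qed

text \<open>Let \<open>S\<close> be the norm of the resolvent \<open>R\<close> at \<open>r\<close>. As \<open>R\<close> is symmetric,
 \<open>R\<^sup>2 - S\<^sup>2 = (R - S) (R + S)\<close> is not bounded below, hence \<open>r + 1/S\<close> or \<open>r - 1/S\<close> is in the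
 spectrum. The quasi-mode gives \<open>1/S \<le> l\<close>.\<close>

lemma symmetric_graph_spectrum:
 fixes G :: "(('a \<Rightarrow> complex) \<times> ('a \<Rightarrow> complex)) set"
 assumes sq: "\<And>u v. (u, v) \<in> G \<Longrightarrow> square_integrable M u \<and> square_integrable M v"
  and sym: "\<And>u v u' v'. (u, v) \<in> G \<Longrightarrow> (u', v') \<in> G \<Longrightarrow> L2_inner M u v' = L2_inner M v u'"
  and lin: "\<And>u v u' v' s. (u, v) \<in> G \<Longrightarrow> (u', v') \<in> G \<Longrightarrow> (\<lambda>x. u x + s *\<^sub>R u' x, \<lambda>x. v x + s *\<^sub>R v' x) \<in> G"
  and quasi: "(u0, v0) \<in> G" "L2_norm_on M u0 > 0" "L2_norm_on M (\<lambda>x. v0 x - r *\<^sub>R u0 x) \<le> l * L2_norm_on M u0"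
  and l: "l > 0"
 defines "Res \<equiv> \<lambda>\<rho>::real. (\<exists>B. \<forall>(u, v)\<in>G. L2_norm_on M u \<le> B * L2_norm_on M (\<lambda>x. v x - \<rho> *\<^sub>R u x)) \<and>
   (\<forall>h. square_integrable M h \<longrightarrow> (\<exists>(u, v)\<in>G. AE x in M. v x - \<rho> *\<^sub>R u x = h x))"
 shows "\<exists>\<rho>\<in>{r - l..r + l}. \<not> Res \<rho>"
proof (rule ccontr)
 assume "\<not> ?thesis"
 then have res: "Res \<rho>" if "\<rho> \<in> {r - l..r + l}" for \<rho> using that by blast
 let ?N = "L2_norm_on M"
 let ?d = "\<lambda>u v x. v x - r *\<^sub>R u x"
 have dsq: "square_integrable M (\<lambda>x. v x - s *\<^sub>R u x)" if "(u, v) \<in> G" for u v s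
  using sq[OF that] by (intro square_integrable_diff square_integrable_scaleR) auto
 define Bs where "Bs = {B. 0 \<le> B \<and> (\<forall>(u, v)\<in>G. ?N u \<le> B * ?N (?d u v))}"
 define S where "S = Inf Bs"
 have "Res r" using res l by simp
 then obtain B where B: "\<forall>(u, v)\<in>G. ?N u \<le> B * ?N (?d u v)" unfolding Res_def by blast
 have "max B 0 \<in> Bs"
 proof -
  have "?N u \<le> max B 0 * ?N (?d u v)" if "(u, v) \<in> G" for u v
  proof -
   have "B * ?N (?d u v) \<le> max B 0 * ?N (?d u v)" by (intro mult_right_mono L2_norm_on_nonneg) simp
   then show ?thesis using B that by fastforce
  qed
  then show ?thesis by (auto simp: Bs_def)
 qed
 then have ne: "Bs \<noteq> {}" by blast
 have bdd: "bdd_below Bs" unfolding Bs_def by (rule bdd_belowI[of _ 0]) auto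
 have S0: "S \<ge> 0" unfolding S_def by (rule cInf_greatest[OF ne]) (simp add: Bs_def)
 have S: "?N u \<le> S * ?N (?d u v)" if uv: "(u, v) \<in> G" for u v
 proof (cases "?N (?d u v) = 0")
  case True
  have "?N u \<le> B * ?N (?d u v)" using B uv by blast
  then show ?thesis using True by simp
 next
  case False
  then have d: "?N (?d u v) > 0" using L2_norm_on_nonneg[of M "?d u v"] by linarith
  have "?N u / ?N (?d u v) \<le> S"
   unfolding S_def by (rule cInf_greatest[OF ne]) (use uv d in \<open>auto simp: Bs_def divide_le_eq\<close>)
  then show ?thesis using d by (simp add: divide_le_eq)
 qed
 have "?N u0 \<le> S * (l * ?N u0)"
  using S[OF quasi(1)] mult_left_mono[OF quasi(3) S0] by linarith
 then have Sl: "1 \<le> S * l" using quasi(2) by simp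
 then have Spos: "S > 0" using S0 l by (cases "S = 0") auto
 have inv: "1 / S \<le> l" using Sl Spos by (simp add: field_simps)
 have "Res (r + 1 / S)" "Res (r - 1 / S)"
 proof -
  have "0 < 1 / S" using Spos by simp
  then have "r + 1 / S \<in> {r - l..r + l}" "r - 1 / S \<in> {r - l..r + l}"
   using inv l unfolding atLeastAtMost_iff by linarith+
  then show "Res (r + 1 / S)" "Res (r - 1 / S)" using res by blast+
 qed
 then obtain B1 B2 where "\<forall>(u, v)\<in>G. ?N u \<le> B1 * ?N (\<lambda>x. v x - (r + 1 / S) *\<^sub>R u x)"
  "\<forall>(u, v)\<in>G. ?N u \<le> B2 * ?N (\<lambda>x. v x - (r - 1 / S) *\<^sub>R u x)" unfolding Res_def by blast
 then have B1: "\<And>u v. (u, v) \<in> G \<Longrightarrow> ?N u \<le> B1 * ?N (\<lambda>x. v x - (r + 1 / S) *\<^sub>R u x)"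
  and B2: "\<And>u v. (u, v) \<in> G \<Longrightarrow> ?N u \<le> B2 * ?N (\<lambda>x. v x - (r - 1 / S) *\<^sub>R u x)" by blast+
 \<comment> \<open>Resolvent bounds at both points \<open>r + 1/S\<close> and \<open>r - 1/S\<close>
   will yield \<open>?N h \<le> C * e\<close>, with \<open>e\<close> the size of R^2 h - S^2 h. The
   choice of \<open>\<delta>\<close> makes this incompatible with the smallness of
   \<open>e\<close>.\<close>
 define C where "C = (1 / S) * ((1 + \<bar>B2\<bar> / S) * ((1 / S) * (1 + \<bar>B1\<bar> / S)))"
 have C: "C > 0" unfolding C_def using Spos by (intro mult_pos_pos add_pos_nonneg) auto
 define \<delta> where "\<delta> = min S (1 / (4 * C^2 * S ^ 3))"
 have \<delta>: "\<delta> > 0" "\<delta> \<le> S" "2 * S ^ 3 * \<delta> * C^2 < 1"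
 proof -
  show "\<delta> > 0" "\<delta> \<le> S" using Spos C by (auto simp: \<delta>_def)
  have "2 * S ^ 3 * \<delta> * C^2 \<le> 2 * S ^ 3 * (1 / (4 * C^2 * S ^ 3)) * C^2"
   using Spos by (intro mult_right_mono mult_left_mono) (auto simp: \<delta>_def)
  also have "\<dots> = 1 / 2" using Spos C by simp
  finally show "2 * S ^ 3 * \<delta> * C^2 < 1" by simp
 qed
 \<comment> \<open>Minimality of \<open>S\<close> provides an \<open>h\<close> on which the
   resolvent R at \<open>r\<close> almost attains its norm; here \<open>u\<close> is R h.\<close>
 have "S - \<delta> \<notin> Bs" using cInf_lower[OF _ bdd, of "S - \<delta>"] \<delta>(1) by (auto simp: S_def)
 then obtain u v where uv: "(u, v) \<in> G" and big: "?N u > (S - \<delta>) * ?N (?d u v)"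
  using \<delta>(2) unfolding Bs_def by fastforce
 define h where "h = ?d u v"
 have hsq: "square_integrable M h" unfolding h_def by (rule dsq[OF uv])
 note usq = sq[OF uv, THEN conjunct1]
 have h0: "?N h > 0"
 proof (rule ccontr)
  assume "\<not> ?N h > 0"
  then have "?N h = 0" using L2_norm_on_nonneg[of M h] by linarith
  then show False using S[OF uv] big by (simp add: h_def)
 qed
 \<comment> \<open>A second application of R: \<open>u'\<close> represents R u, hence R^2 h, up to
   null sets. By symmetry its product with \<open>h\<close> is the squared norm of
   \<open>u\<close>.\<close>
 have "Res r" by fact
 then obtain u' v' where uv': "(u', v') \<in> G" and ae: "AE x in M. v' x - r *\<^sub>R u' x = u x"
  using usq unfolding Res_def by blast
 note usq' = sq[OF uv', THEN conjunct1] and vsq' = sq[OF uv', THEN conjunct2]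
 have Nu': "?N u' \<le> S * ?N u"
  using S[OF uv'] L2_norm_on_cong_AE[OF dsq[OF uv'] usq ae] by simp
 have ip: "L2_inner M u' h = (?N u)^2"
 proof -
  have "L2_inner M u' h = L2_inner M u' v - r * L2_inner M u' u"
   using L2_inner_add_scaleR[OF sq[OF uv, THEN conjunct2] usq usq', of "- r"] by (simp add: h_def)
  also have "\<dots> = L2_inner M u v' - r * L2_inner M u u'"
   using sym[OF uv' uv] by (simp add: L2_inner_sym)
  also have "\<dots> = L2_inner M u (?d u' v')"
   using L2_inner_add_scaleR[OF vsq' usq' usq, of "- r"] by simp
  also have "\<dots> = L2_inner M u u"
   unfolding L2_inner_def
  proof (rule integral_cong_AE)
   show "AE x in M. u x \<bullet> (v' x - r *\<^sub>R u' x) = u x \<bullet> u x" using ae by eventually_elim simp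
  qed (use usq dsq[OF uv', of r] in \<open>auto simp: square_integrable_def\<close>)
  finally show ?thesis by (simp add: L2_norm_on_sq)
 qed
 \<comment> \<open>Expanding the square and using that R has norm at most \<open>S\<close> and
   almost attains it at \<open>h\<close> bounds \<open>e^2\<close> by a multiple of
   \<open>\<delta>\<close>.\<close>
 define e where "e = ?N (\<lambda>x. u' x + (- (S^2)) *\<^sub>R h x)"
 have "e^2 = (?N u')^2 - 2 * S^2 * (?N u)^2 + (S^2)^2 * (?N h)^2"
  unfolding e_def L2_norm_on_add_scaleR_sq[OF usq' hsq] ip by simp
 also have "\<dots> \<le> (S * ?N u)^2 - 2 * S^2 * (?N u)^2 + (S^2)^2 * (?N h)^2"
  using Nu' by (intro add_right_mono diff_right_mono power_mono L2_norm_on_nonneg)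
 also have "\<dots> = S^2 * (S^2 * (?N h)^2 - (?N u)^2)" by (simp add: power_mult_distrib algebra_simps power2_eq_square)
 also have "\<dots> \<le> S^2 * (S^2 * (?N h)^2 - ((S - \<delta>) * ?N h)^2)"
  using big \<delta>(2) L2_norm_on_nonneg[of M h]
  by (intro mult_left_mono diff_left_mono power_mono) (auto simp: h_def)
 also have "\<dots> = S^2 * (2 * S * \<delta> - \<delta>^2) * (?N h)^2" by (simp add: power2_eq_square algebra_simps)
 also have "\<dots> \<le> S^2 * (2 * S * \<delta>) * (?N h)^2" by (intro mult_right_mono mult_left_mono) auto
 finally have e_le: "e^2 \<le> 2 * S ^ 3 * \<delta> * (?N h)^2" by (simp add: power2_eq_square power3_eq_cube mult_ac)
 have e0: "e \<ge> 0" by (simp add: e_def L2_norm_on_nonneg)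
 \<comment> \<open>\<open>w\<close> is (R + S) R h. Applying the operator minus
   \<open>r + 1/S\<close> gives -1/S times (R^2 - S^2) h, of size \<open>e / S\<close>, so the bound
   at \<open>r + 1/S\<close> makes \<open>w\<close> small.\<close>
 define w where "w = (\<lambda>x. u' x + S *\<^sub>R u x)"
 define z where "z = (\<lambda>x. v' x + S *\<^sub>R v x)"
 have wz: "(w, z) \<in> G" unfolding w_def z_def by (rule lin[OF uv' uv])
 note wsq = sq[OF wz, THEN conjunct1]
 have esq: "square_integrable M (\<lambda>x. u' x + (- (S^2)) *\<^sub>R h x)"
  by (intro square_integrable_add square_integrable_scaleR usq' hsq)
 have key: "AE x in M. z x - (r + 1 / S) *\<^sub>R w x = (- 1 / S) *\<^sub>R (u' x + (- (S^2)) *\<^sub>R h x)"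
  using ae
 proof eventually_elim
  case (elim x)
  then have v': "v' x = u x + r *\<^sub>R u' x" by (simp add: algebra_simps)
  show ?case
   unfolding z_def w_def h_def v' using Spos
   by (simp add: algebra_simps power2_eq_square scaleR_add_left)
 qed
 have n1: "?N (\<lambda>x. z x - (r + 1 / S) *\<^sub>R w x) = (1 / S) * e"
  using L2_norm_on_cong_AE[OF dsq[OF wz] square_integrable_scaleR[OF esq] key] Spos
  unfolding L2_norm_on_scaleR e_def by simp
 have Nw: "?N w \<le> \<bar>B1\<bar> * ((1 / S) * e)"
  using B1[OF wz] n1 mult_right_mono[OF abs_ge_self[of B1], of "(1 / S) * e"] Spos e0 by simp
 \<comment> \<open>\<open>k\<close> is (R + S) h. It is small because it combines \<open>w\<close>
   and its image, and it is \<open>S\<close> times the image of \<open>u\<close> under the operator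
   minus \<open>r - 1/S\<close>. The bound there makes \<open>u\<close> small, and then so is
   \<open>S h = k - u\<close>.\<close>
 define k where "k = (\<lambda>x. u x + S *\<^sub>R h x)"
 have ksq: "square_integrable M k" unfolding k_def by (intro square_integrable_add square_integrable_scaleR usq hsq)
 have "AE x in M. k x = (z x - (r + 1 / S) *\<^sub>R w x) + (1 / S) *\<^sub>R w x"
  using ae
 proof eventually_elim
  case (elim x)
  then have v': "v' x = u x + r *\<^sub>R u' x" by (simp add: algebra_simps)
  show ?case
   unfolding z_def w_def h_def k_def v' by (simp add: algebra_simps scaleR_add_left)
 qed
 then have "?N k = ?N (\<lambda>x. (z x - (r + 1 / S) *\<^sub>R w x) + (1 / S) *\<^sub>R w x)"
  by (intro L2_norm_on_cong_AE ksq square_integrable_add square_integrable_scaleR dsq wz wsq)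
 also have "\<dots> \<le> (1 / S) * e + (1 / S) * ?N w"
  using L2_norm_on_triangle_scaleR[OF dsq[OF wz] wsq, of "r + 1 / S" "1 / S"] n1 Spos by simp
 also have "\<dots> \<le> (1 / S) * e + (1 / S) * (\<bar>B1\<bar> * ((1 / S) * e))"
  using Nw Spos by (intro add_left_mono mult_left_mono) auto
 finally have Nk: "?N k \<le> (1 / S) * (1 + \<bar>B1\<bar> / S) * e" by (simp add: algebra_simps)
 have "(\<lambda>x. v x - (r - 1 / S) *\<^sub>R u x) = (\<lambda>x. (1 / S) *\<^sub>R k x)"
  unfolding k_def h_def using Spos by (auto simp: algebra_simps)
 then have "?N u \<le> B2 * ((1 / S) * ?N k)"
  using B2[OF uv] Spos by (simp add: L2_norm_on_scaleR)
 also have "\<dots> \<le> \<bar>B2\<bar> * ((1 / S) * ?N k)"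
  using Spos L2_norm_on_nonneg[of M k] by (intro mult_right_mono) auto
 finally have Nu: "?N u \<le> \<bar>B2\<bar> / S * ?N k" by simp
 have "S * ?N h = ?N (\<lambda>x. k x + (-1) *\<^sub>R u x)"
  unfolding k_def using L2_norm_on_scaleR[of M S h] Spos by simp
 also have "\<dots> \<le> ?N k + ?N u" using L2_norm_on_triangle_scaleR[OF ksq usq, of "-1"] by simp
 also have "\<dots> \<le> (1 + \<bar>B2\<bar> / S) * ?N k" using Nu by (simp add: algebra_simps)
 also have "\<dots> \<le> (1 + \<bar>B2\<bar> / S) * ((1 / S) * (1 + \<bar>B1\<bar> / S) * e)"
  using Nk Spos by (intro mult_left_mono) auto
 finally have "?N h \<le> C * e"
  using Spos unfolding C_def by (simp add: field_simps)
 then have "(?N h)^2 \<le> (C * e)^2" by (intro power_mono L2_norm_on_nonneg)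
 also have "\<dots> = C^2 * e^2" by (simp add: power_mult_distrib)
 also have "\<dots> \<le> C^2 * (2 * S ^ 3 * \<delta> * (?N h)^2)" by (intro mult_left_mono e_le) simp
 also have "\<dots> = (2 * S ^ 3 * \<delta> * C^2) * (?N h)^2" by simp
 also have "\<dots> < 1 * (?N h)^2" using \<delta>(3) h0 by (intro mult_strict_right_mono) auto
 finally show False by simp
qed

context conformal_family
begin

section \<open>The closed Laplace operator of the conformal metrics\<close>

definition conformal_area :: "real \<Rightarrow> 'a measure" where
 "conformal_area t = area_measure A (conformal_metric f g t)"

lemma f_borel: "f \<in> borel_measurable borel"
 by (rule borel_measurable_continuous_onI[OF f_cont])

lemma conformal_area_eq: "conformal_area t = density area (\<lambda>x. ennreal (exp (- t * f x)))"
 unfolding conformal_area_def by (rule area_measure_conformal[OF f_borel])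

lemma sets_conformal_area: "sets (conformal_area t) = sets borel"
 by (simp add: conformal_area_eq)

lemma borel_measurable_conformal_area: "borel_measurable (conformal_area t) = borel_measurable borel"
 by (rule measurable_cong_sets[OF sets_conformal_area refl])

lemma conformal_area_integrable_iff:
 fixes h :: "'a \<Rightarrow> real"
 assumes "h \<in> borel_measurable borel"
 shows "integrable (conformal_area t) h \<longleftrightarrow> integrable area (\<lambda>x. exp (- t * f x) * h x)"
proof -
 have "integrable (density area (\<lambda>x. ennreal (exp (- t * f x)))) h \<longleftrightarrow> integrable area (\<lambda>x. exp (- t * f x) *\<^sub>R h x)"
  by (rule integrable_density) (use assms f_borel in \<open>auto simp: measurable_cong_sets[OF sets_area refl]\<close>)
 then show ?thesis by (simp add: conformal_area_eq)
qed

lemma conformal_area_integral: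
 fixes h :: "'a \<Rightarrow> real"
 assumes "h \<in> borel_measurable borel"
 shows "(LINT x|conformal_area t. h x) = (LINT x|area. exp (- t * f x) * h x)"
proof -
 have "(LINT x|density area (\<lambda>x. ennreal (exp (- t * f x))). h x) = (LINT x|area. exp (- t * f x) *\<^sub>R h x)"
  by (rule integral_density) (use assms f_borel in \<open>auto simp: measurable_cong_sets[OF sets_area refl]\<close>)
 then show ?thesis by (simp add: conformal_area_eq)
qed

lemma L2_inner_conformal:
 assumes "continuous_on UNIV u" "continuous_on UNIV v"
 shows "L2_inner (conformal_area t) u v = weight t u v"
 unfolding L2_inner_def weight_def
 by (rule conformal_area_integral) (intro borel_measurable_continuous_onI continuous_intros assms)

lemma square_integrable_continuous:
 assumes "continuous_on UNIV u" shows "square_integrable (conformal_area t) u"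
proof -
 have c: "continuous_on UNIV (\<lambda>x. (cmod (u x))^2)" by (intro continuous_intros assms)
 have "integrable area (\<lambda>x. exp (- t * f x) * (cmod (u x))^2)"
  by (intro integrable_area_continuous continuous_intros f_cont assms)
 then show ?thesis
  using conformal_area_integrable_iff[OF borel_measurable_continuous_onI[OF c], of t]
   borel_measurable_continuous_onI[OF assms]
  by (simp add: square_integrable_def borel_measurable_conformal_area)
qed

lemma continuous_laplacian_conformal:
 assumes "smooth_function A u" shows "continuous_on UNIV (laplacian A (conformal_metric f g t) u)"
proof -
 have "laplacian A (conformal_metric f g t) u = (\<lambda>x. exp (t * f x) *\<^sub>R laplacian A g u x)"
  by (rule ext) (rule laplacian_conformal)
 then show ?thesis
  using continuous_laplacian[OF assms] f_cont by (auto intro!: continuous_intros)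
qed

lemma laplace_graph_iff:
 "(u, v) \<in> laplace_graph A (conformal_metric f g t) \<longleftrightarrow>
   square_integrable (conformal_area t) u \<and> square_integrable (conformal_area t) v \<and>
   (\<exists>w. (\<forall>n::nat. smooth_function A (w n)) \<and>
    (\<lambda>n. L2_norm_on (conformal_area t) (\<lambda>x. w n x - u x)) \<longlonglongrightarrow> 0 \<and>
    (\<lambda>n. L2_norm_on (conformal_area t) (\<lambda>x. laplacian A (conformal_metric f g t) (w n) x - v x)) \<longlonglongrightarrow> 0)"
 by (simp add: laplace_graph_def conformal_area_def Let_def)

lemma laplace_graph_smooth:
 assumes "smooth_function A u"
 shows "(u, laplacian A (conformal_metric f g t) u) \<in> laplace_graph A (conformal_metric f g t)"
 unfolding laplace_graph_iff
 using assms square_integrable_continuous[OF smooth_function_continuous[OF assms]]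
  square_integrable_continuous[OF continuous_laplacian_conformal[OF assms]]
 by (intro conjI exI[of _ "\<lambda>_. u"]) (simp_all add: L2_norm_on_def)

text \<open>The factor \<open>exp (t * f x)\<close> of the conformal Laplacian cancels the density
  of the conformal area, which leaves the symmetric pairing of the Laplacian of
  \<open>g\<close>.\<close>

lemma weight_laplacian_sym:
 assumes "smooth_function A u" "smooth_function A v"
 shows "L2_inner (conformal_area t) u (laplacian A (conformal_metric f g t) v)
  = L2_inner (conformal_area t) (laplacian A (conformal_metric f g t) u) v"
proof -
 have *: "weight t p (laplacian A (conformal_metric f g t) q) = (LINT x|area. p x \<bullet> laplacian A g q x)" for p q
  unfolding weight_def laplacian_conformal
  by (rule Bochner_Integration.integral_cong) (auto simp: exp_minus mult.assoc[symmetric])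
 show ?thesis
  using L2_inner_conformal[OF smooth_function_continuous[OF assms(1)] continuous_laplacian_conformal[OF assms(2)]]
   L2_inner_conformal[OF smooth_function_continuous[OF assms(2)] continuous_laplacian_conformal[OF assms(1)]]
   laplacian_symmetric[OF assms]
  by (simp add: * L2_inner_sym[of _ "laplacian A (conformal_metric f g t) u"])
qed

lemma laplace_graph_symmetric:
 assumes "(u, v) \<in> laplace_graph A (conformal_metric f g t)" "(u', v') \<in> laplace_graph A (conformal_metric f g t)"
 shows "L2_inner (conformal_area t) u v' = L2_inner (conformal_area t) v u'"
proof -
 let ?M = "conformal_area t" and ?L = "laplacian A (conformal_metric f g t)"
 obtain w where w: "\<And>n::nat. smooth_function A (w n)" "(\<lambda>n. L2_norm_on ?M (\<lambda>x. w n x - u x)) \<longlonglongrightarrow> 0"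
  "(\<lambda>n. L2_norm_on ?M (\<lambda>x. ?L (w n) x - v x)) \<longlonglongrightarrow> 0" using assms(1) unfolding laplace_graph_iff by blast
 obtain w' where w': "\<And>n::nat. smooth_function A (w' n)" "(\<lambda>n. L2_norm_on ?M (\<lambda>x. w' n x - u' x)) \<longlonglongrightarrow> 0"
  "(\<lambda>n. L2_norm_on ?M (\<lambda>x. ?L (w' n) x - v' x)) \<longlonglongrightarrow> 0" using assms(2) unfolding laplace_graph_iff by blast
 have sq: "square_integrable ?M u" "square_integrable ?M v" "square_integrable ?M u'" "square_integrable ?M v'"
  using assms unfolding laplace_graph_iff by blast+
 note s = square_integrable_continuous[OF smooth_function_continuous]
 note sL = square_integrable_continuous[OF continuous_laplacian_conformal]
 have "(\<lambda>n. L2_inner ?M (w n) (?L (w' n))) \<longlonglongrightarrow> L2_inner ?M u v'"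
  by (rule L2_inner_tendsto[OF s[OF w(1)] sq(1) w(2) sL[OF w'(1)] sq(4) w'(3)])
 moreover have "(\<lambda>n. L2_inner ?M (?L (w n)) (w' n)) \<longlonglongrightarrow> L2_inner ?M v u'"
  by (rule L2_inner_tendsto[OF sL[OF w(1)] sq(2) w(3) s[OF w'(1)] sq(3) w'(2)])
 ultimately show ?thesis
  using weight_laplacian_sym[OF w(1) w'(1)] LIMSEQ_unique by simp
qed

lemma laplace_graph_add_scaleR:
 assumes "(u, v) \<in> laplace_graph A (conformal_metric f g t)" "(u', v') \<in> laplace_graph A (conformal_metric f g t)"
 shows "(\<lambda>x. u x + s *\<^sub>R u' x, \<lambda>x. v x + s *\<^sub>R v' x) \<in> laplace_graph A (conformal_metric f g t)"
proof -
 let ?M = "conformal_area t" and ?L = "laplacian A (conformal_metric f g t)"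
 obtain w where w: "\<And>n::nat. smooth_function A (w n)" "(\<lambda>n. L2_norm_on ?M (\<lambda>x. w n x - u x)) \<longlonglongrightarrow> 0"
  "(\<lambda>n. L2_norm_on ?M (\<lambda>x. ?L (w n) x - v x)) \<longlonglongrightarrow> 0" using assms(1) unfolding laplace_graph_iff by blast
 obtain w' where w': "\<And>n::nat. smooth_function A (w' n)" "(\<lambda>n. L2_norm_on ?M (\<lambda>x. w' n x - u' x)) \<longlonglongrightarrow> 0"
  "(\<lambda>n. L2_norm_on ?M (\<lambda>x. ?L (w' n) x - v' x)) \<longlonglongrightarrow> 0" using assms(2) unfolding laplace_graph_iff by blast
 have sq: "square_integrable ?M u" "square_integrable ?M v" "square_integrable ?M u'" "square_integrable ?M v'"
  using assms unfolding laplace_graph_iff by blast+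
 note s = square_integrable_continuous[OF smooth_function_continuous]
 note sL = square_integrable_continuous[OF continuous_laplacian_conformal]
 have lim: "(\<lambda>n. L2_norm_on ?M (\<lambda>x. (a n x + s *\<^sub>R a' n x) - (b x + s *\<^sub>R b' x))) \<longlonglongrightarrow> 0"
  if a: "\<And>n. square_integrable ?M (a n)" "square_integrable ?M b" "(\<lambda>n. L2_norm_on ?M (\<lambda>x. a n x - b x)) \<longlonglongrightarrow> 0"
   and a': "\<And>n. square_integrable ?M (a' n)" "square_integrable ?M b'" "(\<lambda>n. L2_norm_on ?M (\<lambda>x. a' n x - b' x)) \<longlonglongrightarrow> 0"
  for a a' :: "nat \<Rightarrow> 'a \<Rightarrow> complex" and b b'
 proof (rule Lim_null_comparison)
  let ?B = "\<lambda>n. L2_norm_on ?M (\<lambda>x. a n x - b x) + \<bar>s\<bar> * L2_norm_on ?M (\<lambda>x. a' n x - b' x)"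
  have "L2_norm_on ?M (\<lambda>x. (a n x + s *\<^sub>R a' n x) - (b x + s *\<^sub>R b' x))
    \<le> ?B n" for n
   using L2_norm_on_triangle_scaleR[OF square_integrable_diff[OF a(1,2)] square_integrable_diff[OF a'(1,2)], of n s n]
   by (simp add: algebra_simps)
  then show "\<forall>\<^sub>F n in sequentially. norm (L2_norm_on ?M (\<lambda>x. (a n x + s *\<^sub>R a' n x) - (b x + s *\<^sub>R b' x)))
    \<le> ?B n"
   by (simp add: L2_norm_on_nonneg)
  have "?B \<longlonglongrightarrow> 0 + \<bar>s\<bar> * 0"
   by (intro tendsto_intros a a')
  then show "?B \<longlonglongrightarrow> 0" by simp
 qed
 have L: "?L (\<lambda>x. w n x + s *\<^sub>R w' n x) = (\<lambda>x. ?L (w n) x + s *\<^sub>R ?L (w' n) x)" for n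
  unfolding laplacian_conformal[abs_def]
  using laplacian_add[OF w(1) smooth_function_scaleR[OF w'(1)]] laplacian_scaleR[OF w'(1)]
  by (auto simp: laplacian_conformal scaleR_add_right)
 show ?thesis
  unfolding laplace_graph_iff
 proof (intro conjI exI[of _ "\<lambda>n x. w n x + s *\<^sub>R w' n x"])
  show "(\<lambda>n. L2_norm_on ?M (\<lambda>x. w n x + s *\<^sub>R w' n x - (u x + s *\<^sub>R u' x))) \<longlonglongrightarrow> 0"
   by (rule lim[OF s[OF w(1)] sq(1) w(2) s[OF w'(1)] sq(3) w'(2)])
  show "(\<lambda>n. L2_norm_on ?M (\<lambda>x. ?L (\<lambda>x. w n x + s *\<^sub>R w' n x) x - (v x + s *\<^sub>R v' x))) \<longlonglongrightarrow> 0"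
   unfolding L by (rule lim[OF sL[OF w(1)] sq(2) w(3) sL[OF w'(1)] sq(4) w'(3)])
 qed (use sq w w' in \<open>auto intro!: square_integrable_add square_integrable_scaleR smooth_function_add smooth_function_scaleR\<close>)
qed

text \<open>At a real parameter the two conditions of \<open>laplace_resolvent_set\<close> are those
  of \<open>symmetric_graph_spectrum\<close>, since multiplication by the embedded real number is
  real scaling.\<close>

lemma spectrum_near_quasimode:
 assumes u: "smooth_function A u" and n: "L2_norm_on (conformal_area t) u > 0" and l: "l > 0"
  and q: "L2_norm_on (conformal_area t) (\<lambda>x. laplacian A (conformal_metric f g t) u x - r *\<^sub>R u x)
   \<le> l * L2_norm_on (conformal_area t) u"
 shows "laplace_spectrum A (conformal_metric f g t) \<inter> complex_of_real ` {r - l..r + l} \<noteq> {}"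
proof -
 let ?G = "laplace_graph A (conformal_metric f g t)"
 have "\<exists>\<rho>\<in>{r - l..r + l}. \<not> ((\<exists>B. \<forall>(u, v)\<in>?G. L2_norm_on (conformal_area t) u
    \<le> B * L2_norm_on (conformal_area t) (\<lambda>x. v x - \<rho> *\<^sub>R u x)) \<and>
   (\<forall>h. square_integrable (conformal_area t) h \<longrightarrow> (\<exists>(u, v)\<in>?G. AE x in conformal_area t. v x - \<rho> *\<^sub>R u x = h x)))"
  by (rule symmetric_graph_spectrum[OF _ laplace_graph_symmetric laplace_graph_add_scaleR laplace_graph_smooth[OF u] n q l])
    (auto simp: laplace_graph_iff)
 then obtain \<rho> where \<rho>: "\<rho> \<in> {r - l..r + l}" "complex_of_real \<rho> \<notin> laplace_resolvent_set A (conformal_metric f g t)"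
  unfolding laplace_resolvent_set_def Let_def conformal_area_def scaleR_conv_of_real by blast
 then show ?thesis unfolding laplace_spectrum_def by blast
qed

end

section \<open>Interior estimates for elliptic equations in the plane\<close>

lemma partial_deriv_diff:
 assumes "h differentiable (at y)" "k differentiable (at y)"
 shows "partial_deriv i (\<lambda>z. h z - k z) y = partial_deriv i h y - partial_deriv i k y"
 unfolding partial_deriv_def[of _ h] partial_deriv_def[of _ k]
 by (rule partial_deriv_eqI) (intro has_derivative_diff has_derivative_frechet assms)

lemma integrable_on_compact:
 fixes k :: "real^2 \<Rightarrow> real"
 assumes "compact K" "continuous_on K k"
 shows "integrable lborel (\<lambda>y. indicator K y * k y)"
 using borel_integrable_compact[OF assms] by simp

abbreviation int_over :: "(real^2) set \<Rightarrow> (real^2 \<Rightarrow> real) \<Rightarrow> real" where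
 "int_over K k \<equiv> LINT y|lborel. indicator K y * k y"

lemma integral_compact_mono:
 fixes k l :: "real^2 \<Rightarrow> real"
 assumes "compact L" "compact K" "L \<subseteq> K" "continuous_on K k" "continuous_on K l"
  and "\<And>y. y \<in> K \<Longrightarrow> 0 \<le> l y" "\<And>y. y \<in> L \<Longrightarrow> k y \<le> l y"
 shows "int_over L k \<le> int_over K l"
proof (rule integral_mono)
 show "integrable lborel (\<lambda>y. indicator L y * k y)"
  by (rule integrable_on_compact[OF assms(1) continuous_on_subset[OF assms(4,3)]])
 show "integrable lborel (\<lambda>y. indicator K y * l y)"
  by (rule integrable_on_compact[OF assms(2,5)])
qed (use assms in \<open>auto simp: indicator_def\<close>)

text \<open>A finite sum of bumps rescaled by a positive lower bound on \<open>L\<close>. It exceeds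
  1 on \<open>L\<close>, which is what a weight that bounds the integral over \<open>L\<close> has
  to do.\<close>

lemma exists_cutoff:
 assumes "compact L" "L \<subseteq> interior K"
 shows "\<exists>\<omega>. Ck_on 1 UNIV \<omega> \<and> (\<forall>y\<in>L. \<omega> y \<ge> (1::real)) \<and> (\<forall>y. \<omega> y \<ge> 0) \<and> (\<forall>y. y \<notin> K \<longrightarrow> \<omega> y = 0)"
proof -
 have "\<exists>r>0. cball y r \<subseteq> interior K" if "y \<in> L" for y
  using that assms(2) open_contains_cball[of "interior K"] by auto
 then obtain r where r: "\<And>y. y \<in> L \<Longrightarrow> r y > 0" "\<And>y. y \<in> L \<Longrightarrow> cball y (r y) \<subseteq> interior K" by metis
 have cov: "L \<subseteq> (\<Union>y\<in>L. ball y (r y))" using r(1) by force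
 obtain F where F: "F \<subseteq> L" "finite F" "L \<subseteq> (\<Union>y\<in>F. ball y (r y))"
  by (rule compactE_image[OF assms(1) _ cov]) auto
 define s where "s z = (\<Sum>y\<in>F. bump y (r y) z)" for z
 have s: "Ck_on 1 UNIV s" unfolding s_def[abs_def] by (intro Ck_on_sum Ck_on_bump) simp
 have s_pos: "s z > 0" if "z \<in> L" for z
 proof -
  have "z \<in> (\<Union>y\<in>F. ball y (r y))" using F(3) \<open>z \<in> L\<close> by blast
  then obtain y where y: "y \<in> F" "z \<in> ball y (r y)" by blast
  then have "bump y (r y) z > 0" using bump_pos_iff r(1) F(1) by blast
  then show ?thesis unfolding s_def using F(2) y bump_nonneg by (intro sum_pos2[of _ y]) auto
 qed
 have "\<exists>\<delta>>0. \<forall>z\<in>L. \<delta> \<le> s z"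
  using s_pos by (intro compact_positive_lower_bound assms(1) continuous_on_subset[OF Ck_on_imp_continuous[OF s]]) auto
 then obtain \<delta> where \<delta>: "\<delta> > 0" "\<And>z. z \<in> L \<Longrightarrow> \<delta> \<le> s z" by blast
 have nn: "s z \<ge> 0" for z unfolding s_def by (intro sum_nonneg bump_nonneg)
 have "s z = 0" if "z \<notin> K" for z
  unfolding s_def
 proof (rule sum.neutral, rule ballI)
  fix y assume y: "y \<in> F"
  then have "z \<notin> cball y (r y)" using r(2) F(1) that interior_subset by blast
  then show "bump y (r y) z = 0" using bump_zero r(1) F(1) y ball_subset_cball by blast
 qed
 moreover have "Ck_on 1 UNIV (\<lambda>z. (1 / \<delta>) * s z)" by (intro Ck_on_mult Ck_on_const s open_UNIV)
 ultimately show ?thesis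
  using \<delta> nn by (intro exI[of _ "\<lambda>z. (1 / \<delta>) * s z"]) (auto simp del: Ck_on.simps simp: field_simps)
qed

text \<open>With \<open>p\<close> the gradient of \<open>v\<close>, \<open>d\<close> that of
  \<open>\<omega>\<close> and \<open>f0\<close> the divergence of \<open>G\<close>, the first
  bracket is the divergence of \<open>\<omega>^2 * (v \<bullet> G i)\<close>. Young's inequality
  gives up \<open>\<theta> / 8\<close> of the gradient term to the products with \<open>F\<close>
  and \<open>\<theta> / 16\<close> for each of the two indices to those with \<open>d\<close>; a
  quarter is lost and half is kept.\<close>

lemma caccioppoli_pointwise:
 fixes v f0 :: "'b::real_inner" and p F G :: "2 \<Rightarrow> 'b" and a :: "2 \<Rightarrow> 2 \<Rightarrow> real" and \<omega> :: real and d :: "2 \<Rightarrow> real"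
 assumes G: "\<And>i. G i = (\<Sum>j\<in>UNIV. a i j *\<^sub>R p j) - F i"
  and ell: "\<theta> * (\<Sum>i\<in>UNIV. (norm (p i))^2) \<le> (\<Sum>i\<in>UNIV. \<Sum>j\<in>UNIV. a i j * (p i \<bullet> p j))"
  and \<theta>: "\<theta> > 0" and \<omega>: "0 \<le> \<omega>" "\<omega> \<le> \<gamma>" and d: "\<And>i. \<bar>d i\<bar> \<le> \<beta>" and a: "\<And>i j. \<bar>a i j\<bar> \<le> \<alpha>"
 shows "\<theta> / 2 * \<omega>^2 * (\<Sum>i\<in>UNIV. (norm (p i))^2)
  \<le> (\<omega>^2 * (v \<bullet> f0) + (\<Sum>i\<in>UNIV. (2 * \<omega> * d i * (v \<bullet> G i) + \<omega>^2 * (p i \<bullet> G i))))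
   + (64 * \<alpha>^2 * \<beta>^2 / \<theta> + 2 * \<beta>^2 + 2 * \<gamma>^2 + 4 * \<gamma>^2 / \<theta>) * ((norm v)^2 + (norm f0)^2 + (\<Sum>i\<in>UNIV. (norm (F i))^2))"
proof -
 let ?m = "norm v" and ?q = "\<lambda>i. norm (p i)" and ?f = "\<lambda>i. norm (F i)"
 let ?S = "\<omega>^2 * (v \<bullet> f0) + (\<Sum>i\<in>UNIV. (2 * \<omega> * d i * (v \<bullet> G i) + \<omega>^2 * (p i \<bullet> G i)))"
 have young: "2 * k * (x \<bullet> y) \<le> (1 / e) * (s * norm x)^2 + e * (t * norm y)^2"
  if "\<bar>k\<bar> \<le> s * t" "e > 0" for k s t e and x y :: 'b
 proof -
  have "\<bar>k * (x \<bullet> y)\<bar> \<le> s * t * (norm x * norm y)"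
   unfolding abs_mult using that(1) Cauchy_Schwarz_ineq2[of x y] by (intro mult_mono) auto
  then show ?thesis
   using inner_young[OF that(2), of "s * norm x" "t * norm y"] by (simp add: power2_eq_square abs_le_iff mult_ac)
 qed
 have \<alpha>: "\<alpha> \<ge> 0" and \<beta>: "\<beta> \<ge> 0" using a[of 1 1] d[of 1] by linarith+
 have \<omega>\<omega>: "\<omega> * \<omega> \<le> \<omega> * \<gamma>" "\<omega> * \<gamma> \<le> \<gamma> * \<gamma>" using \<omega> by (auto intro: mult_left_mono mult_right_mono)
 have pF: "\<omega>^2 * (p i \<bullet> F i) \<le> \<theta> / 8 * (\<omega>^2 * (?q i)^2) + 2 / \<theta> * (\<gamma>^2 * (?f i)^2)" for i
  using young[of "\<omega>^2 / 2" \<omega> "\<gamma> / 2" "8 / \<theta>" "p i" "F i"] \<omega>\<omega> \<theta> by (simp add: power_mult_distrib power_divide power2_eq_square[of \<omega>])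
 have vp: "- (2 * \<omega> * d i * a i j * (v \<bullet> p j)) \<le> \<theta> / 16 * (\<omega>^2 * (?q j)^2) + 16 / \<theta> * (\<alpha>^2 * \<beta>^2 * ?m^2)" for i j
 proof -
  have "\<bar>- (\<omega> * d i * a i j)\<bar> \<le> (\<beta> * \<alpha>) * \<omega>"
   using mult_left_mono[OF mult_mono[OF d[of i] a[of i j] \<beta> abs_ge_zero] \<omega>(1)] \<omega>(1) by (simp add: abs_mult mult_ac)
  from young[OF this, of "\<theta> / 16" v "p j"] \<theta> show ?thesis by (simp add: power_mult_distrib mult_ac)
 qed
 have vF: "2 * \<omega> * d i * (v \<bullet> F i) \<le> \<beta>^2 * ?m^2 + \<gamma>^2 * (?f i)^2" for i
 proof -
  have "\<bar>\<omega> * d i\<bar> \<le> \<beta> * \<gamma>" using mult_mono[OF \<omega>(2) d[of i]] \<omega> by (simp add: abs_mult mult.commute)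
  from young[OF this, of 1 v "F i"] show ?thesis by (simp add: power_mult_distrib mult_ac)
 qed
 have v0: "- (\<omega>^2 * (v \<bullet> f0)) \<le> \<gamma>^2 * (?m^2 + (norm f0)^2)"
  using young[of "- (\<omega>^2 / 2)" \<gamma> \<gamma> 1 v f0] \<omega>\<omega> mult_nonneg_nonneg[OF \<omega>(1,1)]
  by (simp add: power_mult_distrib distrib_left power2_eq_square[of \<omega>])
 let ?P = "\<Sum>i\<in>UNIV. (?q i)^2" and ?F = "\<Sum>i\<in>UNIV. (?f i)^2"
 let ?R = "(64 * \<alpha>^2 * \<beta>^2 / \<theta> + 2 * \<beta>^2 + \<gamma>^2) * ?m^2 + \<gamma>^2 * (norm f0)^2 + (2 * \<gamma>^2 / \<theta> + \<gamma>^2) * ?F"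
 have "\<omega>^2 * (\<theta> * ?P) \<le> \<omega>^2 * (\<Sum>i\<in>UNIV. \<Sum>j\<in>UNIV. a i j * (p i \<bullet> p j))"
  by (rule mult_left_mono[OF ell]) simp
 also have "\<dots> = ?S
   + (\<Sum>i\<in>UNIV. \<omega>^2 * (p i \<bullet> F i)) + (\<Sum>i\<in>UNIV. \<Sum>j\<in>UNIV. - (2 * \<omega> * d i * a i j * (v \<bullet> p j)))
   + (\<Sum>i\<in>UNIV. 2 * \<omega> * d i * (v \<bullet> F i)) + (- (\<omega>^2 * (v \<bullet> f0)))"
  unfolding G by (simp add: sum_2 inner_diff_right inner_add_right algebra_simps)
 also have "\<dots> \<le> ?S
   + (\<Sum>i\<in>UNIV. \<theta> / 8 * (\<omega>^2 * (?q i)^2) + 2 / \<theta> * (\<gamma>^2 * (?f i)^2))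
   + (\<Sum>i\<in>(UNIV::2 set). \<Sum>j\<in>UNIV. \<theta> / 16 * (\<omega>^2 * (?q j)^2) + 16 / \<theta> * (\<alpha>^2 * \<beta>^2 * ?m^2))
   + (\<Sum>i\<in>UNIV. \<beta>^2 * ?m^2 + \<gamma>^2 * (?f i)^2) + \<gamma>^2 * (?m^2 + (norm f0)^2)"
  by (intro add_mono sum_mono order_refl pF vp vF v0)
 also have "\<dots> = ?S
   + \<theta> / 4 * \<omega>^2 * ?P
   + ?R"
  by (simp add: sum_2 algebra_simps)
 finally have 1: "\<omega>^2 * (\<theta> * ?P) \<le> ?S
   + \<theta> / 4 * \<omega>^2 * ?P
   + ?R" .
 let ?C = "64 * \<alpha>^2 * \<beta>^2 / \<theta> + 2 * \<beta>^2 + 2 * \<gamma>^2 + 4 * \<gamma>^2 / \<theta>"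
 have pos: "0 \<le> 64 * \<alpha>^2 * \<beta>^2 / \<theta>" "0 \<le> 2 * \<gamma>^2 / \<theta>" "2 * \<gamma>^2 / \<theta> \<le> 4 * \<gamma>^2 / \<theta>" "0 \<le> \<beta>^2" "0 \<le> \<gamma>^2" using \<theta> by (auto simp: divide_right_mono)
 have F0: "?F \<ge> 0" by (simp add: sum_nonneg)
 have "?R
   \<le> ?C * ?m^2 + ?C * (norm f0)^2 + ?C * ?F"
 proof -
  have "64 * \<alpha>^2 * \<beta>^2 / \<theta> + 2 * \<beta>^2 + \<gamma>^2 \<le> ?C" "\<gamma>^2 \<le> ?C" "2 * \<gamma>^2 / \<theta> + \<gamma>^2 \<le> ?C"
   using pos by linarith+
  then have "(64 * \<alpha>^2 * \<beta>^2 / \<theta> + 2 * \<beta>^2 + \<gamma>^2) * ?m^2 \<le> ?C * ?m^2" "\<gamma>^2 * (norm f0)^2 \<le> ?C * (norm f0)^2"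
   "(2 * \<gamma>^2 / \<theta> + \<gamma>^2) * ?F \<le> ?C * ?F"
   by (auto intro!: mult_right_mono F0)
  then show ?thesis by (intro add_mono)
 qed
 moreover define Y where "Y = \<theta> * (\<omega>^2 * ?P)"
 have Y: "\<omega>^2 * (\<theta> * ?P) = Y" "\<theta> / 4 * \<omega>^2 * ?P = Y / 4" "\<theta> / 2 * \<omega>^2 * ?P = Y / 2" by (simp_all add: Y_def)
 have "Y \<ge> 0" unfolding Y_def using \<theta> by (intro mult_nonneg_nonneg sum_nonneg) auto
 moreover have "?C * (?m^2 + (norm f0)^2 + ?F) = ?C * ?m^2 + ?C * (norm f0)^2 + ?C * ?F"
  by (simp only: distrib_left)
 ultimately show ?thesis using 1 unfolding Y by linarith
qed

section \<open>Jets, differential operators and the elliptic equation\<close>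

lemma finite_derivative_lists: "finite {is :: 2 list. length is \<le> n}"
 using finite_lists_length_le[of "UNIV :: 2 set" n] by simp

text \<open>Lists that differ by a permutation are counted separately, so that differentiating is a
  mere prefixing of lists.\<close>

definition jet_sq :: "nat \<Rightarrow> (real^2 \<Rightarrow> complex) \<Rightarrow> real^2 \<Rightarrow> real" where
 "jet_sq n u y = (\<Sum>is | length is \<le> n. (norm (partial_derivs is u y))^2)"

lemma jet_sq_nonneg: "jet_sq n u y \<ge> 0"
 by (simp add: jet_sq_def sum_nonneg)

lemma partial_derivs_le_jet: "length is \<le> n \<Longrightarrow> (norm (partial_derivs is u y))^2 \<le> jet_sq n u y"
 unfolding jet_sq_def
 by (rule member_le_sum[of "is" "{is. length is \<le> n}" "\<lambda>is. (norm (partial_derivs is u y))^2"])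
   (auto intro: finite_derivative_lists)

lemma continuous_on_jet_sq:
 assumes "smooth_on V u" shows "continuous_on V (jet_sq n u)"
 unfolding jet_sq_def[abs_def]
 by (intro continuous_intros smooth_on_imp_continuous smooth_on_partial_derivs assms)

text \<open>Linear differential operators of order at most \<open>n\<close> with smooth real
  coefficients. They depend neither on the function nor on the eigenvalue, so the jet bounds on
  compact sets are uniform in both.\<close>

inductive diffop :: "(real^2) set \<Rightarrow> nat \<Rightarrow> ((real^2 \<Rightarrow> complex) \<Rightarrow> real^2 \<Rightarrow> complex) \<Rightarrow> bool"
 for V n where
 single: "smooth_on V a \<Longrightarrow> length is \<le> n \<Longrightarrow> diffop V n (\<lambda>u y. (a y :: real) *\<^sub>R partial_derivs is u y)"
| plus: "diffop V n S \<Longrightarrow> diffop V n T \<Longrightarrow> diffop V n (\<lambda>u y. S u y + T u y)"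

lemma smooth_on_scaleR:
 "open V \<Longrightarrow> smooth_on V a \<Longrightarrow> smooth_on V u \<Longrightarrow> smooth_on V (\<lambda>y. (a y :: real) *\<^sub>R u y)"
 by (simp add: smooth_on_iff_Ck Ck_on_scaleR)

lemma smooth_on_add:
 "open V \<Longrightarrow> smooth_on V u \<Longrightarrow> smooth_on V v \<Longrightarrow> smooth_on V (\<lambda>y. u y + v y)"
 by (simp add: smooth_on_iff_Ck Ck_on_add)

lemma smooth_on_const: "smooth_on V (\<lambda>y. c)"
 by (simp add: smooth_on_iff_Ck Ck_on_const)

lemma diffop_smooth:
 assumes V: "open V" and u: "smooth_on V u"
 shows "diffop V n S \<Longrightarrow> smooth_on V (S u)"
 by (induction rule: diffop.induct)
   (auto intro!: smooth_on_scaleR smooth_on_add smooth_on_partial_derivs V u)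

lemma diffop_bound:
 assumes K: "compact K" "K \<subseteq> V"
 shows "diffop V n S \<Longrightarrow> \<exists>C\<ge>0. \<forall>u. \<forall>y\<in>K. (norm (S u y))^2 \<le> C * jet_sq n u y"
proof (induction rule: diffop.induct)
 case (single a "is")
 obtain b where b: "\<And>y. y \<in> K \<Longrightarrow> \<bar>a y\<bar> \<le> b"
  using compact_bounded_values[OF K(1) continuous_on_subset[OF smooth_on_imp_continuous[OF single(1)] K(2)]] by blast
 have "(norm (a y *\<^sub>R partial_derivs is u y))^2 \<le> b^2 * jet_sq n u y" if "y \<in> K" for u y
 proof -
  have "(norm (a y *\<^sub>R partial_derivs is u y))^2 = \<bar>a y\<bar>\<^sup>2 * (norm (partial_derivs is u y))^2"
   by (simp add: power_mult_distrib)
  also have "\<dots> \<le> b^2 * jet_sq n u y"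
   using b[OF that] single(2) by (intro mult_mono power_mono partial_derivs_le_jet) auto
  finally show ?thesis .
 qed
 then show ?case by (intro exI[of _ "b^2"]) auto
next
 case (plus S T)
 then obtain C D where C: "C \<ge> 0" "\<And>u y. y \<in> K \<Longrightarrow> (norm (S u y))^2 \<le> C * jet_sq n u y"
  and D: "D \<ge> 0" "\<And>u y. y \<in> K \<Longrightarrow> (norm (T u y))^2 \<le> D * jet_sq n u y" by blast
 have "(norm (S u y + T u y))^2 \<le> (2 * C + 2 * D) * jet_sq n u y" if "y \<in> K" for u y
 proof -
  have "(norm (S u y + T u y))^2 \<le> (norm (S u y) + norm (T u y))^2"
   by (intro power_mono norm_triangle_ineq) simp
  also have "\<dots> \<le> 2 * (norm (S u y))^2 + 2 * (norm (T u y))^2"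
   using zero_le_power2[of "norm (S u y) - norm (T u y)"] unfolding power2_sum power2_diff by linarith
  also have "\<dots> \<le> 2 * (C * jet_sq n u y) + 2 * (D * jet_sq n u y)"
   using C(2)[OF that] D(2)[OF that] by (intro add_mono mult_left_mono) auto
  finally show ?thesis by (simp add: algebra_simps)
 qed
 then show ?case using C(1) D(1) by (intro exI[of _ "2 * C + 2 * D"]) auto
qed

lemma diffop_partial_deriv:
 assumes V: "open V"
 shows "diffop V n S \<Longrightarrow> \<exists>T. diffop V (Suc n) T \<and> (\<forall>u. smooth_on V u \<longrightarrow> (\<forall>y\<in>V. partial_deriv k (S u) y = T u y))"
proof (induction rule: diffop.induct)
 case (single a "is")
 let ?T = "\<lambda>u y. a y *\<^sub>R partial_derivs (k # is) u y + partial_deriv k a y *\<^sub>R partial_derivs is u y"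
 have "diffop V (Suc n) ?T"
  using single by (intro diffop.plus diffop.single smooth_on_partial_deriv) auto
 moreover have "partial_deriv k (\<lambda>y. a y *\<^sub>R partial_derivs is u y) y = ?T u y" if "smooth_on V u" "y \<in> V" for u y
  using partial_deriv_scaleR[OF smooth_on_imp_differentiable[OF single(1) that(2)]
    smooth_on_imp_differentiable[OF smooth_on_partial_derivs[OF that(1)] that(2)]] by simp
 ultimately show ?case by blast
next
 case (plus S T)
 then obtain S' T' where S': "diffop V (Suc n) S'" "\<And>u y. smooth_on V u \<Longrightarrow> y \<in> V \<Longrightarrow> partial_deriv k (S u) y = S' u y"
  and T': "diffop V (Suc n) T'" "\<And>u y. smooth_on V u \<Longrightarrow> y \<in> V \<Longrightarrow> partial_deriv k (T u) y = T' u y" by blast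
 have "partial_deriv k (\<lambda>y. S u y + T u y) y = S' u y + T' u y" if "smooth_on V u" "y \<in> V" for u y
  using partial_deriv_add[OF smooth_on_imp_differentiable[OF diffop_smooth[OF V that(1) plus(1)] that(2)]
    smooth_on_imp_differentiable[OF diffop_smooth[OF V that(1) plus(2)] that(2)]] S'(2) T'(2) that by simp
 then show ?case using diffop.plus[OF S'(1) T'(1)] by (intro exI[of _ "\<lambda>u y. S' u y + T' u y"]) auto
qed

text \<open>Ellipticity is demanded on compact subsets, since the coefficients of a metric may
  degenerate towards the boundary of a chart image. The factor \<open>\<rho>\<close> keeps the
  eigenvalue a scalar parameter in which all estimates are polynomial.\<close>

locale elliptic_equation =
 fixes V :: "(real^2) set" and a :: "2 \<Rightarrow> 2 \<Rightarrow> real^2 \<Rightarrow> real" and \<rho> :: "real^2 \<Rightarrow> real"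
 assumes V: "open V" and a: "\<And>i j. smooth_on V (a i j)" and \<rho>: "smooth_on V \<rho>"
  and elliptic: "\<And>K. compact K \<Longrightarrow> K \<subseteq> V \<Longrightarrow> \<exists>\<theta>>0. \<forall>y\<in>K. \<forall>p::2 \<Rightarrow> complex.
   \<theta> * (\<Sum>i\<in>UNIV. (norm (p i))^2) \<le> (\<Sum>i\<in>UNIV. \<Sum>j\<in>UNIV. a i j y * (p i \<bullet> p j))"
begin

definition principal :: "(real^2 \<Rightarrow> complex) \<Rightarrow> real^2 \<Rightarrow> complex" where
 "principal v y = (\<Sum>i\<in>UNIV. partial_deriv i (\<lambda>z. \<Sum>j\<in>UNIV. a i j z *\<^sub>R partial_deriv j v z) y)"

definition solution :: "real \<Rightarrow> (real^2 \<Rightarrow> complex) \<Rightarrow> bool" where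
 "solution \<mu> u \<longleftrightarrow> smooth_on V u \<and> (\<forall>y\<in>V. principal u y = (\<mu> * \<rho> y) *\<^sub>R u y)"

lemma smooth_flux: "smooth_on V v \<Longrightarrow> smooth_on V (\<lambda>z. \<Sum>j\<in>UNIV. a i j z *\<^sub>R partial_deriv j v z)"
 unfolding sum_2 by (intro smooth_on_add smooth_on_scaleR V a smooth_on_partial_deriv)

text \<open>The equation is tested with \<open>\<omega>^2 v\<close>: the divergence in
  \<open>caccioppoli_pointwise\<close> integrates to zero. A source in divergence form is estimated
  without differentiating \<open>F\<close>, which is what allows differentiated equations to be
  treated by the same lemma.\<close>

lemma caccioppoli:
 assumes K: "compact K" "K \<subseteq> V" and L: "compact L" "L \<subseteq> interior K"
 shows "\<exists>C\<ge>0. \<forall>v f0 F. smooth_on V v \<and> smooth_on V f0 \<and> (\<forall>i. smooth_on V (F i)) \<and>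
   (\<forall>y\<in>V. principal v y = f0 y + (\<Sum>i\<in>UNIV. partial_deriv i (F i) y)) \<longrightarrow>
   int_over L (grad_sq v)
    \<le> C * int_over K (\<lambda>y. (norm (v y))^2 + (norm (f0 y))^2 + (\<Sum>i\<in>UNIV. (norm (F i y))^2))"
proof -
 obtain \<theta> where ell: "\<theta> > 0" "\<And>y p. y \<in> K \<Longrightarrow>
   \<theta> * (\<Sum>i\<in>UNIV. (norm (p i))^2) \<le> (\<Sum>i\<in>UNIV. \<Sum>j\<in>UNIV. a i j y * (p i \<bullet> (p j :: complex)))"
  using elliptic[OF K] by blast
 have a: "Ck_on 1 V (a i j)" for i j using a smooth_on_iff_Ck by blast
 obtain \<omega> where \<omega>: "Ck_on 1 UNIV \<omega>" "\<And>y. y \<in> L \<Longrightarrow> \<omega> y \<ge> (1::real)" "\<And>y. \<omega> y \<ge> 0" "\<And>y. y \<notin> K \<Longrightarrow> \<omega> y = 0"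
  using exists_cutoff[OF L] by blast
 note bounded_K = compact_bounded_values[OF K(1)]
 have cont\<omega>: "continuous_on K \<omega>" "continuous_on K (partial_deriv i \<omega>)" for i
  using \<omega>(1) Ck_on_imp_continuous[OF \<omega>(1)] by (auto intro: continuous_on_subset)
 have conta: "continuous_on K (a i j)" for i j
  using Ck_on_imp_continuous[OF a] K(2) continuous_on_subset by blast
 obtain \<gamma> where \<gamma>: "\<And>y. y \<in> K \<Longrightarrow> \<bar>\<omega> y\<bar> \<le> \<gamma>" using bounded_K[OF cont\<omega>(1)] by blast
 obtain b1 b2 where "\<And>y. y \<in> K \<Longrightarrow> \<bar>partial_deriv 1 \<omega> y\<bar> \<le> b1" "\<And>y. y \<in> K \<Longrightarrow> \<bar>partial_deriv 2 \<omega> y\<bar> \<le> b2"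
  using bounded_K[OF cont\<omega>(2)] by metis
 then have \<beta>: "\<bar>partial_deriv i \<omega> y\<bar> \<le> max b1 b2" if "y \<in> K" for i y
  using exhaust_2[of i] that by fastforce
 have "continuous_on K (\<lambda>y. \<Sum>i\<in>UNIV. \<Sum>j\<in>UNIV. \<bar>a i j y\<bar>)" by (intro continuous_intros conta)
 from bounded_K[OF this] obtain \<alpha> where "\<And>y. y \<in> K \<Longrightarrow> \<bar>\<Sum>i\<in>UNIV. \<Sum>j\<in>UNIV. \<bar>a i j y\<bar>\<bar> \<le> \<alpha>" by blast
 then have \<alpha>: "\<bar>a i j y\<bar> \<le> \<alpha>" if "y \<in> K" for i j y
  using exhaust_2[of i] exhaust_2[of j] that by (fastforce simp: sum_2)
 let ?\<beta> = "max b1 b2"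
 define C0 where "C0 = 64 * \<alpha>^2 * ?\<beta>^2 / \<theta> + 2 * ?\<beta>^2 + 2 * \<gamma>^2 + 4 * \<gamma>^2 / \<theta>"
 have C0: "C0 \<ge> 0" using ell(1) by (simp add: C0_def)
 show ?thesis
 proof (rule exI[of _ "2 / \<theta> * C0"], intro conjI allI impI)
  show "0 \<le> 2 / \<theta> * C0" using C0 ell(1) by simp
 next
  fix v f0 :: "real^2 \<Rightarrow> complex" and F :: "2 \<Rightarrow> real^2 \<Rightarrow> complex"
  assume *: "smooth_on V v \<and> smooth_on V f0 \<and> (\<forall>i. smooth_on V (F i)) \<and>
   (\<forall>y\<in>V. principal v y = f0 y + (\<Sum>i\<in>UNIV. partial_deriv i (F i) y))"
  then have v: "Ck_on 2 V v" and f0: "Ck_on 0 V f0" and F: "Ck_on 1 V (F i)" for i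
   using smooth_on_iff_Ck by blast+
  have v': "Ck_on (Suc (Suc 0)) V v" using v by (simp add: numeral_2_eq_2)
  have v1: "Ck_on 1 V v" using v by (rule Ck_on_mono) simp
  have dv: "Ck_on 1 V (partial_deriv j v)" for j using v' by simp
  define G0 where "G0 i z = (\<Sum>j\<in>UNIV. a i j z *\<^sub>R partial_deriv j v z)" for i z
  have G0: "Ck_on 1 V (G0 i)" for i
   unfolding G0_def[abs_def] by (intro Ck_on_sum V Ck_on_scaleR a dv)
  define G where "G i z = G0 i z - F i z" for i z
  have G: "Ck_on 1 V (G i)" for i unfolding G_def[abs_def] by (intro Ck_on_diff V G0 F)
  have \<omega>V: "Ck_on 1 V \<omega>" using \<omega>(1) Ck_on_subset by blast
  define X where "X i y = (if y \<in> V then (\<omega> y * \<omega> y) * (v y \<bullet> G i y) else 0)" for i y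
  have X: "Ck_on 1 UNIV (X i)" for i
   unfolding X_def[abs_def]
   by (rule Ck_on_UNIV_zero_extension[OF V K]) (use \<omega>(4) in \<open>auto intro!: Ck_on_mult Ck_on_inner V \<omega>V v1 G simp del: One_nat_def\<close>)
  have X0: "X i y = 0" if "y \<notin> K" for i y using \<omega>(4)[OF that] by (simp add: X_def)
  note div = integral_partial_deriv_zero[OF X K(1) X0]
  let ?R = "\<lambda>y. (norm (v y))^2 + (norm (f0 y))^2 + (\<Sum>i\<in>UNIV. (norm (F i y))^2)"
  have dX: "(\<Sum>i\<in>UNIV. partial_deriv i (X i) y) = (\<omega> y)^2 * (v y \<bullet> f0 y) +
    (\<Sum>i\<in>UNIV. (2 * \<omega> y * partial_deriv i \<omega> y * (v y \<bullet> G i y) + (\<omega> y)^2 * (partial_deriv i v y \<bullet> G i y)))" if y: "y \<in> V" for y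
  proof -
   have d: "\<omega> differentiable (at y)" "v differentiable (at y)" "G i differentiable (at y)"
    "G0 i differentiable (at y)" "F i differentiable (at y)" for i
    using \<omega>V v1 G[of i] G0[of i] F[of i] y by auto
   have dd: "(\<lambda>y. \<omega> y * \<omega> y) differentiable (at y)" "(\<lambda>y. v y \<bullet> G i y) differentiable (at y)" for i
    using d bounded_bilinear.differentiable_prod[OF bounded_bilinear_inner] by (auto intro: differentiable_mult)
   have "partial_deriv i (X i) y = partial_deriv i (\<lambda>y. (\<omega> y * \<omega> y) * (v y \<bullet> G i y)) y" for i
    by (rule partial_deriv_cong[OF V y]) (simp add: X_def)
   also have "\<dots> i = (\<omega> y)^2 * (v y \<bullet> partial_deriv i (G i) y)
     + (2 * \<omega> y * partial_deriv i \<omega> y * (v y \<bullet> G i y) + (\<omega> y)^2 * (partial_deriv i v y \<bullet> G i y))" for i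
    unfolding partial_deriv_mult[OF dd] partial_deriv_mult[OF d(1) d(1)] partial_deriv_inner[OF d(2,3)]
    by (simp add: algebra_simps power2_eq_square)
   finally have "(\<Sum>i\<in>UNIV. partial_deriv i (X i) y) = (\<omega> y)^2 * (v y \<bullet> (\<Sum>i\<in>UNIV. partial_deriv i (G i) y)) +
    (\<Sum>i\<in>UNIV. (2 * \<omega> y * partial_deriv i \<omega> y * (v y \<bullet> G i y) + (\<omega> y)^2 * (partial_deriv i v y \<bullet> G i y)))"
    by (simp add: sum.distrib inner_sum_right sum_distrib_left)
   moreover have "(\<Sum>i\<in>UNIV. partial_deriv i (G i) y) = f0 y"
   proof -
    have "partial_deriv i (G i) y = partial_deriv i (G0 i) y - partial_deriv i (F i) y" for i
     unfolding G_def[abs_def] by (rule partial_deriv_diff[OF d(4,5)])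
    then show ?thesis using * y by (simp add: sum_subtractf G0_def[abs_def] principal_def)
   qed
   ultimately show ?thesis by simp
  qed
  have pt: "indicator L y * (\<theta> / 2 * grad_sq v y) \<le> (\<Sum>i\<in>UNIV. partial_deriv i (X i) y) + C0 * (indicator K y * ?R y)" for y
  proof (cases "y \<in> K")
   case True
   then have yV: "y \<in> V" using K(2) by blast
   have main: "\<theta> / 2 * (\<omega> y)^2 * grad_sq v y \<le> (\<Sum>i\<in>UNIV. partial_deriv i (X i) y) + C0 * ?R y"
    unfolding dX[OF yV] grad_sq_def C0_def
    by (rule caccioppoli_pointwise[where a = "\<lambda>i j. a i j y", OF _ ell(2)[OF True] ell(1) \<omega>(3) _ \<beta>[OF True] \<alpha>[OF True]])
      (use \<gamma>[OF True] in \<open>auto simp: G_def G0_def\<close>)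
   show ?thesis
   proof (cases "y \<in> L")
    case True
    have "1 \<le> (\<omega> y)^2" using power_mono[OF \<omega>(2)[OF True], of 2] by simp
    then have "\<theta> / 2 * 1 * grad_sq v y \<le> \<theta> / 2 * (\<omega> y)^2 * grad_sq v y"
     using ell(1) grad_sq_nonneg by (intro mult_right_mono mult_left_mono) auto
    then show ?thesis using main True \<open>y \<in> K\<close> by simp
   next
    case False
    have "0 \<le> \<theta> / 2 * (\<omega> y)^2 * grad_sq v y"
     using ell(1) by (intro mult_nonneg_nonneg grad_sq_nonneg) auto
    then show ?thesis using main False \<open>y \<in> K\<close> by simp
   qed
  next
   case False
   have "partial_deriv i (X i) y = 0" for i
    using partial_deriv_cong[of "- K" y "X i" "\<lambda>_. 0" i] False X0 K(1)
    by (simp add: compact_imp_closed open_Compl partial_deriv_const)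
   moreover have "y \<notin> L" using False L(2) interior_subset by blast
   ultimately show ?thesis using False by simp
  qed
  have contR: "continuous_on K ?R"
   using Ck_on_imp_continuous[OF v1] Ck_on_imp_continuous[OF f0] Ck_on_imp_continuous[OF F] K(2)
   by (intro continuous_intros) (auto intro: continuous_on_subset)
  have "L \<subseteq> V" using L(2) interior_subset K(2) by blast
  then have contg: "continuous_on L (grad_sq v)" using continuous_on_grad_sq[OF v1] continuous_on_subset by blast
  have "int_over L (\<lambda>y. \<theta> / 2 * grad_sq v y)
    \<le> (LINT y|lborel. (\<Sum>i\<in>UNIV. partial_deriv i (X i) y) + C0 * (indicator K y * ?R y))"
   using div(1) by (intro integral_mono pt integrable_on_compact L(1) K(1) continuous_intros contg
     Bochner_Integration.integrable_add Bochner_Integration.integrable_sum integrable_mult_right contR)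
  also have "\<dots> = C0 * int_over K ?R"
   using div integrable_on_compact[OF K(1) contR]
   by (subst Bochner_Integration.integral_add) (auto simp: Bochner_Integration.integral_sum)
  finally have "\<theta> / 2 * int_over L (grad_sq v) \<le> C0 * int_over K ?R"
   by (simp add: mult.left_commute[of _ "\<theta> / 2"] del: times_divide_eq_left)
  then show "int_over L (grad_sq v) \<le> 2 / \<theta> * C0 * int_over K ?R"
   using ell(1) by (simp add: field_simps)
 qed
qed

text \<open>The new derivative commutes with the outer one, so the commutator stays under the
  divergence and contains only first derivatives of \<open>v\<close>.\<close>

lemma principal_partial_deriv:
 assumes v: "smooth_on V v" and y: "y \<in> V"
 shows "partial_deriv k (principal v) y = principal (partial_deriv k v) y
  + (\<Sum>i\<in>UNIV. partial_deriv i (\<lambda>z. \<Sum>j\<in>UNIV. partial_deriv k (a i j) z *\<^sub>R partial_deriv j v z) y)"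
proof -
 let ?W = "\<lambda>i z. \<Sum>j\<in>UNIV. a i j z *\<^sub>R partial_deriv j v z"
 let ?W' = "\<lambda>i z. \<Sum>j\<in>UNIV. a i j z *\<^sub>R partial_deriv j (partial_deriv k v) z"
 let ?H = "\<lambda>i z. \<Sum>j\<in>UNIV. partial_deriv k (a i j) z *\<^sub>R partial_deriv j v z"
 have sW: "smooth_on V (?W i)" for i by (rule smooth_flux[OF v])
 have sW': "smooth_on V (?W' i)" for i by (rule smooth_flux[OF smooth_on_partial_deriv[OF v]])
 have sH: "smooth_on V (?H i)" for i
  unfolding sum_2 by (intro smooth_on_add smooth_on_scaleR V smooth_on_partial_deriv a v)
 have c2: "Ck_on 2 V h" if "smooth_on V h" for h :: "real^2 \<Rightarrow> complex" using that smooth_on_iff_Ck by blast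
 have "partial_deriv k (principal v) y = (\<Sum>i\<in>UNIV. partial_deriv k (partial_deriv i (?W i)) y)"
  unfolding principal_def[abs_def]
  by (rule partial_deriv_sum) (rule smooth_on_imp_differentiable[OF smooth_on_partial_deriv[OF sW] y])
 also have "\<dots> = (\<Sum>i\<in>UNIV. partial_deriv i (partial_deriv k (?W i)) y)"
  by (intro sum.cong refl partial_deriv_commute[OF V y] c2 sW)
 also have "\<dots> = (\<Sum>i\<in>UNIV. partial_deriv i (\<lambda>z. ?W' i z + ?H i z) y)"
 proof (intro sum.cong refl partial_deriv_cong[OF V y])
  fix i z assume z: "z \<in> V"
  have "partial_deriv k (?W i) z = (\<Sum>j\<in>UNIV. partial_deriv k (\<lambda>z. a i j z *\<^sub>R partial_deriv j v z) z)"
   by (rule partial_deriv_sum)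
     (rule smooth_on_imp_differentiable[OF smooth_on_scaleR[OF V a smooth_on_partial_deriv[OF v]] z])
  also have "\<dots> = (\<Sum>j\<in>UNIV. a i j z *\<^sub>R partial_deriv k (partial_deriv j v) z + partial_deriv k (a i j) z *\<^sub>R partial_deriv j v z)"
   by (intro sum.cong refl partial_deriv_scaleR smooth_on_imp_differentiable[OF _ z] a smooth_on_partial_deriv v)
  also have "\<dots> = ?W' i z + ?H i z"
   unfolding sum.distrib using partial_deriv_commute[OF V z c2[OF v], of k] by simp
  finally show "partial_deriv k (?W i) z = ?W' i z + ?H i z" .
 qed
 also have "\<dots> = (\<Sum>i\<in>UNIV. partial_deriv i (?W' i) y + partial_deriv i (?H i) y)"
  by (intro sum.cong refl partial_deriv_add smooth_on_imp_differentiable[OF sW' y] smooth_on_imp_differentiable[OF sH y])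
 finally show ?thesis by (simp add: principal_def sum.distrib)
qed

text \<open>Commuting derivatives with the equation only produces terms in divergence form and of no higher
 order than the differentiated solution.\<close>

lemma differentiated_equation:
 "\<exists>S T. diffop V (length is) S \<and> (\<forall>i. diffop V (length is) (T i)) \<and>
   (\<forall>\<mu> u. solution \<mu> u \<longrightarrow> (\<forall>y\<in>V. principal (partial_derivs is u) y
    = \<mu> *\<^sub>R S u y + (\<Sum>i\<in>UNIV. partial_deriv i (T i u) y)))"
proof (induction "is")
 case Nil
 let ?S = "\<lambda>u y. \<rho> y *\<^sub>R partial_derivs [] u y" and ?T = "\<lambda>i u y. 0 *\<^sub>R partial_derivs [] u y"
 have "diffop V (length []) ?S" "diffop V (length []) (?T i)" for i :: 2
  by (intro diffop.single \<rho> smooth_on_const; simp)+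
 moreover have "principal (partial_derivs [] u) y = \<mu> *\<^sub>R ?S u y + (\<Sum>i\<in>UNIV. partial_deriv i (?T i u) y)"
  if "solution \<mu> u" "y \<in> V" for \<mu> u y
  using that by (simp add: solution_def partial_deriv_const)
 ultimately show ?case
  by (intro exI[of _ ?S] exI[of _ ?T] conjI allI impI ballI) blast+
next
 case (Cons k "is")
 then obtain S T where S: "diffop V (length is) S" and T: "\<And>i. diffop V (length is) (T i)"
  and eq: "\<And>\<mu> u y. solution \<mu> u \<Longrightarrow> y \<in> V \<Longrightarrow> principal (partial_derivs is u) y
    = \<mu> *\<^sub>R S u y + (\<Sum>i\<in>UNIV. partial_deriv i (T i u) y)" by blast
 obtain S' where S': "diffop V (Suc (length is)) S'" "\<And>u y. smooth_on V u \<Longrightarrow> y \<in> V \<Longrightarrow> partial_deriv k (S u) y = S' u y"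
  using diffop_partial_deriv[OF V S] by blast
 have "\<forall>i. \<exists>T'. diffop V (Suc (length is)) T' \<and> (\<forall>u. smooth_on V u \<longrightarrow> (\<forall>y\<in>V. partial_deriv k (T i u) y = T' u y))"
  using diffop_partial_deriv[OF V T] by blast
 then obtain T' where T': "\<And>i. diffop V (Suc (length is)) (T' i)"
  "\<And>i u y. smooth_on V u \<Longrightarrow> y \<in> V \<Longrightarrow> partial_deriv k (T i u) y = T' i u y" by metis
 \<comment> \<open>The commutator of the new derivative with the principal part, with opposite sign
   because it is moved to the right side, written as a differential operator applied to
   \<open>u\<close>.\<close>
 define H where "H i u y = (- partial_deriv k (a i 1) y) *\<^sub>R partial_derivs (1 # is) u y
   + (- partial_deriv k (a i 2) y) *\<^sub>R partial_derivs (2 # is) u y" for i and u :: "real^2 \<Rightarrow> complex" and y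
 have neg: "smooth_on V (\<lambda>y. - h y)" if "smooth_on V h" for h :: "real^2 \<Rightarrow> real"
  using that by (simp add: smooth_on_iff_Ck Ck_on_uminus V)
 have H: "diffop V (Suc (length is)) (H i)" for i
  unfolding H_def[abs_def] by (intro diffop.plus diffop.single neg smooth_on_partial_deriv a) auto
 let ?T = "\<lambda>i u y. T' i u y + H i u y"
 have T2: "diffop V (length (k # is)) (?T i)" for i using diffop.plus[OF T' (1) H] by simp
 have "principal (partial_derivs (k # is) u) y = \<mu> *\<^sub>R S' u y + (\<Sum>i\<in>UNIV. partial_deriv i (?T i u) y)"
  if u: "solution \<mu> u" and y: "y \<in> V" for \<mu> u y
 proof -
  have su: "smooth_on V u" using u by (simp add: solution_def)
  let ?v = "partial_derivs is u"
  have sv: "smooth_on V ?v" by (rule smooth_on_partial_derivs[OF su])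
  have dS: "S u differentiable (at y)" "T i u differentiable (at z)" "partial_deriv i (T i u) differentiable (at y)" if "z \<in> V" for i z
   using smooth_on_imp_differentiable diffop_smooth[OF V su] S T y that smooth_on_partial_deriv by blast+
  have dT': "T' i u differentiable (at y)" "H i u differentiable (at y)" for i
   using smooth_on_imp_differentiable[OF diffop_smooth[OF V su] y] T'(1) H by blast+
  have "partial_deriv k (principal ?v) y = partial_deriv k (\<lambda>z. \<mu> *\<^sub>R S u z + (\<Sum>i\<in>UNIV. partial_deriv i (T i u) z)) y"
   by (rule partial_deriv_cong[OF V y eq[OF u]])
  also have "\<dots> = partial_deriv k (\<lambda>z. \<mu> *\<^sub>R S u z) y + partial_deriv k (\<lambda>z. \<Sum>i\<in>UNIV. partial_deriv i (T i u) z) y"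
   using dS[OF y] by (intro partial_deriv_add differentiable_sum differentiable_linear[OF bounded_linear_scaleR_right]) auto
  also have "partial_deriv k (\<lambda>z. \<mu> *\<^sub>R S u z) y = \<mu> *\<^sub>R S' u y"
   using partial_deriv_linear[OF bounded_linear_scaleR_right dS(1)[OF y], of k \<mu>] S'(2)[OF su y] by simp
  also have "partial_deriv k (\<lambda>z. \<Sum>i\<in>UNIV. partial_deriv i (T i u) z) y = (\<Sum>i\<in>UNIV. partial_deriv k (partial_deriv i (T i u)) y)"
   using dS[OF y] by (intro partial_deriv_sum) auto
  also have "\<dots> = (\<Sum>i\<in>UNIV. partial_deriv i (T' i u) y)"
  proof (rule sum.cong[OF refl])
   fix i
   have "Ck_on 2 V (T i u)" using diffop_smooth[OF V su T] smooth_on_iff_Ck by blast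
   then have "partial_deriv k (partial_deriv i (T i u)) y = partial_deriv i (partial_deriv k (T i u)) y"
    by (rule partial_deriv_commute[OF V y])
   also have "\<dots> = partial_deriv i (T' i u) y"
    by (rule partial_deriv_cong[OF V y]) (rule T'(2)[OF su])
   finally show "partial_deriv k (partial_deriv i (T i u)) y = partial_deriv i (T' i u) y" .
  qed
  finally have 1: "partial_deriv k (principal ?v) y = \<mu> *\<^sub>R S' u y + (\<Sum>i\<in>UNIV. partial_deriv i (T' i u) y)" .
  have "partial_deriv i (\<lambda>z. \<Sum>j\<in>UNIV. partial_deriv k (a i j) z *\<^sub>R partial_deriv j ?v z) y = - partial_deriv i (H i u) y" for i
  proof -
   have "(\<lambda>z. \<Sum>j\<in>UNIV. partial_deriv k (a i j) z *\<^sub>R partial_deriv j ?v z) = (\<lambda>z. - H i u z)"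
    by (auto simp: H_def sum_2)
   then show ?thesis
    using partial_deriv_linear[OF bounded_linear_minus[OF bounded_linear_ident] dT'(2)[of i], of i] by simp
  qed
  then have "principal (partial_deriv k ?v) y = partial_deriv k (principal ?v) y + (\<Sum>i\<in>UNIV. partial_deriv i (H i u) y)"
   using principal_partial_deriv[OF sv y, of k] by (simp add: sum_negf)
  then show ?thesis
   unfolding 1 by (simp add: partial_deriv_add[OF dT'] sum.distrib)
 qed
 then show ?case
  using S'(1) T2 by (intro exI[of _ S'] exI[of _ ?T]) auto
qed

text \<open>\<open>caccioppoli\<close> for a derivative of the solution: by
  \<open>differentiated_equation\<close> both the source, which carries one factor
  \<open>\<mu>\<close>, and the divergence part are bounded by the jet of the present order. One
  derivative is gained at the cost of \<open>\<mu>^2\<close>.\<close>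

lemma derivative_estimate_step:
 assumes K: "compact K" "K \<subseteq> V" and L: "compact L" "L \<subseteq> interior K"
 shows "\<exists>C\<ge>0. \<forall>\<mu>\<ge>1. \<forall>u. solution \<mu> u \<longrightarrow>
  int_over L (grad_sq (partial_derivs is u))
   \<le> C * \<mu>^2 * int_over K (jet_sq (length is) u)"
proof -
 let ?n = "length is"
 obtain S T where S: "diffop V ?n S" and T: "\<And>i. diffop V ?n (T i)"
  and eq: "\<And>\<mu> u y. solution \<mu> u \<Longrightarrow> y \<in> V \<Longrightarrow> principal (partial_derivs is u) y
    = \<mu> *\<^sub>R S u y + (\<Sum>i\<in>UNIV. partial_deriv i (T i u) y)"
  using differentiated_equation[of "is"] by blast
 obtain C where C: "C \<ge> 0" and cacc: "\<And>v f0 F. smooth_on V v \<Longrightarrow> smooth_on V f0 \<Longrightarrow> (\<And>i. smooth_on V (F i)) \<Longrightarrow>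
   (\<And>y. y \<in> V \<Longrightarrow> principal v y = f0 y + (\<Sum>i\<in>UNIV. partial_deriv i (F i) y)) \<Longrightarrow>
   int_over L (grad_sq v)
    \<le> C * int_over K (\<lambda>y. (norm (v y))^2 + (norm (f0 y))^2 + (\<Sum>i\<in>UNIV. (norm (F i y))^2))"
  using caccioppoli[OF K L] by blast
 obtain c0 where c0: "c0 \<ge> 0" "\<And>u y. y \<in> K \<Longrightarrow> (norm (S u y))^2 \<le> c0 * jet_sq ?n u y"
  using diffop_bound[OF K S] by blast
 have "\<forall>i. \<exists>c\<ge>0. \<forall>u. \<forall>y\<in>K. (norm (T i u y))^2 \<le> c * jet_sq ?n u y"
  using diffop_bound[OF K T] by blast
 then obtain c where c: "\<And>i. c i \<ge> 0" "\<And>i u y. y \<in> K \<Longrightarrow> (norm (T i u y))^2 \<le> c i * jet_sq ?n u y" by metis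
 let ?D = "1 + c0 + (\<Sum>i\<in>UNIV. c i)"
 show ?thesis
 proof (rule exI[of _ "C * ?D"], intro conjI allI impI)
  show "0 \<le> C * ?D" using C c0(1) c(1) by (simp add: sum_nonneg)
 next
  fix \<mu> :: real and u assume \<mu>: "1 \<le> \<mu>" and u: "solution \<mu> u"
  let ?v = "partial_derivs is u"
  have su: "smooth_on V u" using u by (simp add: solution_def)
  have sv: "smooth_on V ?v" by (rule smooth_on_partial_derivs[OF su])
  have sS: "smooth_on V (\<lambda>y. \<mu> *\<^sub>R S u y)" by (intro smooth_on_scaleR V smooth_on_const diffop_smooth[OF V su S])
  have sT: "smooth_on V (T i u)" for i by (rule diffop_smooth[OF V su T])
  let ?R = "\<lambda>y. (norm (?v y))^2 + (norm (\<mu> *\<^sub>R S u y))^2 + (\<Sum>i\<in>UNIV. (norm (T i u y))^2)"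
  have "int_over L (grad_sq ?v) \<le> C * int_over K ?R"
   by (rule cacc[OF sv sS sT]) (rule eq[OF u])
  also have "\<dots> \<le> C * int_over K (\<lambda>y. (?D * \<mu>^2) * jet_sq ?n u y)"
  proof (intro mult_left_mono C integral_compact_mono[OF K(1) K(1) order_refl])
   show "continuous_on K ?R"
    by (intro continuous_intros continuous_on_subset[OF smooth_on_imp_continuous])
      (use K(2) sv sT diffop_smooth[OF V su S] in auto)
   show "continuous_on K (\<lambda>y. ?D * \<mu>^2 * jet_sq ?n u y)"
    using K(2) by (intro continuous_intros continuous_on_subset[OF continuous_on_jet_sq[OF su]]) auto
   show "0 \<le> ?D * \<mu>^2 * jet_sq ?n u y" for y
    using c0(1) c(1) by (intro mult_nonneg_nonneg add_nonneg_nonneg sum_nonneg jet_sq_nonneg) auto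
   fix y assume y: "y \<in> K"
   have \<mu>2: "1 \<le> \<mu>^2" using power_mono[OF \<mu>, of 2] by simp
   let ?j = "jet_sq ?n u y"
   have j: "?j \<ge> 0" by (rule jet_sq_nonneg)
   have "(norm (?v y))^2 \<le> \<mu>^2 * ?j"
    using partial_derivs_le_jet[of "is" ?n u y] mult_right_mono[OF \<mu>2 j] by simp
   moreover have "(norm (\<mu> *\<^sub>R S u y))^2 \<le> c0 * (\<mu>^2 * ?j)"
    using mult_left_mono[OF c0(2)[OF y, of u], of "\<mu>^2"] by (simp add: power_mult_distrib mult_ac)
   moreover have "(norm (T i u y))^2 \<le> c i * (\<mu>^2 * ?j)" for i
   proof -
    have "(norm (T i u y))^2 \<le> c i * (1 * ?j)" using c(2)[OF y] by simp
    also have "\<dots> \<le> c i * (\<mu>^2 * ?j)" using c(1) \<mu>2 j by (intro mult_left_mono mult_right_mono)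
    finally show ?thesis .
   qed
   then have "(\<Sum>i\<in>UNIV. (norm (T i u y))^2) \<le> (\<Sum>i\<in>UNIV. c i * (\<mu>^2 * ?j))" by (rule sum_mono)
   ultimately have "?R y \<le> \<mu>^2 * ?j + c0 * (\<mu>^2 * ?j) + (\<Sum>i\<in>UNIV. c i * (\<mu>^2 * ?j))"
    by (intro add_mono)
   moreover have "?D * \<mu>^2 * ?j
     = \<mu>^2 * ?j + c0 * (\<mu>^2 * ?j) + (\<Sum>i\<in>UNIV. c i * (\<mu>^2 * ?j))"
    by (simp only: distrib_right sum_distrib_right mult_1 mult.assoc)
   ultimately show "?R y \<le> ?D * \<mu>^2 * ?j" by simp
  qed
  also have "\<dots> = C * ?D * \<mu>^2 * int_over K (jet_sq ?n u)"
  proof -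
   have *: "int_over K (\<lambda>y. r * jet_sq ?n u y) = r * int_over K (jet_sq ?n u)" for r
    by (subst mult.left_commute) (rule integral_mult_right_zero)
   show ?thesis unfolding * by (simp only: mult.assoc)
  qed
  finally show "int_over L (grad_sq ?v)
   \<le> C * ?D * \<mu>^2 * int_over K (jet_sq ?n u)" .
 qed
qed

lemma intermediate_compact:
 assumes "compact L" "L \<subseteq> interior K"
 shows "\<exists>K'. compact K' \<and> L \<subseteq> interior K' \<and> K' \<subseteq> interior (K :: (real^2) set)"
proof -
 obtain e where e: "e > 0" "(\<Union>x\<in>L. ball x e) \<subseteq> interior K"
  using compact_subset_open_imp_ball_epsilon_subset[OF assms(1) open_interior assms(2)] by blast
 \<comment> \<open>The closed neighbourhood of radius \<open>e / 2\<close>, compact as a sum of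
   compact sets.\<close>
 let ?K = "{x + y |x y. x \<in> L \<and> y \<in> cball 0 (e / 2)}"
 have "compact ?K" by (rule compact_sums) (use assms in auto)
 moreover have "L \<subseteq> interior ?K"
 proof
  fix x assume x: "x \<in> L"
  have "ball x (e / 2) \<subseteq> ?K"
  proof
   fix z assume "z \<in> ball x (e / 2)"
   then have "z - x \<in> cball 0 (e / 2)" by (simp add: dist_norm norm_minus_commute)
   then show "z \<in> ?K" using x by (intro CollectI exI[of _ x] exI[of _ "z - x"]) auto
  qed
  then show "x \<in> interior ?K" using e(1) by (intro interiorI[of "ball x (e / 2)"]) auto
 qed
 moreover have "?K \<subseteq> interior K"
 proof
  fix z assume "z \<in> ?K"
  then obtain x y where "x \<in> L" "norm y \<le> e / 2" "z = x + y" by auto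
  then have "z \<in> ball x e" using e(1) by (simp add: dist_norm)
  then show "z \<in> interior K" using e(2) \<open>x \<in> L\<close> by blast
 qed
 ultimately show ?thesis by blast
qed

lemma jet_sq_Suc_le: "jet_sq (Suc n) u y \<le> jet_sq n u y + (\<Sum>is | length is \<le> n. grad_sq (partial_derivs is u) y)"
proof -
 have "{is :: 2 list. length is \<le> Suc n} \<subseteq> {is. length is \<le> n} \<union> (\<lambda>(i, is). i # is) ` (UNIV \<times> {is. length is \<le> n})"
 proof
  fix "is" :: "2 list" assume "is \<in> {is. length is \<le> Suc n}"
  then show "is \<in> {is. length is \<le> n} \<union> (\<lambda>(i, is). i # is) ` (UNIV \<times> {is. length is \<le> n})"
   by (cases "is") auto
 qed
 then have "jet_sq (Suc n) u y \<le> (\<Sum>is\<in>{is. length is \<le> n} \<union> (\<lambda>(i, is). i # is) ` (UNIV \<times> {is. length is \<le> n}).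
   (norm (partial_derivs is u y))^2)"
  unfolding jet_sq_def by (intro sum_mono2) (auto simp: finite_derivative_lists)
 also have "\<dots> \<le> jet_sq n u y + (\<Sum>is\<in>(\<lambda>(i, is). i # is) ` (UNIV \<times> {is. length is \<le> n}). (norm (partial_derivs is u y))^2)"
 proof -
  let ?A = "{is :: 2 list. length is \<le> n}" and ?B = "(\<lambda>(i, is). i # is) ` (UNIV \<times> {is :: 2 list. length is \<le> n})"
  have fin: "finite ?A" "finite ?B" by (auto simp: finite_derivative_lists)
  have "(\<Sum>is\<in>?A \<union> ?B. (norm (partial_derivs is u y))^2) = (\<Sum>is\<in>?A. (norm (partial_derivs is u y))^2)
    + (\<Sum>is\<in>?B - ?A. (norm (partial_derivs is u y))^2)"
   using sum.union_disjoint[of ?A "?B - ?A"] fin by (simp add: Un_Diff_cancel Int_Diff)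
  also have "\<dots> \<le> (\<Sum>is\<in>?A. (norm (partial_derivs is u y))^2) + (\<Sum>is\<in>?B. (norm (partial_derivs is u y))^2)"
   using fin by (intro add_left_mono sum_mono2) auto
  finally show ?thesis unfolding jet_sq_def .
 qed
 also have "(\<Sum>is\<in>(\<lambda>(i, is). i # is) ` (UNIV \<times> {is :: 2 list. length is \<le> n}). (norm (partial_derivs is u y))^2)
   = (\<Sum>(i, is)\<in>UNIV \<times> {is. length is \<le> n}. (norm (partial_deriv i (partial_derivs is u) y))^2)"
  by (subst sum.reindex) (auto simp: inj_on_def intro!: sum.cong)
 also have "\<dots> = (\<Sum>i\<in>UNIV. \<Sum>is | length is \<le> n. (norm (partial_deriv i (partial_derivs is u) y))^2)"
  by (rule sum.cartesian_product[symmetric])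
 also have "\<dots> = (\<Sum>is | length is \<le> n. grad_sq (partial_derivs is u) y)"
  unfolding grad_sq_def by (rule sum.swap)
 finally show ?thesis by simp
qed

text \<open>Each order uses up an intermediate compact set and a factor \<open>\<mu>^2\<close>; the
  induction therefore leaves the inner set \<open>L\<close> arbitrary.\<close>

lemma jet_estimate:
 "compact K \<Longrightarrow> K \<subseteq> V \<Longrightarrow> compact L \<Longrightarrow> L \<subseteq> interior K \<Longrightarrow>
  \<exists>C\<ge>0. \<forall>\<mu>\<ge>1. \<forall>u. solution \<mu> u \<longrightarrow>
   int_over L (jet_sq n u) \<le> C * \<mu> ^ (2 * n) * int_over K (\<lambda>y. (norm (u y))^2)"
proof (induction n arbitrary: L)
 case 0
 show ?case
 proof (rule exI[of _ 1], intro conjI allI impI)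
  fix \<mu> :: real and u assume "solution \<mu> u"
  then have cont: "continuous_on K u"
   using 0(2) by (auto simp: solution_def intro: continuous_on_subset[OF smooth_on_imp_continuous])
  have j: "jet_sq 0 u = (\<lambda>y. (norm (u y))^2)" by (auto simp: jet_sq_def)
  have "int_over L (\<lambda>y. (norm (u y))^2) \<le> int_over K (\<lambda>y. (norm (u y))^2)"
   using 0(4) interior_subset by (intro integral_compact_mono 0 continuous_intros cont) auto
  then show "int_over L (jet_sq 0 u) \<le> 1 * \<mu> ^ (2 * 0) * int_over K (\<lambda>y. (norm (u y))^2)"
   by (simp add: j)
 qed simp
next
 case (Suc n)
 obtain K' where K': "compact K'" "L \<subseteq> interior K'" "K' \<subseteq> interior K"
  using intermediate_compact[OF Suc.prems(3,4)] by blast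
 have K'V: "K' \<subseteq> V" using K'(3) Suc.prems(2) interior_subset by blast
 obtain C where C: "C \<ge> 0" "\<And>\<mu> u. \<mu> \<ge> 1 \<Longrightarrow> solution \<mu> u \<Longrightarrow>
   int_over K' (jet_sq n u) \<le> C * \<mu> ^ (2 * n) * int_over K (\<lambda>y. (norm (u y))^2)"
  using Suc.IH[OF Suc.prems(1,2) K'(1,3)] by blast
 define P where "P is D \<longleftrightarrow> D \<ge> 0 \<and> (\<forall>\<mu>\<ge>1. \<forall>u. solution \<mu> u \<longrightarrow>
  int_over L (grad_sq (partial_derivs is u))
   \<le> D * \<mu>^2 * int_over K' (jet_sq (length is) u))" for "is" D
 have "\<exists>D. P is D" for "is"
  using derivative_estimate_step[OF K'(1) K'V Suc.prems(3) K'(2), of "is"] unfolding P_def by blast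
 then obtain D where "\<And>is. P is (D is)" by metis
 then have D: "D is \<ge> 0" "\<mu> \<ge> 1 \<Longrightarrow> solution \<mu> u \<Longrightarrow>
  int_over L (grad_sq (partial_derivs is u))
   \<le> D is * \<mu>^2 * int_over K' (jet_sq (length is) u)" for "is" \<mu> u
  unfolding P_def by blast+
 let ?I = "{is :: 2 list. length is \<le> n}"
 show ?case
 proof (rule exI[of _ "(1 + (\<Sum>is\<in>?I. D is)) * C"], intro conjI allI impI)
  show "0 \<le> (1 + (\<Sum>is\<in>?I. D is)) * C" using C(1) D(1) by (simp add: sum_nonneg)
 next
  fix \<mu> :: real and u assume \<mu>: "1 \<le> \<mu>" and u: "solution \<mu> u"
  have su: "smooth_on V u" using u by (simp add: solution_def)
  have LK': "L \<subseteq> K'" using K'(2) interior_subset by blast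
  have LV: "L \<subseteq> V" using LK' K'V by blast
  have cj: "continuous_on W (jet_sq k u)" if "W \<subseteq> V" for k W
   using continuous_on_subset[OF continuous_on_jet_sq[OF su] that] .
  have cg: "continuous_on L (grad_sq (partial_derivs is u))" for "is"
   using continuous_on_grad_sq[of V "partial_derivs is u"] smooth_on_partial_derivs[OF su] smooth_on_iff_Ck LV continuous_on_subset by blast
  let ?J = "int_over K' (jet_sq n u)"
  have J0: "?J \<ge> 0" by (intro integral_nonneg_AE AE_I2 mult_nonneg_nonneg jet_sq_nonneg) simp
  have \<mu>2: "1 \<le> \<mu>^2" using power_mono[OF \<mu>, of 2] by simp
  have iL: "integrable lborel (\<lambda>y. indicator L y * jet_sq k u y)" "integrable lborel (\<lambda>y. indicator L y * grad_sq (partial_derivs is u) y)" for k "is"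
   using integrable_on_compact[OF Suc.prems(3)] cj[OF LV] cg by blast+
  have "int_over L (jet_sq (Suc n) u)
    \<le> (LINT y|lborel. indicator L y * jet_sq n u y + (\<Sum>is\<in>?I. indicator L y * grad_sq (partial_derivs is u) y))"
  proof (rule integral_mono)
   fix y
   show "indicator L y * jet_sq (Suc n) u y \<le> indicator L y * jet_sq n u y + (\<Sum>is\<in>?I. indicator L y * grad_sq (partial_derivs is u) y)"
    using jet_sq_Suc_le[of n u y] by (auto simp: indicator_def)
  qed (intro iL Bochner_Integration.integrable_add Bochner_Integration.integrable_sum)+
  also have "\<dots> = int_over L (jet_sq n u) + (\<Sum>is\<in>?I. int_over L (grad_sq (partial_derivs is u)))"
   using iL by (simp add: Bochner_Integration.integral_add Bochner_Integration.integral_sum)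
  also have "\<dots> \<le> \<mu>^2 * ?J + (\<Sum>is\<in>?I. D is * \<mu>^2 * ?J)"
  proof (intro add_mono sum_mono)
   have "int_over L (jet_sq n u) \<le> 1 * ?J"
    using LK' jet_sq_nonneg by (simp, intro integral_compact_mono Suc.prems K' cj K'V) auto
   also have "\<dots> \<le> \<mu>^2 * ?J" by (rule mult_right_mono[OF \<mu>2 J0])
   finally show "int_over L (jet_sq n u) \<le> \<mu>^2 * ?J" .
   fix "is" assume "is \<in> ?I"
   then have le: "length is \<le> n" by simp
   have "jet_sq (length is) u y \<le> jet_sq n u y" for y
    unfolding jet_sq_def using le by (intro sum_mono2) (auto simp: finite_derivative_lists)
   then have "int_over K' (jet_sq (length is) u) \<le> ?J"
    using jet_sq_nonneg by (intro integral_compact_mono K' cj K'V order_refl) auto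
   then have "D is * \<mu>^2 * int_over K' (jet_sq (length is) u) \<le> D is * \<mu>^2 * ?J"
    using D(1) by (intro mult_left_mono) auto
   then show "int_over L (grad_sq (partial_derivs is u)) \<le> D is * \<mu>^2 * ?J"
    using D(2)[OF \<mu> u, of "is"] by linarith
  qed
  also have "\<dots> = (1 + (\<Sum>is\<in>?I. D is)) * \<mu>^2 * ?J" by (simp add: algebra_simps sum_distrib_left)
  also have "\<dots> \<le> (1 + (\<Sum>is\<in>?I. D is)) * \<mu>^2 * (C * \<mu> ^ (2 * n) * int_over K (\<lambda>y. (norm (u y))^2))"
   using C(2)[OF \<mu> u] D(1) by (intro mult_left_mono mult_nonneg_nonneg add_nonneg_nonneg sum_nonneg) auto
  also have "\<dots> = (1 + (\<Sum>is\<in>?I. D is)) * C * \<mu> ^ (2 * Suc n) * int_over K (\<lambda>y. (norm (u y))^2)"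
   by (simp add: power2_eq_square mult_ac)
  finally show "int_over L (jet_sq (Suc n) u)
    \<le> (1 + (\<Sum>is\<in>?I. D is)) * C * \<mu> ^ (2 * Suc n) * int_over K (\<lambda>y. (norm (u y))^2)" .
 qed
qed

end

section \<open>A Sobolev bound in the plane\<close>

lemma nn_integral_lborel_vec2:
 fixes E :: "real^2 \<Rightarrow> ennreal"
 assumes E: "E \<in> borel_measurable borel"
 shows "(\<integral>\<^sup>+ y. E y \<partial>lborel) = (\<integral>\<^sup>+ s. \<integral>\<^sup>+ t. E (s *\<^sub>R axis 1 1 + t *\<^sub>R axis 2 1) \<partial>lborel \<partial>lborel)"
proof -
 have ij: "1 \<noteq> (2::2)" by simp
 note L = lborel_axes[OF ij]
 show ?thesis
  by (subst L(2), subst nn_integral_distr[OF L(1)], simp add: E, subst lborel.nn_integral_fst[symmetric])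
   (simp_all add: measurable_compose[OF L(1) E])
qed

text \<open>Along the segment, \<open>s - 1\<close> times \<open>h\<close> vanishes at
  \<open>s = 1\<close> and equals \<open>- h x\<close> at \<open>s = 0\<close>. Integrating its
  derivative expresses \<open>h x\<close> through \<open>h\<close> and its derivative on one side of
  \<open>x\<close> only.\<close>

lemma sobolev_segment:
 fixes h :: "real^2 \<Rightarrow> complex"
 assumes h: "Ck_on 1 V h" and seg: "\<And>s. s \<in> {0..1} \<Longrightarrow> x + (s * r) *\<^sub>R axis i 1 \<in> V"
 shows "ennreal ((norm (h x))^2) \<le> (\<integral>\<^sup>+ s\<in>{0..1}. ennreal (2 * (norm (h (x + (s * r) *\<^sub>R axis i 1)))^2
  + 2 * r^2 * (norm (partial_deriv i h (x + (s * r) *\<^sub>R axis i 1)))^2) \<partial>lborel)"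
proof -
 let ?z = "\<lambda>s. x + (s * r) *\<^sub>R axis i 1"
 let ?B = "\<lambda>s. 2 * (norm (h (?z s)))^2 + 2 * r^2 * (norm (partial_deriv i h (?z s)))^2"
 define d where "d s = r *\<^sub>R partial_deriv i h (?z s)" for s
 have diff: "h differentiable (at (?z s))" if "s \<in> {0..1}" for s using h seg[OF that] by simp
 have d: "((\<lambda>s. h (?z s)) has_vector_derivative d s) (at s)" if "s \<in> {0..1}" for s
  using has_vector_derivative_along_segment[of h x s "r *\<^sub>R axis i 1"] diff[OF that]
   linear_cmul[OF linear_frechet_derivative[OF diff[OF that]]] by (simp add: d_def partial_deriv_def)
 have cz: "continuous_on {0..1} ?z" by (intro continuous_intros)
 have c: "continuous_on {0..1} (\<lambda>s. h (?z s))" "continuous_on {0..1} (\<lambda>s. partial_deriv i h (?z s))"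
  by (intro continuous_on_compose2[OF Ck_on_imp_continuous[OF h] cz])
   (use h seg in \<open>auto intro!: continuous_on_compose2[OF _ cz, of V]\<close>)
 then have cd: "continuous_on {0..1} d" unfolding d_def[abs_def] by (intro continuous_intros)
 have "((\<lambda>s. (s - 1) *\<^sub>R h (?z s)) has_vector_derivative (s - 1) *\<^sub>R d s + 1 *\<^sub>R h (?z s)) (at s within {0..1})" if "s \<in> {0..1}" for s
  by (rule has_vector_derivative_at_within)
   (intro has_vector_derivative_scaleR d[OF that], auto intro!: derivative_eq_intros)
 then have "((\<lambda>s. (s - 1) *\<^sub>R d s + 1 *\<^sub>R h (?z s)) has_integral (1 - 1) *\<^sub>R h (?z 1) - (0 - 1) *\<^sub>R h (?z 0)) {0..1}"
  by (intro fundamental_theorem_of_calculus) auto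
 then have "norm (h x) = norm (integral {0..1} (\<lambda>s. (s - 1) *\<^sub>R d s + h (?z s)))" by (simp add: integral_unique)
 also have "\<dots> \<le> integral {0..1} (\<lambda>s. norm ((s - 1) *\<^sub>R d s + h (?z s)))"
  by (intro integral_norm_bound_integral integrable_continuous_real continuous_intros c cd) auto
 finally have "(norm (h x))^2 \<le> (integral {0..1} (\<lambda>s. norm ((s - 1) *\<^sub>R d s + h (?z s))))^2" by (rule power_mono) simp
 also have "\<dots> \<le> integral {0..1} (\<lambda>s. (norm ((s - 1) *\<^sub>R d s + h (?z s)))^2)"
  by (intro square_integral_le continuous_intros c cd)
 also have "\<dots> \<le> integral {0..1} ?B"
 proof (intro integral_le integrable_continuous_real continuous_intros c cd)
  fix s :: real assume "s \<in> {0..1}"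
  then have "norm ((s - 1) *\<^sub>R d s) \<le> 1 * norm (d s)" unfolding norm_scaleR by (intro mult_right_mono) auto
  then have "norm ((s - 1) *\<^sub>R d s + h (?z s)) \<le> norm (h (?z s)) + norm (d s)"
   using norm_triangle_ineq[of "(s - 1) *\<^sub>R d s" "h (?z s)"] by simp
  then have "(norm ((s - 1) *\<^sub>R d s + h (?z s)))^2 \<le> (norm (h (?z s)) + norm (d s))^2" by (rule power_mono) simp
  also have "\<dots> \<le> 2 * (norm (h (?z s)))^2 + 2 * (norm (d s))^2"
   using sum_squares_bound[of "norm (h (?z s))" "norm (d s)"] unfolding power2_sum by linarith
  finally show "(norm ((s - 1) *\<^sub>R d s + h (?z s)))^2 \<le> ?B s"
   by (simp add: d_def power_mult_distrib)
 qed
 finally have "ennreal ((norm (h x))^2) \<le> ennreal (integral {0..1} ?B)"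
  by (rule ennreal_leI)
 also have "\<dots> = (\<integral>\<^sup>+ s\<in>{0..1}. ennreal (?B s) \<partial>lborel)"
 proof -
  have "continuous_on {0..1} ?B"
   by (intro continuous_intros c)
  then show ?thesis
   using absolutely_integrable_continuous_real
   by (subst nn_integral_eq_integral_on)
    (auto intro!: borel_measurable_continuous_on_indicator simp del: real_scaleR_def)
 qed
 finally show ?thesis .
qed

text \<open>\<open>sobolev_segment\<close> along the first axis bounds the value at \<open>x\<close>
  by \<open>h\<close> and its first derivative on a segment; applied to both along the second axis
  it brings in derivatives of order two over a square of side \<open>r\<close>. The factor
  \<open>r^2\<close> comes from rescaling that square.\<close>

lemma sup_bound:
 assumes r: "r > 0" and h: "smooth_on V h" and V: "cball x (2 * r) \<subseteq> V"
 shows "r^2 * (norm (h x))^2 \<le> (2 + 2 * r^2)^2 * int_over (cball x (2 * r)) (jet_sq 2 h)"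
proof -
 let ?B = "cball x (2 * r)" and ?c = "2 + 2 * r^2"
 let ?J = "int_over ?B (jet_sq 2 h)"
 define E where "E y = ennreal (indicator ?B y * jet_sq 2 h y)" for y
 have cj: "continuous_on ?B (jet_sq 2 h)" by (rule continuous_on_subset[OF continuous_on_jet_sq[OF h] V])
 have "(\<lambda>y. indicator ?B y *\<^sub>R jet_sq 2 h y) \<in> borel_measurable borel"
  by (rule borel_measurable_continuous_on_indicator) (use cj in auto)
 then have E[measurable]: "E \<in> borel_measurable borel" unfolding E_def by simp
 have J0: "?J \<ge> 0" by (intro integral_nonneg_AE AE_I2 mult_nonneg_nonneg jet_sq_nonneg) simp
 have EJ: "(\<integral>\<^sup>+ y. E y \<partial>lborel) = ennreal ?J"
  unfolding E_def by (rule nn_integral_eq_integral[OF integrable_on_compact[OF compact_cball cj]]) (simp add: jet_sq_nonneg)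
 let ?y = "\<lambda>s. x + (s * r) *\<^sub>R axis 1 1" and ?z = "\<lambda>s t. x + (s * r) *\<^sub>R axis 1 1 + (t * r) *\<^sub>R axis 2 1"
 have zB: "?z s t \<in> ?B" if "s \<in> {0..1}" "t \<in> {0..1}" for s t
 proof -
  have "norm ((s * r) *\<^sub>R axis 1 1 + (t * r) *\<^sub>R axis 2 1 :: real^2) \<le> s * r + t * r"
   using that r by (intro norm_triangle_le) simp
  also have "\<dots> \<le> 1 * r + 1 * r" using that r by (intro add_mono mult_right_mono) auto
  finally show ?thesis unfolding mem_cball dist_norm norm_minus_commute[of x] by (simp add: add.assoc)
 qed
 have yV: "?y s \<in> V" if "s \<in> {0..1}" for s using zB[OF that, of 0] V by auto
 let ?S = "\<lambda>s. \<integral>\<^sup>+ t. E (?z s t) \<partial>lborel"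
 have step: "ennreal ((norm (partial_derivs js h (?y s)))^2) \<le> ennreal ?c * ?S s" if js: "length js \<le> 1" and s: "s \<in> {0..1}" for js s
 proof -
  have "Ck_on 1 V (partial_derivs js h)" using smooth_on_partial_derivs[OF h] smooth_on_iff_Ck by blast
  then have "ennreal ((norm (partial_derivs js h (?y s)))^2) \<le> (\<integral>\<^sup>+ t\<in>{0..1}. ennreal (2 * (norm (partial_derivs js h (?z s t)))^2
    + 2 * r^2 * (norm (partial_deriv 2 (partial_derivs js h) (?z s t)))^2) \<partial>lborel)"
   using zB[OF s] V by (intro sobolev_segment[of V]) auto
  also have "\<dots> \<le> (\<integral>\<^sup>+ t. ennreal ?c * E (?z s t) \<partial>lborel)"
  proof (rule nn_integral_mono)
   fix t :: real
   show "ennreal (2 * (norm (partial_derivs js h (?z s t)))^2 + 2 * r^2 * (norm (partial_deriv 2 (partial_derivs js h) (?z s t)))^2)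
     * indicator {0..1} t \<le> ennreal ?c * E (?z s t)"
   proof (cases "t \<in> {0..1}")
    case True
    have "2 * (norm (partial_derivs js h (?z s t)))^2 + 2 * r^2 * (norm (partial_derivs (2 # js) h (?z s t)))^2
      \<le> 2 * jet_sq 2 h (?z s t) + 2 * r^2 * jet_sq 2 h (?z s t)"
     using js by (intro add_mono mult_left_mono partial_derivs_le_jet) auto
    then have "ennreal (2 * (norm (partial_derivs js h (?z s t)))^2 + 2 * r^2 * (norm (partial_deriv 2 (partial_derivs js h) (?z s t)))^2)
      \<le> ennreal (?c * jet_sq 2 h (?z s t))" by (intro ennreal_leI) (simp add: distrib_right)
    then show ?thesis using zB[OF s True] True by (simp add: E_def ennreal_mult jet_sq_nonneg)
   qed simp
  qed
  also have "\<dots> = ennreal ?c * ?S s" by (rule nn_integral_cmult) measurable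
  finally show ?thesis .
 qed
 have "Ck_on 1 V h" using h smooth_on_iff_Ck by blast
 then have "ennreal ((norm (h x))^2) \<le> (\<integral>\<^sup>+ s\<in>{0..1}. ennreal (2 * (norm (h (?y s)))^2 + 2 * r^2 * (norm (partial_deriv 1 h (?y s)))^2) \<partial>lborel)"
  using yV by (intro sobolev_segment[of V])
 also have "\<dots> \<le> (\<integral>\<^sup>+ s. ennreal ?c * (ennreal ?c * ?S s) \<partial>lborel)"
 proof (rule nn_integral_mono)
  fix s :: real
  show "ennreal (2 * (norm (h (?y s)))^2 + 2 * r^2 * (norm (partial_deriv 1 h (?y s)))^2) * indicator {0..1} s
    \<le> ennreal ?c * (ennreal ?c * ?S s)"
  proof (cases "s \<in> {0..1}")
   case True
   have "ennreal (2 * (norm (h (?y s)))^2 + 2 * r^2 * (norm (partial_deriv 1 h (?y s)))^2)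
     = ennreal 2 * ennreal ((norm (h (?y s)))^2) + ennreal (2 * r^2) * ennreal ((norm (partial_deriv 1 h (?y s)))^2)"
    by (simp add: ennreal_mult)
   also have "\<dots> \<le> ennreal 2 * (ennreal ?c * ?S s) + ennreal (2 * r^2) * (ennreal ?c * ?S s)"
    using step[of "[]" s] step[of "[1]" s] True by (intro add_mono mult_left_mono) auto
   also have "\<dots> = ennreal ?c * (ennreal ?c * ?S s)" by (simp add: distrib_right[symmetric] del: ennreal_numeral)
   finally show ?thesis using True by simp
  qed simp
 qed
 also have "\<dots> = ennreal ?c * (ennreal ?c * (\<integral>\<^sup>+ s. ?S s \<partial>lborel))"
  by (subst nn_integral_cmult, measurable, subst nn_integral_cmult, measurable)
 also have "(\<integral>\<^sup>+ s. ?S s \<partial>lborel) = (\<integral>\<^sup>+ q. E (x + r *\<^sub>R q) \<partial>lborel)"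
  by (subst nn_integral_lborel_vec2) (auto simp: scaleR_add_right add.assoc mult.commute)
 finally have "ennreal (r^2) * ennreal ((norm (h x))^2) \<le> ennreal (r^2) * (ennreal ?c * (ennreal ?c * (\<integral>\<^sup>+ q. E (x + r *\<^sub>R q) \<partial>lborel)))"
  by (rule mult_left_mono) simp
 also have "\<dots> = ennreal ?c * (ennreal ?c * ennreal ?J)"
  using nn_integral_lborel_affine[OF E, of r x] r EJ by (simp add: mult_ac)
 finally have "ennreal (r^2 * (norm (h x))^2) \<le> ennreal (?c^2 * ?J)"
  unfolding power2_eq_square[of ?c] mult.assoc[of ?c] using J0 by (simp only: ennreal_mult zero_le_power2
   add_nonneg_nonneg mult_nonneg_nonneg zero_le_numeral)
 then show ?thesis using J0 by (subst (asm) ennreal_le_iff) auto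
qed

context elliptic_equation
begin

text \<open>A pointwise bound for order \<open>n\<close> needs the square integrals of order
  \<open>n + 2\<close>, which \<open>jet_estimate\<close> supplies on an intermediate set containing
  balls around all points of \<open>L\<close>.\<close>

lemma sup_estimate:
 assumes K: "compact K" "K \<subseteq> V" and L: "compact L" "L \<subseteq> interior K"
 shows "\<exists>C\<ge>0. \<exists>N. \<forall>\<mu>\<ge>1. \<forall>u. solution \<mu> u \<longrightarrow> (\<forall>is :: 2 list. length is \<le> n \<longrightarrow> (\<forall>y\<in>L.
  (norm (partial_derivs is u y))^2 \<le> C * \<mu> ^ N * int_over K (\<lambda>y. (norm (u y))^2)))"
proof -
 obtain K' where K': "compact K'" "L \<subseteq> interior K'" "K' \<subseteq> interior K"
  using intermediate_compact[OF L] by blast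
 obtain e where e: "e > 0" "(\<Union>x\<in>L. ball x e) \<subseteq> interior K'"
  using compact_subset_open_imp_ball_epsilon_subset[OF L(1) open_interior K'(2)] by blast
 have ball: "cball x (e / 2) \<subseteq> K'" if "x \<in> L" for x
 proof -
  have "cball x (e / 2) \<subseteq> ball x e" using e(1) by (simp add: cball_subset_ball_iff)
  then show ?thesis using e(2) that interior_subset by blast
 qed
 have K'V: "K' \<subseteq> V" using K'(3) K(2) interior_subset by blast
 \<comment> \<open>The constant of \<open>sup_bound\<close> for \<open>r = e / 4\<close>, whose ball
   of radius \<open>2 * r\<close> is the one of radius \<open>e / 2\<close> inside
   \<open>K'\<close>.\<close>
 define C where "C = (2 + 2 * (e / 4)^2)^2 / (e / 4)^2"
 have C0: "C \<ge> 0" by (simp add: C_def)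
 have C: "(norm (h x))^2 \<le> C * int_over (cball x (e / 2)) (jet_sq 2 h)"
  if "smooth_on V h" "cball x (e / 2) \<subseteq> V" for h x
  using sup_bound[of "e / 4" V h x] that e(1) by (simp add: C_def field_simps)
 obtain D where D: "D \<ge> 0" "\<And>\<mu> u. \<mu> \<ge> 1 \<Longrightarrow> solution \<mu> u \<Longrightarrow>
   int_over K' (jet_sq (n + 2) u) \<le> D * \<mu> ^ (2 * (n + 2)) * int_over K (\<lambda>y. (norm (u y))^2)"
  using jet_estimate[OF K K'(1,3), of "n + 2"] by blast
 show ?thesis
 proof (intro exI[of _ "C * D"] conjI exI[of _ "2 * (n + 2)"] allI impI ballI)
  show "0 \<le> C * D" using D C0 by simp
 next
  fix \<mu> :: real and u and "is" :: "2 list" and x assume \<mu>: "1 \<le> \<mu>" and u: "solution \<mu> u" and len: "length is \<le> n" and x: "x \<in> L"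
  have su: "smooth_on V u" using u by (simp add: solution_def)
  let ?h = "partial_derivs is u"
  have jet: "jet_sq 2 ?h y \<le> jet_sq (n + 2) u y" for y
  proof -
   have "jet_sq 2 ?h y = (\<Sum>js\<in>(\<lambda>js. js @ is) ` {js. length js \<le> 2}. (norm (partial_derivs js u y))^2)"
    unfolding jet_sq_def by (subst sum.reindex) (auto simp: inj_on_def partial_derivs_append)
   also have "\<dots> \<le> jet_sq (n + 2) u y"
    unfolding jet_sq_def using len by (intro sum_mono2) (auto simp: finite_derivative_lists)
   finally show ?thesis .
  qed
  have BV: "cball x (e / 2) \<subseteq> V" using ball[OF x] K'V by blast
  have "(norm (?h x))^2 \<le> C * int_over (cball x (e / 2)) (jet_sq 2 ?h)"
   by (rule C[OF smooth_on_partial_derivs[OF su] BV])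
  also have "\<dots> \<le> C * int_over K' (jet_sq (n + 2) u)"
   using jet jet_sq_nonneg ball[OF x]
   by (intro mult_left_mono C0 integral_compact_mono K'(1) compact_cball)
     (auto intro: continuous_on_subset[OF continuous_on_jet_sq K'V] smooth_on_partial_derivs su)
  also have "\<dots> \<le> C * (D * \<mu> ^ (2 * (n + 2)) * int_over K (\<lambda>y. (norm (u y))^2))"
   by (intro mult_left_mono C0 D(2) \<mu> u)
  finally show "(norm (?h x))^2 \<le> C * D * \<mu> ^ (2 * (n + 2)) * int_over K (\<lambda>y. (norm (u y))^2)"
   by (simp add: mult_ac)
 qed
qed

end

section \<open>Flat functions and the distance\<close>

text \<open>Induction on the order for all derivatives simultaneously: by the mean value theorem a
  derivative vanishing at \<open>y\<close> is at most the distance times the derivatives of one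
  order more. The constant is uniform in the flat point \<open>y\<close>.\<close>

lemma flat_taylor_bound:
 fixes h :: "real^2 \<Rightarrow> real"
 assumes h: "smooth_on V h" and B: "convex B" "compact B" "B \<subseteq> V"
 shows "\<exists>C\<ge>0. \<forall>y\<in>B. \<forall>x\<in>B. (\<forall>is. partial_derivs is h y = 0) \<longrightarrow> \<bar>partial_derivs is h x\<bar> \<le> C * dist x y ^ N"
proof (induction N arbitrary: "is")
 case 0
 obtain C where "C > 0" "\<forall>x\<in>B. \<bar>partial_derivs is h x\<bar> \<le> C"
  using compact_bounded_values[OF B(2) continuous_on_subset[OF smooth_on_imp_continuous[OF smooth_on_partial_derivs[OF h]] B(3)]] by blast
 then show ?case by (intro exI[of _ C]) auto
next
 case (Suc N)
 have "\<forall>j. \<exists>C\<ge>0. \<forall>y\<in>B. \<forall>x\<in>B. (\<forall>is. partial_derivs is h y = 0) \<longrightarrow> \<bar>partial_derivs (j # is) h x\<bar> \<le> C * dist x y ^ N"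
  using Suc.IH by blast
 then obtain C where C: "\<And>j. C j \<ge> 0" "\<And>j y x. y \<in> B \<Longrightarrow> x \<in> B \<Longrightarrow> (\<forall>is. partial_derivs is h y = 0) \<Longrightarrow>
   \<bar>partial_derivs (j # is) h x\<bar> \<le> C j * dist x y ^ N" by metis
 let ?k = "partial_derivs is h"
 have "\<bar>?k x\<bar> \<le> (\<Sum>j\<in>UNIV. C j) * dist x y ^ Suc N"
  if y: "y \<in> B" and x: "x \<in> B" and flat: "\<forall>is. partial_derivs is h y = 0" for x y
 proof -
  let ?z = "\<lambda>s. y + s *\<^sub>R (x - y)"
  have zB: "?z s \<in> B" if "0 \<le> s" "s \<le> 1" for s
   using convexD_alt[OF B(1) y x that] by (simp add: algebra_simps)
  have dk: "?k differentiable (at (?z s))" if "0 \<le> s" "s \<le> 1" for s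
   using smooth_on_imp_differentiable[OF smooth_on_partial_derivs[OF h]] zB[OF that] B(3) by blast
  have "((\<lambda>s. ?k (?z s)) has_real_derivative frechet_derivative ?k (at (?z s)) (x - y)) (at s)" if s: "0 \<le> s" "s \<le> 1" for s
   using has_vector_derivative_along_segment[OF dk[OF s]] by (simp add: has_real_derivative_iff_has_vector_derivative)
  then obtain s where s: "0 < s" "s < 1" "?k (?z 1) - ?k (?z 0) = (1 - 0) * frechet_derivative ?k (at (?z s)) (x - y)"
   using MVT2[of 0 1 "\<lambda>s. ?k (?z s)" "\<lambda>s. frechet_derivative ?k (at (?z s)) (x - y)"] by auto
  have s01: "0 \<le> s" "s \<le> 1" using s by auto
  have "?k y = 0" using flat by blast
  then have "\<bar>?k x\<bar> = \<bar>\<Sum>j\<in>UNIV. ((x - y) $ j) * partial_derivs (j # is) h (?z s)\<bar>"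
   using s(3) frechet_derivative_eq_sum[OF dk[OF s01], of "x - y"] by simp
  also have "\<dots> \<le> (\<Sum>j\<in>UNIV. \<bar>(x - y) $ j\<bar> * \<bar>partial_derivs (j # is) h (?z s)\<bar>)"
   using sum_abs[of "\<lambda>j. ((x - y) $ j) * partial_derivs (j # is) h (?z s)" UNIV] by (simp add: abs_mult)
  also have "\<dots> \<le> (\<Sum>j\<in>UNIV. dist x y * (C j * dist x y ^ N))"
  proof (intro sum_mono mult_mono)
   fix j
   show "\<bar>(x - y) $ j\<bar> \<le> dist x y" unfolding dist_norm by (rule component_le_norm_cart)
   have "dist (?z s) y \<le> dist x y"
    using s01 by (simp add: dist_norm mult_left_le_one_le)
   then have "dist (?z s) y ^ N \<le> dist x y ^ N" by (intro power_mono) auto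
   then have "C j * dist (?z s) y ^ N \<le> C j * dist x y ^ N" using C(1) by (intro mult_left_mono)
   then show "\<bar>partial_derivs (j # is) h (?z s)\<bar> \<le> C j * dist x y ^ N"
    using C(2)[OF y zB[OF s01] flat, of j] by linarith
  qed auto
  also have "\<dots> = (\<Sum>j\<in>UNIV. C j) * dist x y ^ Suc N" by (simp add: sum_distrib_right sum_distrib_left mult_ac)
  finally show ?thesis .
 qed
 then show ?case using C(1) by (intro exI[of _ "\<Sum>j\<in>UNIV. C j"]) (auto simp: sum_nonneg simp del: power_Suc)
qed

text \<open>The fundamental theorem for a piecewise differentiable curve gives its velocity only a
  gauge integral. Finite length makes the velocity Lebesgue integrable, and then the norm passes
  under the integral.\<close>

lemma norm_has_integral_le_nn_integral:
 fixes v :: "real \<Rightarrow> real^2"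
 assumes I: "(v has_integral I) {a..b}" and L: "(\<integral>\<^sup>+ s \<in> {a..b}. ennreal (norm (v s)) \<partial>lborel) \<le> ennreal L" "L \<ge> 0"
 shows "norm I \<le> L"
proof -
 let ?N = "\<integral>\<^sup>+ s. ennreal (norm (indicator {a..b} s *\<^sub>R v s)) \<partial>lebesgue"
 have meas: "(\<lambda>s. indicator {a..b} s *\<^sub>R v s) \<in> borel_measurable lebesgue"
 proof -
  have "v \<in> borel_measurable (lebesgue_on {a..b})"
   using I has_integral_integrable integrable_imp_measurable by blast
  then show ?thesis
   using borel_measurable_restrict_space_iff[of "{a..b}" lebesgue v] by simp
 qed
 have nn: "?N \<le> ennreal L"
 proof -
  have "?N = (\<integral>\<^sup>+ s \<in> {a..b}. ennreal (norm (v s)) \<partial>lborel)"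
   by (subst nn_integral_completion, rule nn_integral_cong) (auto simp: indicator_def)
  then show ?thesis using L(1) by simp
 qed
 then have int: "integrable lebesgue (\<lambda>s. indicator {a..b} s *\<^sub>R v s)"
  using meas by (intro integrableI_bounded) (auto simp: order_le_less_trans)
 then have "I = (LINT s:{a..b}|lebesgue. v s)"
  using set_lebesgue_integral_eq_integral(2)[of "{a..b}" v] I by (simp add: set_integrable_def integral_unique)
 then have "norm I \<le> (LINT s|lebesgue. norm (indicator {a..b} s *\<^sub>R v s))"
  unfolding set_lebesgue_integral_def by (metis integral_norm_bound)
 also have "ennreal \<dots> = ?N"
  by (rule nn_integral_eq_integral[symmetric, OF integrable_norm[OF int]]) simp
 then have "(LINT s|lebesgue. norm (indicator {a..b} s *\<^sub>R v s)) \<le> L"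
  using nn L(2) by (metis ennreal_le_iff)
 finally show ?thesis .
qed

section \<open>Lengths of curves in charts\<close>

context surface
begin

text \<open>By \<open>quadratic_form_lower_bound\<close>, determinant over trace bounds the form
  from below; it is continuous and positive, hence bounded away from zero on
  \<open>K\<close>.\<close>

lemma metric_lower_bound:
 assumes c: "c \<in> A" and K: "compact K" "K \<subseteq> chart_image c"
 shows "\<exists>m>0. \<forall>y\<in>K. \<forall>v. m^2 * (norm v)^2 \<le> v \<bullet> (in_chart c (g c) y *v v)"
proof -
 let ?G = "in_chart c (g c)"
 let ?q = "\<lambda>y. det (?G y) / (?G y $ 1 $ 1 + ?G y $ 2 $ 2)"
 have tr: "?G y $ 1 $ 1 + ?G y $ 2 $ 2 > 0" if "y \<in> chart_image c" for y
  by (intro add_pos_pos gram_diagonal_pos c that)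
 have "continuous_on K ?q"
  using tr K(2) by (intro continuous_intros continuous_on_subset[OF Ck_on_imp_continuous[OF Ck_on_det_gram[OF c]]]
   continuous_on_subset[OF Ck_on_imp_continuous[OF Ck_on_gram[OF c]]]) fastforce+
 moreover have "?q y > 0" if "y \<in> K" for y using tr det_gram_pos[OF c] that K(2) by (intro divide_pos_pos) auto
 ultimately obtain \<delta> where \<delta>: "\<delta> > 0" "\<And>y. y \<in> K \<Longrightarrow> \<delta> \<le> ?q y"
  using compact_positive_lower_bound[OF K(1), of ?q] by blast
 have "\<delta> * (norm v)^2 \<le> v \<bullet> (?G y *v v)" if y: "y \<in> K" for y v
 proof -
  have yI: "y \<in> chart_image c" using y K(2) by blast
  have sym: "?G y $ 1 $ 2 = ?G y $ 2 $ 1"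
   using arg_cong[OF gram_sym[OF c yI], of "\<lambda>M. M $ 1 $ 2"] by (simp add: transpose_def)
  have "(?G y $ 1 $ 1 + ?G y $ 2 $ 2) * (v \<bullet> (?G y *v v)) \<ge> det (?G y) * (norm v)^2"
   using quadratic_form_lower_bound[of "?G y $ 1 $ 1" "?G y $ 2 $ 2" "?G y $ 1 $ 2" "v $ 1" "v $ 2"] sym
   by (simp add: inner_vec_def matrix_vector_mult_def sum_2 det_2 power2_norm_eq_inner algebra_simps)
  then have "?q y * (norm v)^2 \<le> v \<bullet> (?G y *v v)" using tr[OF yI] by (simp add: field_simps)
  moreover have "\<delta> * (norm v)^2 \<le> ?q y * (norm v)^2" by (intro mult_right_mono \<delta>(2) y) simp
  ultimately show ?thesis by linarith
 qed
 then show ?thesis using \<delta>(1) by (intro exI[of _ "sqrt \<delta>"]) simp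
qed

text \<open>\<open>speed\<close> is computed in the chart chosen at the point. Continuity keeps the
  curve in that chart for nearby parameters, so velocities are related by the Jacobian, which the
  transformation law of the metric compensates.\<close>

lemma speed_chart:
 assumes \<sigma>: "continuous_on {0..1} \<sigma>" and s: "s \<in> {0<..<1}" and c: "c \<in> A" "\<sigma> s \<in> chart_dom c"
  and diff: "\<And>c. c \<in> A \<Longrightarrow> \<sigma> s \<in> chart_dom c \<Longrightarrow> (\<lambda>r. chart_map c (\<sigma> r)) differentiable (at s)"
 shows "speed A g \<sigma> s = sqrt (velocity c \<sigma> s \<bullet> (in_chart c (g c) (chart_map c (\<sigma> s)) *v velocity c \<sigma> s))"
proof -
 let ?d = "chart_at A (\<sigma> s)"
 have d: "?d \<in> A" "\<sigma> s \<in> chart_dom ?d" by (rule chart_at_in)+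
 let ?y = "chart_map ?d (\<sigma> s)"
 have y: "?y \<in> chart_map ?d ` (chart_dom ?d \<inter> chart_dom c)" using d c by auto
 let ?\<psi> = "transition ?d c"
 have vd: "((\<lambda>r. chart_map e (\<sigma> r)) has_vector_derivative velocity e \<sigma> s) (at s)" if "e \<in> A" "\<sigma> s \<in> chart_dom e" for e
  unfolding velocity_def using diff[OF that] by (simp add: vector_derivative_works)
 have d\<psi>: "?\<psi> differentiable (at ?y)" by (rule differentiable_transition[OF d(1) c(1) y])
 have comp: "((\<lambda>r. ?\<psi> (chart_map ?d (\<sigma> r))) has_vector_derivative frechet_derivative ?\<psi> (at ?y) (velocity ?d \<sigma> s)) (at s)"
  using diff_chain_at[OF vd[OF d, unfolded has_vector_derivative_def] has_derivative_frechet[OF d\<psi>]]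
   linear_cmul[OF linear_frechet_derivative[OF d\<psi>]]
  by (simp add: o_def has_vector_derivative_def)
 have "isCont \<sigma> s" using \<sigma> s by (simp add: continuous_on_interior)
 then have "\<forall>\<^sub>F r in at s. \<sigma> r \<in> chart_dom ?d"
  using open_dom[OF d(1)] d(2) unfolding isCont_def tendsto_def by blast
 then obtain e where e: "e > 0" "\<And>r. r \<noteq> s \<Longrightarrow> dist r s < e \<Longrightarrow> \<sigma> r \<in> chart_dom ?d" unfolding eventually_at by blast
 have "((\<lambda>r. chart_map c (\<sigma> r)) has_vector_derivative frechet_derivative ?\<psi> (at ?y) (velocity ?d \<sigma> s)) (at s)"
 proof (rule has_vector_derivative_transform_within_open[OF comp open_ball])
  show "s \<in> ball s e" using e(1) by simp
  fix r assume "r \<in> ball s e"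
  then have "\<sigma> r \<in> chart_dom ?d" using e(2)[of r] d(2) by (cases "r = s") (auto simp: dist_commute)
  then show "?\<psi> (chart_map ?d (\<sigma> r)) = chart_map c (\<sigma> r)" by (rule transition_chart_map[OF d(1) c(1)])
 qed
 then have "velocity c \<sigma> s = frechet_derivative ?\<psi> (at ?y) (velocity ?d \<sigma> s)"
  using vd[OF c] vector_derivative_unique_at by blast
 also have "\<dots> = jacobian ?d c ?y *v velocity ?d \<sigma> s"
  unfolding jacobian_def[OF d(1) c(1)] using linear_frechet_derivative[OF d\<psi>] by (simp add: matrix_works)
 finally have v: "velocity c \<sigma> s = jacobian ?d c ?y *v velocity ?d \<sigma> s" .
 have "velocity ?d \<sigma> s \<bullet> (in_chart ?d (g ?d) ?y *v velocity ?d \<sigma> s)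
   = velocity c \<sigma> s \<bullet> (in_chart c (g c) (chart_map c (\<sigma> s)) *v velocity c \<sigma> s)"
  unfolding gram_transition[OF d(1) c(1) y] v transition_chart_map[OF d(1) c(1) d(2)]
  by (simp add: matrix_vector_mul_assoc[symmetric] transpose_matrix_vector)
   (metis dot_lmul_matrix inner_commute)
 then show ?thesis
  using chart_inv_map[OF d] by (simp add: speed_def Let_def in_chart_def[of ?d])
qed

text \<open>As long as the curve stays in the large coordinate ball, its length controls the
  coordinate displacement by \<open>l / m\<close>, less than \<open>r\<close>. Having started in the
  ball of radius \<open>r\<close> it cannot leave the one of radius \<open>2 * r\<close>.\<close>

lemma short_curve_stays_in_chart:
 assumes c: "c \<in> A" and r: "r > 0" and I: "cball p (2 * r) \<subseteq> chart_image c"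
  and m: "m > 0" "\<And>y v. y \<in> cball p (2 * r) \<Longrightarrow> m^2 * (norm v)^2 \<le> v \<bullet> (in_chart c (g c) y *v v)"
  and \<sigma>: "piecewise_C1_curve A \<sigma>" "\<sigma> 0 \<in> chart_inv c ` ball p r"
  and l: "curve_length A g \<sigma> \<le> ennreal l" "0 \<le> l" "l < m * r"
 shows "\<sigma> 1 \<in> chart_inv c ` cball p (2 * r)" "dist (chart_map c (\<sigma> 0)) (chart_map c (\<sigma> 1)) \<le> l / m"
proof -
 obtain D where cont: "continuous_on {0..1} \<sigma>" and D: "finite D" "\<And>c s. c \<in> A \<Longrightarrow> s \<in> {0<..<1} - D \<Longrightarrow> \<sigma> s \<in> chart_dom c \<Longrightarrow>
   (\<lambda>r. chart_map c (\<sigma> r)) differentiable (at s)"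
  using \<sigma>(1) unfolding piecewise_C1_curve_def by blast
 let ?W = "chart_inv c ` cball p (2 * r)"
 have WD: "?W \<subseteq> chart_dom c" using I chart_inv_in[OF c] by auto
 have W_iff: "x \<in> ?W \<Longrightarrow> chart_map c x \<in> cball p (2 * r)" for x
  using I chart_map_inv[OF c] by fastforce
 obtain y0 where y0: "y0 \<in> ball p r" "\<sigma> 0 = chart_inv c y0" using \<sigma>(2) by blast
 have y0I: "y0 \<in> chart_image c"
 proof -
  have "ball p r \<subseteq> cball p (2 * r)" using r by (auto simp: subset_iff)
  then show ?thesis using y0(1) I by blast
 qed
 have \<sigma>0: "chart_map c (\<sigma> 0) = y0" using y0(2) chart_map_inv[OF c y0I] by simp
 have step: "dist (chart_map c (\<sigma> 0)) (chart_map c (\<sigma> b)) \<le> l / m"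
  if b: "0 \<le> b" "b \<le> 1" and inW: "\<And>s. 0 \<le> s \<Longrightarrow> s \<le> b \<Longrightarrow> \<sigma> s \<in> ?W" for b
 proof -
  let ?h = "\<lambda>s. chart_map c (\<sigma> s)"
  have ch: "continuous_on {0..b} ?h"
   by (rule continuous_on_compose2[OF continuous_chart_map[OF c] continuous_on_subset[OF cont]])
     (use b inW WD in auto)
  have vd: "(?h has_vector_derivative velocity c \<sigma> s) (at s)" if "s \<in> {0<..<b} - D" for s
   unfolding velocity_def using D(2)[OF c, of s] that b inW[of s] WD by (auto simp: vector_derivative_works[symmetric])
  have "(velocity c \<sigma> has_integral (?h b - ?h 0)) {0..b}"
   by (rule fundamental_theorem_of_calculus_interior_strong[OF D(1) b(1) vd ch]) auto
  then have "((\<lambda>s. m *\<^sub>R velocity c \<sigma> s) has_integral m *\<^sub>R (?h b - ?h 0)) {0..b}" by (rule has_integral_cmul)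
  moreover have "(\<integral>\<^sup>+ s \<in> {0..b}. ennreal (norm (m *\<^sub>R velocity c \<sigma> s)) \<partial>lborel) \<le> ennreal l"
  proof -
   \<comment> \<open>The curve may fail to be differentiable at the exceptional parameters, and the
     comparison of speeds is made at interior parameters; the excluded set is finite.\<close>
   have "AE s in lborel. s \<notin> D \<union> {0, b}"
    using D(1) by (intro AE_not_in finite_imp_null_set_lborel) auto
   then have "(\<integral>\<^sup>+ s \<in> {0..b}. ennreal (norm (m *\<^sub>R velocity c \<sigma> s)) \<partial>lborel) \<le> curve_length A g \<sigma>"
    unfolding curve_length_def
   proof (intro nn_integral_mono_AE, eventually_elim)
    case (elim s)
    show ?case
    proof (cases "s \<in> {0..b}")
     case True
     then have s: "s \<in> {0<..<b} - D" "s \<in> {0<..<1}" using elim b by auto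
     have sW: "\<sigma> s \<in> ?W" using inW s by auto
     have "speed A g \<sigma> s = sqrt (velocity c \<sigma> s \<bullet> (in_chart c (g c) (?h s) *v velocity c \<sigma> s))"
      by (rule speed_chart[OF cont s(2) c]) (use sW WD D(2) s in auto)
     moreover have "m^2 * (norm (velocity c \<sigma> s))^2 \<le> velocity c \<sigma> s \<bullet> (in_chart c (g c) (?h s) *v velocity c \<sigma> s)"
      by (rule m(2)[OF W_iff[OF sW]])
     ultimately have "norm (m *\<^sub>R velocity c \<sigma> s) \<le> speed A g \<sigma> s"
      using m(1) by (simp add: real_le_rsqrt power_mult_distrib)
     then show ?thesis using True b by (simp add: ennreal_leI)
    qed simp
   qed
   then show ?thesis using l(1) by (rule order_trans)
  qed
  ultimately have "norm (m *\<^sub>R (?h b - ?h 0)) \<le> l"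
   by (rule norm_has_integral_le_nn_integral) (use l(2) in simp)
  then show ?thesis using m(1) by (simp add: dist_norm norm_minus_commute pos_le_divide_eq mult.commute)
 qed
 have lm: "l / m < r" using l(3) m(1) by (simp add: field_simps)
 define \<rho> where "\<rho> = r + l / m"
 have \<rho>: "\<rho> < 2 * r" using lm by (simp add: \<rho>_def)
 have inV: "\<sigma> s \<in> ?W" if s: "0 \<le> s" "s \<le> 1" for s
 proof (rule ccontr)
  assume out: "\<sigma> s \<notin> ?W"
  let ?V = "chart_inv c ` ball p (2 * r)"
  have VW: "?V \<subseteq> ?W" by (intro image_mono ball_subset_cball)
  have V: "open ?V" by (rule open_chart_inv_image[OF c open_ball]) (use I ball_subset_cball in blast)
  \<comment> \<open>Its least element is the first exit time from the open ball. Before it the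
    displacement bound keeps the curve in the smaller closed set \<open>?C\<close>, and closedness
    carries this over to the exit time itself, a contradiction.\<close>
  define S where "S = {s \<in> {0..1}. \<sigma> s \<in> - ?V}"
  have S_eq: "S = {0..1} \<inter> \<sigma> -` (- ?V)" by (auto simp: S_def)
  have "closed S"
   unfolding S_eq using V by (intro continuous_closed_preimage cont) auto
  then have S: "compact S"
   using closed_Int_compact[OF _ compact_Icc[of 0 "1::real"], of S] by (simp add: S_eq Int_ac)
  have "s \<in> S" using s out VW by (auto simp: S_def)
  then obtain s1 where s1: "s1 \<in> S" "\<And>t. t \<in> S \<Longrightarrow> s1 \<le> t"
   using compact_attains_inf[OF S] by blast
  have before: "\<sigma> t \<in> ?V" if "0 \<le> t" "t < s1" for t
   using s1 that by (force simp: S_def)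
  have "\<sigma> 0 \<in> ?V" using y0 r by (auto intro!: imageI)
  then have s1pos: "0 < s1" using s1(1) by (cases "s1 = 0") (auto simp: S_def)
  have s1le: "s1 \<le> 1" using s1(1) by (simp add: S_def)
  let ?C = "chart_inv c ` cball p \<rho>"
  have CV: "?C \<subseteq> ?V" using \<rho> by (intro image_mono) (auto simp: subset_iff)
  have "cball p \<rho> \<subseteq> chart_image c" using I \<rho> by (meson cball_subset_cball_iff dual_order.trans less_imp_le subset_cball)
  then have C: "closed ?C" by (rule closed_chart_inv_image[OF c compact_cball])
  have inC: "\<sigma> t \<in> ?C" if t: "0 \<le> t" "t < s1" for t
  proof -
   have "dist (chart_map c (\<sigma> 0)) (chart_map c (\<sigma> t)) \<le> l / m"
    by (rule step) (use t s1le before VW in \<open>auto simp: subset_iff\<close>)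
   then have "chart_map c (\<sigma> t) \<in> cball p \<rho>"
    using y0(1) dist_triangle[of p "chart_map c (\<sigma> t)" y0] unfolding \<sigma>0 \<rho>_def by simp
   moreover have "chart_inv c (chart_map c (\<sigma> t)) = \<sigma> t"
    using chart_inv_map[OF c] before[OF t] VW WD by blast
   ultimately show ?thesis by (metis imageI)
  qed
  have "s1 \<in> closure {0..<s1}" using s1pos by simp
  moreover have "continuous_on (closure {0..<s1}) \<sigma>"
   using s1pos s1le by (intro continuous_on_subset[OF cont]) auto
  moreover have "\<sigma> ` {0..<s1} \<subseteq> ?C" using inC by auto
  ultimately have "\<sigma> s1 \<in> ?C"
   using image_closure_subset[of "{0..<s1}" \<sigma> ?C] C by blast
  then show False using CV s1(1) by (auto simp: S_def)
 qed
 then show "\<sigma> 1 \<in> ?W" by simp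
 show "dist (chart_map c (\<sigma> 0)) (chart_map c (\<sigma> 1)) \<le> l / m" by (rule step) (use inV in auto)
qed

text \<open>A short curve stays in one chart, where \<open>flat_taylor_bound\<close> at its end
  point applies. A long one has length at least \<open>m x * r x\<close>, so a multiple of
  \<open>l ^ N\<close> exceeds the global bound of \<open>f\<close>. These two cases are the two
  summands of \<open>?k\<close>; a finite cover makes the constant uniform.\<close>

lemma flat_le_curve_length:
 fixes f :: "'a \<Rightarrow> real"
 assumes f: "smooth_function A f" and flat: "flat_on A S f"
 shows "\<exists>C\<ge>0. \<forall>\<sigma> l. piecewise_C1_curve A \<sigma> \<and> \<sigma> 1 \<in> S \<and> 0 \<le> l \<and> curve_length A g \<sigma> \<le> ennreal l \<longrightarrow> \<bar>f (\<sigma> 0)\<bar> \<le> C * l ^ N"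
proof -
 have "\<exists>c r m. c \<in> A \<and> x \<in> chart_dom c \<and> r > 0 \<and> cball (chart_map c x) (2 * r) \<subseteq> chart_image c \<and> m > 0 \<and>
   (\<forall>y\<in>cball (chart_map c x) (2 * r). \<forall>v. m^2 * (norm v)^2 \<le> v \<bullet> (in_chart c (g c) y *v v))" for x
 proof -
  obtain c r where c: "c \<in> A" "x \<in> chart_dom c" and r: "r > 0" "cball (chart_map c x) r \<subseteq> chart_image c"
   using ex_chart_cball .
  have "cball (chart_map c x) (2 * (r / 2)) \<subseteq> chart_image c" using r by simp
  moreover obtain m where "m > 0" "\<forall>y\<in>cball (chart_map c x) (2 * (r / 2)). \<forall>v. m^2 * (norm v)^2 \<le> v \<bullet> (in_chart c (g c) y *v v)"
   using metric_lower_bound[OF c(1) compact_cball calculation] by blast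
  ultimately show ?thesis using c r(1) by (intro exI[of _ c] exI[of _ "r / 2"] exI[of _ m]) auto
 qed
 then obtain C r m where C: "\<And>x. C x \<in> A" "\<And>x. x \<in> chart_dom (C x)" "\<And>x. r x > 0"
  "\<And>x. cball (chart_map (C x) x) (2 * r x) \<subseteq> chart_image (C x)" "\<And>x. m x > 0"
  "\<And>x y v. y \<in> cball (chart_map (C x) x) (2 * r x) \<Longrightarrow> (m x)^2 * (norm v)^2 \<le> v \<bullet> (in_chart (C x) (g (C x)) y *v v)"
  by metis
 have rI: "ball (chart_map (C x) x) (r x) \<subseteq> chart_image (C x)" for x
  using C(4)[of x] C(3)[of x] by (auto simp: subset_iff)
 let ?U = "\<lambda>x. chart_inv (C x) ` ball (chart_map (C x) x) (r x)"
 have op: "open (?U x)" for x by (rule open_chart_inv_image[OF C(1) open_ball rI])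
 have "x \<in> ?U x" for x
  using chart_inv_map[OF C(1) C(2)] C(3) by (metis centre_in_ball imageI)
 then obtain F where F: "finite F" "UNIV \<subseteq> (\<Union>x\<in>F. ?U x)"
  by (rule finite_open_cover[OF op])
 obtain M where M: "\<And>x. \<bar>f x\<bar> \<le> M"
  using compact_bounded_values[OF compact_UNIV smooth_function_continuous[OF f]] by blast
 have M0: "M \<ge> 0" using M[of undefined] by linarith
 have "\<exists>c\<ge>0. \<forall>\<sigma> l. piecewise_C1_curve A \<sigma> \<and> \<sigma> 1 \<in> S \<and> 0 \<le> l \<and> curve_length A g \<sigma> \<le> ennreal l \<and> \<sigma> 0 \<in> ?U x \<longrightarrow>
   \<bar>f (\<sigma> 0)\<bar> \<le> c * l ^ N" for x
 proof -
  let ?c = "C x" and ?p = "chart_map (C x) x" and ?B = "cball (chart_map (C x) x) (2 * r x)"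
  have fc: "smooth_on (chart_image ?c) (in_chart ?c f)" using f C(1) by (simp add: smooth_function_def)
  obtain K where K: "K \<ge> 0" "\<And>y z. y \<in> ?B \<Longrightarrow> z \<in> ?B \<Longrightarrow> (\<forall>is. partial_derivs is (in_chart ?c f) y = 0) \<Longrightarrow>
    \<bar>partial_derivs [] (in_chart ?c f) z\<bar> \<le> K * dist z y ^ N"
   using flat_taylor_bound[OF fc convex_cball compact_cball C(4), of "[]" N] by blast
  let ?k = "K / m x ^ N + M / (m x * r x) ^ N"
  have mr: "m x * r x > 0" using C(3,5) by simp
  have kpos: "0 \<le> K / m x ^ N" "0 \<le> M / (m x * r x) ^ N"
   using K(1) C(5)[of x] M0 mr by (simp_all add: less_imp_le)
  have "\<bar>f (\<sigma> 0)\<bar> \<le> ?k * l ^ N"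
   if \<sigma>: "piecewise_C1_curve A \<sigma>" "\<sigma> 1 \<in> S" and l: "0 \<le> l" "curve_length A g \<sigma> \<le> ennreal l" and s0: "\<sigma> 0 \<in> ?U x" for \<sigma> l
  proof (cases "l < m x * r x")
   case True
   note stay = short_curve_stays_in_chart[OF C(1) C(3) C(4) C(5) C(6) \<sigma>(1) s0 l(2,1) True]
   obtain z where z: "z \<in> ball ?p (r x)" "\<sigma> 0 = chart_inv ?c z" using s0 by blast
   obtain y where y: "y \<in> ?B" "\<sigma> 1 = chart_inv ?c y" using stay(1) by blast
   have zB: "z \<in> ?B" using z(1) C(3)[of x] by simp
   have zI: "z \<in> chart_image ?c" and yI: "y \<in> chart_image ?c" using zB y(1) C(4) by blast+
   have mz: "chart_map ?c (\<sigma> 0) = z" "chart_map ?c (\<sigma> 1) = y"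
    using z(2) y(2) chart_map_inv[OF C(1)] zI yI by auto
   have "\<forall>is. partial_derivs is (in_chart ?c f) y = 0"
    using flat \<sigma>(2) C(1) chart_inv_in[OF C(1) yI] y(2) mz(2) unfolding flat_on_def by (metis IntI)
   then have "\<bar>in_chart ?c f z\<bar> \<le> K * dist z y ^ N" using K(2)[OF y(1) zB] by simp
   also have "\<dots> \<le> K * (l / m x) ^ N"
    using stay(2) K(1) by (intro mult_left_mono power_mono) (auto simp: mz)
   also have "\<dots> = K / m x ^ N * l ^ N" by (simp add: power_divide)
   also have "\<dots> \<le> ?k * l ^ N" using kpos l(1) by (intro mult_right_mono) auto
   finally show ?thesis using z(2) by (simp add: in_chart_def)
  next
   case False
   then have "(m x * r x) ^ N \<le> l ^ N" using mr by (intro power_mono) auto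
   then have "M \<le> M / (m x * r x) ^ N * l ^ N"
    using mult_left_mono[OF _ M0] zero_less_power[OF mr, of N] by (simp add: pos_le_divide_eq)
   also have "\<dots> \<le> ?k * l ^ N" using kpos l(1) by (intro mult_right_mono) auto
   finally show ?thesis using M[of "\<sigma> 0"] by linarith
  qed
  then show ?thesis using kpos by (intro exI[of _ ?k]) (auto intro: add_nonneg_nonneg)
 qed
 then obtain k where k: "\<And>x. k x \<ge> 0" "\<And>x \<sigma> l. piecewise_C1_curve A \<sigma> \<Longrightarrow> \<sigma> 1 \<in> S \<Longrightarrow> 0 \<le> l \<Longrightarrow> curve_length A g \<sigma> \<le> ennreal l \<Longrightarrow>
   \<sigma> 0 \<in> ?U x \<Longrightarrow> \<bar>f (\<sigma> 0)\<bar> \<le> k x * l ^ N" by metis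
 show ?thesis
 proof (rule exI[of _ "\<Sum>x\<in>F. k x"], intro conjI allI impI)
  show "0 \<le> (\<Sum>x\<in>F. k x)" using k(1) by (simp add: sum_nonneg)
 next
  fix \<sigma> l assume as: "piecewise_C1_curve A \<sigma> \<and> \<sigma> 1 \<in> S \<and> 0 \<le> l \<and> curve_length A g \<sigma> \<le> ennreal l"
  obtain x where x: "x \<in> F" "\<sigma> 0 \<in> ?U x" using F(2) by blast
  then have "\<bar>f (\<sigma> 0)\<bar> \<le> k x * l ^ N" using k(2) as by blast
  also have "\<dots> \<le> (\<Sum>x\<in>F. k x) * l ^ N"
   using as x(1) F(1) k(1) by (intro mult_right_mono member_le_sum) auto
  finally show "\<bar>f (\<sigma> 0)\<bar> \<le> (\<Sum>x\<in>F. k x) * l ^ N" .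
 qed
qed

text \<open>The distance is an infimum, so curves of length below the distance plus \<open>e\<close>
  exist for each positive \<open>e\<close>; the estimate for curves is taken to the limit.\<close>

lemma flat_le_distance:
 fixes f :: "'a \<Rightarrow> real"
 assumes f: "smooth_function A f" and flat: "flat_on A S f"
 shows "\<exists>C\<ge>0. \<forall>x. dist_to_set A g x S < \<infinity> \<longrightarrow> \<bar>f x\<bar> \<le> C * enn2real (dist_to_set A g x S) ^ N"
proof -
 obtain C where C: "C \<ge> 0" "\<And>\<sigma> l. piecewise_C1_curve A \<sigma> \<Longrightarrow> \<sigma> 1 \<in> S \<Longrightarrow> 0 \<le> l \<Longrightarrow> curve_length A g \<sigma> \<le> ennreal l \<Longrightarrow>
   \<bar>f (\<sigma> 0)\<bar> \<le> C * l ^ N"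
  using flat_le_curve_length[OF assms] by blast
 have "\<bar>f x\<bar> \<le> C * enn2real (dist_to_set A g x S) ^ N" if fin: "dist_to_set A g x S < \<infinity>" for x
 proof -
  let ?d = "enn2real (dist_to_set A g x S)"
  have d: "dist_to_set A g x S = ennreal ?d" using fin by simp
  have le: "\<bar>f x\<bar> \<le> C * (?d + e) ^ N" if e: "e > 0" for e
  proof -
   have "dist_to_set A g x S < ennreal (?d + e)"
    by (subst d) (use e in \<open>simp add: ennreal_less_iff\<close>)
   then obtain y where y: "y \<in> S" "riemannian_dist A g x y < ennreal (?d + e)"
    unfolding dist_to_set_def INF_less_iff by blast
   then obtain \<sigma> where \<sigma>: "piecewise_C1_curve A \<sigma>" "\<sigma> 0 = x" "\<sigma> 1 = y" "curve_length A g \<sigma> < ennreal (?d + e)"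
    unfolding riemannian_dist_def INF_less_iff by blast
   show ?thesis using C(2)[of \<sigma> "?d + e"] \<sigma> y(1) e by (simp add: less_imp_le)
  qed
  have "((\<lambda>e. C * (?d + e) ^ N) \<longlongrightarrow> C * (?d + 0) ^ N) (at_right 0)"
   by (intro tendsto_intros)
  moreover have "\<forall>\<^sub>F e in at_right 0. \<bar>f x\<bar> \<le> C * (?d + e) ^ N"
   using le by (auto simp: eventually_at_filter)
  ultimately have "\<bar>f x\<bar> \<le> C * (?d + 0) ^ N"
   by (intro tendsto_lowerbound[where F = "at_right (0::real)"]) auto
  then show ?thesis by simp
 qed
 then show ?thesis using C(1) by blast
qed

end

section \<open>Rapidly decreasing sequences\<close>

lemma rapidly_decreasing_iff:
 "rapidly_decreasing a \<longleftrightarrow> (\<forall>N. \<exists>C\<ge>0. \<forall>\<^sub>F m in sequentially. \<bar>a m\<bar> \<le> C / real m ^ N)"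
proof -
 have "a \<in> O(\<lambda>m. 1 / real m ^ N) \<longleftrightarrow> (\<exists>C\<ge>0. \<forall>\<^sub>F m in sequentially. \<bar>a m\<bar> \<le> C / real m ^ N)"
  (is "_ \<longleftrightarrow> (\<exists>C\<ge>0. ?E C)") for N
 proof
  assume "a \<in> O(\<lambda>m. 1 / real m ^ N)"
  then obtain c where "c > 0" "\<forall>\<^sub>F m in sequentially. norm (a m) \<le> c * norm (1 / real m ^ N)" by (rule landau_o.bigE)
  then show "\<exists>C\<ge>0. ?E C" by (intro exI[of _ c]) simp
 next
  assume "\<exists>C\<ge>0. ?E C"
  then obtain C where "?E C" by blast
  then show "a \<in> O(\<lambda>m. 1 / real m ^ N)" by (intro bigoI[where c = C]) simp
 qed
 then show ?thesis unfolding rapidly_decreasing_def by blast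
qed

lemma rapidly_decreasing_dominated:
 assumes b: "rapidly_decreasing b" and le: "\<forall>\<^sub>F m in sequentially. \<bar>a m\<bar> \<le> C * real m ^ k * \<bar>b m\<bar>" and C: "C \<ge> 0"
 shows "rapidly_decreasing a"
 unfolding rapidly_decreasing_iff
proof
 fix N
 obtain D where D: "D \<ge> 0" "\<forall>\<^sub>F m in sequentially. \<bar>b m\<bar> \<le> D / real m ^ (k + N)"
  using b unfolding rapidly_decreasing_iff by blast
 have "\<forall>\<^sub>F m in sequentially. \<bar>a m\<bar> \<le> (C * D) / real m ^ N"
  using le D(2) eventually_gt_at_top[of 0]
 proof eventually_elim
  case (elim m)
  have "\<bar>a m\<bar> \<le> C * real m ^ k * (D / real m ^ (k + N))"
   using elim(1) mult_left_mono[OF elim(2), of "C * real m ^ k"] C by simp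
  also have "\<dots> = C * D / real m ^ N" using elim(3) by (simp add: power_add)
  finally show ?case .
 qed
 then show "\<exists>C\<ge>0. \<forall>\<^sub>F m in sequentially. \<bar>a m\<bar> \<le> C / real m ^ N"
  using C D(1) by (intro exI[of _ "C * D"]) simp
qed

lemma rapidly_decreasing_add:
 "rapidly_decreasing a \<Longrightarrow> rapidly_decreasing b \<Longrightarrow> rapidly_decreasing (\<lambda>m. a m + b m)"
 unfolding rapidly_decreasing_def by (blast intro: sum_in_bigo)

lemma rapidly_decreasing_sqrt:
 assumes "rapidly_decreasing b" shows "rapidly_decreasing (\<lambda>m. sqrt \<bar>b m\<bar>)"
 unfolding rapidly_decreasing_iff
proof
 fix N
 obtain D where D: "D \<ge> 0" "\<forall>\<^sub>F m in sequentially. \<bar>b m\<bar> \<le> D / real m ^ (2 * N)"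
  using assms unfolding rapidly_decreasing_iff by blast
 have "\<forall>\<^sub>F m in sequentially. \<bar>sqrt \<bar>b m\<bar>\<bar> \<le> sqrt D / real m ^ N"
  using D(2)
 proof eventually_elim
  case (elim m)
  then have "sqrt \<bar>b m\<bar> \<le> sqrt (D / real m ^ (2 * N))" by simp
  also have "\<dots> = sqrt D / real m ^ N"
   by (simp add: real_sqrt_divide power_mult mult.commute[of 2] real_sqrt_power[symmetric])
  finally show ?case by simp
 qed
 then show "\<exists>C\<ge>0. \<forall>\<^sub>F m in sequentially. \<bar>sqrt \<bar>b m\<bar>\<bar> \<le> C / real m ^ N"
  using D(1) by (intro exI[of _ "sqrt D"]) simp
qed

lemma rapidly_decreasing_half_power: "rapidly_decreasing (\<lambda>m. (1 / 2) ^ m)"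
 unfolding rapidly_decreasing_def by (intro allI) real_asymp

lemma eventually_le_real: "\<forall>\<^sub>F m in sequentially. X \<le> real m"
 using filterlim_real_sequentially unfolding filterlim_at_top by blast

lemma rapidly_decreasing_le_1:
 assumes "rapidly_decreasing a" shows "\<forall>\<^sub>F m in sequentially. \<bar>a m\<bar> \<le> 1"
proof -
 obtain K where "\<forall>\<^sub>F m in sequentially. \<bar>a m\<bar> \<le> K / real m ^ 1"
  using assms unfolding rapidly_decreasing_iff by blast
 then show ?thesis
  using eventually_le_real[of "max 1 K"]
 proof eventually_elim
  case (elim m)
  then have "K / real m ^ 1 \<le> 1" by (simp add: field_simps)
  then show ?case by (rule order_trans[OF elim(1)])
 qed
qed

lemma eventually_le_quadratic:
 assumes "c > 0" shows "\<forall>\<^sub>F m in sequentially. X \<le> c * (real m)^2"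
 using eventually_le_real[of "max 1 (X / c)"]
proof eventually_elim
 case (elim m)
 have "real m * 1 \<le> real m * real m" using elim by (intro mult_left_mono) auto
 moreover have "X / c \<le> real m" using elim by simp
 ultimately have "X / c \<le> (real m)^2" unfolding power2_eq_square by linarith
 then show ?case using assms by (simp add: field_simps)
qed

lemma quadratic_growth:
 assumes T: "T > 0" and lam: "(\<lambda>m. lam m - ((2 * pi * real m + \<alpha>) / T)^2) \<in> O(\<lambda>_. 1)"
 shows "\<exists>c>0. \<exists>C>0. \<forall>\<^sub>F m in sequentially. c * (real m)^2 \<le> lam m \<and> lam m \<le> C * (real m)^2"
proof -
 obtain K where K: "K > 0" "\<forall>\<^sub>F m in sequentially. norm (lam m - ((2 * pi * real m + \<alpha>) / T)^2) \<le> K * norm (1::real)"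
  using lam by (rule landau_o.bigE)
 \<comment> \<open>With x = p m the unperturbed root is x + q. Once |q| is at most x/4 and
   \<open>K\<close> at most x^2/4, the square lies between 9/16 and 25/16 of x^2, and
   \<open>lam m\<close> between 1/4 and 2 times x^2.\<close>
 define p q where "p = 2 * pi / T" and "q = \<alpha> / T"
 have p: "p > 0" using T by (simp add: p_def)
 have "\<forall>\<^sub>F m in sequentially. p^2 / 4 * (real m)^2 \<le> lam m \<and> lam m \<le> 2 * p^2 * (real m)^2"
  using K(2) eventually_le_real[of "4 * \<bar>q\<bar> / p"] eventually_le_quadratic[OF zero_less_power[OF p], of "4 * K" 2]
 proof eventually_elim
  case (elim m)
  let ?x = "p * real m"
  have q: "4 * \<bar>q\<bar> \<le> ?x" using elim(2) p by (simp add: field_simps)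
  have K4: "4 * K \<le> ?x^2" using elim(3) by (simp add: power_mult_distrib)
  have x: "?x \<ge> 0" using p by simp
  have "(3 / 4 * ?x)^2 \<le> (?x + q)^2" using q x by (intro power_mono) auto
  moreover have "(?x + q)^2 \<le> (5 / 4 * ?x)^2" using q x by (intro power_mono) auto
  moreover have "(2 * pi * real m + \<alpha>) / T = ?x + q" by (simp add: p_def q_def add_divide_distrib)
  then have "\<bar>lam m - (?x + q)^2\<bar> \<le> K" using elim(1) by simp
  ultimately have "?x^2 / 4 \<le> lam m \<and> lam m \<le> 2 * ?x^2"
   using K4 by (simp add: power_mult_distrib power_divide) (smt (verit) zero_le_power2)
  then show ?case by (simp add: power_mult_distrib mult.assoc)
 qed
 then show ?thesis using p by (intro exI[of _ "p^2 / 4"] conjI exI[of _ "2 * p^2"]) auto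
qed

lemma power_le_fact_exp:
 fixes z :: real
 assumes "z \<ge> 0" shows "z ^ k \<le> fact k * exp z"
proof -
 have "(\<Sum>n\<in>{k}. z ^ n /\<^sub>R fact n) \<le> (\<Sum>n. z ^ n /\<^sub>R fact n)"
  by (rule sum_le_suminf[OF summable_exp_generic]) (use assms in auto)
 then show ?thesis by (simp add: exp_def field_simps)
qed

context surface
begin

text \<open>Flatness gives \<open>f\<close> the factor \<open>d ^ (2 * k)\<close>, and the Gaussian
  turns it into \<open>fact k / s ^ k\<close> because one term of the exponential series is at most
  the whole. At infinite distance \<open>gaussian\<close> is zero.\<close>

lemma flat_times_gaussian:
 fixes f :: "'a \<Rightarrow> real"
 assumes "smooth_function A f" "flat_on A S f"
 shows "\<exists>C\<ge>0. \<forall>s>0. \<forall>x. \<bar>f x\<bar> * gaussian s (dist_to_set A g x S) \<le> C / s ^ k"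
proof -
 obtain C where C: "C \<ge> 0" "\<And>x. dist_to_set A g x S < \<infinity> \<Longrightarrow> \<bar>f x\<bar> \<le> C * enn2real (dist_to_set A g x S) ^ (2 * k)"
  using flat_le_distance[OF assms] by blast
 have "\<bar>f x\<bar> * gaussian s (dist_to_set A g x S) \<le> C * fact k / s ^ k" if s: "s > 0" for s x
 proof (cases "dist_to_set A g x S = \<infinity>")
  case True
  then show ?thesis using s C(1) by (simp add: gaussian_def)
 next
  case False
  let ?d = "enn2real (dist_to_set A g x S)"
  have "(s * ?d^2) ^ k \<le> fact k * exp (s * ?d^2)" using s by (intro power_le_fact_exp) simp
  then have d: "?d ^ (2 * k) * exp (- s * ?d^2) \<le> fact k / s ^ k"
   using s by (simp add: power_mult_distrib power_mult[symmetric] exp_minus field_simps)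
  have "\<bar>f x\<bar> * exp (- s * ?d^2) \<le> C * ?d ^ (2 * k) * exp (- s * ?d^2)"
   using False C(2)[of x] by (intro mult_right_mono) (auto simp: less_top)
  also have "\<dots> \<le> C * (fact k / s ^ k)" using mult_left_mono[OF d C(1)] by (simp add: mult.assoc)
  finally show ?thesis using False by (simp add: gaussian_def)
 qed
 then show ?thesis using C(1) by (intro exI[of _ "C * fact k"]) simp
qed

lemma flat_times_quasi_modes:
 fixes f :: "'a \<Rightarrow> real" and u :: "nat \<Rightarrow> 'a \<Rightarrow> complex"
 assumes f: "smooth_function A f" "flat_on A S f"
  and bound: "\<forall>\<^sub>F m in sequentially. \<forall>x. cmod (u m x) \<le> C * real m powr N * gaussian (b * sqrt (lam m)) (dist_to_set A g x S)"
  and C: "C > 0" and b: "b > 0" and c: "c > 0" and lam: "\<forall>\<^sub>F m in sequentially. c * (real m)^2 \<le> lam m"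
 shows "\<exists>D\<ge>0. \<forall>\<^sub>F m in sequentially. \<forall>x. \<bar>f x\<bar> * cmod (u m x) \<le> D / real m ^ K"
proof -
 \<comment> \<open>The order \<open>n + K\<close> pays both for the polynomial growth of exponent
   \<open>N\<close> and for the required decay, since the Gaussian parameter
   \<open>b * sqrt (lam m)\<close> is at least of order \<open>m\<close>.\<close>
 define n where "n = nat \<lceil>N\<rceil>"
 obtain C' where C': "C' \<ge> 0" "\<And>s x. s > 0 \<Longrightarrow> \<bar>f x\<bar> * gaussian s (dist_to_set A g x S) \<le> C' / s ^ (n + K)"
  using flat_times_gaussian[OF f] by blast
 let ?a = "b * sqrt c"
 let ?D = "C * C' / ?a ^ (n + K)"
 have a: "?a > 0" using b c by simp
 have "\<forall>\<^sub>F m in sequentially. \<forall>x. \<bar>f x\<bar> * cmod (u m x) \<le> ?D / real m ^ K"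
  using bound lam eventually_gt_at_top[of 0]
 proof eventually_elim
  case (elim m)
  let ?s = "b * sqrt (lam m)"
  have m: "real m \<ge> 1" using elim(3) by simp
  have "sqrt (c * (real m)^2) \<le> sqrt (lam m)" using elim(2) by simp
  then have s: "?a * real m \<le> ?s" using b by (simp add: real_sqrt_mult)
  have am: "?a * real m > 0" using b c m by simp
  have powr: "real m powr N \<le> real m ^ n"
  proof -
   have "real m powr N \<le> real m powr real n" using m by (intro powr_mono) (auto simp: n_def, linarith)
   then show ?thesis using m by (simp add: powr_realpow)
  qed
  show ?case
  proof
   fix x
   let ?G = "gaussian ?s (dist_to_set A g x S)"
   have G: "?G \<ge> 0" by (simp add: gaussian_def)
   have "\<bar>f x\<bar> * ?G \<le> C' / ?s ^ (n + K)" using am s by (intro C'(2)) linarith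
   also have "\<dots> \<le> C' / (?a * real m) ^ (n + K)"
   proof (intro divide_left_mono power_mono s C'(1))
    show "0 < ?s ^ (n + K) * (?a * real m) ^ (n + K)"
     using zero_less_power[OF am] zero_less_power[OF less_le_trans[OF am s]] by (rule mult_pos_pos[rotated])
   qed (use am in linarith)
   finally have fG: "\<bar>f x\<bar> * ?G \<le> C' / (?a * real m) ^ (n + K)" .
   have "\<bar>f x\<bar> * cmod (u m x) \<le> \<bar>f x\<bar> * (C * real m powr N * ?G)"
    using elim(1) by (intro mult_left_mono) auto
   also have "\<dots> = (C * real m powr N) * (\<bar>f x\<bar> * ?G)" by simp
   also have "\<dots> \<le> (C * real m ^ n) * (C' / (?a * real m) ^ (n + K))"
    using powr C fG G by (intro mult_mono) auto
   also have "\<dots> = ?D / real m ^ K" using m by (simp add: power_mult_distrib power_add)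
   finally show "\<bar>f x\<bar> * cmod (u m x) \<le> ?D / real m ^ K" .
  qed
 qed
 moreover have "?D \<ge> 0" using C C'(1) a by simp
 ultimately show ?thesis by blast
qed

lemma rapidly_decreasing_integral_square:
 fixes v :: "nat \<Rightarrow> 'a \<Rightarrow> real"
 assumes v: "\<And>m. continuous_on UNIV (v m)" "\<And>K. \<exists>D\<ge>0. \<forall>\<^sub>F m in sequentially. \<forall>x. \<bar>v m x\<bar> \<le> D / real m ^ K"
 shows "rapidly_decreasing (\<lambda>m. LINT x|area. (v m x)^2)"
 unfolding rapidly_decreasing_iff
proof
 fix N
 interpret finite_measure area by (rule finite_measure_area)
 obtain D where D: "D \<ge> 0" "\<forall>\<^sub>F m in sequentially. \<forall>x. \<bar>v m x\<bar> \<le> D / real m ^ N" using v(2) by blast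
 let ?M = "measure area (space area)"
 have "\<forall>\<^sub>F m in sequentially. \<bar>LINT x|area. (v m x)^2\<bar> \<le> (D^2 * ?M) / real m ^ N"
  using D(2) eventually_gt_at_top[of 0]
 proof eventually_elim
  case (elim m)
  have int: "integrable area (\<lambda>x. (v m x)^2)" by (intro integrable_area_continuous continuous_intros v)
  have "(LINT x|area. (v m x)^2) \<le> (LINT x|area. (D / real m ^ N)^2)"
  proof (rule integral_mono[OF int])
   fix x
   have "\<bar>v m x\<bar>\<^sup>2 \<le> (D / real m ^ N)^2" using elim by (intro power_mono) auto
   then show "(v m x)^2 \<le> (D / real m ^ N)^2" by simp
  qed simp
  also have "\<dots> = D^2 * ?M / (real m ^ N * real m ^ N)" by (simp add: power_divide power2_eq_square)
  also have "\<dots> \<le> D^2 * ?M / (real m ^ N * 1)"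
   using elim(2) by (intro divide_left_mono mult_left_mono mult_pos_pos) (auto simp: Suc_le_eq)
  finally show ?case by simp
 qed
 then show "\<exists>C\<ge>0. \<forall>\<^sub>F m in sequentially. \<bar>LINT x|area. (v m x)^2\<bar> \<le> C / real m ^ N"
  by (intro exI[of _ "D^2 * ?M"]) simp
qed

end

context conformal_family
begin

text \<open>With F = exp (t f), the defect of \<open>u\<close> for the conformal Laplacian is F
  times its defect for \<open>g\<close> plus \<open>r * (F - 1) * u\<close>. As F - 1 is at most
  \<open>f x * exp B\<close>, the second term is controlled by the product of \<open>f\<close> and
  \<open>u\<close>.\<close>

lemma quasimode_conformal:
 assumes u: "smooth_function A u" "L2_norm_on area u = 1" and t: "t \<in> {0..1}" and B: "\<And>x. f x \<le> B"
 shows "L2_norm_on (conformal_area t) (\<lambda>x. laplacian A (conformal_metric f g t) u x - r *\<^sub>R u x)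
  \<le> sqrt (exp B * (2 * exp B * (L2_norm_on area (\<lambda>x. laplacian A g u x - r *\<^sub>R u x))^2
    + 2 * r^2 * (exp B)^2 * (LINT x|area. (f x * cmod (u x))^2))) * L2_norm_on (conformal_area t) u"
  (is "?l \<le> sqrt (exp B * ?R) * ?n") and "L2_norm_on (conformal_area t) u > 0"
proof -
 have cu: "continuous_on UNIV u" by (rule smooth_function_continuous[OF u(1)])
 let ?v = "\<lambda>x. laplacian A g u x - r *\<^sub>R u x"
 let ?w = "\<lambda>x. laplacian A (conformal_metric f g t) u x - r *\<^sub>R u x"
 have cv: "continuous_on UNIV ?v" by (intro continuous_intros continuous_laplacian u cu)
 have cw: "continuous_on UNIV ?w" by (intro continuous_intros continuous_laplacian_conformal u cu)
 have ptw: "exp (- t * f x) * (cmod (?w x))^2 \<le> 2 * exp B * (cmod (?v x))^2 + 2 * r^2 * (exp B)^2 * (f x * cmod (u x))^2" for x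
 proof -
  let ?F = "exp (t * f x)"
  have tf: "0 \<le> t * f x" "t * f x \<le> f x" using t f_nonneg[of x] by (auto simp: mult_left_le_one_le)
  have F: "1 \<le> ?F" "?F \<le> exp B" using tf B[of x] by auto
  have "1 - t * f x \<le> exp (- (t * f x))" using exp_ge_add_one_self[of "- (t * f x)"] by simp
  then have "?F * (1 - t * f x) \<le> ?F * exp (- (t * f x))" by (intro mult_left_mono) auto
  then have "?F - 1 \<le> t * f x * ?F" by (simp add: exp_minus algebra_simps)
  also have "\<dots> \<le> f x * exp B" using tf F f_nonneg by (intro mult_mono) auto
  finally have F1: "(?F - 1)^2 \<le> (f x * exp B)^2" using F by (intro power_mono) auto
  have eq: "?w x = ?F *\<^sub>R ?v x + (r * (?F - 1)) *\<^sub>R u x"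
   by (simp add: laplacian_conformal algebra_simps)
  have "cmod (?w x) \<le> ?F * cmod (?v x) + \<bar>r * (?F - 1)\<bar> * cmod (u x)"
   unfolding eq using norm_triangle_ineq[of "?F *\<^sub>R ?v x" "(r * (?F - 1)) *\<^sub>R u x"] by (simp del: scaleR_left_diff_distrib)
  then have "(cmod (?w x))^2 \<le> (?F * cmod (?v x) + \<bar>r * (?F - 1)\<bar> * cmod (u x))^2" by (intro power_mono) auto
  also have "\<dots> \<le> 2 * (?F * cmod (?v x))^2 + 2 * (\<bar>r * (?F - 1)\<bar> * cmod (u x))^2"
   using sum_squares_bound[of "?F * cmod (?v x)" "\<bar>r * (?F - 1)\<bar> * cmod (u x)"] by (simp only: power2_sum)
  finally have "exp (- t * f x) * (cmod (?w x))^2 \<le> exp (- t * f x) * (2 * (?F * cmod (?v x))^2 + 2 * (\<bar>r * (?F - 1)\<bar> * cmod (u x))^2)"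
   by (intro mult_left_mono) auto
  also have "\<dots> = 2 * ?F * (cmod (?v x))^2 + 2 * r^2 * (exp (- t * f x) * (?F - 1)^2) * (cmod (u x))^2"
   by (simp add: power_mult_distrib exp_minus power2_eq_square field_simps)
  also have "\<dots> \<le> 2 * exp B * (cmod (?v x))^2 + 2 * r^2 * (1 * (f x * exp B)^2) * (cmod (u x))^2"
   using F F1 tf by (intro add_mono mult_right_mono mult_left_mono mult_mono) auto
  finally show ?thesis by (simp add: power_mult_distrib mult_ac)
 qed
 have sq: "(L2_norm_on (conformal_area t) k)^2 = (LINT x|area. exp (- t * f x) * (cmod (k x))^2)" if "continuous_on UNIV k" for k
  using L2_inner_conformal[OF that that] by (simp add: L2_norm_on_sq weight_def power2_norm_eq_inner)
 have "?l^2 \<le> (LINT x|area. 2 * exp B * (cmod (?v x))^2 + 2 * r^2 * (exp B)^2 * (f x * cmod (u x))^2)"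
  unfolding sq[OF cw]
  by (intro integral_mono ptw integrable_area_continuous continuous_intros cv cw cu f_cont)
 also have "\<dots> = ?R"
  by (subst Bochner_Integration.integral_add)
   (auto intro!: integrable_area_continuous continuous_intros cv cu f_cont simp: L2_norm_on_def)
 finally have l: "?l^2 \<le> ?R" .
 \<comment> \<open>\<open>u\<close> is normalised for \<open>area\<close>; in the conformal area its
   squared norm is still at least \<open>exp (- B)\<close>. This accounts for the outer factor
   \<open>exp B\<close> under the root.\<close>
 have "exp (- B) = exp (- B) * (L2_norm_on area u)^2" using u(2) by simp
 also have "\<dots> = (LINT x|area. exp (- B) * (cmod (u x))^2)" by (simp add: L2_norm_on_def)
 also have "\<dots> \<le> ?n^2"
  unfolding sq[OF cu]
 proof (intro integral_mono integrable_area_continuous continuous_intros cu f_cont mult_right_mono)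
  fix x
  have "t * f x \<le> B" using t f_nonneg[of x] B[of x] mult_left_le_one_le[of "f x" t] by auto
  then show "exp (- B) \<le> exp (- t * f x)" by simp
 qed auto
 finally have n: "exp (- B) \<le> ?n^2" .
 show "?n > 0" using n L2_norm_on_nonneg[of "conformal_area t" u] exp_gt_zero[of "- B"]
  by (metis less_eq_real_def not_le power_zero_numeral)
 have R: "?R \<ge> 0" using l by (meson order_trans zero_le_power2)
 have "?R = exp B * ?R * exp (- B)" by (simp add: exp_minus)
 also have "\<dots> \<le> exp B * ?R * ?n^2" using n R by (intro mult_left_mono) auto
 finally have "?l^2 \<le> exp B * ?R * ?n^2" using l by linarith
 then have "sqrt (?l^2) \<le> sqrt (exp B * ?R * ?n^2)" by (rule real_sqrt_le_mono)
 then show "?l \<le> sqrt (exp B * ?R) * ?n"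
  by (simp add: real_sqrt_mult L2_norm_on_nonneg)
qed

end

section \<open>Decay of the eigenfunctions near the quasi-eigenvalues\<close>

context conformal_family
begin

lemma small_mass_almost_everywhere:
 assumes l: "rapidly_decreasing l" "\<And>m. l m > 0"
  and lam: "c > 0" "C > 0" "\<forall>\<^sub>F m in sequentially. c * (real m)^2 \<le> lam m \<and> lam m \<le> C * (real m)^2"
 shows "\<exists>Z. Z \<subseteq> {0..1} \<and> Z \<in> sets lebesgue \<and> emeasure lebesgue Z = 1 \<and>
  (\<forall>t\<in>Z. \<forall>\<^sub>F m in sequentially. \<forall>\<mu>\<in>{lam m - l m..lam m + l m}. \<forall>\<phi>. weighted_eigenfunction t \<mu> \<phi> \<and> weight t \<phi> \<phi> = 1 \<longrightarrow> mass t \<phi> \<le> sqrt (l m))"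
proof -
 define bad where "bad m = {t \<in> {0..1}. \<exists>\<mu>\<in>{lam m - l m..lam m + l m}. \<exists>\<phi>. weighted_eigenfunction t \<mu> \<phi> \<and> weight t \<phi> \<phi> = 1 \<and> mass t \<phi> > sqrt (l m)}" for m
 obtain D where D: "D > 0" "\<And>r l \<epsilon>. 0 \<le> l \<and> r - l \<ge> 1 \<and> \<epsilon> > 0 \<longrightarrow>
   (\<exists>U\<in>sets borel. emeasure lborel U \<le> ennreal (D * (2 + r + l) * (4 * l / \<epsilon>)) \<and>
    {t \<in> {0..1}. \<exists>\<mu>\<in>{r - l..r + l}. \<exists>\<phi>. weighted_eigenfunction t \<mu> \<phi> \<and> weight t \<phi> \<phi> = 1 \<and> mass t \<phi> > \<epsilon>} \<subseteq> U)"
  using bad_parameters_cover by blast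
 let ?w = "\<lambda>m. D * (2 + lam m + l m) * (4 * l m / sqrt (l m))"
 have "\<exists>U\<in>sets borel. lam m - l m \<ge> 1 \<longrightarrow> emeasure lborel U \<le> ennreal (?w m) \<and> bad m \<subseteq> U" for m
 proof (cases "lam m - l m \<ge> 1")
  case True
  then show ?thesis using D(2)[of "l m" "lam m" "sqrt (l m)"] l(2)[of m] unfolding bad_def by auto
 qed auto
 then obtain U' where U': "\<And>m. U' m \<in> sets borel"
  "\<And>m. lam m - l m \<ge> 1 \<Longrightarrow> emeasure lborel (U' m) \<le> ennreal (?w m) \<and> bad m \<subseteq> U' m" by metis
 \<comment> \<open>The covering bound requires the window to lie above 1, which holds for large
   \<open>m\<close>. The finitely many other covers are replaced by the empty set, harmless for a
   statement about large \<open>m\<close>.\<close>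
 define U where "U m = (if lam m - l m \<ge> 1 then U' m else {})" for m
 have U_sets: "U m \<in> sets lborel" for m using U'(1) by (simp add: U_def)
 have U_fin: "emeasure lborel (U m) < \<infinity>" for m
  using U'(2)[of m] by (cases "lam m - l m \<ge> 1") (auto simp: U_def intro: le_less_trans)
 have gap: "\<forall>\<^sub>F m in sequentially. lam m - l m \<ge> 1 \<and> l m \<le> 1"
  using rapidly_decreasing_le_1[OF l(1)] lam(3) eventually_le_quadratic[OF lam(1), of 2] by eventually_elim linarith
 have "rapidly_decreasing (\<lambda>m. measure lborel (U m))"
 proof (rule rapidly_decreasing_dominated[OF rapidly_decreasing_sqrt[OF l(1)]])
  show "\<forall>\<^sub>F m in sequentially. \<bar>measure lborel (U m)\<bar> \<le> (D * (3 + C) * 4) * real m ^ 2 * \<bar>sqrt \<bar>l m\<bar>\<bar>"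
   using gap lam(3) eventually_le_quadratic[OF zero_less_one, of 2]
  proof eventually_elim
   case (elim m)
   have lm: "l m > 0" by (rule l)
   have m: "2 \<le> (real m)^2" using elim by simp
   have s: "2 + lam m + l m \<le> (3 + C) * (real m)^2" "0 \<le> 2 + lam m + l m"
    using elim m lm by (auto simp: algebra_simps)
   \<comment> \<open>The threshold \<open>sqrt (l m)\<close> leaves a measure of order
     \<open>lam m * sqrt (l m)\<close>: rapidly decreasing, as \<open>lam m\<close> grows only
     quadratically.\<close>
   have "l m / sqrt (l m) = sqrt (l m)" using lm by (simp add: real_div_sqrt)
   then have "4 * l m / sqrt (l m) = 4 * sqrt (l m)" unfolding times_divide_eq_right[symmetric] by (rule arg_cong)
   then have w: "?w m = D * (2 + lam m + l m) * (4 * sqrt (l m))" by (rule arg_cong)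
   have w0: "0 \<le> ?w m" unfolding w using D(1) lm s by simp
   have "emeasure lborel (U m) \<le> ennreal (?w m)" using U'(2) elim(1) by (simp add: U_def)
   then have "measure lborel (U m) \<le> ?w m"
    using U_fin[of m] w0 by (simp add: measure_def enn2real_leI)
   also have "\<dots> \<le> D * ((3 + C) * (real m)^2) * (4 * sqrt (l m))"
    unfolding w using s D(1) lm by (intro mult_right_mono mult_left_mono) auto
   also have "\<dots> = (D * (3 + C) * 4) * real m ^ 2 * \<bar>sqrt \<bar>l m\<bar>\<bar>" using lm by simp
   finally show ?case by simp
  qed
  show "D * (3 + C) * 4 \<ge> 0" using D(1) lam(2) by simp
 qed
 then obtain K where K: "\<forall>\<^sub>F m in sequentially. \<bar>measure lborel (U m)\<bar> \<le> K / real m ^ 2"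
  unfolding rapidly_decreasing_iff by blast
 have "summable (\<lambda>m. measure lborel (U m))"
 proof (rule summable_comparison_test_ev)
  show "\<forall>\<^sub>F m in sequentially. norm (measure lborel (U m)) \<le> K * inverse (real m ^ 2)"
   using K by (simp add: divide_inverse)
  show "summable (\<lambda>m. K * inverse (real m ^ 2))" by (intro summable_mult inverse_power_summable) simp
 qed
 then have null: "limsup U \<in> null_sets lborel"
  by (rule borel_cantelli_limsup1[OF U_sets U_fin])
 define Z where "Z = {0..1} - limsup U"
 have Z: "Z \<in> sets borel" using null by (auto simp: Z_def null_sets_def)
 have "emeasure lborel Z = emeasure lborel {0..1::real}"
  unfolding Z_def by (rule emeasure_Diff_null_set[OF null]) simp
 then have Z1: "emeasure lebesgue Z = 1" using Z by simp
 have ev: "\<forall>\<^sub>F m in sequentially. \<forall>\<mu>\<in>{lam m - l m..lam m + l m}. \<forall>\<phi>. weighted_eigenfunction t \<mu> \<phi> \<and> weight t \<phi> \<phi> = 1 \<longrightarrow> mass t \<phi> \<le> sqrt (l m)"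
  if t: "t \<in> Z" for t
 proof -
  have "t \<notin> (\<Inter>n. \<Union>m\<in>{n..}. U m)" using t by (simp add: Z_def limsup_INF_SUP)
  then have "\<forall>\<^sub>F m in sequentially. t \<notin> U m" by (auto simp: eventually_sequentially)
  then have "\<forall>\<^sub>F m in sequentially. t \<notin> bad m"
   using gap by eventually_elim (use U'(2) in \<open>auto simp: U_def\<close>)
  then show ?thesis
  proof eventually_elim
   case (elim m)
   have "t \<in> {0..1}" using t by (simp add: Z_def)
   then show ?case using elim unfolding bad_def by (auto simp: not_less)
  qed
 qed
 show ?thesis
 proof (intro exI[of _ Z] conjI ballI)
  show "Z \<subseteq> {0..1}" by (auto simp: Z_def)
  show "Z \<in> sets lebesgue" using Z by simp
 qed (rule Z1, rule ev)
qed

text \<open>Multiplying the weighted eigenvalue equation by \<open>- vol c\<close> brings it into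
  divergence form; \<open>\<rho>\<close> collects the factor multiplying the eigenvalue.\<close>

lemma elliptic_coeff:
 assumes c: "c \<in> A" and f: "smooth_function A f"
 shows "elliptic_equation (chart_image c) (coeff c) (\<lambda>y. - (vol c y * exp (- t * in_chart c f y)))"
proof
 show "open (chart_image c)" by (rule open_image[OF c])
 show "smooth_on (chart_image c) (coeff c i j)" for i j
  unfolding smooth_on_iff_Ck using Ck_on_coeff[OF c] by blast
 show "smooth_on (chart_image c) (\<lambda>y. - (vol c y * exp (- t * in_chart c f y)))"
 proof -
  have "smooth_on (chart_image c) (in_chart c f)" using f c by (simp add: smooth_function_def)
  then have "Ck_on n (chart_image c) (in_chart c f)" for n unfolding smooth_on_iff_Ck by blast
  then have "Ck_on n (chart_image c) (\<lambda>y. (-1) *\<^sub>R (vol c y *\<^sub>R exp ((- t) *\<^sub>R in_chart c f y)))" for n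
   by (intro Ck_on_scaleR Ck_on_exp Ck_on_const Ck_on_vol c open_image)
  then show ?thesis unfolding smooth_on_iff_Ck by simp
 qed
next
 fix K assume K: "compact K" "K \<subseteq> chart_image c"
 let ?a = "coeff c"
 have "continuous_on K (\<lambda>y. ?a 1 1 y + ?a 2 2 y)"
  by (intro continuous_on_subset[OF continuous_on_add K(2)] Ck_on_imp_continuous[OF Ck_on_coeff[OF c, of 0]])
 then obtain M where M: "M > 0" "\<And>y. y \<in> K \<Longrightarrow> \<bar>?a 1 1 y + ?a 2 2 y\<bar> \<le> M"
  using compact_bounded_values[OF K(1)] by blast
 have "1 / M * (\<Sum>i\<in>UNIV. (norm (p i))^2) \<le> (\<Sum>i\<in>UNIV. \<Sum>j\<in>UNIV. ?a i j y * (p i \<bullet> p j))"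
  if y: "y \<in> K" for y and p :: "2 \<Rightarrow> complex"
 proof -
  let ?Q = "\<Sum>i\<in>UNIV. \<Sum>j\<in>UNIV. ?a i j y * (p i \<bullet> p j)"
  have yI: "y \<in> chart_image c" using y K(2) by blast
  have "(?a 1 1 y + ?a 2 2 y) * ?Q \<le> M * ?Q"
   using M(2)[OF y] coeff_form_nonneg[OF c yI, of p] by (intro mult_right_mono) auto
  then show ?thesis using coeff_lower_bound[OF c yI, of p] M(1) by (simp add: field_simps)
 qed
 then show "\<exists>\<theta>>0. \<forall>y\<in>K. \<forall>p::2 \<Rightarrow> complex. \<theta> * (\<Sum>i\<in>UNIV. (norm (p i))^2) \<le> (\<Sum>i\<in>UNIV. \<Sum>j\<in>UNIV. ?a i j y * (p i \<bullet> p j))"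
  using M(1) by (intro exI[of _ "1 / M"]) simp
qed

text \<open>On the compact set \<open>K\<close> the product of \<open>vol c\<close> and
  \<open>f\<close> is bounded away from zero, so the integral against \<open>f\<close> dominates the
  plain square integral.\<close>

lemma local_mass_bound:
 assumes c: "c \<in> A" and K: "compact K" "K \<subseteq> chart_image c" "\<And>y. y \<in> K \<Longrightarrow> in_chart c f y > 0"
 shows "\<exists>C\<ge>0. \<forall>\<phi> :: 'a \<Rightarrow> complex. continuous_on UNIV \<phi> \<longrightarrow>
  int_over K (\<lambda>y. (cmod (in_chart c \<phi> y))^2) \<le> C * (LINT x|area. f x * (cmod (\<phi> x))^2)"
proof -
 let ?q = "\<lambda>y. vol c y * in_chart c f y" and ?W = "chart_inv c ` K"
 have ci: "continuous_on K (in_chart c h)" if "continuous_on UNIV h" for h :: "'a \<Rightarrow> 'b::topological_space"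
  unfolding in_chart_def
  using continuous_on_compose2[OF that continuous_on_subset[OF continuous_chart_inv[OF c] K(2)]] by simp
 have "continuous_on K ?q"
  by (intro continuous_intros ci f_cont continuous_on_subset[OF continuous_vol[OF c] K(2)])
 moreover have "?q y > 0" if "y \<in> K" for y using that K(2,3) vol_pos[OF c] by (intro mult_pos_pos) auto
 ultimately obtain \<delta> where \<delta>: "\<delta> > 0" "\<And>y. y \<in> K \<Longrightarrow> \<delta> \<le> ?q y"
  using compact_positive_lower_bound[OF K(1), of ?q] by blast
 have "\<delta> * int_over K (\<lambda>y. (cmod (in_chart c \<phi> y))^2) \<le> (LINT x|area. f x * (cmod (\<phi> x))^2)"
  if \<phi>: "continuous_on UNIV \<phi>" for \<phi> :: "'a \<Rightarrow> complex"
 proof -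
  let ?h = "\<lambda>x. f x * (cmod (\<phi> x))^2"
  have h: "continuous_on UNIV ?h" "\<And>x. ?h x \<ge> 0" by (auto intro!: continuous_intros mult_nonneg_nonneg f_cont \<phi> f_nonneg)
  have "ennreal (int_over K (\<lambda>y. \<delta> * (cmod (in_chart c \<phi> y))^2))
    = (\<integral>\<^sup>+ y. ennreal (indicator K y * (\<delta> * (cmod (in_chart c \<phi> y))^2)) \<partial>lborel)"
   using \<delta>(1) by (intro nn_integral_eq_integral[symmetric] integrable_on_compact K(1) continuous_intros ci \<phi>) auto
  also have "\<dots> \<le> (\<integral>\<^sup>+ y \<in> K. ennreal (vol c y * ?h (chart_inv c y)) \<partial>lborel)"
  proof (rule nn_integral_mono)
   fix y
   have "\<delta> * (cmod (in_chart c \<phi> y))^2 \<le> ?q y * (cmod (in_chart c \<phi> y))^2" if "y \<in> K"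
    by (intro mult_right_mono \<delta>(2) that) simp
   then show "ennreal (indicator K y * (\<delta> * (cmod (in_chart c \<phi> y))^2)) \<le> ennreal (vol c y * ?h (chart_inv c y)) * indicator K y"
    by (cases "y \<in> K") (auto simp: in_chart_def mult.assoc intro!: ennreal_leI)
  qed
  also have "\<dots> = (\<integral>\<^sup>+ x \<in> ?W. ennreal (?h x) \<partial>area)"
   by (rule nn_integral_area_chart_inv_image[OF c K(1,2) borel_measurable_continuous_onI[OF h(1)] h(2), symmetric])
  also have "\<dots> \<le> (\<integral>\<^sup>+ x. ennreal (?h x) \<partial>area)" by (rule nn_integral_mono) (simp add: indicator_def)
  also have "\<dots> = ennreal (LINT x|area. ?h x)" by (rule nn_integral_area_continuous[OF h])
  finally have "int_over K (\<lambda>y. \<delta> * (cmod (in_chart c \<phi> y))^2) \<le> (LINT x|area. ?h x)"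
   using h(2) by (subst (asm) ennreal_le_iff) (auto intro: Bochner_Integration.integral_nonneg)
  then show ?thesis by (simp add: mult.left_commute[of _ \<delta>])
 qed
 then show ?thesis using \<delta>(1) by (intro exI[of _ "1 / \<delta>"]) (auto simp: field_simps)
qed

text \<open>The interior estimate bounds derivatives on \<open>L\<close> by the square integral over
  a slightly larger compact set. That set is chosen inside the open region where \<open>f\<close> is
  positive, so that \<open>local_mass_bound\<close> applies to it.\<close>

lemma eigenfunction_Ck_bound:
 assumes f: "smooth_function A f" and c: "c \<in> A" and L: "compact L" "L \<subseteq> chart_dom c" "\<And>x. x \<in> L \<Longrightarrow> f x > 0"
 shows "\<exists>C\<ge>0. \<exists>N. \<forall>\<mu>\<ge>1. \<forall>\<phi>. weighted_eigenfunction t \<mu> \<phi> \<longrightarrow>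
  (\<forall>is :: 2 list. length is \<le> k \<longrightarrow> (\<forall>x\<in>L. (cmod (partial_derivs is (in_chart c \<phi>) (chart_map c x)))^2
   \<le> C * \<mu> ^ N * (LINT x|area. f x * (cmod (\<phi> x))^2)))"
proof -
 let ?\<rho> = "\<lambda>y. - (vol c y * exp (- t * in_chart c f y))"
 interpret elliptic_equation "chart_image c" "coeff c" ?\<rho> by (rule elliptic_coeff[OF c f])
 let ?V = "chart_image c \<inter> in_chart c f -` {0<..}"
 have cf: "continuous_on (chart_image c) (in_chart c f)"
  using smooth_on_imp_continuous f c by (auto simp: smooth_function_def)
 have V: "open ?V" by (rule continuous_open_preimage[OF cf open_image[OF c]]) simp
 let ?L = "chart_map c ` L"
 have L': "compact ?L"
  by (rule compact_continuous_image[OF continuous_on_subset[OF continuous_chart_map[OF c] L(2)] L(1)])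
 have "?L \<subseteq> ?V"
  using L(2,3) chart_map_in[OF c] in_chart_map[OF c, of _ f] by fastforce
 then have LV: "?L \<subseteq> interior ?V" unfolding interior_open[OF V] .
 obtain K where K: "compact K" "?L \<subseteq> interior K" "K \<subseteq> interior ?V"
  using intermediate_compact[OF L' LV] by blast
 have KV: "K \<subseteq> ?V" using K(3) interior_subset by blast
 have KI: "K \<subseteq> chart_image c" using KV by blast
 obtain C N where CN: "C \<ge> 0" "\<And>\<mu> v is y. \<mu> \<ge> 1 \<Longrightarrow> solution \<mu> v \<Longrightarrow> length (is :: 2 list) \<le> k \<Longrightarrow> y \<in> ?L \<Longrightarrow>
   (norm (partial_derivs is v y))^2 \<le> C * \<mu> ^ N * int_over K (\<lambda>y. (norm (v y))^2)"
  using sup_estimate[OF K(1) KI L' K(2), of k] by blast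
 obtain C' where C': "C' \<ge> 0" "\<And>\<phi> :: 'a \<Rightarrow> complex. continuous_on UNIV \<phi> \<Longrightarrow>
  int_over K (\<lambda>y. (cmod (in_chart c \<phi> y))^2) \<le> C' * (LINT x|area. f x * (cmod (\<phi> x))^2)"
  using local_mass_bound[OF c K(1) KI] KV by fastforce
 have "(cmod (partial_derivs is (in_chart c \<phi>) (chart_map c x)))^2 \<le> (C * C') * \<mu> ^ N * (LINT x|area. f x * (cmod (\<phi> x))^2)"
  if \<mu>: "\<mu> \<ge> 1" and \<phi>: "smooth_function A \<phi>" "\<And>x. laplacian A g \<phi> x = (\<mu> * exp (- t * f x)) *\<^sub>R \<phi> x"
   and "is": "length is \<le> k" and x: "x \<in> L" for \<mu> \<phi> "is" x
 proof -
  have "principal (in_chart c \<phi>) y = (\<mu> * ?\<rho> y) *\<^sub>R in_chart c \<phi> y" if y: "y \<in> chart_image c" for y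
  proof -
   have v: "vol c y > 0" by (rule vol_pos[OF c y])
   have "local_laplacian c (in_chart c \<phi>) y = (\<mu> * exp (- t * in_chart c f y)) *\<^sub>R in_chart c \<phi> y"
    using laplacian_chart[OF c chart_inv_in[OF c y] \<phi>(1)] \<phi>(2) chart_map_inv[OF c y] by (simp add: in_chart_def)
   then have "- ((1 / vol c y) *\<^sub>R principal (in_chart c \<phi>) y) = (\<mu> * exp (- t * in_chart c f y)) *\<^sub>R in_chart c \<phi> y"
    by (simp add: local_laplacian_def principal_def)
   then have "(- vol c y) *\<^sub>R (- ((1 / vol c y) *\<^sub>R principal (in_chart c \<phi>) y))
     = (- vol c y) *\<^sub>R ((\<mu> * exp (- t * in_chart c f y)) *\<^sub>R in_chart c \<phi> y)" by simp
   then show ?thesis using v by (simp add: mult_ac)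
  qed
  then have "solution \<mu> (in_chart c \<phi>)"
   using \<phi>(1) c unfolding solution_def smooth_function_def by blast
  then have "(cmod (partial_derivs is (in_chart c \<phi>) (chart_map c x)))^2
    \<le> C * \<mu> ^ N * int_over K (\<lambda>y. (cmod (in_chart c \<phi> y))^2)"
   using CN(2)[OF \<mu> _ "is"] x by blast
  also have "\<dots> \<le> C * \<mu> ^ N * (C' * (LINT x|area. f x * (cmod (\<phi> x))^2))"
   using C'(2)[OF smooth_function_continuous[OF \<phi>(1)]] CN(1) \<mu> by (intro mult_left_mono) auto
  finally show ?thesis by (simp add: mult_ac)
 qed
 then show ?thesis using CN(1) C'(1) by (intro exI[of _ "C * C'"] conjI exI[of _ N]) auto
qed

lemma eigenfunction_Ck_norm_bound:
 assumes f: "smooth_function A f" and P: "chart_decomposition A K P" "\<forall>x\<in>K. f x > 0"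
 shows "\<exists>C\<ge>0. \<exists>N. \<forall>\<mu>\<ge>1. \<forall>\<phi>. weighted_eigenfunction t \<mu> \<phi> \<longrightarrow>
  \<bar>Ck_norm P k \<phi>\<bar> \<le> sqrt (C * \<mu> ^ N * (LINT x|area. f x * (cmod (\<phi> x))^2))"
proof -
 have fin: "finite P" and PA: "\<And>c L. (c, L) \<in> P \<Longrightarrow> c \<in> A \<and> compact L \<and> L \<subseteq> chart_dom c \<and> L \<subseteq> K"
  using P(1) unfolding chart_decomposition_def by blast+
 define good where "good p C N \<longleftrightarrow> (\<forall>\<mu>\<ge>1. \<forall>\<phi>. weighted_eigenfunction t \<mu> \<phi> \<longrightarrow>
  (\<forall>is :: 2 list. length is \<le> k \<longrightarrow> (\<forall>x\<in>snd p. (cmod (partial_derivs is (in_chart (fst p) \<phi>) (chart_map (fst p) x)))^2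
   \<le> C * \<mu> ^ N * (LINT x|area. f x * (cmod (\<phi> x))^2))))" for p C and N :: nat
 have "\<exists>C\<ge>0. \<exists>N. good p C N" if "p \<in> P" for p
 proof -
  have "(fst p, snd p) \<in> P" using that by simp
  from PA[OF this] show ?thesis
   unfolding good_def using P(2) by (intro eigenfunction_Ck_bound[OF f]) auto
 qed
 then obtain C N where CN: "\<And>p. p \<in> P \<Longrightarrow> C p \<ge> 0" "\<And>p. p \<in> P \<Longrightarrow> good p (C p) (N p)" by metis
 \<comment> \<open>Sums dominate the constants and exponents of all pieces simultaneously; for the
   exponents this uses \<open>\<mu> \<ge> 1\<close>.\<close>
 let ?C = "\<Sum>p\<in>P. C p" and ?N = "\<Sum>p\<in>P. N p"
 have "\<bar>Ck_norm P k \<phi>\<bar> \<le> sqrt (?C * \<mu> ^ ?N * (LINT x|area. f x * (cmod (\<phi> x))^2))"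
  if \<mu>: "\<mu> \<ge> 1" and \<phi>: "smooth_function A \<phi>" "\<forall>x. laplacian A g \<phi> x = (\<mu> * exp (- t * f x)) *\<^sub>R \<phi> x" for \<mu> \<phi>
 proof -
  let ?I = "LINT x|area. f x * (cmod (\<phi> x))^2"
  let ?S = "insert 0 {cmod (partial_derivs is (in_chart c \<phi>) (chart_map c x)) | is c L x.
    (c, L) \<in> P \<and> x \<in> L \<and> length is \<le> k}"
  have I: "?I \<ge> 0" using f_nonneg by (intro Bochner_Integration.integral_nonneg) simp
  have B: "?C * \<mu> ^ ?N * ?I \<ge> 0" using CN(1) \<mu> I by (simp add: sum_nonneg)
  have le: "s \<le> sqrt (?C * \<mu> ^ ?N * ?I)" if "s \<in> ?S" for s
  proof (cases "s = 0")
   case False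
   with that have "s \<in> {cmod (partial_derivs is (in_chart c \<phi>) (chart_map c x)) | is c L x.
     (c, L) \<in> P \<and> x \<in> L \<and> length is \<le> k}" by simp
   then obtain "is" c L x where s: "s = cmod (partial_derivs is (in_chart c \<phi>) (chart_map c x))"
    "(c, L) \<in> P" "x \<in> L" "length is \<le> k" by blast
   have "s^2 \<le> C (c, L) * \<mu> ^ N (c, L) * ?I"
    using CN(2)[OF s(2)] \<mu> \<phi> s unfolding good_def by simp
   also have "\<dots> \<le> ?C * \<mu> ^ ?N * ?I"
    using s(2) fin CN(1) \<mu> I by (intro mult_right_mono mult_mono member_le_sum power_increasing) (auto simp: sum_nonneg)
   finally show ?thesis by (rule real_le_rsqrt)
  qed (use B in simp)
  have "bdd_above ?S" using le by (rule bdd_aboveI)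
  then have "0 \<le> Ck_norm P k \<phi>" unfolding Ck_norm_def by (intro cSup_upper) simp_all
  moreover have "Ck_norm P k \<phi> \<le> sqrt (?C * \<mu> ^ ?N * ?I)"
   unfolding Ck_norm_def by (intro cSup_least le) simp_all
  ultimately show ?thesis by simp
 qed
 moreover have "?C \<ge> 0" using CN(1) by (rule sum_nonneg)
 ultimately show ?thesis by blast
qed

lemma normalized_eigenfunction_conformal:
 assumes "normalized_eigenfunction A (conformal_metric f g t) \<mu> \<phi>"
 shows "smooth_function A \<phi>" "laplacian A g \<phi> x = (\<mu> * exp (- t * f x)) *\<^sub>R \<phi> x" "weight t \<phi> \<phi> = 1"
proof -
 show s: "smooth_function A \<phi>" using assms by (simp add: normalized_eigenfunction_def)
 have "exp (t * f x) *\<^sub>R laplacian A g \<phi> x = \<mu> *\<^sub>R \<phi> x"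
  using assms by (simp add: normalized_eigenfunction_def laplacian_conformal scaleR_conv_of_real)
 then have "exp (- t * f x) *\<^sub>R (exp (t * f x) *\<^sub>R laplacian A g \<phi> x) = exp (- t * f x) *\<^sub>R (\<mu> *\<^sub>R \<phi> x)" by simp
 then show "laplacian A g \<phi> x = (\<mu> * exp (- t * f x)) *\<^sub>R \<phi> x"
  by (simp add: exp_minus mult.commute)
 have c: "continuous_on UNIV \<phi>" by (rule smooth_function_continuous[OF s])
 have "L2_norm_on (conformal_area t) \<phi> = 1"
  using assms by (simp add: normalized_eigenfunction_def conformal_area_def)
 then show "weight t \<phi> \<phi> = 1" using L2_norm_on_sq[of "conformal_area t" \<phi>] L2_inner_conformal[OF c c] by simp
qed

end

theorem corollary4p1:
 fixes A :: "'a::t2_space chart set" and g\<^sub>0 :: "'a metric"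
  and \<gamma> :: "real \<Rightarrow> 'a" and T :: real
  and u :: "nat \<Rightarrow> 'a \<Rightarrow> complex" and lam :: "nat \<Rightarrow> real"
  and f :: "'a \<Rightarrow> real"
 assumes "closed_riemannian_surface A g\<^sub>0"
  and "closed_geodesic A g\<^sub>0 \<gamma> T"
  and "elliptic_generic A g\<^sub>0 \<gamma> T"
  and "quasi_modes A g\<^sub>0 \<gamma> T u lam"
  and "smooth_function A f" and "\<And>x. f x \<ge> 0"
  and "flat_on A (range \<gamma>) f" and "{x. f x = 0} = range \<gamma>"
 shows "\<exists>l::nat \<Rightarrow> real. (\<forall>m. l m > 0) \<and> rapidly_decreasing l \<and>
   (\<forall>t\<in>{0..1}. \<forall>m.
    laplace_spectrum A (conformal_metric f g\<^sub>0 t) \<inter>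
     complex_of_real ` {lam m - l m..lam m + l m} \<noteq> {}) \<and>
   (\<exists>Z. Z \<subseteq> {0..1} \<and> Z \<in> sets lebesgue \<and> emeasure lebesgue Z = 1 \<and>
    (\<forall>t\<in>Z. \<forall>\<mu> \<phi>.
      (\<forall>m. \<mu> m \<in> {lam m - l m..lam m + l m} \<and>
        normalized_eigenfunction A (conformal_metric f g\<^sub>0 t) (\<mu> m) (\<phi> m)) \<longrightarrow>
      rapidly_decreasing (\<lambda>m. LINT x|area_measure A g\<^sub>0. f x * (cmod (\<phi> m x))^2) \<and>
      (\<forall>K k P. compact K \<and> K \<inter> range \<gamma> = {} \<and> chart_decomposition A K P \<longrightarrow>
       rapidly_decreasing (\<lambda>m. Ck_norm P k (\<phi> m)))))"
proof -
 interpret surface A g\<^sub>0 by standard (rule assms(1))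
 have f_cont: "continuous_on UNIV f" by (rule smooth_function_continuous[OF assms(5)])
 interpret conformal_family A g\<^sub>0 f by standard (rule f_cont assms(6))+
 have area: "area_measure A g\<^sub>0 = area" by (simp add: area_def)
 have qm: "\<And>m. smooth_function A (u m)" "\<And>m. L2_norm_on area (u m) = 1"
  "rapidly_decreasing (\<lambda>m. L2_norm_on area (\<lambda>x. laplacian A g\<^sub>0 (u m) x - lam m *\<^sub>R u m x))"
  using assms(4) unfolding quasi_modes_def Let_def area by (simp_all add: scaleR_conv_of_real)
 obtain \<alpha> where "(\<lambda>m. lam m - ((2 * pi * real m + \<alpha>) / T)^2) \<in> O(\<lambda>_. 1)"
  using assms(4) unfolding quasi_modes_def Let_def by blast
 moreover have "T > 0" using assms(2) by (simp add: closed_geodesic_def)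
 ultimately obtain c C where growth: "c > 0" "C > 0" "\<forall>\<^sub>F m in sequentially. c * (real m)^2 \<le> lam m \<and> lam m \<le> C * (real m)^2"
  using quadratic_growth by blast
 obtain b C' N where gauss: "b > 0" "C' > 0" "\<forall>\<^sub>F m in sequentially. \<forall>x.
   cmod (u m x) \<le> C' * real m powr N * gaussian (b * sqrt (lam m)) (dist_to_set A g\<^sub>0 x (range \<gamma>))"
  using assms(4) unfolding quasi_modes_def Let_def by blast
 have growth_below: "\<forall>\<^sub>F m in sequentially. c * (real m)^2 \<le> lam m"
  using growth(3) by eventually_elim simp
 obtain B where B: "\<And>x. f x \<le> B"
  using compact_bounded_values[OF compact_UNIV f_cont] by (metis UNIV_I abs_le_D1)
 define F where "F m = (LINT x|area. (f x * cmod (u m x))^2)" for m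
 have F: "rapidly_decreasing F"
  unfolding F_def
 proof (rule rapidly_decreasing_integral_square)
  show "continuous_on UNIV (\<lambda>x. f x * cmod (u m x))" for m
   by (intro continuous_intros f_cont smooth_function_continuous[OF qm(1)])
  show "\<exists>D\<ge>0. \<forall>\<^sub>F m in sequentially. \<forall>x. \<bar>f x * cmod (u m x)\<bar> \<le> D / real m ^ K" for K
   using flat_times_quasi_modes[OF assms(5,7) gauss(3,2,1) growth(1) growth_below, of K] by (simp add: abs_mult)
 qed
 define res where "res m = L2_norm_on area (\<lambda>x. laplacian A g\<^sub>0 (u m) x - lam m *\<^sub>R u m x)" for m
 \<comment> \<open>The radicand of \<open>quasimode_conformal\<close> at \<open>r = lam m\<close>.
   The factor \<open>(lam m)^2\<close> grows polynomially and is absorbed by the rapid decrease of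
   \<open>F\<close>.\<close>
 define err where "err m = exp B * (2 * exp B * (res m)^2 + 2 * (lam m)^2 * (exp B)^2 * F m)" for m
 \<comment> \<open>The second summand keeps the window nondegenerate even where the error vanishes,
   so that it contains a point of the spectrum for every \<open>m\<close> and not only for large
   ones.\<close>
 define l where "l m = sqrt (err m) + (1 / 2) ^ m" for m
 have F0: "F m \<ge> 0" for m by (simp add: F_def)
 have err0: "err m \<ge> 0" for m using F0 by (simp add: err_def)
 have res_rd: "rapidly_decreasing (\<lambda>m. 2 * (exp B)^2 * (res m)^2)"
 proof (rule rapidly_decreasing_dominated[OF qm(3)[folded res_def], where C = "2 * (exp B)^2" and k = 0])
  show "\<forall>\<^sub>F m in sequentially. \<bar>2 * (exp B)^2 * (res m)^2\<bar> \<le> 2 * (exp B)^2 * real m ^ 0 * \<bar>res m\<bar>"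
   using rapidly_decreasing_le_1[OF qm(3)[folded res_def]]
  proof eventually_elim
   case (elim m)
   then have "\<bar>res m\<bar> * \<bar>res m\<bar> \<le> 1 * \<bar>res m\<bar>" by (intro mult_right_mono) auto
   then show ?case by (simp add: power2_eq_square abs_mult)
  qed
 qed simp
 have lamF_rd: "rapidly_decreasing (\<lambda>m. 2 * exp B ^ 3 * (lam m)^2 * F m)"
 proof (rule rapidly_decreasing_dominated[OF F, where C = "2 * exp B ^ 3 * C^2" and k = 4])
  show "\<forall>\<^sub>F m in sequentially. \<bar>2 * exp B ^ 3 * (lam m)^2 * F m\<bar> \<le> 2 * exp B ^ 3 * C^2 * real m ^ 4 * \<bar>F m\<bar>"
   using growth(3)
  proof eventually_elim
   case (elim m)
   have "0 \<le> c * (real m)^2" using growth(1) by simp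
   then have "(lam m)^2 \<le> (C * (real m)^2)^2" using elim by (intro power_mono) auto
   also have "\<dots> = C^2 * real m ^ 4" by (simp add: power_mult_distrib)
   finally have "2 * exp B ^ 3 * (lam m)^2 * F m \<le> 2 * exp B ^ 3 * (C^2 * real m ^ 4) * F m"
    using F0 by (intro mult_right_mono mult_left_mono) auto
   then show ?case using F0[of m] by (simp add: abs_mult mult.assoc)
  qed
 qed simp
 have "err = (\<lambda>m. 2 * (exp B)^2 * (res m)^2 + 2 * exp B ^ 3 * (lam m)^2 * F m)"
  by (simp add: fun_eq_iff err_def algebra_simps power2_eq_square power3_eq_cube)
 then have "rapidly_decreasing err" using rapidly_decreasing_add[OF res_rd lamF_rd] by simp
 then have l_rd: "rapidly_decreasing l"
  unfolding l_def[abs_def]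
  using rapidly_decreasing_add[OF rapidly_decreasing_sqrt[OF \<open>rapidly_decreasing err\<close>] rapidly_decreasing_half_power] err0 by simp
 have l_pos: "l m > 0" for m using err0[of m] by (simp add: l_def add_nonneg_pos)
 have spec: "laplace_spectrum A (conformal_metric f g\<^sub>0 t) \<inter> complex_of_real ` {lam m - l m..lam m + l m} \<noteq> {}"
  if t: "t \<in> {0..1}" for t m
 proof (rule spectrum_near_quasimode[OF qm(1) quasimode_conformal(2)[OF qm(1,2) t B] l_pos])
  have "L2_norm_on (conformal_area t) (\<lambda>x. laplacian A (conformal_metric f g\<^sub>0 t) (u m) x - lam m *\<^sub>R u m x)
    \<le> sqrt (err m) * L2_norm_on (conformal_area t) (u m)"
   unfolding err_def res_def F_def by (rule quasimode_conformal(1)[OF qm(1,2) t B])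
  also have "\<dots> \<le> l m * L2_norm_on (conformal_area t) (u m)"
   by (intro mult_right_mono L2_norm_on_nonneg) (simp add: l_def)
  finally show "L2_norm_on (conformal_area t) (\<lambda>x. laplacian A (conformal_metric f g\<^sub>0 t) (u m) x - lam m *\<^sub>R u m x)
    \<le> l m * L2_norm_on (conformal_area t) (u m)" .
 qed
 obtain Z where Z: "Z \<subseteq> {0..1}" "Z \<in> sets lebesgue" "emeasure lebesgue Z = 1"
  "\<And>t. t \<in> Z \<Longrightarrow> \<forall>\<^sub>F m in sequentially. \<forall>\<mu>\<in>{lam m - l m..lam m + l m}. \<forall>\<phi>. weighted_eigenfunction t \<mu> \<phi> \<and> weight t \<phi> \<phi> = 1 \<longrightarrow> mass t \<phi> \<le> sqrt (l m)"
  using small_mass_almost_everywhere[OF l_rd l_pos growth] by blast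
 have "rapidly_decreasing (\<lambda>m. LINT x|area. f x * (cmod (\<phi> m x))^2) \<and>
   (\<forall>K k P. compact K \<and> K \<inter> range \<gamma> = {} \<and> chart_decomposition A K P \<longrightarrow> rapidly_decreasing (\<lambda>m. Ck_norm P k (\<phi> m)))" (is "_ \<and> ?C")
  if t: "t \<in> Z" and \<phi>: "\<forall>m. \<mu> m \<in> {lam m - l m..lam m + l m} \<and>
    normalized_eigenfunction A (conformal_metric f g\<^sub>0 t) (\<mu> m) (\<phi> m)" for t \<mu> \<phi>
 proof
  let ?I = "\<lambda>m. LINT x|area. f x * (cmod (\<phi> m x))^2"
  have eig: "smooth_function A (\<phi> m)" "laplacian A g\<^sub>0 (\<phi> m) x = (\<mu> m * exp (- t * f x)) *\<^sub>R \<phi> m x" "weight t (\<phi> m) (\<phi> m) = 1" for m x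
   using normalized_eigenfunction_conformal \<phi> by blast+
  have c\<phi>: "continuous_on UNIV (\<phi> m)" for m by (rule smooth_function_continuous[OF eig(1)])
  have t01: "t \<in> {0..1}" using t Z(1) by blast
  have I0: "?I m \<ge> 0" for m using assms(6) by (intro Bochner_Integration.integral_nonneg) simp
  \<comment> \<open>\<open>mass\<close> carries the density \<open>exp (- t * f x)\<close> while the
    claim integrates against the area of the original metric; the density is at least
    \<open>exp (- B)\<close>.\<close>
  have I_mass: "?I m \<le> exp B * mass t (\<phi> m)" for m
  proof -
   have "?I m \<le> (LINT x|area. exp B * (f x * exp (- t * f x) * (\<phi> m x \<bullet> \<phi> m x)))"
   proof (intro integral_mono integrable_area_continuous continuous_intros f_cont c\<phi>)
    fix x
    have "t * f x \<le> B" using t01 assms(6)[of x] B[of x] mult_left_le_one_le[of "f x" t] by auto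
    then have "1 \<le> exp B * exp (- t * f x)" by (simp add: exp_add[symmetric])
    then have "(f x * (\<phi> m x \<bullet> \<phi> m x)) * 1 \<le> (f x * (\<phi> m x \<bullet> \<phi> m x)) * (exp B * exp (- t * f x))"
     using assms(6) by (intro mult_left_mono) auto
    then show "f x * (cmod (\<phi> m x))^2 \<le> exp B * (f x * exp (- t * f x) * (\<phi> m x \<bullet> \<phi> m x))"
     by (simp add: power2_norm_eq_inner mult_ac)
   qed
   then show ?thesis by (simp add: mass_def)
  qed
  show I_rd: "rapidly_decreasing ?I"
  proof (rule rapidly_decreasing_dominated[OF rapidly_decreasing_sqrt[OF l_rd], where C = "exp B" and k = 0])
   show "\<forall>\<^sub>F m in sequentially. \<bar>?I m\<bar> \<le> exp B * real m ^ 0 * \<bar>sqrt \<bar>l m\<bar>\<bar>"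
    using Z(4)[OF t]
   proof eventually_elim
    case (elim m)
    then have "mass t (\<phi> m) \<le> sqrt (l m)" using \<phi> eig by blast
    then have "exp B * mass t (\<phi> m) \<le> exp B * sqrt (l m)" by simp
    with I_mass[of m] have "?I m \<le> exp B * sqrt (l m)" by linarith
    then show ?case using I0[of m] l_pos[of m] by simp
   qed
  qed simp
  show ?C
  proof (intro allI impI)
   fix K k P assume K: "compact K \<and> K \<inter> range \<gamma> = {} \<and> chart_decomposition A K P"
   have pos: "\<forall>x\<in>K. f x > 0"
   proof
    fix x assume "x \<in> K"
    then show "f x > 0" using K assms(6)[of x] assms(8) by (metis (mono_tags) disjoint_iff less_eq_real_def mem_Collect_eq)
   qed
   obtain D n where D: "D \<ge> 0" "\<forall>\<mu>\<ge>1. \<forall>\<phi>. weighted_eigenfunction t \<mu> \<phi> \<longrightarrow>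
     \<bar>Ck_norm P k \<phi>\<bar> \<le> sqrt (D * \<mu> ^ n * (LINT x|area. f x * (cmod (\<phi> x))^2))"
    using eigenfunction_Ck_norm_bound[of K P t k, OF assms(5) conjunct2[OF conjunct2[OF K]] pos]
    by (elim exE conjE) (assumption | rule that)+
   \<comment> \<open>For large \<open>m\<close> the eigenvalue is at most \<open>lam m + 1\<close>,
     hence at most \<open>(C + 1) * m^2\<close>, so its power is polynomial in \<open>m\<close> and
     the integral against \<open>f\<close> supplies the decay.\<close>
   let ?b = "\<lambda>m. D * (C + 1) ^ n * real m ^ (2 * n) * ?I m"
   have "rapidly_decreasing ?b"
    by (rule rapidly_decreasing_dominated[OF I_rd, where C = "D * (C + 1) ^ n" and k = "2 * n"])
     (use D(1) growth(2) in \<open>simp_all add: abs_mult\<close>)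
   then have "rapidly_decreasing (\<lambda>m. sqrt \<bar>?b m\<bar>)" by (rule rapidly_decreasing_sqrt)
   then show "rapidly_decreasing (\<lambda>m. Ck_norm P k (\<phi> m))"
   proof (rule rapidly_decreasing_dominated[where C = 1 and k = 0])
    show "\<forall>\<^sub>F m in sequentially. \<bar>Ck_norm P k (\<phi> m)\<bar> \<le> 1 * real m ^ 0 * \<bar>sqrt \<bar>?b m\<bar>\<bar>"
     using growth(3) rapidly_decreasing_le_1[OF l_rd] eventually_le_quadratic[OF growth(1), of 2] eventually_le_quadratic[OF zero_less_one, of 1]
    proof eventually_elim
     case (elim m)
     have l1: "l m \<le> 1" and lam2: "2 \<le> lam m" using elim(1-3) by linarith+
     have \<mu>: "lam m - l m \<le> \<mu> m" "\<mu> m \<le> lam m + l m" using \<phi> by auto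
     have \<mu>1: "1 \<le> \<mu> m" using \<mu> lam2 l1 by linarith
     have "1 \<le> (real m)^2" using elim(4) by simp
     then have "\<mu> m \<le> (C + 1) * (real m)^2" using \<mu>(2) l1 elim(1) by (simp add: algebra_simps)
     then have "\<mu> m ^ n \<le> ((C + 1) * (real m)^2) ^ n" using \<mu>1 by (intro power_mono) auto
     also have "\<dots> = (C + 1) ^ n * real m ^ (2 * n)" by (simp add: power_mult_distrib power_mult)
     finally have "D * \<mu> m ^ n * ?I m \<le> D * ((C + 1) ^ n * real m ^ (2 * n)) * ?I m"
      using D(1) I0 by (intro mult_right_mono mult_left_mono)
     then have "D * \<mu> m ^ n * ?I m \<le> \<bar>?b m\<bar>" by (simp add: mult.assoc)
     then have "sqrt (D * \<mu> m ^ n * ?I m) \<le> sqrt \<bar>?b m\<bar>" by (rule real_sqrt_le_mono)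
     moreover have "\<bar>Ck_norm P k (\<phi> m)\<bar> \<le> sqrt (D * \<mu> m ^ n * ?I m)"
      by (rule D(2)[rule_format, OF \<mu>1]) (use eig in blast)
     ultimately have "\<bar>Ck_norm P k (\<phi> m)\<bar> \<le> sqrt \<bar>?b m\<bar>" by (rule order_trans[rotated])
     then show ?case by simp
    qed
   qed simp
  qed
 qed
 then show ?thesis
  unfolding area using l_pos l_rd spec Z(1-3) by (intro exI[of _ l] conjI exI[of _ Z] allI ballI impI) simp_all
qed

end
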